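(* Let $X$ be a finite $C_2$-CW complex and let $\psi_{Bor}\colon H^*_{Bor}(X;\mathbf{F}_2)\to H^*_{sing}(X;\mathbf{F}_2)$ be the forgetful map. Then: (1) $X$ is an M-space if and only if $\psi_{Bor}$ is onto; (2) $X$ is a GM-space if and only if the image of $\psi_{Bor}$ is the fixed subspace $H_{sing}^*(X;\mathbf{F}_2)^{C_2}$.
   Context: $C_2$ is the group with two elements. A $C_2$-CW complex is a CW complex with a cellular $C_2$-action such that cells mapped to themselves are fixed pointwise. $H_{sing}^*$ denotes ordinary singular cohomology; $C_2$ acts on $H^*_{sing}(X;\mathbf F_2)$ via its action on $X$. Borel cohomology is $H^*_{Bor}(X;\mathbf{F}_2):=H^*_{sing}(X_{C_2};\mathbf{F}_2)$, where $X_{C_2}=(X\times EC_2)/C_2$ is the Borel construction, the total space of a fibration $X\hookrightarrow X_{C_2}\to BC_2$. The forgetful map $\psi_{Bor}$ is the map in cohomology induced by the inclusion of the fibre $X\hookrightarrow X_{C_2}$. A $C_2$-CW complex $X$ of dimension $n$ is an M-space (Maximal) if $$\sum_{q=0}^n\dim_{\mathbf{F}_2}H_{sing}^q(X^{C_2};\mathbf{F}_2)=\sum_{q=0}^n\dim_{\mathbf{F}_2}H_{sing}^q(X;\mathbf{F}_2),$$ and a GM-space (Galois-Maximal) if $$\sum_{q=0}^n\dim_{\mathbf{F}_2}H_{sing}^q(X^{C_2};\mathbf{F}_2)=\sum_{q=0}^n\dim_{\mathbf{F}_2}H^1(C_2,H_{sing}^q(X;\mathbf{F}_2)),$$ where $H^1(C_2,-)$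 is group cohomology. *)

theory Defs
  imports
    "HOL-Homology.Homology"
    "HOL-Algebra.Group_Action"
    "HOL-Library.Z2"
    "Jordan_Normal_Form.Missing_VectorSpace"
begin

section \<open>Vector spaces over \<open>\<F>\<^sub>2\<close>\<close>

abbreviation F2 :: "bit ring"
  where "F2 \<equiv> \<lparr>carrier = UNIV, monoid.mult = (*), one = 1, zero = 0, add = (+)\<rparr>"

text \<open>
  An \<open>\<F>\<^sub>2\<close>-vector space is the same thing as an abelian group of exponent dividing 2: the
  scalar multiplication is forced. Cohomology groups are therefore treated, as homology groups
  are in \<^theory>\<open>HOL-Homology.Homology_Groups\<close>, as (multiplicatively written) groups, and
  \<open>F2_vs\<close> equips them with their scalar multiplication when a dimension is needed.
  The fields \<^const>\<open>monoid.mult\<close> and \<^const>\<open>one\<close> of the resulting module play no role.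
\<close>

definition F2_vs :: "('m, 'b) monoid_scheme \<Rightarrow> (bit, 'm) module"
  where "F2_vs M =
    \<lparr>carrier = carrier M, monoid.mult = undefined, one = undefined,
     zero = \<one>\<^bsub>M\<^esub>, add = (\<lambda>x y. x \<otimes>\<^bsub>M\<^esub> y),
     smult = (\<lambda>a x. if a = 1 then x else \<one>\<^bsub>M\<^esub>)\<rparr>"

definition F2_dim :: "('m, 'b) monoid_scheme \<Rightarrow> nat"
  where "F2_dim M = vectorspace.dim F2 (F2_vs M)"


section \<open>Singular cohomology with coefficients in \<open>\<F>\<^sub>2\<close>\<close>

type_synonym 'a cochain = "((nat \<Rightarrow> real) \<Rightarrow> 'a) \<Rightarrow> bit"

definition cochain_group :: "nat \<Rightarrow> 'a topology \<Rightarrow> 'a cochain monoid"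
  where "cochain_group p X = product_group (singular_simplex_set p X) (\<lambda>_. add_monoid F2)"

text \<open>The signs \<open>(-1)\<^sup>k\<close> are omitted, as they are trivial in \<open>\<F>\<^sub>2\<close>.\<close>

definition coboundary :: "nat \<Rightarrow> 'a topology \<Rightarrow> 'a cochain \<Rightarrow> 'a cochain"
  where "coboundary p X c =
    (\<lambda>\<sigma>\<in>singular_simplex_set (Suc p) X. \<Sum>k\<le>Suc p. c (singular_face (Suc p) k \<sigma>))"

definition cocycles :: "nat \<Rightarrow> 'a topology \<Rightarrow> 'a cochain set"
  where "cocycles p X = kernel (cochain_group p X) (cochain_group (Suc p) X) (coboundary p X)"

fun coboundaries :: "nat \<Rightarrow> 'a topology \<Rightarrow> 'a cochain set"
  where
    "coboundaries 0 X = {\<one>\<^bsub>cochain_group 0 X\<^esub>}"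
  | "coboundaries (Suc p) X = coboundary p X ` carrier (cochain_group p X)"

definition cohomology_group :: "nat \<Rightarrow> 'a topology \<Rightarrow> 'a cochain set monoid"
  where "cohomology_group p X =
    subgroup_generated (cochain_group p X) (cocycles p X) Mod coboundaries p X"

definition cochain_map :: "nat \<Rightarrow> 'a topology \<Rightarrow> ('a \<Rightarrow> 'b) \<Rightarrow> 'b cochain \<Rightarrow> 'a cochain"
  where "cochain_map p X f c = (\<lambda>\<sigma>\<in>singular_simplex_set p X. c (simplex_map p f \<sigma>))"

text \<open>
  The map \<open>H\<^sup>p(Y) \<rightarrow> H\<^sup>p(X)\<close> induced by a continuous map \<open>f : X \<rightarrow> Y\<close>. All cocycles in the
  class \<open>u\<close> are sent to the same coset.
\<close>

definition cohomology_map ::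
    "nat \<Rightarrow> 'a topology \<Rightarrow> ('a \<Rightarrow> 'b) \<Rightarrow> 'b cochain set \<Rightarrow> 'a cochain set"
  where "cohomology_map p X f u =
    the_elem ((\<lambda>c. coboundaries p X #>\<^bsub>cochain_group p X\<^esub> cochain_map p X f c) ` u)"


section \<open>First group cohomology\<close>

text \<open>
  \<open>M\<close> is an abelian group, written multiplicatively, on which \<open>G\<close> acts via \<open>\<rho>\<close>:
  crossed homomorphisms modulo principal crossed homomorphisms.
\<close>

definition crossed_homs ::
    "('g, 'c) monoid_scheme \<Rightarrow> ('m, 'd) monoid_scheme \<Rightarrow> ('g \<Rightarrow> 'm \<Rightarrow> 'm) \<Rightarrow> ('g \<Rightarrow> 'm) set"
  where "crossed_homs G M \<rho> =
    {f \<in> carrier G \<rightarrow>\<^sub>E carrier M.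
      \<forall>g\<in>carrier G. \<forall>h\<in>carrier G. f (g \<otimes>\<^bsub>G\<^esub> h) = f g \<otimes>\<^bsub>M\<^esub> \<rho> g (f h)}"

definition principal_crossed_homs ::
    "('g, 'c) monoid_scheme \<Rightarrow> ('m, 'd) monoid_scheme \<Rightarrow> ('g \<Rightarrow> 'm \<Rightarrow> 'm) \<Rightarrow> ('g \<Rightarrow> 'm) set"
  where "principal_crossed_homs G M \<rho> =
    (\<lambda>m. \<lambda>g\<in>carrier G. \<rho> g m \<otimes>\<^bsub>M\<^esub> inv\<^bsub>M\<^esub> m) ` carrier M"

definition group_H1 ::
    "('g, 'c) monoid_scheme \<Rightarrow> ('m, 'd) monoid_scheme \<Rightarrow> ('g \<Rightarrow> 'm \<Rightarrow> 'm) \<Rightarrow> ('g \<Rightarrow> 'm) set monoid"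
  where "group_H1 G M \<rho> =
    subgroup_generated (product_group (carrier G) (\<lambda>_. M)) (crossed_homs G M \<rho>)
      Mod principal_crossed_homs G M \<rho>"


section \<open>CW complexes\<close>

definition disc :: "nat \<Rightarrow> (nat \<Rightarrow> real) topology"
  where "disc n = subtopology (Euclidean_space n) {x. (\<Sum>i<n. (x i)\<^sup>2) \<le> 1}"

definition open_disc :: "nat \<Rightarrow> (nat \<Rightarrow> real) set"
  where "open_disc n = {x \<in> topspace (disc n). (\<Sum>i<n. (x i)\<^sup>2) < 1}"

text \<open>
  Throughout, \<open>C n\<close> is the set of open \<open>n\<close>-cells, as subsets of the space.
\<close>

definition characteristic_map ::
    "'a topology \<Rightarrow> (nat \<Rightarrow> 'a set set) \<Rightarrow> nat \<Rightarrow> 'a set \<Rightarrow> ((nat \<Rightarrow> real) \<Rightarrow> 'a) \<Rightarrow> bool"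
  where "characteristic_map X C n c \<Phi> \<longleftrightarrow>
    continuous_map (disc n) X \<Phi> \<and>
    homeomorphic_map (subtopology (disc n) (open_disc n)) (subtopology X c) \<Phi> \<and>
    (\<exists>F. finite F \<and> F \<subseteq> (\<Union>m<n. C m) \<and> \<Phi> ` (topspace (disc n) - open_disc n) \<subseteq> \<Union>F)"

text \<open>
  Closure finiteness is part of \<^const>\<open>characteristic_map\<close>; the last clause below is the weak
  topology. In a Hausdorff space, the closure of an open cell is the closed cell, i.e. the
  image of the disc under the characteristic map.
\<close>

definition CW_complex :: "'a topology \<Rightarrow> (nat \<Rightarrow> 'a set set) \<Rightarrow> bool"
  where "CW_complex X C \<longleftrightarrow>
    Hausdorff_space X \<and>
    topspace X = (\<Union>n. \<Union>(C n)) \<and>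
    (\<forall>m n. \<forall>c\<in>C m. \<forall>d\<in>C n. (m, c) \<noteq> (n, d) \<longrightarrow> c \<inter> d = {}) \<and>
    (\<forall>n. \<forall>c\<in>C n. \<exists>\<Phi>. characteristic_map X C n c \<Phi>) \<and>
    (\<forall>A\<subseteq>topspace X. (\<forall>n. \<forall>c\<in>C n. closedin X (A \<inter> X closure_of c)) \<longrightarrow> closedin X A)"

definition finite_cells :: "(nat \<Rightarrow> 'a set set) \<Rightarrow> bool"
  where "finite_cells C \<longleftrightarrow> finite (SIGMA n:UNIV. C n)"

text \<open>
  For finitely many cells, \<^const>\<open>Sup\<close> on \<^typ>\<open>nat\<close> is the maximum, with value \<open>0\<close> for the
  empty complex (all of whose cohomology vanishes).
\<close>

definition cw_dim :: "(nat \<Rightarrow> 'a set set) \<Rightarrow> nat"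
  where "cw_dim C = Sup {n. C n \<noteq> {}}"


section \<open>Spaces with an action of \<open>C\<^sub>2\<close>\<close>

abbreviation C2 :: "int monoid"
  where "C2 \<equiv> integer_mod_group 2"

definition C2_space :: "'a topology \<Rightarrow> (int \<Rightarrow> 'a \<Rightarrow> 'a) \<Rightarrow> bool"
  where "C2_space X \<phi> \<longleftrightarrow>
    group_action C2 (topspace X) \<phi> \<and> (\<forall>g\<in>carrier C2. continuous_map X X (\<phi> g))"

definition C2_CW_complex ::
    "'a topology \<Rightarrow> (int \<Rightarrow> 'a \<Rightarrow> 'a) \<Rightarrow> (nat \<Rightarrow> 'a set set) \<Rightarrow> bool"
  where "C2_CW_complex X \<phi> C \<longleftrightarrow>
    CW_complex X C \<and> C2_space X \<phi> \<and>
    (\<forall>g\<in>carrier C2. \<forall>n. \<forall>c\<in>C n.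
      \<phi> g ` c \<in> C n \<and> (\<phi> g ` c = c \<longrightarrow> (\<forall>x\<in>c. \<phi> g x = x)))"

definition fixed_space :: "'a topology \<Rightarrow> (int \<Rightarrow> 'a \<Rightarrow> 'a) \<Rightarrow> 'a topology"
  where "fixed_space X \<phi> = subtopology X {x. \<forall>g\<in>carrier C2. \<phi> g x = x}"

text \<open>
  Pulling back along \<open>\<phi> g\<close> is a priori a right action, but \<open>C\<^sub>2\<close> is abelian.
\<close>

definition cohomology_action ::
    "nat \<Rightarrow> 'a topology \<Rightarrow> (int \<Rightarrow> 'a \<Rightarrow> 'a) \<Rightarrow> int \<Rightarrow> 'a cochain set \<Rightarrow> 'a cochain set"
  where "cohomology_action q X \<phi> g = cohomology_map q X (\<phi> g)"

definition cohomology_fixed ::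
    "nat \<Rightarrow> 'a topology \<Rightarrow> (int \<Rightarrow> 'a \<Rightarrow> 'a) \<Rightarrow> 'a cochain set set"
  where "cohomology_fixed q X \<phi> =
    {u \<in> carrier (cohomology_group q X). \<forall>g\<in>carrier C2. cohomology_action q X \<phi> g u = u}"

definition M_space :: "'a topology \<Rightarrow> (int \<Rightarrow> 'a \<Rightarrow> 'a) \<Rightarrow> (nat \<Rightarrow> 'a set set) \<Rightarrow> bool"
  where "M_space X \<phi> C \<longleftrightarrow>
    (\<Sum>q\<le>cw_dim C. F2_dim (cohomology_group q (fixed_space X \<phi>))) =
    (\<Sum>q\<le>cw_dim C. F2_dim (cohomology_group q X))"

definition GM_space :: "'a topology \<Rightarrow> (int \<Rightarrow> 'a \<Rightarrow> 'a) \<Rightarrow> (nat \<Rightarrow> 'a set set) \<Rightarrow> bool"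
  where "GM_space X \<phi> C \<longleftrightarrow>
    (\<Sum>q\<le>cw_dim C. F2_dim (cohomology_group q (fixed_space X \<phi>))) =
    (\<Sum>q\<le>cw_dim C. F2_dim (group_H1 C2 (cohomology_group q X) (cohomology_action q X \<phi>)))"


section \<open>Borel cohomology\<close>

text \<open>
  \<open>EC\<^sub>2\<close> is only determined up to equivariant homotopy equivalence; \<open>is_EC2\<close> describes its
  models, the contractible free \<open>C\<^sub>2\<close>-CW complexes. Non-emptiness is required separately because
  \<^const>\<open>contractible_space\<close> holds of the empty space.
\<close>

definition is_EC2 :: "'e topology \<Rightarrow> (int \<Rightarrow> 'e \<Rightarrow> 'e) \<Rightarrow> bool"
  where "is_EC2 E \<epsilon> \<longleftrightarrow>
    (\<exists>D. C2_CW_complex E \<epsilon> D) \<and>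
    topspace E \<noteq> {} \<and> contractible_space E \<and>
    (\<forall>g\<in>carrier C2. \<forall>x\<in>topspace E. \<epsilon> g x = x \<longrightarrow> g = \<one>\<^bsub>C2\<^esub>)"

definition diagonal_action :: "(int \<Rightarrow> 'a \<Rightarrow> 'a) \<Rightarrow> (int \<Rightarrow> 'e \<Rightarrow> 'e) \<Rightarrow> int \<Rightarrow> 'a \<times> 'e \<Rightarrow> 'a \<times> 'e"
  where "diagonal_action \<phi> \<epsilon> g = map_prod (\<phi> g) (\<epsilon> g)"

text \<open>The orbit space \<open>Y / C\<^sub>2\<close>, with the quotient topology.\<close>

definition orbit_space :: "'a topology \<Rightarrow> (int \<Rightarrow> 'a \<Rightarrow> 'a) \<Rightarrow> 'a set topology"
  where "orbit_space Y \<phi> =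
    topology (\<lambda>U. U \<subseteq> orbits C2 (topspace Y) \<phi> \<and> openin Y {y \<in> topspace Y. orbit C2 \<phi> y \<in> U})"

definition borel_construction ::
    "'a topology \<Rightarrow> (int \<Rightarrow> 'a \<Rightarrow> 'a) \<Rightarrow> 'e topology \<Rightarrow> (int \<Rightarrow> 'e \<Rightarrow> 'e) \<Rightarrow> ('a \<times> 'e) set topology"
  where "borel_construction X \<phi> E \<epsilon> = orbit_space (prod_topology X E) (diagonal_action \<phi> \<epsilon>)"

definition borel_cohomology_group ::
    "nat \<Rightarrow> 'a topology \<Rightarrow> (int \<Rightarrow> 'a \<Rightarrow> 'a) \<Rightarrow> 'e topology \<Rightarrow> (int \<Rightarrow> 'e \<Rightarrow> 'e) \<Rightarrow>
      ('a \<times> 'e) set cochain set monoid"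
  where "borel_cohomology_group q X \<phi> E \<epsilon> = cohomology_group q (borel_construction X \<phi> E \<epsilon>)"

text \<open>The inclusion of the fibre of \<open>X\<^bsub>C\<^sub>2\<^esub> \<rightarrow> BC\<^sub>2 = E / C\<^sub>2\<close> over the orbit of \<open>e\<close>.\<close>

definition fibre_inclusion ::
    "(int \<Rightarrow> 'a \<Rightarrow> 'a) \<Rightarrow> (int \<Rightarrow> 'e \<Rightarrow> 'e) \<Rightarrow> 'e \<Rightarrow> 'a \<Rightarrow> ('a \<times> 'e) set"
  where "fibre_inclusion \<phi> \<epsilon> e x = orbit C2 (diagonal_action \<phi> \<epsilon>) (x, e)"

definition psi_Bor ::
    "nat \<Rightarrow> 'a topology \<Rightarrow> (int \<Rightarrow> 'a \<Rightarrow> 'a) \<Rightarrow> (int \<Rightarrow> 'e \<Rightarrow> 'e) \<Rightarrow> 'e \<Rightarrow>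
      ('a \<times> 'e) set cochain set \<Rightarrow> 'a cochain set"
  where "psi_Bor q X \<phi> \<epsilon> e = cohomology_map q X (fibre_inclusion \<phi> \<epsilon> e)"

end

theory Submission
  imports Defs "HOL-Library.Function_Algebras" "HOL-Library.Product_Plus"
    "HOL-Analysis.Abstract_Topological_Spaces"
begin

text \<open>
  The proof counts cohomology classes. Write \<open>b\<^sub>n\<close> and \<open>f\<^sub>n\<close> for the orders of
  \<open>H\<^sup>n(X)\<close> and of \<open>H\<^sup>n\<close> of the fixed points, \<open>a\<^sub>n\<close> for the order of the image
  of \<open>\<psi>\<close> in degree \<open>n\<close>, and \<open>h\<^sub>n\<close> for the order of Borel cohomology. The Gysin sequence of the
  double cover \<open>X \<times> EC\<^sub>2\<close> of the Borel construction gives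
  \<open>h\<^sub>n\<^sub>+\<^sub>1 b\<^sub>n = a\<^sub>n\<^sub>+\<^sub>1 a\<^sub>n h\<^sub>n\<close>. In degrees above \<open>dim X\<close>, Borel cohomology does
  not change on restriction to the fixed points (the cells outside are permuted freely), where it has
  order \<open>\<Prod>f\<^sub>n\<close>; multiplying up, \<open>\<Prod>f\<^sub>n \<Prod>b\<^sub>n = (\<Prod>a\<^sub>n)\<^sup>2\<close>. As \<open>a\<^sub>n \<le> b\<^sub>n\<close>, the first claim is the
  case of equality. For the second, the image of \<open>\<psi>\<close> is invariant, and \<open>H\<^sup>1(C\<^sub>2, M)\<close> has order
  \<open>|M\<^sup>G|\<^sup>2 / |M|\<close> for a finite \<open>\<F>\<^sub>2\<close>-module \<open>M\<close>.
\<close>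

section \<open>Indices of subgroups\<close>

text \<open>Cochains of the Borel construction are handled as invariant cochains of X x E: a simplex
  of the orbit space has two lifts, exchanged by the involution, so pulling back identifies the
  cocycles. The Gysin relation is the long exact sequence of \<open>1 + s\<close>, which maps all
  cochains onto the invariant ones; modulo 2 its kernel is again the invariant cochains. The same
  relation gives the Borel cohomology of the fixed points: projection to the first factor extends
  every class of the fibre there, so a_n = b_n and the products collapse. The obstacle is that
  invariant cochains of X x E relative to the fixed points must have no cohomology above dim X. This
  is shown by induction over orbits of cells from homotopy invariance and Mayer-Vietoris, both
  required for invariant relative cochains. Homotopies and subdivisions are therefore built from
  natural chain operators, which commute with the involution and preserve subspaces. The same
  induction gives the finiteness of the other two cohomologies: an infinite index counts as 0, every
  step is an equation or a divisibility of numbers, and nonzero means finite.\<close>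

definition sgrp :: "'g::ab_group_add set \<Rightarrow> bool"
  where "sgrp A \<longleftrightarrow> 0 \<in> A \<and> (\<forall>x\<in>A. \<forall>y\<in>A. x - y \<in> A)"

lemma sgrpI: "\<lbrakk>0 \<in> A; \<And>x y. \<lbrakk>x \<in> A; y \<in> A\<rbrakk> \<Longrightarrow> x - y \<in> A\<rbrakk> \<Longrightarrow> sgrp A"
  by (simp add: sgrp_def)

lemma sgrp_zero: "sgrp A \<Longrightarrow> 0 \<in> A"
  by (simp add: sgrp_def)

lemma sgrp_diff: "\<lbrakk>sgrp A; x \<in> A; y \<in> A\<rbrakk> \<Longrightarrow> x - y \<in> A"
  by (simp add: sgrp_def)

lemma sgrp_uminus: "\<lbrakk>sgrp A; x \<in> A\<rbrakk> \<Longrightarrow> - x \<in> A"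
  using sgrp_diff[of A 0 x] sgrp_zero by auto

lemma sgrp_add: "\<lbrakk>sgrp A; x \<in> A; y \<in> A\<rbrakk> \<Longrightarrow> x + y \<in> A"
  using sgrp_diff[of A x "- y"] sgrp_uminus by auto

lemma sgrp_Int: "\<lbrakk>sgrp A; sgrp B\<rbrakk> \<Longrightarrow> sgrp (A \<inter> B)"
  by (auto simp: sgrp_def)

lemma sgrp_singleton_0: "sgrp {0}"
  by (simp add: sgrp_def)

lemma sgrp_image:
  assumes "sgrp A" and f: "\<And>x y. \<lbrakk>x \<in> A; y \<in> A\<rbrakk> \<Longrightarrow> f (x - y) = f x - f y"
  shows "sgrp (f ` A)"
proof (rule sgrpI)
  have "f 0 = 0"
    using f[of 0 0] sgrp_zero[OF assms(1)] by simp
  then show "0 \<in> f ` A"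
    using sgrp_zero[OF assms(1)] by force
next
  fix u v assume "u \<in> f ` A" "v \<in> f ` A"
  then obtain x y where "x \<in> A" "y \<in> A" "u = f x" "v = f y" by auto
  then show "u - v \<in> f ` A"
    using f[of x y] sgrp_diff[OF assms(1), of x y] by (metis imageI)
qed

definition ssum :: "'g::ab_group_add set \<Rightarrow> 'g set \<Rightarrow> 'g set"
  where "ssum A B = (\<lambda>(a, b). a + b) ` (A \<times> B)"

lemma in_ssum_iff: "sgrp A \<Longrightarrow> x \<in> ssum A B \<longleftrightarrow> (\<exists>b\<in>B. x - b \<in> A)"
  unfolding ssum_def by (force simp: image_iff intro: bexI[of _ "_ - _"])

lemma sgrp_ssum:
  assumes "sgrp A" "sgrp B" shows "sgrp (ssum A B)"
proof (rule sgrpI)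
  show "0 \<in> ssum A B"
    unfolding in_ssum_iff[OF assms(1)] using assms by (force simp: sgrp_def)
next
  fix x y assume "x \<in> ssum A B" "y \<in> ssum A B"
  then obtain b c where "b \<in> B" "c \<in> B" "x - b \<in> A" "y - c \<in> A"
    unfolding in_ssum_iff[OF assms(1)] by auto
  then have "b - c \<in> B" "(x - b) - (y - c) \<in> A"
    using assms sgrp_diff by auto
  moreover have "(x - b) - (y - c) = (x - y) - (b - c)" by simp
  ultimately show "x - y \<in> ssum A B"
    unfolding in_ssum_iff[OF assms(1)] by (metis)
qed

lemma ssum_upper: "sgrp A \<Longrightarrow> sgrp B \<Longrightarrow> A \<subseteq> ssum A B \<and> B \<subseteq> ssum A B"
  using sgrp_zero[of A] sgrp_zero[of B] by (auto simp: in_ssum_iff) (metis diff_zero, metis diff_self)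

lemma ssum_least: "\<lbrakk>A \<subseteq> Z; B \<subseteq> Z; sgrp Z\<rbrakk> \<Longrightarrow> ssum A B \<subseteq> Z"
  by (auto simp: ssum_def intro: sgrp_add)

text \<open>As a cardinality, \<open>idx Z B\<close> is \<open>0\<close> if there are infinitely many cosets.\<close>

definition idx :: "'g::ab_group_add set \<Rightarrow> 'g set \<Rightarrow> nat"
  where "idx Z B = card ((\<lambda>z. (+) z ` B) ` Z)"

lemma coset_eq_iff:
  fixes x y :: "'g::ab_group_add"
  assumes "sgrp B" shows "(+) x ` B = (+) y ` B \<longleftrightarrow> x - y \<in> B"
proof
  assume "(+) x ` B = (+) y ` B"
  moreover have "x \<in> (+) x ` B"
    using sgrp_zero[OF assms] by force
  ultimately obtain b where "b \<in> B" "x = y + b" by auto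
  then show "x - y \<in> B" by simp
next
  have sub: "(+) x ` B \<subseteq> (+) y ` B" if "x - y \<in> B" for x y
  proof
    fix z assume "z \<in> (+) x ` B"
    then obtain b where "b \<in> B" "z = x + b" by auto
    then have "z = y + ((x - y) + b)" "(x - y) + b \<in> B"
      using that sgrp_add[OF assms] by auto
    then show "z \<in> (+) y ` B" by blast
  qed
  assume "x - y \<in> B"
  moreover have "y - x \<in> B"
    using sgrp_uminus[OF assms \<open>x - y \<in> B\<close>] by simp
  ultimately show "(+) x ` B = (+) y ` B"
    using sub by blast
qed

text \<open>Indices are compared by matching the fibres of coset maps, which puts finite and
  infinite images on the same footing.\<close>

lemma card_image_eq_if_same_fibres:
  assumes "\<And>x y. \<lbrakk>x \<in> Z; y \<in> Z\<rbrakk> \<Longrightarrow> f x = f y \<longleftrightarrow> g x = g y"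
  shows "card (f ` Z) = card (g ` Z)"
proof -
  let ?h = "\<lambda>u. g (inv_into Z f u)"
  have "?h (f x) = g x" if "x \<in> Z" for x
    using assms[of "inv_into Z f (f x)" x] that
    by (metis f_inv_into_f imageI inv_into_into)
  then have "inj_on ?h (f ` Z)" "?h ` f ` Z = g ` Z"
    using assms by (auto simp: inj_on_def image_image)
  then show ?thesis
    by (metis card_image)
qed

text \<open>The isomorphism theorem: \<open>f\<close> induces a map from Z/B to W/D, where
  \<open>ker\<close> makes it well defined and injective and \<open>onto\<close> makes it
  surjective.\<close>

lemma idx_iso:
  assumes Z: "sgrp Z" and B: "sgrp B" and D: "sgrp D"
    and f: "\<And>x y. \<lbrakk>x \<in> Z; y \<in> Z\<rbrakk> \<Longrightarrow> f (x - y) = f x - f y"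
    and into: "\<And>z. z \<in> Z \<Longrightarrow> f z \<in> W"
    and ker: "\<And>z. z \<in> Z \<Longrightarrow> f z \<in> D \<longleftrightarrow> z \<in> B"
    and onto: "\<And>w. w \<in> W \<Longrightarrow> \<exists>z\<in>Z. w - f z \<in> D"
  shows "idx Z B = idx W D"
proof -
  have "(\<lambda>w. (+) w ` D) ` W = (\<lambda>z. (+) (f z) ` D) ` Z"
  proof (intro equalityI subsetI)
    fix u assume "u \<in> (\<lambda>w. (+) w ` D) ` W"
    then obtain w where "w \<in> W" and u: "u = (+) w ` D" by auto
    with onto obtain z where z: "z \<in> Z" "w - f z \<in> D" by auto
    then have "u = (+) (f z) ` D"
      unfolding u coset_eq_iff[OF D] by simp
    with z show "u \<in> (\<lambda>z. (+) (f z) ` D) ` Z" by blast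
  qed (use into in auto)
  moreover have "card ((\<lambda>z. (+) z ` B) ` Z) = card ((\<lambda>z. (+) (f z) ` D) ` Z)"
    by (rule card_image_eq_if_same_fibres)
      (simp add: coset_eq_iff B D f[symmetric] ker sgrp_diff[OF Z])
  ultimately show ?thesis
    by (simp add: idx_def)
qed

lemma idx_tower:
  assumes Z: "sgrp Z" and A: "sgrp A" and B: "sgrp B" and "A \<subseteq> Z" "B \<subseteq> A"
  shows "idx Z B = idx Z A * idx A B"
proof -
  \<comment> \<open>The predicate under \<open>SOME\<close> depends only on the coset of
    \<open>z\<close> modulo \<open>A\<close>, so \<open>r\<close> picks one representative per
    coset. Then \<open>z - r z\<close> is the component of \<open>z\<close> in \<open>A\<close>, and
    the pair \<open>?g z\<close> carries the same information as the coset of \<open>z\<close>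
    modulo \<open>B\<close>. Products of cardinalities are multiplicative for infinite sets too, so
    an infinite index stays consistent with the value 0.\<close>
  define r where "r = (\<lambda>z. SOME w. w \<in> Z \<and> z - w \<in> A)"
  have r: "r z \<in> Z" "z - r z \<in> A" if "z \<in> Z" for z
    using someI[of "\<lambda>w. w \<in> Z \<and> z - w \<in> A" z] that sgrp_zero[OF A] by (auto simp: r_def)
  have rcong: "r x = r y" if "x - y \<in> A" for x y
  proof -
    have "x - w \<in> A \<longleftrightarrow> y - w \<in> A" for w
    proof -
      have "y - w = (x - w) - (x - y)" "x - w = (y - w) + (x - y)" by simp_all
      then show ?thesis
        using sgrp_diff[OF A] sgrp_add[OF A] that by metis
    qed
    then show ?thesis by (simp add: r_def)
  qed
  let ?g = "\<lambda>z. ((+) z ` A, (+) (z - r z) ` B)"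
  have "card ((\<lambda>z. (+) z ` B) ` Z) = card (?g ` Z)"
  proof (rule card_image_eq_if_same_fibres)
    fix x y assume "x \<in> Z" "y \<in> Z"
    show "(+) x ` B = (+) y ` B \<longleftrightarrow> ?g x = ?g y"
    proof (cases "x - y \<in> A")
      case True
      then show ?thesis using rcong[OF True] by (simp add: coset_eq_iff A B)
    next
      case False
      then have "x - y \<notin> B" using assms by auto
      then show ?thesis using False by (simp add: coset_eq_iff A B)
    qed
  qed
  moreover have "?g ` Z = ((\<lambda>z. (+) z ` A) ` Z) \<times> ((\<lambda>z. (+) z ` B) ` A)"
  proof (intro equalityI subsetI)
    fix u assume "u \<in> ((\<lambda>z. (+) z ` A) ` Z) \<times> ((\<lambda>z. (+) z ` B) ` A)"
    then obtain z a where z: "z \<in> Z" and a: "a \<in> A" and u: "u = ((+) z ` A, (+) a ` B)" by auto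
    define w where "w = r z + a"
    have "w - z \<in> A"
      using sgrp_diff[OF A a r(2)[OF z]] by (simp add: w_def algebra_simps)
    then have "r w = r z" "(+) w ` A = (+) z ` A"
      by (auto intro: rcong simp: coset_eq_iff A)
    moreover have "w \<in> Z"
      using r(1)[OF z] a assms(4) by (auto simp: w_def intro: sgrp_add[OF Z])
    ultimately show "u \<in> ?g ` Z"
      unfolding u by (intro image_eqI[of _ _ w]) (auto simp: w_def)
  qed (use r in auto)
  ultimately show ?thesis
    by (simp add: idx_def card_cartesian_product)
qed

lemma idx_self: "sgrp Z \<Longrightarrow> idx Z Z = 1"
proof -
  assume Z: "sgrp Z"
  have "(\<lambda>z. (+) z ` Z) ` Z = {(+) 0 ` Z}"
  proof -
    have "(+) z ` Z = (+) 0 ` Z" if "z \<in> Z" for z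
      using Z that by (simp only: coset_eq_iff) simp
    then show ?thesis using sgrp_zero[OF Z] by blast
  qed
  then show ?thesis by (simp add: idx_def)
qed

lemma idx_eq_1_iff:
  assumes "sgrp Z" "sgrp B" "B \<subseteq> Z"
  shows "idx Z B = 1 \<longleftrightarrow> Z = B"
proof
  assume "idx Z B = 1"
  then obtain u where u: "(\<lambda>z. (+) z ` B) ` Z = {u}"
    by (auto simp: idx_def card_1_singleton_iff)
  have "z \<in> B" if "z \<in> Z" for z
  proof -
    have "(+) z ` B \<in> {u}" "(+) 0 ` B \<in> {u}"
      using u that sgrp_zero[OF assms(1)] by (metis imageI)+
    then have "(+) z ` B = (+) 0 ` B" by simp
    then show ?thesis by (simp only: coset_eq_iff[OF assms(2)]) simp
  qed
  then show "Z = B" using assms by blast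
next
  show "Z = B \<Longrightarrow> idx Z B = 1" using idx_self assms by auto
qed

lemma idx_Times:
  assumes "sgrp Z" "sgrp B" "sgrp W" "sgrp D"
  shows "idx (Z \<times> W) (B \<times> D) = idx Z B * idx W D"
proof -
  have BD: "sgrp (B \<times> D)" using assms by (auto simp: sgrp_def zero_prod_def)
  have "card ((\<lambda>z. (+) z ` (B \<times> D)) ` (Z \<times> W))
      = card ((\<lambda>z. ((+) (fst z) ` B, (+) (snd z) ` D)) ` (Z \<times> W))"
    by (rule card_image_eq_if_same_fibres)
      (simp add: coset_eq_iff BD assms, auto)
  also have "(\<lambda>z. ((+) (fst z) ` B, (+) (snd z) ` D)) ` (Z \<times> W)
      = ((\<lambda>z. (+) z ` B) ` Z) \<times> ((\<lambda>z. (+) z ` D) ` W)"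
    by force
  finally show ?thesis
    by (simp add: idx_def card_cartesian_product)
qed


section \<open>Orders of cohomology groups of cochain complexes\<close>

text \<open>All degrees live in one ambient group type and the axioms speak about \<open>K p\<close>
  only, so that subcomplexes and kernels reuse the same differential. Additivity is stated for
  differences, the operation under which \<open>sgrp\<close> is closed.\<close>

definition cplx :: "(nat \<Rightarrow> 'g::ab_group_add set) \<Rightarrow> (nat \<Rightarrow> 'g \<Rightarrow> 'g) \<Rightarrow> bool"
  where "cplx K d \<longleftrightarrow> (\<forall>p. sgrp (K p)) \<and> (\<forall>p. \<forall>x\<in>K p. d p x \<in> K (Suc p)) \<and>
    (\<forall>p. \<forall>x\<in>K p. \<forall>y\<in>K p. d p (x - y) = d p x - d p y) \<and> (\<forall>p. \<forall>x\<in>K p. d (Suc p) (d p x) = 0)"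

definition cyc :: "(nat \<Rightarrow> 'g::ab_group_add set) \<Rightarrow> (nat \<Rightarrow> 'g \<Rightarrow> 'g) \<Rightarrow> nat \<Rightarrow> 'g set"
  where "cyc K d p = {x \<in> K p. d p x = 0}"

definition bnd :: "(nat \<Rightarrow> 'g::ab_group_add set) \<Rightarrow> (nat \<Rightarrow> 'g \<Rightarrow> 'g) \<Rightarrow> nat \<Rightarrow> 'g set"
  where "bnd K d p = (case p of 0 \<Rightarrow> {0} | Suc q \<Rightarrow> d q ` K q)"

definition hcard :: "(nat \<Rightarrow> 'g::ab_group_add set) \<Rightarrow> (nat \<Rightarrow> 'g \<Rightarrow> 'g) \<Rightarrow> nat \<Rightarrow> nat"
  where "hcard K d p = idx (cyc K d p) (bnd K d p)"

lemma cplxD: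
  assumes "cplx K d"
  shows "sgrp (K p)" and "x \<in> K p \<Longrightarrow> d p x \<in> K (Suc p)"
    and "\<lbrakk>x \<in> K p; y \<in> K p\<rbrakk> \<Longrightarrow> d p (x - y) = d p x - d p y"
    and "x \<in> K p \<Longrightarrow> d (Suc p) (d p x) = 0"
  using assms by (auto simp: cplx_def)

lemma cplx_d0: "cplx K d \<Longrightarrow> d p 0 = 0"
  using cplxD(3)[of K d 0 p 0] sgrp_zero cplxD(1) by fastforce

lemma bnd_0 [simp]: "bnd K d 0 = {0}" and bnd_Suc [simp]: "bnd K d (Suc p) = d p ` K p"
  by (simp_all add: bnd_def)

lemma sgrp_cyc: "cplx K d \<Longrightarrow> sgrp (cyc K d p)"
  unfolding cyc_def
  by (rule sgrpI) (auto simp: cplx_d0 cplxD(3) sgrp_zero sgrp_diff cplxD(1))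

lemma cyc_subset: "cyc K d p \<subseteq> K p"
  by (auto simp: cyc_def)

lemma sgrp_bnd: "cplx K d \<Longrightarrow> sgrp (bnd K d p)"
  by (cases p) (auto simp: sgrp_singleton_0 cplxD intro!: sgrp_image)

lemma bnd_subset_cyc: "cplx K d \<Longrightarrow> bnd K d p \<subseteq> cyc K d p"
  by (cases p) (auto simp: cyc_def cplxD cplx_d0 sgrp_zero)

lemma hcard_eq_1_iff: "cplx K d \<Longrightarrow> hcard K d p = 1 \<longleftrightarrow> cyc K d p = bnd K d p"
  unfolding hcard_def by (rule idx_eq_1_iff) (auto simp: sgrp_cyc sgrp_bnd bnd_subset_cyc)

section \<open>Chain maps and exact sequences\<close>

definition cmap :: "(nat \<Rightarrow> 'g::ab_group_add set) \<Rightarrow> (nat \<Rightarrow> 'g \<Rightarrow> 'g) \<Rightarrow>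
    (nat \<Rightarrow> 'h::ab_group_add set) \<Rightarrow> (nat \<Rightarrow> 'h \<Rightarrow> 'h) \<Rightarrow> (nat \<Rightarrow> 'g \<Rightarrow> 'h) \<Rightarrow> bool"
  where "cmap K d L e f \<longleftrightarrow> (\<forall>p. \<forall>x\<in>K p. f p x \<in> L p) \<and>
    (\<forall>p. \<forall>x\<in>K p. \<forall>y\<in>K p. f p (x - y) = f p x - f p y) \<and>
    (\<forall>p. \<forall>x\<in>K p. f (Suc p) (d p x) = e p (f p x))"

lemma cmapD:
  assumes "cmap K d L e f"
  shows "x \<in> K p \<Longrightarrow> f p x \<in> L p"
    and "\<lbrakk>x \<in> K p; y \<in> K p\<rbrakk> \<Longrightarrow> f p (x - y) = f p x - f p y"
    and "x \<in> K p \<Longrightarrow> f (Suc p) (d p x) = e p (f p x)"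
  using assms by (auto simp: cmap_def)

lemma cmap_0: "\<lbrakk>cmap K d L e f; cplx K d\<rbrakk> \<Longrightarrow> f p 0 = 0"
  using cmapD(2)[of K d L e f 0 p 0] sgrp_zero cplxD(1) by fastforce

lemma cmap_cyc: "\<lbrakk>cmap K d L e f; cplx K d; x \<in> cyc K d p\<rbrakk> \<Longrightarrow> f p x \<in> cyc L e p"
  using cmapD(3)[of K d L e f x p] by (auto simp: cyc_def cmapD(1) cmap_0)

lemma cmap_bnd: "\<lbrakk>cmap K d L e f; cplx K d; x \<in> bnd K d p\<rbrakk> \<Longrightarrow> f p x \<in> bnd L e p"
  by (cases p) (auto simp: cmap_0 cmapD)

text \<open>In the long exact sequence of a surjection, acyclicity of the kernel in degree
  \<open>n\<close> gives injectivity on cohomology in degree \<open>n\<close>, and acyclicity in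
  degree \<open>Suc n\<close> gives surjectivity there.\<close>

lemma hcard_surj_acyclic_kernel:
  assumes K: "cplx K d" and L: "cplx L e" and f: "cmap K d L e f"
    and surj: "\<And>p y. y \<in> L p \<Longrightarrow> \<exists>x\<in>K p. f p x = y"
    and ker: "\<And>q z. \<lbrakk>q = n \<or> q = Suc n; z \<in> cyc K d q; f q z = 0\<rbrakk>
      \<Longrightarrow> z \<in> bnd (\<lambda>p. {x \<in> K p. f p x = 0}) d q"
  shows "hcard K d n = hcard L e n"
  unfolding hcard_def
proof (rule idx_iso[where f = "f n"])
  note KD = cplxD[OF K] and LD = cplxD[OF L] and fD = cmapD[OF f]
  fix z assume z: "z \<in> cyc K d n"
  then have zK: "z \<in> K n" "d n z = 0" by (auto simp: cyc_def)
  show "f n z \<in> bnd L e n \<longleftrightarrow> z \<in> bnd K d n"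
  proof
    assume L': "f n z \<in> bnd L e n"
    show "z \<in> bnd K d n"
    proof (cases n)
      case 0
      with L' have "f n z = 0" by simp
      with ker[of n z] z show ?thesis using 0 by simp
    next
      case (Suc m)
      with L' surj obtain x where x: "x \<in> K m" "f n z = e m (f m x)" by fastforce
      have dx: "d m x \<in> K n" "d n (d m x) = 0" using KD x Suc by auto
      have "f n (z - d m x) = 0"
        using fD(2)[of z n "d m x"] zK dx fD(3)[OF x(1)] x Suc by simp
      moreover have "z - d m x \<in> cyc K d n"
        using zK dx KD by (auto simp: cyc_def sgrp_diff)
      ultimately have "z - d m x \<in> bnd (\<lambda>p. {x \<in> K p. f p x = 0}) d n"
        using ker by blast
      then obtain w where w: "w \<in> K m" "z - d m x = d m w" using Suc by auto
      \<comment> \<open>Only differences are known to be respected by \<open>d\<close>, so the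
        primitive \<open>w + x\<close> of \<open>z\<close> is written as
        \<open>w - (0 - x)\<close>.\<close>
      have "d m (0 - x) = d m 0 - d m x"
        using KD(3) KD(1)[of m] sgrp_zero x(1) by metis
      then have "z = d m w - d m (0 - x)"
        using cplx_d0[OF K, of m] w(2) by (simp add: algebra_simps)
      also have "\<dots> = d m (w - (0 - x))"
        using KD(3)[of w m "0 - x"] w x KD(1)[of m] sgrp_diff sgrp_zero by metis
      finally have "z \<in> d m ` K m"
        using w x KD(1)[of m] by (metis imageI sgrp_diff sgrp_zero)
      then show ?thesis using Suc by simp
    qed
  qed (use cmap_bnd[OF f K] in blast)
next
  note KD = cplxD[OF K] and LD = cplxD[OF L] and fD = cmapD[OF f]
  fix w assume "w \<in> cyc L e n"
  then have w: "w \<in> L n" "e n w = 0" by (auto simp: cyc_def)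
  then obtain x where x: "x \<in> K n" "f n x = w" using surj by blast
  have "f (Suc n) (d n x) = 0" using fD(3)[OF x(1)] x w by simp
  moreover have "d n x \<in> cyc K d (Suc n)" using KD x by (auto simp: cyc_def)
  ultimately have "d n x \<in> bnd (\<lambda>p. {x \<in> K p. f p x = 0}) d (Suc n)"
    using ker by blast
  then obtain v where v: "v \<in> K n" "f n v = 0" "d n x = d n v" by auto
  then have "x - v \<in> cyc K d n" "w - f n (x - v) = 0"
    using x KD fD(2)[OF x(1) v(1)] by (auto simp: cyc_def sgrp_diff)
  then show "\<exists>z\<in>cyc K d n. w - f n z \<in> bnd L e n"
    by (metis sgrp_bnd[OF L] sgrp_zero)
next
  show "f n z \<in> cyc L e n" if "z \<in> cyc K d n" for z
    using that by (rule cmap_cyc[OF f K])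
next
  show "f n (x - y) = f n x - f n y" if "x \<in> cyc K d n" "y \<in> cyc K d n" for x y
    using that cmapD(2)[OF f] by (auto simp: cyc_def)
qed (auto simp: sgrp_cyc[OF K] sgrp_bnd[OF K] sgrp_bnd[OF L])

text \<open>The long exact sequence of A -> K -> C, cut into images. The index of
  \<open>bnd K d p\<close> in \<open>ssum (cyc A d p) (bnd K d p)\<close> is the order of the image
  of H^p(A) in H^p(K), \<open>x\<close> is the order of the image of the connecting map from H^n(C)
  to H^(n+1)(A), and \<open>y\<close> that of the image of H^n(K) in H^n(C). Each group is then
  counted as kernel times image.\<close>

lemma hcard_short_exact:
  assumes A: "cplx A d" and K: "cplx K d" and C: "cplx C e" and f: "cmap K d C e f"
    and surj: "\<And>p y. y \<in> C p \<Longrightarrow> \<exists>x\<in>K p. f p x = y"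
    and ker: "\<And>p. A p = {x \<in> K p. f p x = 0}"
  obtains x y where
    "hcard A d (Suc n) = idx (ssum (cyc A d (Suc n)) (bnd K d (Suc n))) (bnd K d (Suc n)) * x"
    "hcard C e n = x * y"
    "hcard K d n = y * idx (ssum (cyc A d n) (bnd K d n)) (bnd K d n)"
proof
  note AD = cplxD[OF A] and KD = cplxD[OF K] and CD = cplxD[OF C] and fD = cmapD[OF f]
  have AK: "A p \<subseteq> K p" for p using ker by auto
  have cAK: "cyc A d p \<subseteq> cyc K d p" for p using AK by (auto simp: cyc_def)
  let ?S = "\<lambda>p. ssum (cyc A d p) (bnd K d p)"
  have sS: "sgrp (?S p)" for p by (simp add: sgrp_ssum sgrp_cyc sgrp_bnd A K)
  define x where "x = idx (cyc C e n) (f n ` cyc K d n)"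
  define y where "y = idx (cyc K d n) (?S n)"
  have fcyc: "sgrp (f n ` cyc K d n)"
    by (rule sgrp_image[OF sgrp_cyc[OF K]]) (auto simp: fD cyc_def)
  show "hcard K d n = y * idx (?S n) (bnd K d n)"
    unfolding hcard_def y_def
    by (intro idx_tower ssum_least conjunct2[OF ssum_upper])
      (simp_all add: sgrp_cyc sgrp_bnd K A sS bnd_subset_cyc cAK)
  show "hcard C e n = x * y"
  proof -
    have "y = idx (f n ` cyc K d n) (bnd C e n)"
      unfolding y_def
    proof (rule idx_iso[where f = "f n"])
      fix z assume z: "z \<in> cyc K d n"
      then have zK: "z \<in> K n" "d n z = 0" by (auto simp: cyc_def)
      have *: "z - b \<in> cyc A d n \<longleftrightarrow> f n z = f n b" if "b \<in> bnd K d n" for b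
      proof -
        have b: "b \<in> K n" "d n b = 0" using bnd_subset_cyc[OF K] that by (auto simp: cyc_def)
        show ?thesis using b zK KD(3)[of z n b] KD(1)[of n] fD(2)[of z n b] by (auto simp: cyc_def ker sgrp_diff)
      qed
      have "f n ` bnd K d n = bnd C e n"
      proof (cases n)
        case 0 then show ?thesis using cmap_0[OF f K] by simp
      next
        case (Suc m)
        then show ?thesis using surj[of _ m] fD(3)[of _ m] fD(1)[of _ m] by (auto simp: image_iff) metis+
      qed
      then show "f n z \<in> bnd C e n \<longleftrightarrow> z \<in> ?S n"
        unfolding in_ssum_iff[OF sgrp_cyc[OF A]] using * by (metis (mono_tags, lifting) image_iff)
    next
      show "f n (x - y) = f n x - f n y" if "x \<in> cyc K d n" "y \<in> cyc K d n" for x y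
        using that fD(2) by (auto simp: cyc_def)
      show "\<exists>z\<in>cyc K d n. w - f n z \<in> bnd C e n" if "w \<in> f n ` cyc K d n" for w
        using that by (metis diff_self imageE sgrp_zero[OF sgrp_bnd[OF C]])
    qed (simp_all add: sgrp_cyc[OF K] sgrp_bnd[OF C] sS)
    then show ?thesis
      unfolding hcard_def x_def
    proof (simp, intro idx_tower)
      show "bnd C e n \<subseteq> f n ` cyc K d n"
      proof (cases n)
        case 0 then show ?thesis using cmap_0[OF f K, of 0] sgrp_zero[OF sgrp_cyc[OF K, of 0]] by force
      next
        case (Suc m)
        show ?thesis
        proof
          fix u assume "u \<in> bnd C e n"
          then obtain v where "v \<in> K m" "u = f n (d m v)" using Suc surj fD(3)[of _ m] by fastforce
          then show "u \<in> f n ` cyc K d n" using KD Suc by (auto simp: cyc_def)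
        qed
      qed
    qed (use cmap_cyc[OF f K] in \<open>auto simp: sgrp_cyc sgrp_bnd C fcyc\<close>)
  qed
  \<comment> \<open>The lifts to \<open>K\<close> of cocycles of \<open>C\<close>, as in the snake
    lemma. Modulo \<open>A n\<close> and the cocycles of \<open>K\<close>, the map \<open>f\<close>
    identifies them with cocycle classes of \<open>C\<close> that do not lift to cocycles, and the
    map \<open>d\<close> identifies them with the kernel of H^(n+1)(A) -> H^(n+1)(K). The connecting
    map thus appears only through its order.\<close>
  let ?P = "{w \<in> K n. d n w \<in> A (Suc n)}"
  have sP: "sgrp ?P"
    by (rule sgrpI) (auto simp: KD sgrp_diff sgrp_zero cplx_d0[OF K] AD)
  let ?I = "cyc A d (Suc n) \<inter> bnd K d (Suc n)"
  have sT: "sgrp (ssum (A n) (cyc K d n))" by (simp add: sgrp_ssum AD sgrp_cyc K)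
  have fin: "f n (z - c) = f n z - f n c" "d n (z - c) = d n z - d n c" "z - c \<in> K n"
    if "z \<in> K n" "c \<in> K n" for z c
    using that fD KD sgrp_diff[OF KD(1)] by auto
  have "idx ?P (ssum (A n) (cyc K d n)) = idx (cyc C e n) (f n ` cyc K d n)"
  proof (rule idx_iso[where f = "f n"])
    fix z assume z: "z \<in> ?P"
    show "f n z \<in> cyc C e n"
      using z ker cmap_0[OF f K] fD(1)[of z n] fD(3)[of z n] by (auto simp: cyc_def)
    have "z - c \<in> A n \<longleftrightarrow> f n z = f n c" if "c \<in> cyc K d n" for c
      using fin[of z c] z that ker[of n] by (auto simp: cyc_def)
    then show "f n z \<in> f n ` cyc K d n \<longleftrightarrow> z \<in> ssum (A n) (cyc K d n)"
      unfolding in_ssum_iff[OF AD(1)] by (metis (mono_tags, lifting) image_iff)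
  next
    fix w assume "w \<in> cyc C e n"
    then have "w \<in> C n" "e n w = 0" by (auto simp: cyc_def)
    then obtain v where "v \<in> K n" "f n v = w" using surj by blast
    then have "v \<in> ?P" "w - f n v = 0" using fD(3)[of v n] \<open>e n w = 0\<close> ker KD by auto
    then show "\<exists>z\<in>?P. w - f n z \<in> f n ` cyc K d n"
      by (metis sgrp_zero[OF fcyc])
  qed (use sP sT fcyc fD in auto)
  moreover have "idx ?P (ssum (A n) (cyc K d n)) = idx ?I (bnd A d (Suc n))"
  proof (rule idx_iso[where f = "d n"])
    fix z assume z: "z \<in> ?P"
    then have "d (Suc n) (d n z) = 0" using KD by auto
    then show "d n z \<in> ?I" using z by (auto simp: cyc_def)
    have "z - c \<in> cyc K d n \<longleftrightarrow> d n z = d n c" if "c \<in> A n" for c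
      using fin[of z c] z that AK[of n] by (auto simp: cyc_def)
    then have "d n z \<in> d n ` A n \<longleftrightarrow> z \<in> ssum (cyc K d n) (A n)"
      unfolding in_ssum_iff[OF sgrp_cyc[OF K]] by (metis (mono_tags, lifting) image_iff)
    then show "d n z \<in> bnd A d (Suc n) \<longleftrightarrow> z \<in> ssum (A n) (cyc K d n)"
      by (simp add: ssum_def image_iff) (metis add.commute)
  next
    fix w assume "w \<in> ?I"
    then obtain v where "v \<in> K n" "w = d n v" "w \<in> A (Suc n)" by (auto simp: cyc_def)
    then have "v \<in> ?P" "w - d n v = 0" by auto
    then show "\<exists>z\<in>?P. w - d n z \<in> bnd A d (Suc n)"
      by (metis sgrp_zero[OF sgrp_bnd[OF A]])
  qed (use sP sT KD sgrp_bnd[OF A, of "Suc n"] in auto)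
  ultimately have 2: "idx ?I (bnd A d (Suc n)) = x"
    by (simp add: x_def)
  have 1: "idx (cyc A d (Suc n)) ?I = idx (?S (Suc n)) (bnd K d (Suc n))"
  proof (rule idx_iso[where f = "\<lambda>z. z"])
    fix w assume "w \<in> ?S (Suc n)"
    then obtain b where "b \<in> bnd K d (Suc n)" "w - b \<in> cyc A d (Suc n)"
      unfolding in_ssum_iff[OF sgrp_cyc[OF A]] by blast
    then show "\<exists>z\<in>cyc A d (Suc n). w - z \<in> bnd K d (Suc n)"
      by (intro bexI[of _ "w - b"]) auto
  qed (use ssum_upper[of "cyc A d (Suc n)" "bnd K d (Suc n)"] in
      \<open>auto simp: sgrp_cyc sgrp_bnd A K sgrp_Int simp del: bnd_Suc\<close>)
  have "hcard A d (Suc n) = idx (cyc A d (Suc n)) ?I * idx ?I (bnd A d (Suc n))"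
    unfolding hcard_def
    by (rule idx_tower)
      (use bnd_subset_cyc[OF A, of "Suc n"] AK in \<open>auto simp: sgrp_cyc sgrp_bnd A K sgrp_Int simp del: bnd_Suc\<close>,
       use AK in auto)
  then show "hcard A d (Suc n) = idx (?S (Suc n)) (bnd K d (Suc n)) * x"
    by (simp only: 1 2)
qed

text \<open>The left end of the exact sequence: boundaries in degree 0 are zero, so the image of
  H^0(A) in H^0(K) is as large as H^0(A).\<close>

lemma hcard_short_exact_0:
  assumes A: "cplx A d"
  shows "hcard A d 0 = idx (ssum (cyc A d 0) (bnd K d 0)) (bnd K d 0)"
proof -
  have "ssum (cyc A d 0) {0} = cyc A d 0"
    by (force simp: ssum_def)
  then show ?thesis by (simp add: hcard_def)
qed

lemma idx_image_dvd_hcard: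
  assumes "cplx A d" "cplx K d" "\<And>p. A p \<subseteq> K p"
  shows "idx (ssum (cyc A d n) (bnd K d n)) (bnd K d n) dvd hcard K d n"
proof -
  have "cyc A d n \<subseteq> cyc K d n" using assms(3) by (auto simp: cyc_def)
  then have "hcard K d n = idx (cyc K d n) (ssum (cyc A d n) (bnd K d n)) * idx (ssum (cyc A d n) (bnd K d n)) (bnd K d n)"
    unfolding hcard_def using assms
    by (intro idx_tower ssum_least conjunct2[OF ssum_upper])
      (simp_all add: sgrp_cyc sgrp_bnd sgrp_ssum bnd_subset_cyc)
  then show ?thesis by simp
qed

lemma hcard_Times:
  assumes "cplx K d" "cplx L e"
  shows "cplx (\<lambda>p. K p \<times> L p) (\<lambda>p. map_prod (d p) (e p))" (is ?c)
    and "hcard (\<lambda>p. K p \<times> L p) (\<lambda>p. map_prod (d p) (e p)) n = hcard K d n * hcard L e n" (is ?h)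
proof -
  show ?c
    using assms by (auto simp: cplx_def sgrp_def zero_prod_def)
  have "cyc (\<lambda>p. K p \<times> L p) (\<lambda>p. map_prod (d p) (e p)) n = cyc K d n \<times> cyc L e n"
    by (auto simp: cyc_def zero_prod_def)
  moreover have "bnd (\<lambda>p. K p \<times> L p) (\<lambda>p. map_prod (d p) (e p)) n = bnd K d n \<times> bnd L e n"
    by (cases n) (auto simp: zero_prod_def)
  ultimately show ?h
    unfolding hcard_def by (simp add: idx_Times sgrp_cyc sgrp_bnd assms)
qed

lemma cplx_subcomplex:
  assumes "cplx K d" "\<And>p. sgrp (A p)" "\<And>p. A p \<subseteq> K p" "\<And>p x. x \<in> A p \<Longrightarrow> d p x \<in> A (Suc p)"
  shows "cplx A d"
  using assms unfolding cplx_def by (meson subsetD)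

section \<open>Cochains with symmetry and vanishing conditions\<close>

text \<open>The bridge from integral singular chains to cochains modulo 2: through it, identities
  for \<open>chain_boundary\<close>, \<open>chain_map\<close> and subdivision become identities for
  cochains, and signs disappear.\<close>

definition pairing :: "('s \<Rightarrow> bit) \<Rightarrow> ('s \<Rightarrow>\<^sub>0 int) \<Rightarrow> bit"
  where "pairing c x = (\<Sum>\<sigma>\<in>Poly_Mapping.keys x. of_int (Poly_Mapping.lookup x \<sigma>) * c \<sigma>)"

text \<open>Bits are to be simplified as elements of a ring, not as truth values.\<close>

declare add_bit_eq_xor [simp del] mult_bit_eq_and [simp del]

lemma pairing_superset:
  assumes "finite S" "Poly_Mapping.keys x \<subseteq> S"
  shows "pairing c x = (\<Sum>\<sigma>\<in>S. of_int (Poly_Mapping.lookup x \<sigma>) * c \<sigma>)"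
  unfolding pairing_def
  by (rule sum.mono_neutral_left) (use assms in \<open>auto simp: in_keys_iff\<close>)

lemma pairing_0 [simp]: "pairing c 0 = 0"
  by (simp add: pairing_def)

lemma pairing_of [simp]: "pairing c (frag_of \<sigma>) = c \<sigma>"
  by (simp add: pairing_def)

lemma pairing_add [simp]: "pairing c (x + y) = pairing c x + pairing c y"
proof -
  let ?S = "Poly_Mapping.keys x \<union> Poly_Mapping.keys y"
  have "finite ?S" "Poly_Mapping.keys (x + y) \<subseteq> ?S" using keys_add[of x y] by auto
  then show ?thesis
    by (simp add: pairing_superset[of ?S] lookup_add distrib_right sum.distrib)
qed

lemma pairing_uminus [simp]: "pairing c (- x) = pairing c x"
  by (simp add: pairing_def)

lemma pairing_diff [simp]: "pairing c (x - y) = pairing c x + pairing c y"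
  using pairing_add[of c x "- y"] by simp

lemma pairing_sum [simp]: "pairing c (\<Sum>i\<in>I. f i) = (\<Sum>i\<in>I. pairing c (f i))"
  by (induction I rule: infinite_finite_induct) auto

lemma pairing_sign [simp]: "pairing c (frag_cmul ((- 1) ^ k) x) = pairing c x"
  by (cases "even k") auto

lemma pairing_zero_left [simp]: "pairing (\<lambda>\<sigma>. 0) x = 0"
  by (simp add: pairing_def)

lemma pairing_cong:
  assumes "\<And>\<sigma>. \<sigma> \<in> Poly_Mapping.keys x \<Longrightarrow> c \<sigma> = c' \<sigma>" shows "pairing c x = pairing c' x"
  using assms by (simp add: pairing_def)

lemma pairing_frag_extend: "pairing c (frag_extend f x) = pairing (\<lambda>\<sigma>. pairing c (f \<sigma>)) x"
  using subset_UNIV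
  by (induction x rule: frag_induction) (auto simp: frag_extend_diff)

lemma pairing_chain_map: "pairing c (chain_map p f x) = pairing (\<lambda>\<sigma>. c (simplex_map p f \<sigma>)) x"
  by (simp add: chain_map_def pairing_frag_extend)

text \<open>Same formula as \<open>coboundary\<close>, but with the value 0 in place of
  \<open>undefined\<close> outside the singular simplices. Cochains then form subgroups of the
  additive group of all functions, where \<open>sgrp\<close> and \<open>idx\<close> apply.\<close>

definition cob :: "'a topology \<Rightarrow> nat \<Rightarrow> 'a cochain \<Rightarrow> 'a cochain"
  where "cob Y p c = (\<lambda>\<sigma>. if singular_simplex (Suc p) Y \<sigma>
    then \<Sum>k\<le>Suc p. c (singular_face (Suc p) k \<sigma>) else 0)"

lemma cob_eq_pairing:
  "singular_simplex (Suc p) Y \<sigma> \<Longrightarrow> cob Y p c \<sigma> = pairing c (chain_boundary (Suc p) (frag_of \<sigma>))"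
  by (simp add: cob_def chain_boundary_of del: sum.atMost_Suc)

lemma pairing_cob:
  assumes "singular_chain (Suc p) Y x"
  shows "pairing (cob Y p c) x = pairing c (chain_boundary (Suc p) x)"
  using assms unfolding singular_chain_def
  by (induction x rule: frag_induction) (auto simp: cob_eq_pairing chain_boundary_diff)

text \<open>
  The invariant cochains of \<open>Y\<close> relative to \<open>B\<close>. Ordinary cochains are the special
  case \<open>\<tau> = id\<close>, \<open>B = {}\<close>.
\<close>

definition coch :: "'a topology \<Rightarrow> ('a \<Rightarrow> 'a) \<Rightarrow> 'a set \<Rightarrow> nat \<Rightarrow> 'a cochain set"
  where "coch Y \<tau> B p = {c.
    (\<forall>\<sigma>. c \<sigma> \<noteq> 0 \<longrightarrow> singular_simplex p Y \<sigma> \<and> \<not> \<sigma> ` standard_simplex p \<subseteq> B) \<and>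
    (\<forall>\<sigma>. singular_simplex p Y \<sigma> \<longrightarrow> c (simplex_map p \<tau> \<sigma>) = c \<sigma>)}"

definition inv_pair :: "'a topology \<Rightarrow> ('a \<Rightarrow> 'a) \<Rightarrow> 'a set \<Rightarrow> bool"
  where "inv_pair Y \<tau> B \<longleftrightarrow> continuous_map Y Y \<tau> \<and> (\<forall>y\<in>topspace Y. \<tau> (\<tau> y) = y) \<and>
    (\<forall>y\<in>topspace Y. y \<in> B \<longrightarrow> \<tau> y \<in> B)"

lemma cochI:
  assumes "\<And>\<sigma>. \<not> singular_simplex p Y \<sigma> \<Longrightarrow> c \<sigma> = 0"
    and "\<And>\<sigma>. \<lbrakk>singular_simplex p Y \<sigma>; \<sigma> ` standard_simplex p \<subseteq> B\<rbrakk> \<Longrightarrow> c \<sigma> = 0"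
    and "\<And>\<sigma>. singular_simplex p Y \<sigma> \<Longrightarrow> c (simplex_map p \<tau> \<sigma>) = c \<sigma>"
  shows "c \<in> coch Y \<tau> B p"
  unfolding coch_def using assms by blast

lemma cochD:
  assumes "c \<in> coch Y \<tau> B p"
  shows "\<not> singular_simplex p Y \<sigma> \<Longrightarrow> c \<sigma> = 0"
    and "\<sigma> ` standard_simplex p \<subseteq> B \<Longrightarrow> c \<sigma> = 0"
    and "singular_simplex p Y \<sigma> \<Longrightarrow> c (simplex_map p \<tau> \<sigma>) = c \<sigma>"
  using assms unfolding coch_def by blast+

lemma inv_pair_id: "inv_pair Y id {}"
  by (simp add: inv_pair_def)

lemma sgrp_coch: "sgrp (coch Y \<tau> B p)"
proof (rule sgrpI)
  fix c c' assume c: "c \<in> coch Y \<tau> B p" and c': "c' \<in> coch Y \<tau> B p"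
  show "c - c' \<in> coch Y \<tau> B p"
    by (rule cochI) (simp_all add: cochD[OF c] cochD[OF c'])
qed (auto simp: coch_def)

lemma pairing_coch_relative:
  assumes "c \<in> coch Y \<tau> B p" "singular_chain p (subtopology Y B) x"
  shows "pairing c x = 0"
proof -
  have "pairing c x = pairing (\<lambda>\<sigma>. 0) x"
    using assms(2) cochD(2)[OF assms(1)]
    by (intro pairing_cong) (auto simp: singular_chain_subtopology)
  then show ?thesis by simp
qed

lemma pairing_coch_invariant:
  assumes "c \<in> coch Y \<tau> B p" "singular_chain p Y x"
  shows "pairing c (chain_map p \<tau> x) = pairing c x"
  unfolding pairing_chain_map
  using assms(2) cochD(3)[OF assms(1)] by (intro pairing_cong) (auto simp: singular_chain_def)

lemma singular_face_image_subset:
  assumes "k \<le> Suc p"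
  shows "singular_face (Suc p) k \<sigma> ` standard_simplex p \<subseteq> \<sigma> ` standard_simplex (Suc p)"
proof -
  have "simplical_face k x \<in> standard_simplex (Suc p)" if "x \<in> standard_simplex p" for x
    using simplical_face_in_standard_simplex[of "Suc p" k x] assms that by simp
  then show ?thesis by (auto simp: singular_face_def)
qed

lemma singular_simplex_face:
  "\<lbrakk>singular_simplex (Suc p) Y \<sigma>; k \<le> Suc p\<rbrakk> \<Longrightarrow> singular_simplex p Y (singular_face (Suc p) k \<sigma>)"
  using singular_simplex_singular_face[of "Suc p" Y \<sigma> k] by simp

lemma singular_face_simplex_map':
  assumes "k \<le> Suc p"
  shows "singular_face (Suc p) k (simplex_map (Suc p) f \<sigma>) = simplex_map p f (singular_face (Suc p) k \<sigma>)"
proof -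
  have "simplical_face k x \<in> standard_simplex (Suc p)" if "x \<in> standard_simplex p" for x
    using simplical_face_in_standard_simplex[of "Suc p" k x] assms that by simp
  then show ?thesis
    by (auto simp: singular_face_def simplex_map_def fun_eq_iff)
qed

lemma cplx_coch:
  assumes "inv_pair Y \<tau> B" shows "cplx (coch Y \<tau> B) (cob Y)"
  unfolding cplx_def
proof (intro conjI allI ballI)
  fix p c assume c: "c \<in> coch Y \<tau> B p"
  show "cob Y p c \<in> coch Y \<tau> B (Suc p)"
  proof (rule cochI)
    fix \<sigma> assume \<sigma>: "singular_simplex (Suc p) Y \<sigma>"
    show "cob Y p c \<sigma> = 0" if "\<sigma> ` standard_simplex (Suc p) \<subseteq> B"
    proof -
      have "c (singular_face (Suc p) k \<sigma>) = 0" if "k \<le> Suc p" for k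
        by (rule cochD(2)[OF c]) (use singular_face_image_subset[of k p \<sigma>] that \<open>_ \<subseteq> B\<close> in blast)
      then show ?thesis by (simp add: cob_def del: sum.atMost_Suc)
    qed
    have "singular_simplex (Suc p) Y (simplex_map (Suc p) \<tau> \<sigma>)"
      using assms \<sigma> by (auto simp: inv_pair_def intro: singular_simplex_simplex_map)
    then show "cob Y p c (simplex_map (Suc p) \<tau> \<sigma>) = cob Y p c \<sigma>"
      using \<sigma> cochD(3)[OF c] by (simp add: cob_def singular_face_simplex_map' singular_simplex_face del: sum.atMost_Suc)
  qed (simp add: cob_def)
  show "cob Y (Suc p) (cob Y p c) = 0"
  proof
    fix \<sigma> show "cob Y (Suc p) (cob Y p c) \<sigma> = 0 \<sigma>"
    proof (cases "singular_simplex (Suc (Suc p)) Y \<sigma>")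
      case True
      then have ch: "singular_chain (Suc (Suc p)) Y (frag_of \<sigma>)" by (simp add: singular_chain_of)
      then have "pairing (cob Y p c) (chain_boundary (Suc (Suc p)) (frag_of \<sigma>))
          = pairing c (chain_boundary (Suc p) (chain_boundary (Suc (Suc p)) (frag_of \<sigma>)))"
        by (intro pairing_cob singular_chain_boundary_alt)
      also have "\<dots> = 0" using chain_boundary_boundary_alt[OF ch] by simp
      finally show ?thesis using True by (simp add: cob_eq_pairing)
    qed (simp add: cob_def)
  qed
next
  fix p c c' show "cob Y p (c - c') = cob Y p c - cob Y p c'"
    by (auto simp: cob_def fun_eq_iff sum.distrib simp del: sum.atMost_Suc)
qed (rule sgrp_coch)

text \<open>For \<open>\<tau> = id\<close> and \<open>B = {}\<close> this is the order of singular
  cohomology; for a free involution and \<open>B = {}\<close> it is that of the orbit space.\<close>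

definition coh :: "'a topology \<Rightarrow> ('a \<Rightarrow> 'a) \<Rightarrow> 'a set \<Rightarrow> nat \<Rightarrow> nat"
  where "coh Y \<tau> B p = hcard (coch Y \<tau> B) (cob Y) p"

definition pull :: "'a topology \<Rightarrow> ('a \<Rightarrow> 'b) \<Rightarrow> nat \<Rightarrow> 'b cochain \<Rightarrow> 'a cochain"
  where "pull Y f p c = (\<lambda>\<sigma>. if singular_simplex p Y \<sigma> then c (simplex_map p f \<sigma>) else 0)"

lemma cob_pull:
  assumes "continuous_map Y Y' f"
  shows "cob Y p (pull Y f p c) = pull Y f (Suc p) (cob Y' p c)"
proof
  fix \<sigma>
  show "cob Y p (pull Y f p c) \<sigma> = pull Y f (Suc p) (cob Y' p c) \<sigma>"
  proof (cases "singular_simplex (Suc p) Y \<sigma>")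
    case True
    then show ?thesis
      using singular_simplex_simplex_map[OF True assms]
      by (simp add: cob_def pull_def singular_simplex_face singular_face_simplex_map' del: sum.atMost_Suc)
  qed (simp add: cob_def pull_def)
qed

definition pair_map :: "'a topology \<Rightarrow> ('a \<Rightarrow> 'a) \<Rightarrow> 'a set \<Rightarrow> 'b topology \<Rightarrow> ('b \<Rightarrow> 'b) \<Rightarrow> 'b set \<Rightarrow> ('a \<Rightarrow> 'b) \<Rightarrow> bool"
  where "pair_map Y \<tau> B Y' \<tau>' B' f \<longleftrightarrow> continuous_map Y Y' f \<and>
    (\<forall>y\<in>topspace Y. f (\<tau> y) = \<tau>' (f y)) \<and> (\<forall>y\<in>topspace Y. y \<in> B \<longrightarrow> f y \<in> B')"

lemma simplex_map_commute:
  assumes "singular_simplex p Y \<sigma>" "\<And>y. y \<in> topspace Y \<Longrightarrow> f (g y) = h (k y)"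
  shows "simplex_map p f (simplex_map p g \<sigma>) = simplex_map p h (simplex_map p k \<sigma>)"
proof -
  have "\<sigma> x \<in> topspace Y" if "x \<in> standard_simplex p" for x
    using assms(1) that unfolding singular_simplex_def continuous_map_def by auto
  then show ?thesis
    using assms(2) by (auto simp: simplex_map_def fun_eq_iff)
qed

lemma singular_simplex_in_topspace:
  "\<lbrakk>singular_simplex p Y \<sigma>; x \<in> standard_simplex p\<rbrakk> \<Longrightarrow> \<sigma> x \<in> topspace Y"
  unfolding singular_simplex_def continuous_map_def by auto

lemma cmap_pull:
  assumes "inv_pair Y \<tau> B" "pair_map Y \<tau> B Y' \<tau>' B' f"
  shows "cmap (coch Y' \<tau>' B') (cob Y') (coch Y \<tau> B) (cob Y) (pull Y f)"
  unfolding cmap_def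
proof (intro conjI allI ballI)
  have f: "continuous_map Y Y' f" using assms(2) by (simp add: pair_map_def)
  fix p c assume c: "c \<in> coch Y' \<tau>' B' p"
  show "pull Y f p c \<in> coch Y \<tau> B p"
  proof (rule cochI)
    fix \<sigma> assume \<sigma>: "singular_simplex p Y \<sigma>"
    show "pull Y f p c \<sigma> = 0" if "\<sigma> ` standard_simplex p \<subseteq> B"
    proof -
      have "simplex_map p f \<sigma> ` standard_simplex p \<subseteq> B'"
        using that assms(2) singular_simplex_in_topspace[OF \<sigma>]
        by (auto simp: simplex_map_def pair_map_def image_subset_iff)
      then show ?thesis using cochD(2)[OF c] by (simp add: pull_def)
    qed
    have "singular_simplex p Y (simplex_map p \<tau> \<sigma>)"
      using assms \<sigma> by (auto simp: inv_pair_def intro: singular_simplex_simplex_map)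
    moreover have "simplex_map p f (simplex_map p \<tau> \<sigma>) = simplex_map p \<tau>' (simplex_map p f \<sigma>)"
      using assms(2) by (intro simplex_map_commute[OF \<sigma>]) (auto simp: pair_map_def)
    ultimately show "pull Y f p c (simplex_map p \<tau> \<sigma>) = pull Y f p c \<sigma>"
      using \<sigma> cochD(3)[OF c singular_simplex_simplex_map[OF \<sigma> f]] by (simp add: pull_def)
  qed (simp add: pull_def)
  show "pull Y f (Suc p) (cob Y' p c) = cob Y p (pull Y f p c)"
    by (simp add: cob_pull[OF f])
qed (auto simp: pull_def fun_eq_iff)


section \<open>Natural chain homotopies\<close>

abbreviation simplex_top :: "nat \<Rightarrow> (nat \<Rightarrow> real) topology"
  where "simplex_top p \<equiv> subtopology (powertop_real UNIV) (standard_simplex p)"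

abbreviation id_simplex :: "nat \<Rightarrow> (nat \<Rightarrow> real) chain"
  where "id_simplex p \<equiv> frag_of (restrict id (standard_simplex p))"

abbreviation cyl :: "'a topology \<Rightarrow> (real \<times> 'a) topology"
  where "cyl Y \<equiv> prod_topology (top_of_set {0..1}) Y"

lemma contractible_simplex_top: "contractible_space (simplex_top p)"
  unfolding contractible_space_def
proof (intro exI)
  define a :: "nat \<Rightarrow> real" where "a = (\<lambda>j. if j = 0 then 1 else 0)"
  have a: "a \<in> standard_simplex p" by (simp add: a_def)
  define h where "h = (\<lambda>(u, x) i. (1 - u) * x i + u * a i)"
  show "homotopic_with (\<lambda>x. True) (simplex_top p) (simplex_top p) id (\<lambda>x. a)"
    unfolding homotopic_with_def
  proof (intro exI conjI allI ballI)
    have "continuous_map (cyl (simplex_top p)) (powertop_real UNIV) h"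
      unfolding continuous_map_componentwise_UNIV h_def case_prod_unfold
    proof (intro allI continuous_map_add continuous_map_real_mult continuous_map_diff)
      fix k :: nat
      have "continuous_map (powertop_real UNIV) euclideanreal (\<lambda>x. x k)"
        by (rule continuous_map_product_projection) simp
      then show "continuous_map (cyl (simplex_top p)) euclideanreal (\<lambda>x. snd x k)"
        by (intro continuous_map_compose[OF continuous_map_snd, unfolded o_def] continuous_map_from_subtopology)
      show "continuous_map (cyl (simplex_top p)) euclideanreal fst"
        by (meson continuous_map_fst continuous_map_into_fulltopology)
      then show "continuous_map (cyl (simplex_top p)) euclideanreal fst" .
    qed auto
    then show "continuous_map (cyl (simplex_top p)) (simplex_top p) h"
      by (auto simp: continuous_map_in_subtopology h_def convex_standard_simplex a)
  qed (auto simp: h_def)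
qed

lemma contractible_cyl_simplex: "contractible_space (cyl (simplex_top p))"
  by (simp add: contractible_space_prod_topology contractible_simplex_top convex_imp_contractible del: contractible_space_subtopology_euclideanreal)

text \<open>The identity is homotopic to a constant map, so the cycle is homologous to its image at
  a point, and in positive degree cycles of a point bound.\<close>

lemma cycle_bounds_in_contractible_space:
  assumes X: "contractible_space X" and p: "0 < p" and c: "singular_chain p X c" "chain_boundary p c = 0"
  obtains d where "singular_chain (Suc p) X d" "chain_boundary (Suc p) d = c"
proof (cases "topspace X = {}")
  case True
  then have "c = 0" using c by (simp add: singular_chain_empty)
  then show ?thesis using that[of 0] by simp
next
  case False
  then obtain a where a: "a \<in> topspace X" "homotopic_with (\<lambda>x. True) X X id (\<lambda>x. a)"
    using X unfolding contractible_space by (auto simp flip: null_topspace_iff_trivial)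
  have cyc: "singular_relcycle p X {} c" using c by (simp add: singular_cycle)
  have "homologous_rel p X {} (chain_map p id c) (chain_map p (\<lambda>x. a) c)"
    by (rule homotopic_imp_homologous_rel_chain_maps[OF _ cyc]) (use a in simp)
  moreover have "chain_map p id c = c" using c by (simp add: chain_map_ident)
  moreover have "singular_relboundary p X {} (chain_map p (\<lambda>x. a) c)"
  proof -
    have "singular_relcycle p (subtopology X {a}) {} (chain_map p (\<lambda>x. a) c)"
      by (rule singular_relcycle_chain_map[OF cyc]) (use a in \<open>auto simp: continuous_map_in_subtopology\<close>)
    then have "singular_relboundary p (subtopology X {a}) {} (chain_map p (\<lambda>x. a) c)"
      using singular_boundary_eq_cycle_singleton[of "subtopology X {a}" a p] a p by auto
    then show ?thesis
      by (metis singular_boundary_mono subset_UNIV subtopology_UNIV)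
  qed
  ultimately have "singular_relboundary p X {} (c - chain_map p (\<lambda>x. a) c + chain_map p (\<lambda>x. a) c)"
    unfolding homologous_rel_def by (intro singular_relboundary_add) auto
  then show ?thesis using that by (auto simp: singular_boundary)
qed

text \<open>A natural operator on singular chains is determined by its value on the identity
  simplex. \<open>nat_op\<close> builds the operator from such a model chain \<open>u\<close>;
  \<open>prism\<close> does the same with a model chain on the cylinder over the simplex.\<close>

definition nat_op :: "nat \<Rightarrow> (nat \<Rightarrow> real) chain \<Rightarrow> 'a chain \<Rightarrow> 'a chain"
  where "nat_op p u = frag_extend (\<lambda>\<sigma>. chain_map p \<sigma> u)"

definition prism :: "nat \<Rightarrow> (real \<times> (nat \<Rightarrow> real)) chain \<Rightarrow> 'a chain \<Rightarrow> (real \<times> 'a) chain"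
  where "prism k q = frag_extend (\<lambda>\<sigma>. chain_map k (map_prod id \<sigma>) q)"

lemma prism_simps [simp]:
  "prism k q 0 = 0" "prism k q (frag_of \<sigma>) = chain_map k (map_prod id \<sigma>) q"
  "prism k q (x - y) = prism k q x - prism k q y"
  by (simp_all add: prism_def frag_extend_diff)

lemma nat_op_simps [simp]:
  "nat_op k q 0 = 0" "nat_op k q (frag_of \<sigma>) = chain_map k \<sigma> q"
  "nat_op k q (x - y) = nat_op k q x - nat_op k q y"
  by (simp_all add: nat_op_def frag_extend_diff)

lemma continuous_map_cyl:
  "continuous_map Y Y' f \<Longrightarrow> continuous_map (cyl Y) (cyl Y') (map_prod id f)"
  by (rule continuous_map_prod_top[THEN iffD2, unfolded map_prod_def[symmetric]] | simp add: map_prod_def continuous_map_prod_top)+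

lemma singular_chain_prism:
  assumes "singular_chain k (cyl (simplex_top n)) q" "singular_chain n Y c"
  shows "singular_chain k (cyl Y) (prism k q c)"
  using assms(2) unfolding singular_chain_def[of n]
proof (induction c rule: frag_induction)
  case (one \<sigma>)
  then show ?case
    using assms(1) by (auto intro!: singular_chain_chain_map continuous_map_cyl simp: singular_simplex_def)
qed (auto simp: singular_chain_diff)

lemma prism_natural:
  assumes q: "singular_chain k (cyl (simplex_top n)) q" and c: "singular_chain n Y c"
  shows "chain_map k (map_prod id f) (prism k q c) = prism k q (chain_map n f c)"
  using c unfolding singular_chain_def[of n]
proof (induction c rule: frag_induction)
  case (one \<sigma>)
  have "chain_map k (map_prod id f \<circ> map_prod id \<sigma>) q = chain_map k (map_prod id (simplex_map n f \<sigma>)) q"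
    by (rule chain_map_eq[OF q]) (auto simp: simplex_map_def)
  then show ?case by (simp only: chain_map_compose prism_simps chain_map_of o_apply)
qed (auto simp: chain_map_diff)

lemma boundary_id_simplex_map:
  assumes "singular_simplex p Y \<sigma>"
  shows "chain_map (p - Suc 0) \<sigma> (chain_boundary p (id_simplex p)) = chain_boundary p (frag_of \<sigma>)"
proof -
  have "singular_chain p (simplex_top p) (id_simplex p)"
    by (auto simp: singular_chain_of singular_simplex_def continuous_map_in_subtopology
        intro!: continuous_map_eq[OF continuous_map_from_subtopology[OF continuous_map_id]])
  then show ?thesis
    using chain_boundary_chain_map[of p "simplex_top p" "id_simplex p" \<sigma>] singular_simplex_chain_map_id[OF assms]
    by simp
qed

text \<open>The homotopy formula has to be checked on the identity simplex only: applying
  \<open>map_prod id \<sigma>\<close> transports it to \<open>\<sigma>\<close>, and linearity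
  extends it to all chains.\<close>

lemma boundary_prism:
  assumes x: "singular_chain p (cyl (simplex_top (p - Suc 0))) x" and y: "singular_chain (Suc p) (cyl (simplex_top p)) y"
    and eq: "chain_boundary (Suc p) y = chain_map p (Pair 1) u - chain_map p (Pair 0) (id_simplex p)
      - prism p x (chain_boundary p (id_simplex p))"
    and c: "singular_chain p Y c"
  shows "chain_boundary (Suc p) (prism (Suc p) y c) =
    chain_map p (Pair 1) (nat_op p u c) - chain_map p (Pair 0) c - prism p x (chain_boundary p c)"
  using c unfolding singular_chain_def[of p]
proof (induction c rule: frag_induction)
  case (one \<sigma>)
  then have \<sigma>: "singular_simplex p Y \<sigma>" by simp
  have idc: "singular_chain p (simplex_top p) (id_simplex p)"
    by (auto simp: singular_chain_of singular_simplex_def continuous_map_in_subtopology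
        intro!: continuous_map_eq[OF continuous_map_from_subtopology[OF continuous_map_id]])
  have "chain_map p (map_prod id \<sigma>) (chain_map p (Pair t) z) = chain_map p (Pair t) (chain_map p \<sigma> z)" for t :: real and z
    using chain_map_compose[of p "map_prod id \<sigma>" "Pair t"] chain_map_compose[of p "Pair t" \<sigma>]
    by (simp add: fun_eq_iff o_def)
  moreover have "chain_map p (map_prod id \<sigma>) (prism p x (chain_boundary p (id_simplex p)))
      = prism p x (chain_boundary p (frag_of \<sigma>))"
    using prism_natural[OF x singular_chain_boundary[OF idc], of \<sigma>] boundary_id_simplex_map[OF \<sigma>] by simp
  ultimately show ?case
    using chain_boundary_chain_map[OF y, of "map_prod id \<sigma>"] eq singular_simplex_chain_map_id[OF \<sigma>]
    by (simp add: chain_map_diff del: chain_map_of)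
next
  case (diff a b)
  then show ?case by (simp add: chain_boundary_diff chain_map_diff)
qed auto

text \<open>The method of acyclic models: the cylinder over a simplex is contractible.\<close>

lemma natural_homotopy_exists:
  fixes u :: "nat \<Rightarrow> (nat \<Rightarrow> real) chain"
  assumes u: "\<And>p. singular_chain p (simplex_top p) (u p)" and u0: "u 0 = id_simplex 0"
    and du: "\<And>p. chain_boundary (Suc p) (u (Suc p)) = nat_op p (u p) (chain_boundary (Suc p) (id_simplex (Suc p)))"
  obtains q where "\<And>p. singular_chain (Suc p) (cyl (simplex_top p)) (q p)"
    and "\<And>p. chain_boundary (Suc p) (q p) = chain_map p (Pair 1) (u p) - chain_map p (Pair 0) (id_simplex p)
      - prism p (q (p - Suc 0)) (chain_boundary p (id_simplex p))"
proof -
  have idc: "singular_chain p (simplex_top p) (id_simplex p)" for p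
    by (auto simp: singular_chain_of singular_simplex_def continuous_map_in_subtopology
        intro!: continuous_map_eq[OF continuous_map_from_subtopology[OF continuous_map_id]])
  have cont: "continuous_map Y (cyl Y) (Pair t)" if "t \<in> {0..1}" for t and Y :: "(nat \<Rightarrow> real) topology"
    using that by (auto simp: continuous_map_pairwise o_def)
  \<comment> \<open>\<open>P\<close> is the invariant of the recursion: on cycles the prism formula
    holds without its correction term. Applied to the boundary of the next identity simplex, it
    shows that the chain to be filled in the next degree is a cycle. \<open>Q\<close> is the
    homotopy formula relating consecutive degrees.\<close>
  define P where "P = (\<lambda>p x. singular_chain (Suc p) (cyl (simplex_top p)) x \<and>
    (\<forall>c. singular_chain p (simplex_top (Suc p)) c \<longrightarrow> chain_boundary p c = 0 \<longrightarrow>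
      chain_boundary (Suc p) (prism (Suc p) x c) = chain_map p (Pair 1) (nat_op p (u p) c) - chain_map p (Pair 0) c))"
  define Q where "Q = (\<lambda>p x y. chain_boundary (Suc (Suc p)) y =
    chain_map (Suc p) (Pair 1) (u (Suc p)) - chain_map (Suc p) (Pair 0) (id_simplex (Suc p))
      - prism (Suc p) x (chain_boundary (Suc p) (id_simplex (Suc p))))"
  have "\<exists>q. (\<forall>p. P p (q p)) \<and> (\<forall>p. Q p (q p) (q (Suc p))) \<and>
      chain_boundary (Suc 0) (q 0) = chain_map 0 (Pair 1) (u 0) - chain_map 0 (Pair 0) (id_simplex 0)"
  proof -
    have "\<exists>x. singular_chain (Suc 0) (cyl (simplex_top 0)) x \<and>
      chain_boundary (Suc 0) x = chain_map 0 (Pair 1) (u 0) - chain_map 0 (Pair 0) (id_simplex 0)"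
    proof -
      \<comment> \<open>Degree 0 is treated apart, because a 0-cycle of a contractible space need
        not bound. The required boundary exists since the two end inclusions of the cylinder are
        homotopic and \<open>u 0\<close> is the identity simplex.\<close>
      have "homotopic_with (\<lambda>h. h \<in> {} \<rightarrow> {}) (simplex_top 0) (cyl (simplex_top 0)) (Pair 1) (Pair 0)"
        by (rule homotopic_with_mono[OF homotopic_into_contractible_space])
          (auto intro: cont contractible_cyl_simplex)
      then have "homologous_rel 0 (cyl (simplex_top 0)) {} (chain_map 0 (Pair 1) (id_simplex 0)) (chain_map 0 (Pair 0) (id_simplex 0))"
        by (rule homotopic_imp_homologous_rel_chain_maps)
          (use idc in \<open>auto simp: singular_cycle chain_boundary_def\<close>)
      then show ?thesis
        unfolding homologous_rel_def u0 by (simp add: singular_boundary)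
    qed
    then obtain x0 where x0: "singular_chain (Suc 0) (cyl (simplex_top 0)) x0"
      "chain_boundary (Suc 0) x0 = chain_map 0 (Pair 1) (u 0) - chain_map 0 (Pair 0) (id_simplex 0)"
      by blast
    have P0: "P 0 x0"
      unfolding P_def
      using boundary_prism[of 0 0 x0 "u 0"] x0 by (auto simp: chain_boundary_def)
    have step: "\<exists>y. P (Suc p) y \<and> Q p x y" if "P p x" for p x
    proof -
      from that have x: "singular_chain (Suc p) (cyl (simplex_top p)) x" by (simp add: P_def)
      let ?b = "chain_boundary (Suc p) (id_simplex (Suc p))"
      have b: "singular_chain p (simplex_top (Suc p)) ?b" "chain_boundary p ?b = 0"
        using singular_chain_boundary_alt[OF idc] chain_boundary_boundary_alt[OF idc]
          chain_boundary_boundary[OF idc, of "Suc p"] by auto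
      let ?z = "chain_map (Suc p) (Pair 1) (u (Suc p)) - chain_map (Suc p) (Pair 0) (id_simplex (Suc p))
        - prism (Suc p) x ?b"
      have z: "singular_chain (Suc p) (cyl (simplex_top (Suc p))) ?z"
        by (intro singular_chain_diff singular_chain_chain_map[OF u] singular_chain_chain_map[OF idc]
            cont singular_chain_prism[OF x] b) auto
      have "chain_boundary (Suc p) (prism (Suc p) x ?b) =
          chain_map p (Pair 1) (nat_op p (u p) ?b) - chain_map p (Pair 0) ?b"
        using that b by (auto simp: P_def)
      then have "chain_boundary (Suc p) ?z = 0"
        using chain_boundary_chain_map[OF u, of "Suc p" "Pair (1::real)"] chain_boundary_chain_map[OF idc, of "Suc p" "Pair (0::real)"]
        by (simp add: chain_boundary_diff du del: chain_map_of)
      then obtain y where y: "singular_chain (Suc (Suc p)) (cyl (simplex_top (Suc p))) y" "chain_boundary (Suc (Suc p)) y = ?z"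
        using cycle_bounds_in_contractible_space[OF contractible_cyl_simplex _ z] by blast
      have "P (Suc p) y"
        unfolding P_def using boundary_prism[of "Suc p" x y "u (Suc p)" "simplex_top (Suc (Suc p))"] x y by auto
      then show ?thesis using y by (auto simp: Q_def)
    qed
    obtain q where "q 0 = x0" "\<And>p. P p (q p)" "\<And>p. Q p (q p) (q (Suc p))"
      using dependent_nat_choice[of "\<lambda>p x. P p x \<and> (p = 0 \<longrightarrow> x = x0)" Q] P0 step by (metis nat.distinct(1))
    then show ?thesis using x0 by blast
  qed
  then obtain q where q: "\<And>p. P p (q p)" "\<And>p. Q p (q p) (q (Suc p))"
      "chain_boundary (Suc 0) (q 0) = chain_map 0 (Pair 1) (u 0) - chain_map 0 (Pair 0) (id_simplex 0)"
    by blast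
  show ?thesis
  proof (rule that)
    show "singular_chain (Suc p) (cyl (simplex_top p)) (q p)" for p using q(1) by (simp add: P_def)
    \<comment> \<open>For \<open>p = 0\<close> the index \<open>p - Suc 0\<close> is truncated to 0,
      but the term is zero because \<open>chain_boundary 0\<close> vanishes.\<close>
    show "chain_boundary (Suc p) (q p) = chain_map p (Pair 1) (u p) - chain_map p (Pair 0) (id_simplex p)
      - prism p (q (p - Suc 0)) (chain_boundary p (id_simplex p))" for p
      using q(2)[of "p - 1"] q(3) by (cases p) (auto simp: Q_def chain_boundary_def)
  qed
qed


lemma singular_chain_id_simplex: "singular_chain p (simplex_top p) (id_simplex p)"
  by (auto simp: singular_chain_of singular_simplex_def continuous_map_in_subtopology
      intro!: continuous_map_eq[OF continuous_map_from_subtopology[OF continuous_map_id]])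

lemma prism_boundary_formula:
  assumes q: "\<And>p. singular_chain (Suc p) (cyl (simplex_top p)) (q p)"
    and dq: "\<And>p. chain_boundary (Suc p) (q p) = chain_map p (Pair 1) (u p) - chain_map p (Pair 0) (id_simplex p)
      - prism p (q (p - Suc 0)) (chain_boundary p (id_simplex p))"
    and c: "singular_chain p Y c"
  shows "chain_boundary (Suc p) (prism (Suc p) (q p) c) =
    chain_map p (Pair 1) (nat_op p (u p) c) - chain_map p (Pair 0) c - prism p (q (p - Suc 0)) (chain_boundary p c)"
proof (cases p)
  case 0
  then show ?thesis
    using boundary_prism[of 0 0 "q 0" "u 0" Y c] q[of 0] dq[of 0] c by (simp add: chain_boundary_def)
next
  case (Suc n)
  then show ?thesis
    using boundary_prism[of p "q n" "q p" "u p" Y c] q[of n] q[of p] dq[of p] c by simp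
qed

section \<open>Homotopy invariance of invariant relative cohomology\<close>

lemma nat_op_id:
  assumes "singular_chain p Y c" shows "nat_op p (id_simplex p) c = c"
  using assms unfolding singular_chain_def
proof (induction c rule: frag_induction)
  case (one \<sigma>)
  then show ?case using singular_simplex_chain_map_id by (simp only: nat_op_simps mem_Collect_eq)
qed auto

text \<open>With identity simplices as models, the natural homotopy followed by \<open>H\<close> is
  a chain homotopy \<open>D\<close> from \<open>f\<close> to \<open>g\<close>. Naturality makes
  \<open>D\<close> commute with the involutions and send chains of \<open>B\<close> to chains of
  \<open>B'\<close>, so that its dual stays within invariant relative cochains; an arbitrary chain
  homotopy need not have these properties.\<close>

lemma coch_homotopic:
  assumes Y: "inv_pair Y \<tau> B" and Y': "inv_pair Y' \<tau>' B'"
    and H: "continuous_map (cyl Y) Y' H"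
    and equi: "\<And>t y. \<lbrakk>t \<in> {0..1}; y \<in> topspace Y\<rbrakk> \<Longrightarrow> H (t, \<tau> y) = \<tau>' (H (t, y))"
    and rel: "\<And>t y. \<lbrakk>t \<in> {0..1}; y \<in> topspace Y; y \<in> B\<rbrakk> \<Longrightarrow> H (t, y) \<in> B'"
    and f: "\<And>y. y \<in> topspace Y \<Longrightarrow> H (0, y) = f y" and g: "\<And>y. y \<in> topspace Y \<Longrightarrow> H (1, y) = g y"
    and c: "c \<in> cyc (coch Y' \<tau>' B') (cob Y') p"
  shows "pull Y g p c - pull Y f p c \<in> bnd (coch Y \<tau> B) (cob Y) p"
proof -
  obtain q where q: "\<And>p. singular_chain (Suc p) (cyl (simplex_top p)) (q p)"
    and dq: "\<And>p. chain_boundary (Suc p) (q p) = chain_map p (Pair 1) (id_simplex p) - chain_map p (Pair 0) (id_simplex p)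
      - prism p (q (p - Suc 0)) (chain_boundary p (id_simplex p))"
  proof (rule natural_homotopy_exists[of id_simplex])
    show "chain_boundary (Suc p) (id_simplex (Suc p)) =
        nat_op p (id_simplex p) (chain_boundary (Suc p) (id_simplex (Suc p)))" for p
      using nat_op_id[OF singular_chain_boundary_alt[OF singular_chain_id_simplex]] by simp
  qed (use singular_chain_id_simplex in auto)
  define D where "D = (\<lambda>p c. chain_map (Suc p) H (prism (Suc p) (q p) c))"
  have D_chain: "singular_chain (Suc p) (subtopology Y' S') (D p x)"
    if x: "singular_chain p (subtopology Y S) x" and S: "\<And>t y. \<lbrakk>t \<in> {0..1}; y \<in> topspace Y; y \<in> S\<rbrakk> \<Longrightarrow> H (t, y) \<in> S'"
    for p x S S'
  proof -
    have "continuous_map (cyl (subtopology Y S)) (subtopology Y' S') H"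
      using H S by (auto simp: continuous_map_in_subtopology prod_topology_subtopology intro: continuous_map_from_subtopology)
    then show ?thesis
      unfolding D_def by (rule singular_chain_chain_map[OF singular_chain_prism[OF q x]])
  qed
  have D_nat: "D p (chain_map p \<tau> x) = chain_map (Suc p) \<tau>' (D p x)" if x: "singular_chain p Y x" for p x
  proof -
    have "D p (chain_map p \<tau> x) = chain_map (Suc p) (H \<circ> map_prod id \<tau>) (prism (Suc p) (q p) x)"
      by (simp add: D_def prism_natural[OF q x, symmetric] chain_map_compose)
    also have "\<dots> = chain_map (Suc p) (\<tau>' \<circ> H) (prism (Suc p) (q p) x)"
      by (rule chain_map_eq[OF singular_chain_prism[OF q x]]) (auto simp: equi)
    finally show ?thesis by (simp add: D_def chain_map_compose)
  qed
  have D_bd: "chain_boundary (Suc p) (D p x) = chain_map p g x - chain_map p f x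
      - chain_map p H (prism p (q (p - Suc 0)) (chain_boundary p x))"
    if x: "singular_chain p Y x" for p x
  proof -
    have "chain_map p H (chain_map p (Pair 1) x) = chain_map p g x" "chain_map p H (chain_map p (Pair 0) x) = chain_map p f x"
      unfolding chain_map_compose[of p H, THEN fun_cong, unfolded o_apply[of "chain_map p H"], symmetric]
      by (rule chain_map_eq[OF x], simp add: f g)+
    then show ?thesis
      unfolding D_def chain_boundary_chain_map[OF singular_chain_prism[OF q x]]
      using prism_boundary_formula[OF q dq x] nat_op_id[OF x]
      by (simp add: chain_map_diff)
  qed
  have c': "c \<in> coch Y' \<tau>' B' p" "cob Y' p c = 0" using c by (auto simp: cyc_def)
  have key: "c (simplex_map p g \<sigma>) - c (simplex_map p f \<sigma>)
      = pairing c (chain_map p H (prism p (q (p - Suc 0)) (chain_boundary p (frag_of \<sigma>))))"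
    if \<sigma>: "singular_simplex p Y \<sigma>" for \<sigma>
  proof -
    have x: "singular_chain p Y (frag_of \<sigma>)" using \<sigma> by (simp add: singular_chain_of)
    have "pairing (cob Y' p c) (D p (frag_of \<sigma>)) = pairing c (chain_boundary (Suc p) (D p (frag_of \<sigma>)))"
      by (rule pairing_cob) (use D_chain[of p UNIV "frag_of \<sigma>" UNIV] x in simp)
    then have "0 = c (simplex_map p g \<sigma>) - c (simplex_map p f \<sigma>)
        - pairing c (chain_map p H (prism p (q (p - Suc 0)) (chain_boundary p (frag_of \<sigma>))))"
      using D_bd[OF x] c'(2) by (simp add: zero_fun_def)
    then show ?thesis by (metis eq_iff_diff_eq_0)
  qed
  show ?thesis
  proof (cases p)
    case 0
    have "pull Y g p c - pull Y f p c = 0"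
      using key 0 by (auto simp: pull_def fun_eq_iff chain_boundary_def)
    then show ?thesis using 0 by simp
  next
    case (Suc n)
    \<comment> \<open>\<open>e\<close> is \<open>c\<close> composed with \<open>D\<close>. It is
      relative by \<open>D_chain\<close>, invariant by \<open>D_nat\<close>, and its coboundary is
      the difference of the pullbacks by \<open>key\<close>.\<close>
    define e where "e = (\<lambda>\<sigma>. if singular_simplex n Y \<sigma> then pairing c (D n (frag_of \<sigma>)) else 0)"
    have pe: "pairing e x = pairing c (D n x)" if "singular_chain n Y x" for x
      using that unfolding singular_chain_def
      by (induction x rule: frag_induction) (auto simp: e_def D_def chain_map_diff simp del: chain_map_of)
    have "e \<in> coch Y \<tau> B n"
    proof (rule cochI)
      fix \<sigma> assume \<sigma>: "singular_simplex n Y \<sigma>"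
      then have x: "singular_chain n Y (frag_of \<sigma>)" by (simp add: singular_chain_of)
      show "e \<sigma> = 0" if "\<sigma> ` standard_simplex n \<subseteq> B"
      proof -
        have "singular_chain n (subtopology Y B) (frag_of \<sigma>)"
          using \<sigma> that by (simp add: singular_chain_of singular_simplex_subtopology)
        then show ?thesis
          using pairing_coch_relative[OF c'(1)] D_chain[of n B "frag_of \<sigma>" B'] rel Suc by (auto simp: e_def)
      qed
      have "singular_simplex n Y (simplex_map n \<tau> \<sigma>)"
        using Y \<sigma> by (auto simp: inv_pair_def intro: singular_simplex_simplex_map)
      moreover have "pairing c (D n (frag_of (simplex_map n \<tau> \<sigma>))) = pairing c (D n (frag_of \<sigma>))"
        using D_nat[OF x] pairing_coch_invariant[OF c'(1)[unfolded Suc], of "D n (frag_of \<sigma>)"]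
          D_chain[of n UNIV "frag_of \<sigma>" UNIV] x by simp
      ultimately show "e (simplex_map n \<tau> \<sigma>) = e \<sigma>" using \<sigma> by (simp add: e_def)
    qed (simp add: e_def)
    moreover have "pull Y g p c - pull Y f p c = cob Y n e"
    proof
      fix \<sigma> show "(pull Y g p c - pull Y f p c) \<sigma> = cob Y n e \<sigma>"
      proof (cases "singular_simplex p Y \<sigma>")
        case True
        then have "singular_chain n Y (chain_boundary (Suc n) (frag_of \<sigma>))"
          using Suc by (intro singular_chain_boundary_alt) (simp add: singular_chain_of)
        then show ?thesis
          using True key[OF True] Suc pe by (simp add: pull_def cob_eq_pairing D_def)
      qed (use Suc in \<open>simp add: pull_def cob_def\<close>)
    qed
    ultimately show ?thesis using Suc by auto
  qed
qed

definition equi_homotopic :: "'a topology \<Rightarrow> ('a \<Rightarrow> 'a) \<Rightarrow> 'a set \<Rightarrow> 'b topology \<Rightarrow> ('b \<Rightarrow> 'b) \<Rightarrow> 'b set \<Rightarrow>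
    ('a \<Rightarrow> 'b) \<Rightarrow> ('a \<Rightarrow> 'b) \<Rightarrow> bool"
  where "equi_homotopic Y \<tau> B Y' \<tau>' B' f g \<longleftrightarrow> (\<exists>H. continuous_map (cyl Y) Y' H \<and>
    (\<forall>t\<in>{0..1}. \<forall>y\<in>topspace Y. H (t, \<tau> y) = \<tau>' (H (t, y)) \<and> (y \<in> B \<longrightarrow> H (t, y) \<in> B')) \<and>
    (\<forall>y\<in>topspace Y. H (0, y) = f y \<and> H (1, y) = g y))"

lemma pull_equi_homotopic:
  assumes "inv_pair Y \<tau> B" "inv_pair Y' \<tau>' B'" "equi_homotopic Y \<tau> B Y' \<tau>' B' f g"
    "c \<in> cyc (coch Y' \<tau>' B') (cob Y') p"
  shows "pull Y g p c - pull Y f p c \<in> bnd (coch Y \<tau> B) (cob Y) p"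
  using assms(3) coch_homotopic[OF assms(1,2) _ _ _ _ _ assms(4)]
  unfolding equi_homotopic_def by metis

lemma pull_pull:
  assumes "continuous_map Y Y' f"
  shows "pull Y f p (pull Y' g p c) = pull Y (g \<circ> f) p c"
  using singular_simplex_simplex_map[OF _ assms] by (auto simp: pull_def fun_eq_iff simplex_map_compose)

lemma pull_id:
  assumes "c \<in> coch Y \<tau> B p" "\<And>y. y \<in> topspace Y \<Longrightarrow> f y = y"
  shows "pull Y f p c = c"
proof
  show "pull Y f p c \<sigma> = c \<sigma>" for \<sigma>
    using cochD(1)[OF assms(1), of \<sigma>] simplex_map_id_gen[of p Y \<sigma> f] assms(2) by (simp add: pull_def)
qed

text \<open>The first two claims are injectivity and surjectivity of the pullback on classes.
  Injectivity is recorded on its own because the image of the forgetful map, and not just the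
  orders, is later compared along an equivalence.\<close>

lemma coh_homotopy_equivalence:
  assumes Y: "inv_pair Y \<tau> B" and Y': "inv_pair Y' \<tau>' B'"
    and f: "pair_map Y \<tau> B Y' \<tau>' B' f" and g: "pair_map Y' \<tau>' B' Y \<tau> B g"
    and gf: "equi_homotopic Y \<tau> B Y \<tau> B id (g \<circ> f)" and fg: "equi_homotopic Y' \<tau>' B' Y' \<tau>' B' id (f \<circ> g)"
  shows "z \<in> cyc (coch Y' \<tau>' B') (cob Y') p \<Longrightarrow>
      pull Y f p z \<in> bnd (coch Y \<tau> B) (cob Y) p \<longleftrightarrow> z \<in> bnd (coch Y' \<tau>' B') (cob Y') p" (is "?A \<Longrightarrow> ?P")
    and "w \<in> cyc (coch Y \<tau> B) (cob Y) p \<Longrightarrow>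
      \<exists>z\<in>cyc (coch Y' \<tau>' B') (cob Y') p. w - pull Y f p z \<in> bnd (coch Y \<tau> B) (cob Y) p" (is "?B \<Longrightarrow> ?Q")
    and "coh Y \<tau> B p = coh Y' \<tau>' B' p"
proof -
  note cY = cplx_coch[OF Y] and cY' = cplx_coch[OF Y'] and cf = cmap_pull[OF Y f] and cg = cmap_pull[OF Y' g]
  have contf: "continuous_map Y Y' f" "continuous_map Y' Y g" using f g by (auto simp: pair_map_def)
  show 1: "pull Y f p z \<in> bnd (coch Y \<tau> B) (cob Y) p \<longleftrightarrow> z \<in> bnd (coch Y' \<tau>' B') (cob Y') p"
    if z: "z \<in> cyc (coch Y' \<tau>' B') (cob Y') p" for z
  proof
    assume "pull Y f p z \<in> bnd (coch Y \<tau> B) (cob Y) p"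
    then have "pull Y' g p (pull Y f p z) \<in> bnd (coch Y' \<tau>' B') (cob Y') p"
      by (rule cmap_bnd[OF cg cY])
    moreover have "pull Y' (f \<circ> g) p z - pull Y' id p z \<in> bnd (coch Y' \<tau>' B') (cob Y') p"
      by (rule pull_equi_homotopic[OF Y' Y' fg z])
    moreover have "pull Y' id p z = z"
      using z by (intro pull_id[of z Y' \<tau>' B']) (auto simp: cyc_def)
    ultimately have "pull Y' (f \<circ> g) p z - (pull Y' (f \<circ> g) p z - z) \<in> bnd (coch Y' \<tau>' B') (cob Y') p"
      using sgrp_diff[OF sgrp_bnd[OF cY']] by (simp only: pull_pull[OF contf(2)])
    moreover have "pull Y' (f \<circ> g) p z - (pull Y' (f \<circ> g) p z - z) = z" by (rule ext) simp
    ultimately show "z \<in> bnd (coch Y' \<tau>' B') (cob Y') p" by simp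
  qed (rule cmap_bnd[OF cf cY'])
  show 2: "\<exists>z\<in>cyc (coch Y' \<tau>' B') (cob Y') p. w - pull Y f p z \<in> bnd (coch Y \<tau> B) (cob Y) p"
    if w: "w \<in> cyc (coch Y \<tau> B) (cob Y) p" for w
  proof (rule bexI[of _ "pull Y' g p w"])
    have "pull Y (g \<circ> f) p w - pull Y id p w \<in> bnd (coch Y \<tau> B) (cob Y) p"
      by (rule pull_equi_homotopic[OF Y Y gf w])
    moreover have "pull Y id p w = w"
      using w by (intro pull_id[of w Y \<tau> B]) (auto simp: cyc_def)
    ultimately have "- (pull Y (g \<circ> f) p w - w) \<in> bnd (coch Y \<tau> B) (cob Y) p"
      by (metis sgrp_uminus[OF sgrp_bnd[OF cY]])
    then show "w - pull Y f p (pull Y' g p w) \<in> bnd (coch Y \<tau> B) (cob Y) p"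
      by (simp only: pull_pull[OF contf(1)] minus_diff_eq)
  qed (rule cmap_cyc[OF cg cY w])
  have "coh Y' \<tau>' B' p = coh Y \<tau> B p"
    unfolding coh_def hcard_def
  proof (rule idx_iso[where f = "pull Y f p"])
    show "pull Y f p z \<in> cyc (coch Y \<tau> B) (cob Y) p" if "z \<in> cyc (coch Y' \<tau>' B') (cob Y') p" for z
      by (rule cmap_cyc[OF cf cY' that])
    show "pull Y f p (x - y) = pull Y f p x - pull Y f p y" for x y
      by (auto simp: pull_def fun_eq_iff)
  qed (use 1 2 in \<open>auto simp: sgrp_cyc[OF cY'] sgrp_bnd[OF cY] sgrp_bnd[OF cY']\<close>)
  then show "coh Y \<tau> B p = coh Y' \<tau>' B' p" by simp
qed

section \<open>Small simplices and the Mayer-Vietoris sequence\<close>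

lemma simplex_map_id_singular: "singular_simplex p Y \<sigma> \<Longrightarrow> simplex_map p id \<sigma> = \<sigma>"
  by (rule simplex_map_id_gen) auto

lemma pull_restrict: "pull W id p c = (\<lambda>\<sigma>. if singular_simplex p W \<sigma> then c \<sigma> else 0)"
  unfolding pull_def by (rule ext) (simp add: simplex_map_id_singular del: simplex_map_id)

lemma inv_pair_subtopology:
  assumes "inv_pair Y \<tau> B" "\<And>y. \<lbrakk>y \<in> topspace Y; y \<in> U\<rbrakk> \<Longrightarrow> \<tau> y \<in> U"
  shows "inv_pair (subtopology Y U) \<tau> B"
  using assms unfolding inv_pair_def
  by (auto simp: continuous_map_in_subtopology intro: continuous_map_from_subtopology)

lemma singular_subdivision_eq_nat_op:
  "singular_subdivision p = nat_op p (simplicial_subdivision p (id_simplex p))"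
  by (simp add: singular_subdivision_def nat_op_def)

text \<open>Acyclic models applied to the subdivided identity simplices; projecting the cylinder
  back to the space turns the prism into a homotopy \<open>T\<close> from the identity to
  subdivision. Naturality of \<open>T\<close> is the point: it yields compatibility with the
  involution and with every subspace at once.\<close>

lemma natural_subdivision_homotopy:
  obtains T :: "nat \<Rightarrow> 'a chain \<Rightarrow> 'a chain" where
    "\<And>p x y. T p (x - y) = T p x - T p y"
    "\<And>p Y x. singular_chain p Y x \<Longrightarrow> singular_chain (Suc p) Y (T p x)"
    "\<And>p Y x f. singular_chain p Y x \<Longrightarrow> chain_map (Suc p) f (T p x) = T p (chain_map p f x)"
    "\<And>p Y x. singular_chain p Y x \<Longrightarrow> chain_boundary (Suc p) (T p x) =
      singular_subdivision p x - x - T (p - Suc 0) (chain_boundary p x)"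
proof -
  define u where "u = (\<lambda>p. simplicial_subdivision p (id_simplex p))"
  have u_chain: "singular_chain p (simplex_top p) (u p)" for p
    unfolding u_def
    by (intro simplicial_imp_singular_chain simplicial_chain_simplicial_subdivision) simp
  have u_Sd: "u p = singular_subdivision p (id_simplex p)" for p
    using chain_map_id_gen[OF u_chain, of p "restrict id (standard_simplex p)"] by (simp add: singular_subdivision_eq_nat_op u_def)
  obtain q where q: "\<And>p. singular_chain (Suc p) (cyl (simplex_top p)) (q p)"
    and dq: "\<And>p. chain_boundary (Suc p) (q p) = chain_map p (Pair 1) (u p) - chain_map p (Pair 0) (id_simplex p)
      - prism p (q (p - Suc 0)) (chain_boundary p (id_simplex p))"
  proof (rule natural_homotopy_exists[OF u_chain])
    show "u 0 = id_simplex 0"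
      unfolding u_Sd by (rule singular_subdivision_zero[OF singular_chain_id_simplex])
    show "chain_boundary (Suc p) (u (Suc p)) = nat_op p (u p) (chain_boundary (Suc p) (id_simplex (Suc p)))" for p
    proof -
      have "chain_boundary (Suc p) (u (Suc p)) = singular_subdivision p (chain_boundary (Suc p) (id_simplex (Suc p)))"
        using chain_boundary_singular_subdivision[OF singular_chain_id_simplex, of "Suc p"]
        by (simp add: u_Sd)
      then show ?thesis
        by (simp only: singular_subdivision_eq_nat_op u_def)
    qed
  qed blast
  define T where "T = (\<lambda>p (x :: 'a chain). chain_map (Suc p) snd (prism (Suc p) (q p) x))"
  have snd: "continuous_map (cyl Y) Y snd" for Y :: "'a topology"
    by (rule continuous_map_snd)
  show ?thesis
  proof
    show "T p (x - y) = T p x - T p y" for p x y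
      by (simp add: T_def chain_map_diff)
    fix p and Y :: "'a topology" and x assume x: "singular_chain p Y x"
    show "singular_chain (Suc p) Y (T p x)"
      unfolding T_def by (rule singular_chain_chain_map[OF singular_chain_prism[OF q x] snd])
    show "chain_map (Suc p) f (T p x) = T p (chain_map p f x)" for f
    proof -
      have "f \<circ> snd = snd \<circ> map_prod (id :: real \<Rightarrow> real) f" by auto
      then show ?thesis
        unfolding T_def prism_natural[OF q x, symmetric]
        using chain_map_compose[of "Suc p" f "snd :: real \<times> _ \<Rightarrow> _"] chain_map_compose[of "Suc p" snd "map_prod (id :: real \<Rightarrow> real) f"]
        by (simp add: fun_eq_iff)
    qed
    have sp: "chain_map p snd (chain_map p (Pair (t::real)) z) = z" if "singular_chain p Y z" for t z
    proof -
      have "chain_map p (snd \<circ> Pair t) z = z"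
        using that by (rule chain_map_id_gen) simp
      then show ?thesis by (simp add: chain_map_compose)
    qed
    have "T (p - Suc 0) (chain_boundary p x) = chain_map p snd (prism p (q (p - Suc 0)) (chain_boundary p x))"
      by (cases p) (auto simp: T_def chain_boundary_def)
    moreover have "T p x = chain_map (Suc p) snd (prism (Suc p) (q p) x)"
      by (simp add: T_def)
    ultimately show "chain_boundary (Suc p) (T p x) =
      singular_subdivision p x - x - T (p - Suc 0) (chain_boundary p x)"
      using chain_boundary_chain_map[OF singular_chain_prism[OF q x], of snd] prism_boundary_formula[OF q dq x] sp[OF x] sp[OF singular_chain_singular_subdivision[OF x]]
      by (simp add: chain_map_diff singular_subdivision_eq_nat_op u_def)
  qed
qed

section \<open>Subdivision into small simplices\<close>

definition small_chain :: "nat \<Rightarrow> 'a topology \<Rightarrow> 'a set \<Rightarrow> 'a set \<Rightarrow> 'a chain \<Rightarrow> bool"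
  where "small_chain p Y U V x \<longleftrightarrow> Poly_Mapping.keys x \<subseteq>
    {\<sigma>. singular_simplex p (subtopology Y U) \<sigma> \<or> singular_simplex p (subtopology Y V) \<sigma>}"

lemma small_chain_0 [simp]: "small_chain p Y U V 0"
  by (simp add: small_chain_def)

lemma small_chain_diff: "\<lbrakk>small_chain p Y U V x; small_chain p Y U V y\<rbrakk> \<Longrightarrow> small_chain p Y U V (x - y)"
  unfolding small_chain_def using keys_diff[of x y] by blast

lemma small_chain_add: "\<lbrakk>small_chain p Y U V x; small_chain p Y U V y\<rbrakk> \<Longrightarrow> small_chain p Y U V (x + y)"
  unfolding small_chain_def using keys_add[of x y] by blast

lemma small_chain_cmul: "small_chain p Y U V x \<Longrightarrow> small_chain p Y U V (frag_cmul a x)"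
  unfolding small_chain_def using keys_cmul[of a x] by blast

lemma small_chain_sum: "(\<And>i. i \<in> I \<Longrightarrow> small_chain p Y U V (f i)) \<Longrightarrow> small_chain p Y U V (\<Sum>i\<in>I. f i)"
  by (induction I rule: infinite_finite_induct) (auto intro: small_chain_add)

lemma singular_chain_imp_small:
  "singular_chain p (subtopology Y U) x \<or> singular_chain p (subtopology Y V) x \<Longrightarrow> small_chain p Y U V x"
  by (auto simp: small_chain_def singular_chain_def)

lemma small_chain_operator:
  assumes F: "\<And>x y. F (x - y) = F x - F y"
    and chain: "\<And>W x. singular_chain p W x \<Longrightarrow> singular_chain p' W (F x)"
    and x: "small_chain p Y U V x"
  shows "small_chain p' Y U V (F x)"
  using x unfolding small_chain_def[of p]
proof (induction x rule: frag_induction)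
  case zero
  have "F 0 = 0" using F[of 0 0] by simp
  then show ?case by simp
next
  case (one \<sigma>)
  then show ?case
    using chain by (intro singular_chain_imp_small) (auto simp: singular_chain_of)
qed (simp add: F small_chain_diff)

lemma singular_chain_subdivision_power:
  "singular_chain p Y x \<Longrightarrow> singular_chain p Y ((singular_subdivision p ^^ n) x)"
  by (induction n) (auto intro: singular_chain_singular_subdivision)

lemma small_chain_subdivision_power:
  "small_chain p Y U V x \<Longrightarrow> small_chain p Y U V ((singular_subdivision p ^^ n) x)"
  by (rule small_chain_operator) (auto intro: singular_chain_subdivision_power simp: singular_subdivision_power_diff)

lemma subdivision_power_natural:
  "singular_chain p Y x \<Longrightarrow> (singular_subdivision p ^^ n) (chain_map p f x) = chain_map p f ((singular_subdivision p ^^ n) x)"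
  by (induction n) (auto simp: naturality_singular_subdivision[OF singular_chain_subdivision_power])

lemma chain_boundary_subdivision_power:
  "singular_chain p Y x \<Longrightarrow> chain_boundary p ((singular_subdivision p ^^ n) x)
    = (singular_subdivision (p - Suc 0) ^^ n) (chain_boundary p x)"
  by (induction n) (auto simp: chain_boundary_singular_subdivision[OF singular_chain_subdivision_power])

lemma eventually_small:
  assumes "openin Y U" "openin Y V" "topspace Y = U \<union> V" "singular_simplex p Y \<sigma>"
  shows "\<exists>n. \<forall>m\<ge>n. small_chain p Y U V ((singular_subdivision p ^^ m) (frag_of \<sigma>))"
proof -
  have \<sigma>: "singular_chain p Y (frag_of \<sigma>)" using assms by (simp add: singular_chain_of)
  obtain n where n: "\<And>m f. \<lbrakk>n \<le> m; f \<in> Poly_Mapping.keys ((singular_subdivision p ^^ m) (frag_of \<sigma>))\<rbrakk>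
      \<Longrightarrow> \<exists>W\<in>{U, V}. f \<in> standard_simplex p \<rightarrow> W"
    by (rule sufficient_iterated_singular_subdivision_exists[of "{U, V}" Y p "frag_of \<sigma>"])
      (use assms \<sigma> in auto)
  have "small_chain p Y U V ((singular_subdivision p ^^ m) (frag_of \<sigma>))" if "n \<le> m" for m
    using n[OF that] singular_chain_subdivision_power[OF \<sigma>, of m]
    by (fastforce simp: small_chain_def singular_chain_def singular_simplex_subtopology)
  then show ?thesis by blast
qed

text \<open>
  Enough subdivisions to make a simplex small, and monotone under passing to faces.
\<close>

primrec depth :: "'a topology \<Rightarrow> 'a set \<Rightarrow> 'a set \<Rightarrow> nat \<Rightarrow> ((nat \<Rightarrow> real) \<Rightarrow> 'a) \<Rightarrow> nat"
  where
  "depth Y U V 0 \<sigma> = (LEAST n. \<forall>m\<ge>n. small_chain 0 Y U V ((singular_subdivision 0 ^^ m) (frag_of \<sigma>)))"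
| "depth Y U V (Suc p) \<sigma> = Max (insert
     (LEAST n. \<forall>m\<ge>n. small_chain (Suc p) Y U V ((singular_subdivision (Suc p) ^^ m) (frag_of \<sigma>)))
     ((\<lambda>k. depth Y U V p (singular_face (Suc p) k \<sigma>)) ` {..Suc p}))"

lemma depth_ge_Least:
  "(LEAST n. \<forall>m\<ge>n. small_chain p Y U V ((singular_subdivision p ^^ m) (frag_of \<sigma>))) \<le> depth Y U V p \<sigma>"
  by (cases p) (auto intro: Max_ge simp del: funpow.simps)

lemma small_chain_depth:
  assumes "openin Y U" "openin Y V" "topspace Y = U \<union> V" "singular_simplex p Y \<sigma>" "depth Y U V p \<sigma> \<le> m"
  shows "small_chain p Y U V ((singular_subdivision p ^^ m) (frag_of \<sigma>))"
proof -
  have "\<forall>m\<ge>(LEAST n. \<forall>m\<ge>n. small_chain p Y U V ((singular_subdivision p ^^ m) (frag_of \<sigma>))).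
      small_chain p Y U V ((singular_subdivision p ^^ m) (frag_of \<sigma>))"
    by (rule LeastI_ex) (rule eventually_small[OF assms(1-4)])
  then show ?thesis
    using depth_ge_Least[of p Y U V \<sigma>] assms(5) by (meson order_trans)
qed

lemma depth_face: "k \<le> Suc p \<Longrightarrow> depth Y U V p (singular_face (Suc p) k \<sigma>) \<le> depth Y U V (Suc p) \<sigma>"
  unfolding depth.simps by (rule Max_ge) auto

text \<open>A simplex inside \<open>U\<close> or \<open>V\<close> stays small under subdivision, and
  so do its faces. This makes the subdivision homotopy vanish on small simplices, hence keeps
  cochains that vanish on small chains among themselves.\<close>

lemma depth_small:
  assumes "singular_simplex p (subtopology Y U) \<sigma> \<or> singular_simplex p (subtopology Y V) \<sigma>"
  shows "depth Y U V p \<sigma> = 0"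
  using assms
proof (induction p arbitrary: \<sigma>)
  have *: "(LEAST n. \<forall>m\<ge>n. small_chain p Y U V ((singular_subdivision p ^^ m) (frag_of \<sigma>))) = 0"
    if "singular_simplex p (subtopology Y U) \<sigma> \<or> singular_simplex p (subtopology Y V) \<sigma>" for p \<sigma>
  proof (rule Least_equality)
    have "small_chain p Y U V (frag_of \<sigma>)"
      by (rule singular_chain_imp_small) (use that in \<open>simp add: singular_chain_of\<close>)
    then show "\<forall>m\<ge>0. small_chain p Y U V ((singular_subdivision p ^^ m) (frag_of \<sigma>))"
      by (simp add: small_chain_subdivision_power)
  qed simp
  { case 0 then show ?case using *[of 0 \<sigma>] by simp }
  { case (Suc p)
    have "depth Y U V p (singular_face (Suc p) k \<sigma>) = 0" if "k \<le> Suc p" for k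
      by (rule Suc.IH) (use Suc.prems that singular_simplex_face in blast)
    then have "(\<lambda>k. depth Y U V p (singular_face (Suc p) k \<sigma>)) ` {..Suc p} = {0}" by force
    then show ?case using *[OF Suc.prems] by simp }
qed

lemma small_chain_chain_map:
  assumes x: "small_chain p Y U V x" and \<tau>: "continuous_map Y Y \<tau>" "\<tau> ` (topspace Y \<inter> U) \<subseteq> U" "\<tau> ` (topspace Y \<inter> V) \<subseteq> V"
  shows "small_chain p Y U V (chain_map p \<tau> x)"
  using x unfolding small_chain_def[of p Y U V x]
proof (induction x rule: frag_induction)
  case (one \<sigma>)
  have "continuous_map (subtopology Y U) (subtopology Y U) \<tau>" "continuous_map (subtopology Y V) (subtopology Y V) \<tau>"
    using \<tau> by (auto simp: continuous_map_in_subtopology intro: continuous_map_from_subtopology)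
  then show ?case
    using one by (intro singular_chain_imp_small) (auto simp: singular_chain_of intro: singular_simplex_simplex_map)
qed (auto simp: chain_map_diff intro: small_chain_diff)

text \<open>Subdivision is natural and \<open>\<tau>\<close> preserves \<open>U\<close> and
  \<open>V\<close> and is its own inverse, so \<open>\<sigma>\<close> and its translate become small
  at the same stage. Without equal depths the homotopy built below would not commute with the
  involution.\<close>

lemma depth_invariant:
  assumes \<tau>: "continuous_map Y Y \<tau>" "\<And>y. y \<in> topspace Y \<Longrightarrow> \<tau> (\<tau> y) = y"
      "\<tau> ` (topspace Y \<inter> U) \<subseteq> U" "\<tau> ` (topspace Y \<inter> V) \<subseteq> V"
    and \<sigma>: "singular_simplex p Y \<sigma>"
  shows "depth Y U V p (simplex_map p \<tau> \<sigma>) = depth Y U V p \<sigma>"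
  using \<sigma>
proof (induction p arbitrary: \<sigma>)
  have *: "small_chain p Y U V ((singular_subdivision p ^^ m) (frag_of (simplex_map p \<tau> \<sigma>)))
      \<longleftrightarrow> small_chain p Y U V ((singular_subdivision p ^^ m) (frag_of \<sigma>))" (is "?l \<longleftrightarrow> ?r")
    if \<sigma>: "singular_simplex p Y \<sigma>" for p \<sigma> m
  proof -
    have x: "singular_chain p Y (frag_of \<sigma>)" using \<sigma> by (simp add: singular_chain_of)
    let ?s = "(singular_subdivision p ^^ m) (frag_of \<sigma>)"
    have eq: "(singular_subdivision p ^^ m) (frag_of (simplex_map p \<tau> \<sigma>)) = chain_map p \<tau> ?s"
      using subdivision_power_natural[OF x, of m \<tau>] by simp
    have "chain_map p (\<tau> \<circ> \<tau>) ?s = ?s"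
      by (rule chain_map_id_gen[OF singular_chain_subdivision_power[OF x]]) (simp add: \<tau>)
    then have "chain_map p \<tau> (chain_map p \<tau> ?s) = ?s" by (simp add: chain_map_compose)
    then show ?thesis
      unfolding eq using small_chain_chain_map[OF _ \<tau>(1,3,4)] by metis
  qed
  { case 0 then show ?case using *[OF 0] by simp }
  { case (Suc p)
    have "depth Y U V p (singular_face (Suc p) k (simplex_map (Suc p) \<tau> \<sigma>)) = depth Y U V p (singular_face (Suc p) k \<sigma>)"
      if "k \<le> Suc p" for k
      using that by (simp add: singular_face_simplex_map' Suc.IH singular_simplex_face[OF Suc.prems])
    then have "(\<lambda>k. depth Y U V p (singular_face (Suc p) k (simplex_map (Suc p) \<tau> \<sigma>))) ` {..Suc p}
      = (\<lambda>k. depth Y U V p (singular_face (Suc p) k \<sigma>)) ` {..Suc p}" by (intro image_cong) auto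
    then show ?case by (simp only: depth.simps *[OF Suc.prems]) }
qed

text \<open>The theorem on small simplices in dual form. A cocycle \<open>c\<close> that vanishes on
  small chains is the coboundary of \<open>c\<close> composed with \<open>D\<close>, where
  \<open>D\<close> is the subdivision homotopy stopped, on each simplex, at the depth of that
  simplex. The choices behind \<open>D\<close> are invariant and local, so the primitive is again
  invariant, relative and zero on small chains.\<close>

lemma small_cochains_acyclic:
  assumes Y: "inv_pair Y \<tau> B" and UV: "openin Y U" "openin Y V" "topspace Y = U \<union> V"
    and \<tau>: "\<tau> ` U \<subseteq> U" "\<tau> ` V \<subseteq> V"
    and c: "c \<in> cyc (coch Y \<tau> B) (cob Y) p"
    and small: "\<And>x. small_chain p Y U V x \<Longrightarrow> pairing c x = 0"
  shows "c \<in> bnd (\<lambda>p. {e \<in> coch Y \<tau> B p. \<forall>x. small_chain p Y U V x \<longrightarrow> pairing e x = 0}) (cob Y) p"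
proof -
  obtain T :: "nat \<Rightarrow> 'a chain \<Rightarrow> 'a chain" where T:
    "\<And>p x y. T p (x - y) = T p x - T p y"
    "\<And>p Y x. singular_chain p Y x \<Longrightarrow> singular_chain (Suc p) Y (T p x)"
    "\<And>p Y x f. singular_chain p Y x \<Longrightarrow> chain_map (Suc p) f (T p x) = T p (chain_map p f x)"
    "\<And>p Y x. singular_chain p Y x \<Longrightarrow> chain_boundary (Suc p) (T p x) =
      singular_subdivision p x - x - T (p - Suc 0) (chain_boundary p x)"
    using natural_subdivision_homotopy by blast
  note Sdc = singular_chain_subdivision_power
  have \<tau>': "continuous_map Y Y \<tau>" "\<And>y. y \<in> topspace Y \<Longrightarrow> \<tau> (\<tau> y) = y"
    "\<tau> ` (topspace Y \<inter> U) \<subseteq> U" "\<tau> ` (topspace Y \<inter> V) \<subseteq> V"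
    using Y \<tau> by (auto simp: inv_pair_def)
  \<comment> \<open>The homotopy from the identity to the \<open>n\<close>-fold subdivision,
    obtained by adding up the homotopies of the single subdivisions.\<close>
  define h where "h = (\<lambda>n p x. \<Sum>i<n. T p ((singular_subdivision p ^^ i) x))"
  have h_chain: "singular_chain (Suc p) W (h n p x)" if "singular_chain p W x" for n p W x
    unfolding h_def by (intro singular_chain_sum T Sdc that)
  have h_diff: "h n p (x - y) = h n p x - h n p y" for n p x y
    by (simp add: h_def singular_subdivision_power_diff T sum_subtractf)
  have h_nat: "chain_map (Suc p) f (h n p x) = h n p (chain_map p f x)" if "singular_chain p W x" for n p f W x
    by (simp add: h_def chain_map_sum subdivision_power_natural[OF that] T(3)[OF Sdc[OF that]])
  have h_Suc: "h (Suc n) p x = h n p x + T p ((singular_subdivision p ^^ n) x)" for n p x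
    by (simp add: h_def)
  have h_bd: "chain_boundary (Suc p) (h n p x) = (singular_subdivision p ^^ n) x - x - h n (p - Suc 0) (chain_boundary p x)"
    if "singular_chain p W x" for n p W x
  proof (induction n)
    case (Suc n)
    have "chain_boundary (Suc p) (T p ((singular_subdivision p ^^ n) x)) =
      (singular_subdivision p ^^ Suc n) x - (singular_subdivision p ^^ n) x
      - T (p - Suc 0) ((singular_subdivision (p - Suc 0) ^^ n) (chain_boundary p x))"
      using T(4)[OF Sdc[OF that, of n]] chain_boundary_subdivision_power[OF that, of n] by simp
    then show ?case unfolding h_Suc chain_boundary_add Suc.IH by simp
  qed (simp add: h_def)
  define D where "D = (\<lambda>p. frag_extend (\<lambda>\<sigma>. h (depth Y U V p \<sigma>) p (frag_of \<sigma>)))"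
  have D_of: "D p (frag_of \<sigma>) = h (depth Y U V p \<sigma>) p (frag_of \<sigma>)" for p \<sigma> by (simp add: D_def)
  \<comment> \<open>Since a simplex and its faces may have different depths, \<open>D\<close> is a
    homotopy from the identity not to a power of subdivision but to \<open>\<rho>\<close>. It is
    enough that \<open>\<rho>\<close> takes values in small chains.\<close>
  define \<rho> where "\<rho> = (\<lambda>\<sigma>. frag_of \<sigma> + chain_boundary (Suc p) (D p (frag_of \<sigma>)) + D (p - Suc 0) (chain_boundary p (frag_of \<sigma>)))"
  have \<rho>_small: "small_chain p Y U V (\<rho> \<sigma>)" if \<sigma>: "singular_simplex p Y \<sigma>" for \<sigma>
  proof -
    let ?n = "depth Y U V p \<sigma>"
    have x: "singular_chain p Y (frag_of \<sigma>)" using \<sigma> by (simp add: singular_chain_of)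
    have "\<rho> \<sigma> = (singular_subdivision p ^^ ?n) (frag_of \<sigma>)
        - (h ?n (p - Suc 0) (chain_boundary p (frag_of \<sigma>)) - D (p - Suc 0) (chain_boundary p (frag_of \<sigma>)))"
      unfolding \<rho>_def D_of h_bd[OF x] by simp
    moreover have "small_chain p Y U V (h ?n (p - Suc 0) (chain_boundary p (frag_of \<sigma>)) - D (p - Suc 0) (chain_boundary p (frag_of \<sigma>)))"
    proof (cases p)
      case 0
      have "h n p 0 = 0" for n p using h_diff[of n p 0 0] by simp
      then show ?thesis using 0 by (simp add: chain_boundary_def D_def)
    next
      case (Suc n)
      have h0: "h i j 0 = 0" for i j using h_diff[of i j 0 0] by simp
      have hadd: "h i j (x + y) = h i j x + h i j y" for i j x y
      proof -
        have "h i j (- y) = - h i j y" using h_diff[of i j 0 y] h0 by simp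
        then show ?thesis using h_diff[of i j x "- y"] by simp
      qed
      have hneg: "h i j (frag_cmul ((-1) ^ k) x) = frag_cmul ((-1) ^ k) (h i j x)" for i j k x
        using h_diff[of i j 0 x] h0 by (cases "even k") auto
      have hsum: "h i j (sum f I) = (\<Sum>k\<in>I. h i j (f k))" for i j f and I :: "nat set"
        by (induction I rule: infinite_finite_induct) (auto simp: h0 hadd)
      have cmul_diff: "frag_cmul ((-1) ^ k) (x - y) = frag_cmul ((-1) ^ k) x - frag_cmul ((-1) ^ k) y"
        for k and x y :: "'a chain"
        by (cases "even k") auto
      have face_small: "small_chain p Y U V (h ?n n (frag_of \<upsilon>) - h (depth Y U V n \<upsilon>) n (frag_of \<upsilon>))"
        if k: "k \<le> Suc n" and \<upsilon>: "\<upsilon> = singular_face (Suc n) k \<sigma>" for k \<upsilon>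
      proof -
        have le: "depth Y U V n \<upsilon> \<le> ?n" using depth_face[OF k] Suc \<upsilon> by simp
        have s\<upsilon>: "singular_simplex n Y \<upsilon>" using \<sigma> Suc \<upsilon> k singular_simplex_face by blast
        \<comment> \<open>Faces have at most the depth of the simplex, so only the homotopies of
          late subdivisions survive in the difference. They act on chains that are already small,
          and \<open>T\<close> keeps each simplex within the set that contains it.\<close>
        have "h ?n n (frag_of \<upsilon>) - h (depth Y U V n \<upsilon>) n (frag_of \<upsilon>)
            = (\<Sum>i\<in>{depth Y U V n \<upsilon>..<?n}. T n ((singular_subdivision n ^^ i) (frag_of \<upsilon>)))"
          unfolding h_def using le
          using sum_diff_nat_ivl[OF le0 le, of "\<lambda>i. T n ((singular_subdivision n ^^ i) (frag_of \<upsilon>))"]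
          by (simp add: lessThan_atLeast0)
        also have "small_chain p Y U V \<dots>"
          unfolding Suc
          by (intro small_chain_sum small_chain_operator[where F = "T n" and p = n] T small_chain_depth[OF UV s\<upsilon>]) auto
        finally show ?thesis .
      qed
      have "h ?n n (chain_boundary p (frag_of \<sigma>)) - D n (chain_boundary p (frag_of \<sigma>)) =
        (\<Sum>k\<le>Suc n. frag_cmul ((-1) ^ k) (h ?n n (frag_of (singular_face (Suc n) k \<sigma>))
          - h (depth Y U V n (singular_face (Suc n) k \<sigma>)) n (frag_of (singular_face (Suc n) k \<sigma>))))"
        using Suc by (simp add: chain_boundary_of hsum hneg D_def frag_extend_sum frag_extend_cmul
            cmul_diff sum_subtractf del: sum.atMost_Suc depth.simps)
      also have "small_chain p Y U V \<dots>"
        by (intro small_chain_sum small_chain_cmul face_small) auto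
      finally show ?thesis using Suc by simp
    qed
    ultimately show ?thesis
      using small_chain_depth[OF UV \<sigma> order_refl] by (simp add: small_chain_diff)
  qed
  have c': "c \<in> coch Y \<tau> B p" "cob Y p c = 0" using c by (auto simp: cyc_def)
  have key: "c \<sigma> = pairing c (D (p - Suc 0) (chain_boundary p (frag_of \<sigma>)))" if \<sigma>: "singular_simplex p Y \<sigma>" for \<sigma>
  proof -
    have x: "singular_chain p Y (frag_of \<sigma>)" using \<sigma> by (simp add: singular_chain_of)
    have "pairing (cob Y p c) (D p (frag_of \<sigma>)) = pairing c (chain_boundary (Suc p) (D p (frag_of \<sigma>)))"
      unfolding D_of by (rule pairing_cob) (rule h_chain[OF x])
    then have "0 = c \<sigma> + pairing c (D (p - Suc 0) (chain_boundary p (frag_of \<sigma>)))"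
      using small[OF \<rho>_small[OF \<sigma>]] c'(2) by (simp add: \<rho>_def zero_fun_def)
    then show ?thesis by (metis add_eq_0_iff uminus_bit_def id_apply)
  qed
  show ?thesis
  proof (cases p)
    case 0
    have "c \<sigma> = 0" for \<sigma>
      using key[of \<sigma>] 0 cochD(1)[OF c'(1), of \<sigma>]
      by (cases "singular_simplex p Y \<sigma>") (auto simp: chain_boundary_def D_def)
    then show ?thesis using 0 by (auto simp: fun_eq_iff)
  next
    case (Suc n)
    define e where "e = (\<lambda>\<sigma>. if singular_simplex n Y \<sigma> then pairing c (D n (frag_of \<sigma>)) else 0)"
    have pe: "pairing e x = pairing c (D n x)" if "singular_chain n Y x" for x
      using that unfolding singular_chain_def
      by (induction x rule: frag_induction) (auto simp: e_def D_def frag_extend_diff)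
    have e: "e \<in> coch Y \<tau> B n"
    proof (rule cochI)
      fix \<sigma> assume \<sigma>: "singular_simplex n Y \<sigma>"
      then have x: "singular_chain n Y (frag_of \<sigma>)" by (simp add: singular_chain_of)
      show "e \<sigma> = 0" if "\<sigma> ` standard_simplex n \<subseteq> B"
      proof -
        have "singular_chain n (subtopology Y B) (frag_of \<sigma>)"
          using \<sigma> that by (simp add: singular_chain_of singular_simplex_subtopology)
        then show ?thesis
          using pairing_coch_relative[OF c'(1)] h_chain Suc by (auto simp: e_def D_of)
      qed
      have "singular_simplex n Y (simplex_map n \<tau> \<sigma>)"
        using Y \<sigma> by (auto simp: inv_pair_def intro: singular_simplex_simplex_map)
      moreover have "pairing c (D n (frag_of (simplex_map n \<tau> \<sigma>))) = pairing c (D n (frag_of \<sigma>))"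
        using pairing_coch_invariant[OF c'(1)[unfolded Suc] h_chain[OF x]]
        by (simp add: D_of depth_invariant[OF \<tau>' \<sigma>] h_nat[OF x])
      ultimately show "e (simplex_map n \<tau> \<sigma>) = e \<sigma>" using \<sigma> by (simp add: e_def)
    qed (simp add: e_def)
    have "pairing e x = 0" if "small_chain n Y U V x" for x
    proof -
      have "pairing e x = pairing (\<lambda>\<sigma>. 0) x"
      proof (rule pairing_cong)
        fix \<sigma> assume "\<sigma> \<in> Poly_Mapping.keys x"
        then have "depth Y U V n \<sigma> = 0" using that depth_small by (force simp: small_chain_def)
        then show "e \<sigma> = 0" by (simp add: e_def D_of h_def)
      qed
      then show ?thesis by simp
    qed
    moreover have "c = cob Y n e"
    proof
      fix \<sigma> show "c \<sigma> = cob Y n e \<sigma>"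
      proof (cases "singular_simplex p Y \<sigma>")
        case True
        then have "singular_chain n Y (chain_boundary (Suc n) (frag_of \<sigma>))"
          using Suc by (intro singular_chain_boundary_alt) (simp add: singular_chain_of)
        then show ?thesis
          using True key[OF True] Suc pe by (simp add: cob_eq_pairing)
      qed (use Suc cochD(1)[OF c'(1)] in \<open>simp add: cob_def\<close>)
    qed
    ultimately show ?thesis using Suc e by auto
  qed
qed

section \<open>The Mayer-Vietoris sequence\<close>

lemma singular_simplex_subtopology_invariant:
  assumes Y: "inv_pair Y \<tau> B" and U: "\<And>y. \<lbrakk>y \<in> topspace Y; y \<in> U\<rbrakk> \<Longrightarrow> \<tau> y \<in> U" and \<sigma>: "singular_simplex p Y \<sigma>"
  shows "singular_simplex p (subtopology Y U) (simplex_map p \<tau> \<sigma>) \<longleftrightarrow> singular_simplex p (subtopology Y U) \<sigma>"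
proof -
  have "continuous_map Y Y \<tau>" using Y by (simp add: inv_pair_def)
  moreover have "\<tau> y \<in> U \<longleftrightarrow> y \<in> U" if "y \<in> topspace Y" for y
  proof -
    have "\<tau> y \<in> topspace Y" "\<tau> (\<tau> y) = y"
      using Y that by (auto simp: inv_pair_def continuous_map_def)
    then show ?thesis using U[of y] U[of "\<tau> y"] that by auto
  qed
  ultimately show ?thesis
    using \<sigma> singular_simplex_simplex_map[OF \<sigma>] singular_simplex_in_topspace[OF \<sigma>]
    by (auto simp: singular_simplex_subtopology simplex_map_def image_subset_iff)
qed

text \<open>Exactness of H^n(U \<inter> V) -> H^(n+1)(Y) -> H^(n+1)(U) x H^(n+1)(V) bounds the order
  of the middle group by divisibility. That is the form needed later: divisors of nonzero numbers
  are nonzero and divisors of 1 are 1, so finiteness and vanishing both propagate.\<close>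

lemma coh_Mayer_Vietoris:
  assumes Y: "inv_pair Y \<tau> B" and UV: "openin Y U" "openin Y V" "topspace Y = U \<union> V"
    and \<tau>: "\<tau> ` U \<subseteq> U" "\<tau> ` V \<subseteq> V"
  shows "coh Y \<tau> B (Suc n) dvd coh (subtopology Y U) \<tau> B (Suc n) * coh (subtopology Y V) \<tau> B (Suc n)
      * coh (subtopology Y (U \<inter> V)) \<tau> B n"
    and "coh Y \<tau> B 0 dvd coh (subtopology Y U) \<tau> B 0 * coh (subtopology Y V) \<tau> B 0"
proof -
  let ?U = "subtopology Y U" and ?V = "subtopology Y V" and ?W = "subtopology Y (U \<inter> V)"
  have inv: "inv_pair ?U \<tau> B" "inv_pair ?V \<tau> B" "inv_pair ?W \<tau> B"
    by (rule inv_pair_subtopology[OF Y]; use \<tau> in blast)+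
  note c = cplx_coch[OF Y] cplx_coch[OF inv(1)] cplx_coch[OF inv(2)] cplx_coch[OF inv(3)]
  define P where "P = (\<lambda>p. coch ?U \<tau> B p \<times> coch ?V \<tau> B p)"
  define d where "d = (\<lambda>p. map_prod (cob ?U p) (cob ?V p))"
  have P: "cplx P d" "hcard P d n = coh ?U \<tau> B n * coh ?V \<tau> B n" for n
    unfolding P_def d_def coh_def by (rule hcard_Times[OF c(2,3)])+
  have sub: "pair_map (subtopology Y S) \<tau> B Y \<tau> B id" for S
    by (simp add: pair_map_def continuous_map_from_subtopology)
  define f where "f = (\<lambda>p x. (pull ?U id p x, pull ?V id p x))"
  \<comment> \<open>Cochains on small simplices, realised as pairs of restrictions of one cochain of
    \<open>Y\<close>. The kernel of restriction consists of the cochains that vanish on small chains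
    and is acyclic, so \<open>L\<close> has the cohomology of \<open>Y\<close>.\<close>
  define L where "L = (\<lambda>p. f p ` coch Y \<tau> B p)"
  have cf: "cmap (coch Y \<tau> B) (cob Y) P d f"
    using cmap_pull[OF inv(1) sub] cmap_pull[OF inv(2) sub] unfolding cmap_def f_def P_def d_def by auto
  have L: "cplx L d"
  proof (rule cplx_subcomplex[OF P(1)])
    show "sgrp (L p)" for p
      unfolding L_def by (rule sgrp_image[OF sgrp_coch]) (rule cmapD(2)[OF cf])
    show "L p \<subseteq> P p" for p unfolding L_def using cmapD(1)[OF cf] by auto
    show "d p x \<in> L (Suc p)" if "x \<in> L p" for p x
      using that cmapD(3)[OF cf, symmetric] cplxD(2)[OF c(1)] unfolding L_def by auto
  qed
  have f_eq_0: "f p x = 0 \<longleftrightarrow> (\<forall>s. small_chain p Y U V s \<longrightarrow> pairing x s = 0)" if x: "x \<in> coch Y \<tau> B p" for p x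
  proof
    assume 0: "f p x = 0"
    have "x \<sigma> = 0" if "singular_simplex p ?U \<sigma> \<or> singular_simplex p ?V \<sigma>" for \<sigma>
    proof -
      have "pull ?U id p x \<sigma> = 0" "pull ?V id p x \<sigma> = 0"
        using 0 by (simp_all add: f_def zero_prod_def)
      then show ?thesis using that by (auto simp: pull_restrict split: if_splits)
    qed
    then show "\<forall>s. small_chain p Y U V s \<longrightarrow> pairing x s = 0"
      unfolding pairing_def small_chain_def by (auto intro!: sum.neutral)
  next
    assume R: "\<forall>s. small_chain p Y U V s \<longrightarrow> pairing x s = 0"
    have "x \<sigma> = 0" if "singular_simplex p ?U \<sigma> \<or> singular_simplex p ?V \<sigma>" for \<sigma>
      using R[rule_format, of "frag_of \<sigma>"] that by (simp add: small_chain_def)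
    then have "pull ?U id p x = (\<lambda>\<sigma>. 0)" "pull ?V id p x = (\<lambda>\<sigma>. 0)"
      unfolding pull_restrict by auto
    then show "f p x = 0" by (simp add: f_def zero_prod_def zero_fun_def)
  qed
  have hL: "coh Y \<tau> B n = hcard L d n" for n
    unfolding coh_def
  proof (rule hcard_surj_acyclic_kernel[OF c(1) L])
    show "cmap (coch Y \<tau> B) (cob Y) L d f"
      using cf unfolding cmap_def L_def by auto
    show "\<exists>x\<in>coch Y \<tau> B p. f p x = y" if "y \<in> L p" for p y using that by (auto simp: L_def)
    fix q z assume z: "z \<in> cyc (coch Y \<tau> B) (cob Y) q" "f q z = 0"
    then have zc: "z \<in> coch Y \<tau> B q" by (simp add: cyc_def)
    have "{e \<in> coch Y \<tau> B p. \<forall>x. small_chain p Y U V x \<longrightarrow> pairing e x = 0} = {x \<in> coch Y \<tau> B p. f p x = 0}" for p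
      using f_eq_0 by blast
    then show "z \<in> bnd (\<lambda>p. {x \<in> coch Y \<tau> B p. f p x = 0}) (cob Y) q"
      using small_cochains_acyclic[OF Y UV \<tau> z(1)] f_eq_0[OF zc] z(2) by simp
  qed
  define g where "g = (\<lambda>p z. pull ?W id p (fst z) - pull ?W id p (snd z))"
  have WU: "pair_map ?W \<tau> B ?U \<tau> B id" and WV: "pair_map ?W \<tau> B ?V \<tau> B id"
    by (auto simp: pair_map_def continuous_map_in_subtopology continuous_map_from_subtopology)
  note cU = cmap_pull[OF inv(3) WU] and cV = cmap_pull[OF inv(3) WV]
  have cg: "cmap P d (coch ?W \<tau> B) (cob ?W) g"
    unfolding cmap_def
  proof (intro conjI allI ballI)
    fix p z assume "z \<in> P p"
    then have z: "fst z \<in> coch ?U \<tau> B p" "snd z \<in> coch ?V \<tau> B p" by (auto simp: P_def)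
    show "g p z \<in> coch ?W \<tau> B p"
      unfolding g_def by (rule sgrp_diff[OF sgrp_coch cmapD(1)[OF cU z(1)] cmapD(1)[OF cV z(2)]])
    show "g (Suc p) (d p z) = cob ?W p (g p z)"
      unfolding g_def d_def using cmapD(3)[OF cU z(1)] cmapD(3)[OF cV z(2)]
        cplxD(3)[OF c(4) cmapD(1)[OF cU z(1)] cmapD(1)[OF cV z(2)]] by simp
  next
    fix p x y show "g p (x - y) = g p x - g p y"
      unfolding g_def pull_restrict by (rule ext) (simp add: ac_simps)
  qed
  have simp: "singular_simplex p ?W \<sigma> \<longleftrightarrow> singular_simplex p ?U \<sigma> \<and> singular_simplex p ?V \<sigma>" for p \<sigma>
    by (auto simp: singular_simplex_subtopology)
  have invS: "singular_simplex p ?U (simplex_map p \<tau> \<sigma>) \<longleftrightarrow> singular_simplex p ?U \<sigma>"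
    "singular_simplex p ?V (simplex_map p \<tau> \<sigma>) \<longleftrightarrow> singular_simplex p ?V \<sigma>" if "singular_simplex p Y \<sigma>" for p \<sigma>
    by (rule singular_simplex_subtopology_invariant[OF Y _ that]; use \<tau> in blast)+
  have surj: "\<exists>x\<in>P p. g p x = y" if y: "y \<in> coch ?W \<tau> B p" for p y
  proof -
    \<comment> \<open>Extension by zero: \<open>y\<close> remains invariant on \<open>U\<close>
      because a simplex lies in \<open>V\<close> exactly when its translate does.\<close>
    have "y \<in> coch ?U \<tau> B p"
    proof (rule cochI)
      fix \<sigma>
      show "\<not> singular_simplex p ?U \<sigma> \<Longrightarrow> y \<sigma> = 0" using cochD(1)[OF y] simp by blast
      show "\<sigma> ` standard_simplex p \<subseteq> B \<Longrightarrow> y \<sigma> = 0" using cochD(2)[OF y] .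
      assume "singular_simplex p ?U \<sigma>"
      then have "singular_simplex p Y \<sigma>" by (simp add: singular_simplex_subtopology)
      then show "y (simplex_map p \<tau> \<sigma>) = y \<sigma>"
        using invS(2)[of p \<sigma>] simp[of p] cochD(1,3)[OF y] \<open>singular_simplex p ?U \<sigma>\<close>
        by (cases "singular_simplex p ?V \<sigma>") auto
    qed
    then have "(y, 0) \<in> P p" by (simp add: P_def sgrp_zero[OF sgrp_coch])
    moreover have "g p (y, 0) = y"
      unfolding g_def pull_restrict using cochD(1)[OF y] by auto
    ultimately show ?thesis by blast
  qed
  have ker: "L p = {x \<in> P p. g p x = 0}" for p
  proof (intro equalityI subsetI)
    fix z assume "z \<in> L p"
    then obtain x where x: "x \<in> coch Y \<tau> B p" "z = f p x" by (auto simp: L_def)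
    then have "g p z = 0"
      unfolding f_def g_def pull_restrict using simp by auto
    then show "z \<in> {x \<in> P p. g p x = 0}" using x cmapD(1)[OF cf] by auto
  next
    fix z assume "z \<in> {x \<in> P p. g p x = 0}"
    then obtain a b where z: "z = (a, b)" and a: "a \<in> coch ?U \<tau> B p" and b: "b \<in> coch ?V \<tau> B p"
      and ab: "g p (a, b) = 0" by (auto simp: P_def)
    have agree: "a \<sigma> = b \<sigma>" if "singular_simplex p ?W \<sigma>" for \<sigma>
    proof -
      have "a \<sigma> - b \<sigma> = 0" using fun_cong[OF ab, of \<sigma>] that by (simp add: g_def pull_restrict)
      then show ?thesis by (metis eq_iff_diff_eq_0)
    qed
    define x where "x = (\<lambda>\<sigma>. if singular_simplex p ?U \<sigma> then a \<sigma> else b \<sigma>)"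
    have "x \<in> coch Y \<tau> B p"
    proof (rule cochI)
      fix \<sigma>
      show "\<not> singular_simplex p Y \<sigma> \<Longrightarrow> x \<sigma> = 0"
        using cochD(1)[OF a, of \<sigma>] cochD(1)[OF b, of \<sigma>] by (simp add: x_def singular_simplex_subtopology)
      show "\<sigma> ` standard_simplex p \<subseteq> B \<Longrightarrow> x \<sigma> = 0"
        using cochD(2)[OF a] cochD(2)[OF b] by (auto simp: x_def)
      assume "singular_simplex p Y \<sigma>"
      then show "x (simplex_map p \<tau> \<sigma>) = x \<sigma>"
        using invS[of p \<sigma>] cochD(1,3)[OF a] cochD(1,3)[OF b] unfolding x_def
        by (cases "singular_simplex p ?U \<sigma>"; cases "singular_simplex p ?V \<sigma>") simp_all
    qed
    moreover have "f p x = z"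
    proof -
      have "pull ?U id p x \<sigma> = a \<sigma>" "pull ?V id p x \<sigma> = b \<sigma>" for \<sigma>
        using agree[of \<sigma>] simp[of p \<sigma>] cochD(1)[OF a, of \<sigma>] cochD(1)[OF b, of \<sigma>]
        by (simp_all add: pull_restrict x_def)
      then show ?thesis by (simp add: f_def z fun_eq_iff)
    qed
    ultimately show "z \<in> L p" by (auto simp: L_def)
  qed
  have LP: "L p \<subseteq> P p" for p using ker by auto
  obtain x y where "hcard L d (Suc n) = idx (ssum (cyc L d (Suc n)) (bnd P d (Suc n))) (bnd P d (Suc n)) * x"
    "hcard (coch ?W \<tau> B) (cob ?W) n = x * y"
    by (rule hcard_short_exact[OF L P(1) c(4) cg surj ker, of n])
  then show "coh Y \<tau> B (Suc n) dvd coh ?U \<tau> B (Suc n) * coh ?V \<tau> B (Suc n) * coh ?W \<tau> B n"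
    unfolding hL P(2)[symmetric] coh_def[of ?W]
    by (metis mult_dvd_mono dvd_triv_left idx_image_dvd_hcard[OF L P(1) LP])
  show "coh Y \<tau> B 0 dvd coh ?U \<tau> B 0 * coh ?V \<tau> B 0"
    unfolding hL P(2)[symmetric] hcard_short_exact_0[OF L, of P] by (rule idx_image_dvd_hcard[OF L P(1) LP])
qed

section \<open>Contractible spaces, double covers and relative cohomology\<close>

lemma coch_cong:
  assumes "\<And>y. y \<in> topspace Y \<Longrightarrow> \<tau> y = \<tau>' y" "B \<inter> topspace Y = B' \<inter> topspace Y"
  shows "coch Y \<tau> B = coch Y \<tau>' B'"
proof -
  have "\<sigma> ` standard_simplex p \<subseteq> B \<longleftrightarrow> \<sigma> ` standard_simplex p \<subseteq> B'" if "singular_simplex p Y \<sigma>" for p \<sigma>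
    using assms(2) singular_simplex_in_topspace[OF that] by blast
  moreover have "simplex_map p \<tau> \<sigma> = simplex_map p \<tau>' \<sigma>" if "singular_simplex p Y \<sigma>" for p \<sigma>
    using simplex_map_eq[OF that] assms(1) by blast
  ultimately show ?thesis
    unfolding coch_def by (intro ext Collect_cong) (metis (no_types, lifting))
qed

lemma coh_cong:
  assumes "\<And>y. y \<in> topspace Y \<Longrightarrow> \<tau> y = \<tau>' y" "B \<inter> topspace Y = B' \<inter> topspace Y"
  shows "coh Y \<tau> B = coh Y \<tau>' B'"
  using coch_cong[OF assms] by (auto simp: coh_def)

lemma hcard_eq_1_if_zero:
  assumes "\<And>p. K p = {0}" "\<And>p. d p 0 = 0" shows "hcard K d n = 1"
proof -
  have "cyc K d n = {0}" "bnd K d n = {0}"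
    using assms by (cases n; auto simp: cyc_def)+
  then show ?thesis by (simp add: hcard_def idx_def)
qed

lemma coh_all_relative:
  assumes "topspace Y \<subseteq> B" shows "coh Y \<tau> B n = 1"
  unfolding coh_def
proof (rule hcard_eq_1_if_zero)
  fix p
  have "\<sigma> ` standard_simplex p \<subseteq> B" if "singular_simplex p Y \<sigma>" for \<sigma>
    using assms singular_simplex_in_topspace[OF that] by blast
  then have "c = 0" if "c \<in> coch Y \<tau> B p" for c
    using cochD(1,2)[OF that] by (metis ext zero_fun_apply)
  then show "coch Y \<tau> B p = {0}"
    using sgrp_zero[OF sgrp_coch] by blast
qed (simp add: cob_def fun_eq_iff)

lemma coh_empty: "topspace Y = {} \<Longrightarrow> coh Y \<tau> B n = 1"
  by (simp add: coh_all_relative)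

text \<open>There is one simplex in each degree and its boundary has p + 2 faces when it is of
  degree p + 1. Modulo 2 the coboundary out of degree \<open>p\<close> is thus bijective for odd
  \<open>p\<close> and zero for even \<open>p\<close>, so it kills all cohomology in positive
  degree.\<close>

lemma coh_singleton:
  assumes "topspace Y = {a}"
  shows "coh Y id {} n \<noteq> 0" and "coh Y id {} (Suc n) = 1"
proof -
  define k where "k = (\<lambda>p. restrict (\<lambda>x. a) (standard_simplex p))"
  have k: "singular_simplex p Y \<sigma> \<longleftrightarrow> \<sigma> = k p" for p \<sigma>
    using singular_simplex_singleton[OF assms] by (simp add: k_def)
  define \<xi> where "\<xi> = (\<lambda>p \<sigma>. if \<sigma> = k p then (1::bit) else 0)"
  have c_cases: "c = 0 \<or> c = \<xi> p" if "c \<in> coch Y id {} p" for c p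
  proof (cases "c (k p)")
    case zero
    then have "c \<sigma> = 0" for \<sigma> using cochD(1)[OF that] k by metis
    then show ?thesis by auto
  next
    case one
    then have "c \<sigma> = \<xi> p \<sigma>" for \<sigma> using cochD(1)[OF that] k by (metis \<xi>_def)
    then show ?thesis by auto
  qed
  have \<xi>: "\<xi> p \<in> coch Y id {} p" for p
    by (rule cochI) (auto simp: \<xi>_def k nonempty_standard_simplex simplex_map_id_singular[of p Y] simp del: simplex_map_id)
  note c = cplx_coch[OF inv_pair_id, of Y]
  have "finite (cyc (coch Y id {}) (cob Y) n)"
    by (rule finite_subset[of _ "{0, \<xi> n}"]) (use c_cases in \<open>auto simp: cyc_def\<close>)
  then show "coh Y id {} n \<noteq> 0"
    using sgrp_zero[OF sgrp_cyc[OF c]] by (auto simp: coh_def hcard_def idx_def card_eq_0_iff)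
  have face: "singular_face (Suc p) j (k (Suc p)) = k p" if "j \<le> Suc p" for j p
    using singular_simplex_face[of p Y "k (Suc p)" j] that k by simp
  have cob: "cob Y p (\<xi> p) (k (Suc p)) = of_nat (p + 2)" for p
  proof -
    have "cob Y p (\<xi> p) (k (Suc p)) = (\<Sum>j\<le>Suc p. 1)"
      unfolding cob_def using k by (auto simp: face \<xi>_def simp del: sum.atMost_Suc intro!: sum.cong)
    also have "\<dots> = of_nat (p + 2)" by (simp only: sum_constant card_atMost) simp
    finally show ?thesis .
  qed
  have "cyc (coch Y id {}) (cob Y) (Suc n) \<subseteq> bnd (coch Y id {}) (cob Y) (Suc n)"
  proof
    fix c' assume c': "c' \<in> cyc (coch Y id {}) (cob Y) (Suc n)"
    show "c' \<in> bnd (coch Y id {}) (cob Y) (Suc n)"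
    proof (cases "c' = 0")
      case True
      then show ?thesis using sgrp_zero[OF sgrp_bnd[OF c]] by blast
    next
      case False
      then have "c' = \<xi> (Suc n)" "cob Y (Suc n) c' = 0" using c' c_cases by (auto simp: cyc_def)
      then have "of_nat (Suc n + 2) = (0 :: bit)"
        using cob[of "Suc n"] by (metis zero_fun_apply)
      then have "odd n" by (cases "even n") (auto elim!: evenE oddE)
      then have "cob Y n (\<xi> n) (k (Suc n)) = 1" unfolding cob by (auto elim!: oddE)
      moreover have "cob Y n (\<xi> n) \<in> coch Y id {} (Suc n)" using cplxD(2)[OF c \<xi>] .
      ultimately have "cob Y n (\<xi> n) = \<xi> (Suc n)" using c_cases by fastforce
      then show ?thesis using \<xi> \<open>c' = \<xi> (Suc n)\<close> by (metis bnd_Suc imageI)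
    qed
  qed
  then show "coh Y id {} (Suc n) = 1"
    unfolding coh_def hcard_eq_1_iff[OF c] using bnd_subset_cyc[OF c] by blast
qed

lemma equi_homotopic_if_homotopic:
  assumes "homotopic_with (\<lambda>h. True) Y Y' f g" shows "equi_homotopic Y id {} Y' id {} f g"
  using assms unfolding homotopic_with_def equi_homotopic_def by auto

lemma equi_homotopic_refl:
  assumes "pair_map Y \<tau> B Y' \<tau>' B' f" "\<And>y. y \<in> topspace Y \<Longrightarrow> f y = g y"
  shows "equi_homotopic Y \<tau> B Y' \<tau>' B' f g"
  unfolding equi_homotopic_def
proof (intro exI[of _ "f \<circ> snd"] conjI)
  show "continuous_map (cyl Y) Y' (f \<circ> snd)"
    using assms(1) by (intro continuous_map_compose[OF continuous_map_snd]) (simp add: pair_map_def)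
qed (use assms in \<open>auto simp: pair_map_def\<close>)

lemma coh_contractible:
  assumes "contractible_space Y" "topspace Y \<noteq> {}"
  shows "coh Y id {} n \<noteq> 0" and "coh Y id {} (Suc n) = 1"
proof -
  obtain a where a: "a \<in> topspace Y" using assms by blast
  let ?P = "subtopology Y {a}"
  have P: "topspace ?P = {a}" using a by auto
  have "coh ?P id {} p = coh Y id {} p" for p
  proof (rule coh_homotopy_equivalence(3)[where f = id and g = "\<lambda>x. a"])
    show "equi_homotopic Y id {} Y id {} id (id \<circ> (\<lambda>x. a))"
      using assms a unfolding contractible_space_alt by (auto intro: equi_homotopic_if_homotopic simp: o_def)
    show "equi_homotopic ?P id {} ?P id {} id ((\<lambda>x. a) \<circ> id)"
      by (rule equi_homotopic_refl) (auto simp: pair_map_def)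
  qed (use a in \<open>auto simp: inv_pair_id pair_map_def continuous_map_in_subtopology continuous_map_from_subtopology\<close>)
  then show "coh Y id {} n \<noteq> 0" "coh Y id {} (Suc n) = 1"
    using coh_singleton[OF P] by metis+
qed

text \<open>A simplex is connected, so it lies in exactly one of the two sheets, and the involution
  exchanges them. An invariant cochain is therefore the same as an arbitrary cochain on the sheet
  \<open>W\<close>, and restriction has zero kernel.\<close>

lemma coh_two_sheets:
  assumes Y: "inv_pair Y \<tau> {}" and W: "openin Y W" "openin Y (\<tau> ` W)" "topspace Y = W \<union> \<tau> ` W" "W \<inter> \<tau> ` W = {}"
  shows "coh Y \<tau> {} n = coh (subtopology Y W) id {} n"
proof -
  let ?W = "subtopology Y W"
  have W': "singular_simplex p ?W \<sigma> \<or> singular_simplex p (subtopology Y (\<tau> ` W)) \<sigma>"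
    and excl: "\<not> (singular_simplex p ?W \<sigma> \<and> singular_simplex p (subtopology Y (\<tau> ` W)) \<sigma>)"
    if \<sigma>: "singular_simplex p Y \<sigma>" for p \<sigma>
  proof -
    have "connectedin Y (\<sigma> ` standard_simplex p)"
    proof (rule connectedin_continuous_map_image)
      show "continuous_map (simplex_top p) Y \<sigma>" using \<sigma> by (simp add: singular_simplex_def)
      show "connectedin (simplex_top p) (standard_simplex p)"
        using connectedin_standard_simplex by (simp add: connectedin_subtopology)
    qed
    moreover have "closedin Y W"
    proof -
      have "topspace Y - \<tau> ` W = W" using W by blast
      then show ?thesis using W(2) by (metis openin_closedin_eq)
    qed
    ultimately have "\<sigma> ` standard_simplex p \<subseteq> W \<or> disjnt (\<sigma> ` standard_simplex p) W"
      using connectedin_clopen_cases W(1) by blast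
    moreover have "\<sigma> ` standard_simplex p \<subseteq> W \<union> \<tau> ` W"
      using singular_simplex_in_topspace[OF \<sigma>] W(3) by blast
    ultimately show "singular_simplex p ?W \<sigma> \<or> singular_simplex p (subtopology Y (\<tau> ` W)) \<sigma>"
      using \<sigma> by (auto simp: singular_simplex_subtopology disjnt_def)
    show "\<not> (singular_simplex p ?W \<sigma> \<and> singular_simplex p (subtopology Y (\<tau> ` W)) \<sigma>)"
    proof
      assume "singular_simplex p ?W \<sigma> \<and> singular_simplex p (subtopology Y (\<tau> ` W)) \<sigma>"
      then have "\<sigma> ` standard_simplex p \<subseteq> W \<inter> \<tau> ` W" by (simp add: singular_simplex_subtopology)
      then show False using W(4) nonempty_standard_simplex[of p] by simp
    qed
  qed
  have cont: "continuous_map Y Y \<tau>" and inv: "\<tau> (\<tau> y) = y" if "y \<in> topspace Y" for y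
    using Y that by (auto simp: inv_pair_def)
  have swap: "singular_simplex p ?W (simplex_map p \<tau> \<sigma>)" if "singular_simplex p (subtopology Y (\<tau> ` W)) \<sigma>" for p \<sigma>
  proof -
    have "continuous_map (subtopology Y (\<tau> ` W)) ?W \<tau>"
      using Y W by (auto simp: inv_pair_def continuous_map_in_subtopology intro: continuous_map_from_subtopology)
    then show ?thesis using that singular_simplex_simplex_map by blast
  qed
  have swap': "singular_simplex p (subtopology Y (\<tau> ` W)) (simplex_map p \<tau> \<sigma>)" if "singular_simplex p ?W \<sigma>" for p \<sigma>
  proof -
    have "continuous_map ?W (subtopology Y (\<tau> ` W)) \<tau>"
      using Y W by (auto simp: inv_pair_def continuous_map_in_subtopology intro: continuous_map_from_subtopology)
    then show ?thesis using that singular_simplex_simplex_map by blast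
  qed
  have \<tau>\<tau>: "simplex_map p \<tau> (simplex_map p \<tau> \<sigma>) = \<sigma>" if "singular_simplex p Y \<sigma>" for p \<sigma>
  proof -
    have "simplex_map p (\<tau> \<circ> \<tau>) \<sigma> = \<sigma>"
      by (rule simplex_map_id_gen[OF that]) (use inv in simp)
    then show ?thesis by (simp add: simplex_map_compose)
  qed
  have sub: "pair_map ?W id {} Y id {} id" by (simp add: pair_map_def continuous_map_from_subtopology)
  show ?thesis
    unfolding coh_def
  proof (rule hcard_surj_acyclic_kernel[where f = "pull ?W id"])
    show "cplx (coch Y \<tau> {}) (cob Y)" "cplx (coch ?W id {}) (cob ?W)"
      by (auto intro: cplx_coch Y inv_pair_id)
    show "cmap (coch Y \<tau> {}) (cob Y) (coch ?W id {}) (cob ?W) (pull ?W id)"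
      unfolding cmap_def
    proof (intro conjI allI ballI)
      fix p x assume x: "x \<in> coch Y \<tau> {} p"
      show "pull ?W id p x \<in> coch ?W id {} p"
        by (rule cochI) (auto simp: pull_restrict nonempty_standard_simplex simplex_map_id_singular[of p ?W] simp del: simplex_map_id)
      show "pull ?W id (Suc p) (cob Y p x) = cob ?W p (pull ?W id p x)"
        by (rule cob_pull[symmetric]) (simp add: continuous_map_from_subtopology)
    qed (auto simp: pull_def fun_eq_iff)
    fix p y assume y: "y \<in> coch ?W id {} p"
    define x where "x = (\<lambda>\<sigma>. if singular_simplex p ?W \<sigma> then y \<sigma> else
      if singular_simplex p Y \<sigma> then y (simplex_map p \<tau> \<sigma>) else 0)"
    have "x \<in> coch Y \<tau> {} p"
    proof (rule cochI)
      fix \<sigma> assume \<sigma>: "singular_simplex p Y \<sigma>"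
      then have \<sigma>': "singular_simplex p Y (simplex_map p \<tau> \<sigma>)"
        using Y by (auto simp: inv_pair_def intro: singular_simplex_simplex_map)
      show "x (simplex_map p \<tau> \<sigma>) = x \<sigma>"
        using W'[OF \<sigma>] excl[OF \<sigma>] excl[OF \<sigma>'] swap[of p \<sigma>] swap'[of p \<sigma>] \<sigma> \<sigma>' \<tau>\<tau>[OF \<sigma>]
        by (auto simp: x_def)
    qed (auto simp: x_def singular_simplex_subtopology nonempty_standard_simplex)
    moreover have "pull ?W id p x = y"
      using cochD(1)[OF y] by (auto simp: pull_restrict x_def fun_eq_iff)
    ultimately show "\<exists>x\<in>coch Y \<tau> {} p. pull ?W id p x = y" by blast
  next
    have z0: "z = 0" if z: "z \<in> coch Y \<tau> {} q" "pull ?W id q z = 0" for q z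
    proof
      fix \<sigma>
      have zW: "z \<sigma> = 0" if "singular_simplex q ?W \<sigma>" for \<sigma>
        using fun_cong[OF z(2), of \<sigma>] that by (simp add: pull_restrict)
      show "z \<sigma> = 0 \<sigma>"
      proof (cases "singular_simplex q Y \<sigma>")
        case True
        then show ?thesis
          using W'[OF True] zW[of \<sigma>] zW[of "simplex_map q \<tau> \<sigma>"] swap[of q \<sigma>] cochD(3)[OF z(1) True] by auto
      qed (use cochD(1)[OF z(1)] in simp)
    qed
    fix q z assume "z \<in> cyc (coch Y \<tau> {}) (cob Y) q" "pull ?W id q z = 0"
    then have "z = 0" using z0 by (auto simp: cyc_def)
    moreover have "cob Y p 0 = 0" "pull ?W id p 0 = 0" for p
      by (auto simp: cob_def pull_def fun_eq_iff)
    ultimately show "z \<in> bnd (\<lambda>p. {x \<in> coch Y \<tau> {} p. pull ?W id p x = 0}) (cob Y) q"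
      by (cases q) (auto intro!: image_eqI[of _ _ 0] sgrp_zero[OF sgrp_coch])
  qed
qed

text \<open>The localisation step. The cochains relative to \<open>B\<close> are the kernel of
  restriction to \<open>B\<close>, and their vanishing in two consecutive degrees makes restriction
  an isomorphism in the lower one.\<close>

lemma coh_restrict_eq:
  assumes Y: "inv_pair Y \<tau> B" and "coh Y \<tau> B n = 1" "coh Y \<tau> B (Suc n) = 1"
  shows "coh Y \<tau> {} n = coh (subtopology Y B) \<tau> {} n"
proof -
  let ?B = "subtopology Y B"
  have Y0: "inv_pair Y \<tau> {}" using Y by (simp add: inv_pair_def)
  have B0: "inv_pair ?B \<tau> {}" using Y by (intro inv_pair_subtopology[OF Y0]) (auto simp: inv_pair_def)
  have f: "cmap (coch Y \<tau> {}) (cob Y) (coch ?B \<tau> {}) (cob ?B) (pull ?B id)"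
    by (rule cmap_pull[OF B0]) (simp add: pair_map_def continuous_map_from_subtopology)
  have inv: "singular_simplex p ?B (simplex_map p \<tau> \<sigma>) \<longleftrightarrow> singular_simplex p ?B \<sigma>" if "singular_simplex p Y \<sigma>" for p \<sigma>
    by (rule singular_simplex_subtopology_invariant[OF Y0 _ that]) (use Y in \<open>simp add: inv_pair_def\<close>)
  have ker: "{x \<in> coch Y \<tau> {} p. pull ?B id p x = 0} = coch Y \<tau> B p" for p
  proof (intro equalityI subsetI)
    fix x assume "x \<in> {x \<in> coch Y \<tau> {} p. pull ?B id p x = 0}"
    then have x: "x \<in> coch Y \<tau> {} p" "pull ?B id p x = 0" by auto
    show "x \<in> coch Y \<tau> B p"
    proof (rule cochI)
      fix \<sigma> assume "singular_simplex p Y \<sigma>" "\<sigma> ` standard_simplex p \<subseteq> B"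
      then show "x \<sigma> = 0"
        using fun_cong[OF x(2), of \<sigma>] by (simp add: pull_restrict singular_simplex_subtopology)
    qed (use cochD[OF x(1)] in auto)
  next
    fix x assume x: "x \<in> coch Y \<tau> B p"
    have "x \<in> coch Y \<tau> {} p"
      by (rule cochI) (use cochD[OF x] nonempty_standard_simplex in auto)
    moreover have "pull ?B id p x = 0"
      using cochD(2)[OF x] by (auto simp: pull_restrict singular_simplex_subtopology fun_eq_iff)
    ultimately show "x \<in> {x \<in> coch Y \<tau> {} p. pull ?B id p x = 0}" by blast
  qed
  show ?thesis
    unfolding coh_def
  proof (rule hcard_surj_acyclic_kernel[OF cplx_coch[OF Y0] cplx_coch[OF B0] f])
    fix p y assume y: "y \<in> coch ?B \<tau> {} p"
    have "y \<in> coch Y \<tau> {} p"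
    proof (rule cochI)
      fix \<sigma> assume \<sigma>: "singular_simplex p Y \<sigma>"
      then show "y (simplex_map p \<tau> \<sigma>) = y \<sigma>"
        using inv[OF \<sigma>] cochD(1)[OF y, of \<sigma>] cochD(1)[OF y, of "simplex_map p \<tau> \<sigma>"] cochD(3)[OF y, of \<sigma>]
        by (cases "singular_simplex p ?B \<sigma>") auto
    qed (use cochD(1)[OF y] nonempty_standard_simplex in \<open>auto simp: singular_simplex_subtopology\<close>)
    moreover have "pull ?B id p y = y" using cochD(1)[OF y] by (auto simp: pull_restrict fun_eq_iff)
    ultimately show "\<exists>x\<in>coch Y \<tau> {} p. pull ?B id p x = y" by blast
  next
    fix q z assume q: "q = n \<or> q = Suc n" and z: "z \<in> cyc (coch Y \<tau> {}) (cob Y) q" "pull ?B id q z = 0"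
    have "cyc (coch Y \<tau> B) (cob Y) q = bnd (coch Y \<tau> B) (cob Y) q"
      using q assms(2,3) hcard_eq_1_iff[OF cplx_coch[OF Y]] unfolding coh_def by blast
    moreover have "z \<in> cyc (coch Y \<tau> B) (cob Y) q"
      using z unfolding cyc_def ker[symmetric] by blast
    ultimately show "z \<in> bnd (\<lambda>p. {x \<in> coch Y \<tau> {} p. pull ?B id p x = 0}) (cob Y) q"
      unfolding ker by simp
  qed
qed

section \<open>Discs and equivariant cells\<close>

lemma topspace_disc: "topspace (disc n) = {x. (\<forall>i\<ge>n. x i = 0) \<and> (\<Sum>i<n. (x i)\<^sup>2) \<le> 1}"
  by (auto simp: disc_def topspace_Euclidean_space)

lemma disc_eq: "disc n = subtopology (powertop_real UNIV) (topspace (disc n))"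
  unfolding topspace_disc by (auto simp: disc_def Euclidean_space_def subtopology_subtopology intro!: arg_cong2[where f = subtopology])

lemma continuous_map_into_disc:
  "continuous_map Z (disc n) f \<longleftrightarrow>
    (\<forall>i. continuous_map Z euclideanreal (\<lambda>z. f z i)) \<and> f \<in> topspace Z \<rightarrow> topspace (disc n)"
  by (subst disc_eq) (simp add: continuous_map_in_subtopology continuous_map_componentwise_UNIV)

lemma continuous_map_disc_coordinate: "continuous_map (disc n) euclideanreal (\<lambda>x. x i)"
  by (subst disc_eq) (intro continuous_map_from_subtopology continuous_map_product_projection, simp)

text \<open>A closed subset of the cube of sequences in [-1, 1], which is compact by Tychonoff's
  theorem.\<close>

lemma compact_space_disc: "compact_space (disc n)"
proof -
  have "compactin (powertop_real UNIV) (topspace (disc n))"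
  proof (rule closed_compactin)
    show "compactin (powertop_real UNIV) (UNIV \<rightarrow>\<^sub>E {-1..1})"
      by (simp add: compactin_PiE)
    show "topspace (disc n) \<subseteq> UNIV \<rightarrow>\<^sub>E {-1..1}"
    proof
      fix x assume x: "x \<in> topspace (disc n)"
      have "x i \<in> {-1..1}" for i
      proof (cases "i < n")
        case True
        then have "(x i)\<^sup>2 \<le> (\<Sum>i<n. (x i)\<^sup>2)" by (intro member_le_sum) auto
        also have "\<dots> \<le> 1" using x by (simp add: topspace_disc)
        finally have "\<bar>x i\<bar> \<le> 1" by (simp add: abs_square_le_1)
        then show ?thesis by auto
      qed (use x in \<open>auto simp: topspace_disc\<close>)
      then show "x \<in> UNIV \<rightarrow>\<^sub>E {-1..1}" by auto
    qed
    have eq: "topspace (disc n) = (\<Inter>i\<in>{n..}. {x \<in> topspace (powertop_real UNIV). x i \<in> {0}}) \<inter>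
        {x \<in> topspace (powertop_real UNIV). (\<Sum>i<n. (x i)\<^sup>2) \<in> {..1}}"
      by (auto simp: topspace_disc)
    show "closedin (powertop_real UNIV) (topspace (disc n))"
    proof -
      have pr: "continuous_map (powertop_real UNIV) euclideanreal (\<lambda>x. x i)" for i :: nat
        by (rule continuous_map_product_projection) simp
      have "closedin (powertop_real UNIV) {x \<in> topspace (powertop_real UNIV). x i \<in> {0}}" for i :: nat
        by (rule closedin_continuous_map_preimage[OF pr]) simp
      moreover have "continuous_map (powertop_real UNIV) euclideanreal (\<lambda>x. \<Sum>i<n. (x i)\<^sup>2)"
        by (intro continuous_map_sum continuous_map_real_pow pr) simp
      then have "closedin (powertop_real UNIV) {x \<in> topspace (powertop_real UNIV). (\<Sum>i<n. (x i)\<^sup>2) \<in> {..1}}"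
        by (rule closedin_continuous_map_preimage) simp
      ultimately show ?thesis
        unfolding eq by (intro closedin_Int closedin_Inter) auto
    qed
  qed
  then show ?thesis by (subst disc_eq) (simp add: compact_space_subtopology)
qed

lemma disc_convex:
  assumes x: "x \<in> topspace (disc n)" and y: "y \<in> open_disc n" and t: "0 < t" "t \<le> 1"
  shows "(\<lambda>i. (1 - t) * x i + t * y i) \<in> open_disc n"
proof -
  have xy: "(\<Sum>i<n. (x i)\<^sup>2) \<le> 1" "(\<Sum>i<n. (y i)\<^sup>2) < 1" using x y by (auto simp: topspace_disc open_disc_def)
  have "(\<Sum>i<n. ((1 - t) * x i + t * y i)\<^sup>2) \<le> (\<Sum>i<n. (1 - t) * (x i)\<^sup>2 + t * (y i)\<^sup>2)"
  proof (rule sum_mono)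
    fix i
    have "(1 - t) * (x i)\<^sup>2 + t * (y i)\<^sup>2 - ((1 - t) * x i + t * y i)\<^sup>2 = t * (1 - t) * (x i - y i)\<^sup>2"
      by (simp add: power2_eq_square algebra_simps)
    also have "\<dots> \<ge> 0" using t by simp
    finally show "((1 - t) * x i + t * y i)\<^sup>2 \<le> (1 - t) * (x i)\<^sup>2 + t * (y i)\<^sup>2" by simp
  qed
  also have "\<dots> = (1 - t) * (\<Sum>i<n. (x i)\<^sup>2) + t * (\<Sum>i<n. (y i)\<^sup>2)"
    by (simp add: sum.distrib sum_distrib_left)
  also have "\<dots> < 1"
  proof -
    have "(1 - t) * (\<Sum>i<n. (x i)\<^sup>2) \<le> (1 - t) * 1" using xy t by (intro mult_left_mono) auto
    moreover have "t * (\<Sum>i<n. (y i)\<^sup>2) < t * 1" using xy t by (intro mult_strict_left_mono) auto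
    ultimately show ?thesis by simp
  qed
  finally show ?thesis using x y by (auto simp: topspace_disc open_disc_def)
qed

lemma zero_in_open_disc: "(\<lambda>i. 0) \<in> open_disc n"
  by (simp add: open_disc_def topspace_disc)

lemma open_disc_subset: "open_disc n \<subseteq> topspace (disc n)"
  by (auto simp: open_disc_def)

text \<open>Shrinking towards the centre approximates boundary points from inside. Identities on an
  open cell can thereby be carried to its closure.\<close>

lemma open_disc_closure: "topspace (disc n) \<subseteq> Abstract_Topology.closure_of (disc n) (open_disc n)"
proof
  fix x assume x: "x \<in> topspace (disc n)"
  define g where "g = (\<lambda>t i. (1 - t) * x i + t * (0::real))"
  have g: "g t \<in> open_disc n" if "t \<in> {0<..1}" for t
    unfolding g_def by (rule disc_convex[OF x zero_in_open_disc]) (use that in auto)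
  have g0: "g 0 = x" by (simp add: g_def)
  have "continuous_map (top_of_set {0..1}) (disc n) g"
    unfolding continuous_map_into_disc
  proof (intro conjI allI)
    show "continuous_map (top_of_set {0..1}) euclideanreal (\<lambda>t. g t i)" for i
      unfolding g_def continuous_map_iff_continuous by (intro continuous_intros)
    have "g t \<in> topspace (disc n)" if "t \<in> {0..1}" for t
      using g[of t] g0 x open_disc_subset that by (cases "t = 0") auto
    then show "g \<in> topspace (top_of_set {0..1}) \<rightarrow> topspace (disc n)" by auto
  qed
  then have "g ` (Abstract_Topology.closure_of (top_of_set {0..1}) {0<..1}) \<subseteq> Abstract_Topology.closure_of (disc n) (g ` {0<..1})"
    by (rule continuous_map_image_closure_subset)
  moreover have "0 \<in> Abstract_Topology.closure_of (top_of_set {0..1::real}) {0<..1}"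
  proof -
    have "closure {0<..1::real} = {0..1}" by simp
    then show ?thesis by (simp add: closure_of_subtopology Int_absorb1 greaterThanAtMost_subseteq_atLeastAtMost_iff)
  qed
  ultimately have "x \<in> Abstract_Topology.closure_of (disc n) (g ` {0<..1})" using g0 by force
  then show "x \<in> Abstract_Topology.closure_of (disc n) (open_disc n)"
    using closure_of_mono[of "g ` {0<..1}" "open_disc n" "disc n"] g by blast
qed

section \<open>Equivariant homotopies of closed cells\<close>

lemma continuous_map_closed_cover_3:
  assumes cover: "topspace X = A \<union> B \<union> C" and "closedin X A" "closedin X B" "closedin X C"
    and f: "continuous_map (subtopology X A) Y f" "continuous_map (subtopology X B) Y f" "continuous_map (subtopology X C) Y f"
  shows "continuous_map X Y f"
  unfolding continuous_map_closedin
proof (intro conjI allI impI)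
  have "f x \<in> topspace Y" if "x \<in> topspace X" for x
    using that cover f unfolding continuous_map_def by fastforce
  then show "f \<in> topspace X \<rightarrow> topspace Y" by blast
  fix K assume K: "closedin Y K"
  have *: "closedin X {x \<in> T. f x \<in> K}" if "closedin X T" "continuous_map (subtopology X T) Y f" for T
  proof -
    have "closedin (subtopology X T) {x \<in> topspace (subtopology X T). f x \<in> K}"
      using that(2) K by (simp add: continuous_map_closedin)
    moreover have "{x \<in> topspace (subtopology X T). f x \<in> K} = {x \<in> T. f x \<in> K}"
      using closedin_subset[OF that(1)] by auto
    ultimately show ?thesis using closedin_trans_full that(1) by metis
  qed
  have "{x \<in> topspace X. f x \<in> K} = {x \<in> A. f x \<in> K} \<union> {x \<in> B. f x \<in> K} \<union> {x \<in> C. f x \<in> K}"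
    using cover by auto
  then show "closedin X {x \<in> topspace X. f x \<in> K}"
    using * assms by (simp add: closedin_Un)
qed

text \<open>From a compact cylinder to a Hausdorff space, \<open>map_prod id \<Phi>\<close> is a
  closed map. It stays closed over the saturated set \<open>S\<close>, which need not be closed,
  hence is a quotient map onto the cylinder over the image; a homotopy compatible with the
  identifications made by \<open>\<Phi>\<close> therefore descends.\<close>

lemma disc_image_homotopy:
  assumes X: "Hausdorff_space X" and \<Phi>: "continuous_map (disc n) X \<Phi>"
    and S: "S \<subseteq> topspace (disc n)" and sat: "\<forall>x\<in>S. \<forall>y\<in>topspace (disc n). \<Phi> x = \<Phi> y \<longrightarrow> y \<in> S"
    and k: "continuous_map (cyl (subtopology (disc n) S)) (disc n) k"
    and compat: "\<forall>t\<in>{0..1}. \<forall>x\<in>S. \<forall>y\<in>S. \<Phi> x = \<Phi> y \<longrightarrow> \<Phi> (k (t, x)) = \<Phi> (k (t, y))"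
  shows "\<exists>H. continuous_map (cyl (subtopology X (\<Phi> ` S))) X H \<and>
    (\<forall>t\<in>{0..1}. \<forall>x\<in>S. H (t, \<Phi> x) = \<Phi> (k (t, x)))"
proof -
  let ?q = "map_prod id \<Phi> :: real \<times> _ \<Rightarrow> _"
  have \<Phi>X: "\<Phi> x \<in> topspace X" if "x \<in> topspace (disc n)" for x
    using \<Phi> that by (auto simp: continuous_map_def)
  have "continuous_map (cyl (disc n)) (cyl X) ?q" by (rule continuous_map_cyl[OF \<Phi>])
  moreover have "compact_space (cyl (disc n))"
    by (simp add: compact_space_prod_topology compact_space_disc compact_space_subtopology)
  moreover have "Hausdorff_space (cyl X)"
    by (simp add: Hausdorff_space_prod_topology X Hausdorff_space_subtopology)
  ultimately have "closed_map (cyl (disc n)) (cyl X) ?q" by (rule continuous_imp_closed_map)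
  then have "closed_map (subtopology (cyl (disc n)) ({0..1} \<times> S)) (subtopology (cyl X) ({0..1} \<times> \<Phi> ` S)) ?q"
    by (rule closed_map_restriction) (use S sat in \<open>auto 4 3\<close>)
  moreover have cylS: "subtopology (cyl (disc n)) ({0..1} \<times> S) = cyl (subtopology (disc n) S)"
    "subtopology (cyl X) ({0..1} \<times> \<Phi> ` S) = cyl (subtopology X (\<Phi> ` S))"
    by (simp_all only: subtopology_Times subtopology_subtopology Int_absorb)
  ultimately have cl: "closed_map (cyl (subtopology (disc n) S)) (cyl (subtopology X (\<Phi> ` S))) ?q" by simp
  have co: "continuous_map (cyl (subtopology (disc n) S)) (cyl (subtopology X (\<Phi> ` S))) ?q"
    by (rule continuous_map_cyl) (use \<Phi> in \<open>auto simp: continuous_map_in_subtopology continuous_map_from_subtopology\<close>)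
  have quo: "quotient_map (cyl (subtopology (disc n) S)) (cyl (subtopology X (\<Phi> ` S))) ?q"
  proof (rule continuous_closed_imp_quotient_map[OF co cl])
    have "topspace (disc n) \<inter> S = S" "topspace X \<inter> \<Phi> ` S = \<Phi> ` S" using S \<Phi>X by auto
    then show "?q ` topspace (cyl (subtopology (disc n) S)) = topspace (cyl (subtopology X (\<Phi> ` S)))"
      by (auto simp: image_iff)
  qed
  have c: "continuous_map (cyl (subtopology (disc n) S)) X (\<Phi> \<circ> k)"
    by (rule continuous_map_compose[OF k \<Phi>])
  have cong: "(\<Phi> \<circ> k) x = (\<Phi> \<circ> k) y"
    if "x \<in> topspace (cyl (subtopology (disc n) S))" "y \<in> topspace (cyl (subtopology (disc n) S))" "?q x = ?q y" for x y
  proof -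
    obtain t a t' b where xy: "x = (t, a)" "y = (t', b)" by (cases x; cases y) blast
    then have "t = t'" "t \<in> {0..1}" "a \<in> S" "b \<in> S" "\<Phi> a = \<Phi> b" using that by auto
    then show ?thesis using bspec[OF bspec[OF bspec[OF compat]], of t a b] xy by simp
  qed
  have "\<exists>g. continuous_map (cyl (subtopology X (\<Phi> ` S))) X g \<and>
    (\<forall>z\<in>topspace (cyl (subtopology (disc n) S)). g (?q z) = (\<Phi> \<circ> k) z)"
  proof (rule quotient_map_lift_exists[OF quo c])
    fix g assume "continuous_map (cyl (subtopology X (\<Phi> ` S))) X g"
      "\<And>z. z \<in> topspace (cyl (subtopology (disc n) S)) \<Longrightarrow> g (?q z) = (\<Phi> \<circ> k) z"
    then show ?thesis by blast
  qed (rule cong)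
  then obtain g where g: "continuous_map (cyl (subtopology X (\<Phi> ` S))) X g"
    "\<And>z. z \<in> topspace (cyl (subtopology (disc n) S)) \<Longrightarrow> g (?q z) = (\<Phi> \<circ> k) z"
    by blast
  have "g (t, \<Phi> x) = \<Phi> (k (t, x))" if "t \<in> {0..1}" "x \<in> S" for t x
    using g(2)[of "(t, x)"] that S by auto
  with g(1) show ?thesis by blast
qed

definition orbit_image :: "('a \<Rightarrow> 'a) \<Rightarrow> ('b \<Rightarrow> 'a) \<Rightarrow> 'b set \<Rightarrow> 'a set"
  where "orbit_image \<tau> \<Phi> S = \<Phi> ` S \<union> \<tau> ` \<Phi> ` S"

text \<open>
  Gluing the homotopy \<open>k\<close> on a characteristic map \<open>\<Phi>\<close>, its translate under \<open>\<tau>\<close>, and the constant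
  homotopy on \<open>A\<close>.
\<close>

lemma orbit_homotopy:
  assumes X: "Hausdorff_space X" and \<tau>: "continuous_map X X \<tau>" "\<forall>x\<in>topspace X. \<tau> (\<tau> x) = x"
    and \<Phi>: "continuous_map (disc n) X \<Phi>"
    and S: "S \<subseteq> topspace (disc n)" and sat: "\<forall>x\<in>S. \<forall>y\<in>topspace (disc n). \<Phi> x = \<Phi> y \<longrightarrow> y \<in> S"
    and k: "continuous_map (cyl (subtopology (disc n) S)) (disc n) k"
    and compat: "\<forall>t\<in>{0..1}. \<forall>x\<in>S. \<forall>y\<in>S. \<Phi> x = \<Phi> y \<longrightarrow> \<Phi> (k (t, x)) = \<Phi> (k (t, y))"
    and compat\<tau>: "\<forall>t\<in>{0..1}. \<forall>x\<in>S. \<forall>y\<in>S. \<Phi> x = \<tau> (\<Phi> y) \<longrightarrow> \<Phi> (k (t, x)) = \<tau> (\<Phi> (k (t, y)))"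
    and compatA: "\<forall>t\<in>{0..1}. \<forall>x\<in>S. \<Phi> x \<in> A \<longrightarrow> \<Phi> (k (t, x)) = \<Phi> x"
    and A: "A \<subseteq> topspace X" "\<tau> ` A \<subseteq> A"
    and N: "N = A \<union> orbit_image \<tau> \<Phi> S"
    and cl: "closedin (subtopology X N) A" "closedin (subtopology X N) (\<Phi> ` S)"
  shows "\<exists>H. continuous_map (cyl (subtopology X N)) X H \<and>
    (\<forall>t\<in>{0..1}. (\<forall>u\<in>A. H (t, u) = u) \<and> (\<forall>u\<in>N. H (t, \<tau> u) = \<tau> (H (t, u))) \<and>
      (\<forall>x\<in>S. H (t, \<Phi> x) = \<Phi> (k (t, x)) \<and> H (t, \<tau> (\<Phi> x)) = \<tau> (\<Phi> (k (t, x)))))"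
proof -
  note \<tau> = \<tau>(1) bspec[OF \<tau>(2)]
  note compatA = compatA[rule_format] and compat\<tau> = compat\<tau>[rule_format]
  obtain H1 where H1: "continuous_map (cyl (subtopology X (\<Phi> ` S))) X H1"
    "\<And>t x. \<lbrakk>t \<in> {0..1}; x \<in> S\<rbrakk> \<Longrightarrow> H1 (t, \<Phi> x) = \<Phi> (k (t, x))"
    using disc_image_homotopy[OF X \<Phi> S sat k compat] by blast
  have \<Phi>X: "\<Phi> x \<in> topspace X" if "x \<in> S" for x
    using \<Phi> that S by (auto simp: continuous_map_def)
  have \<tau>X: "\<tau> x \<in> topspace X" if "x \<in> topspace X" for x using \<tau>(1) that by (auto simp: continuous_map_def)
  have \<tau>N: "\<tau> u \<in> N" if "u \<in> N" for u
    using that A \<tau>(2)[OF \<Phi>X] by (auto simp: N orbit_image_def)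
  have NX: "N \<subseteq> topspace X" using A(1) \<Phi>X \<tau>X by (auto simp: N orbit_image_def)
  \<comment> \<open>The order of the cases is immaterial: on overlaps the three prescriptions agree
    by \<open>compatA\<close> and \<open>compat\<tau>\<close>. The last case conjugates
    \<open>H1\<close> with the involution, which forces equivariance.\<close>
  define H where "H = (\<lambda>(t, u). if u \<in> A then u else if u \<in> \<Phi> ` S then H1 (t, u) else \<tau> (H1 (t, \<tau> u)))"
  have HA: "H (t, u) = u" if "u \<in> A" for t u using that by (simp add: H_def)
  have H\<Phi>: "H (t, \<Phi> x) = \<Phi> (k (t, x))" if "t \<in> {0..1}" "x \<in> S" for t x
    using that compatA H1(2) by (auto simp: H_def)
  have H\<tau>: "H (t, \<tau> (\<Phi> x)) = \<tau> (\<Phi> (k (t, x)))" if t: "t \<in> {0..1}" and x: "x \<in> S" for t x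
  proof (cases "\<tau> (\<Phi> x) \<in> A")
    case True
    then have "\<Phi> x \<in> A" using A(2) \<tau>(2)[OF \<Phi>X[OF x]] by (metis image_subset_iff)
    then show ?thesis using compatA[OF t x] True by (simp add: H_def)
  next
    case False
    show ?thesis
    proof (cases "\<tau> (\<Phi> x) \<in> \<Phi> ` S")
      case True
      then obtain y where "y \<in> S" "\<Phi> y = \<tau> (\<Phi> x)" by auto
      then show ?thesis using H\<Phi>[OF t, of y] compat\<tau>[of t y x] t x by simp
    next
      case F2: False
      then show ?thesis using False H1(2)[OF t x] \<tau>(2)[OF \<Phi>X[OF x]] by (simp add: H_def)
    qed
  qed
  have equi: "H (t, \<tau> u) = \<tau> (H (t, u))" if t: "t \<in> {0..1}" and u: "u \<in> N" for t u
  proof -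
    consider "u \<in> A" | x where "x \<in> S" "u = \<Phi> x" | x where "x \<in> S" "u = \<tau> (\<Phi> x)"
      using u by (auto simp: N orbit_image_def)
    then show ?thesis
    proof cases
      case 1 then show ?thesis using A(2) HA by (metis image_subset_iff)
    next
      case 2 then show ?thesis using H\<Phi> H\<tau> t by simp
    next
      case 3
      have "k (t, x) \<in> topspace (disc n)"
        using k t 3(1) S by (auto simp: continuous_map_def Pi_iff)
      then have "\<tau> (\<tau> (\<Phi> (k (t, x)))) = \<Phi> (k (t, x))" using \<tau>(2) \<Phi> by (auto simp: continuous_map_def)
      then show ?thesis using 3 H\<Phi>[OF t 3(1)] H\<tau>[OF t 3(1)] \<tau>(2)[OF \<Phi>X[OF 3(1)]] by simp
    qed
  qed
  have "continuous_map (cyl (subtopology X N)) X H"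
  proof (rule continuous_map_closed_cover_3[where A = "{0..1} \<times> A" and B = "{0..1} \<times> \<Phi> ` S" and C = "{0..1} \<times> \<tau> ` \<Phi> ` S"])
    show "topspace (cyl (subtopology X N)) = {0..1} \<times> A \<union> {0..1} \<times> \<Phi> ` S \<union> {0..1} \<times> \<tau> ` \<Phi> ` S"
      using NX by (auto simp: N orbit_image_def)
    have c01: "closedin (top_of_set {0..1}) {0..1::real}" by simp
    show "closedin (cyl (subtopology X N)) ({0..1} \<times> A)" "closedin (cyl (subtopology X N)) ({0..1} \<times> \<Phi> ` S)"
      using cl c01 by (auto simp: closedin_prod_Times_iff)
    have "\<tau> ` \<Phi> ` S = {u \<in> topspace (subtopology X N). \<tau> u \<in> \<Phi> ` S}"
      using NX \<tau>(2) \<Phi>X \<tau>X by (auto simp: N orbit_image_def image_iff) metis+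
    moreover have "continuous_map (subtopology X N) (subtopology X N) \<tau>"
      using \<tau>(1) \<tau>N by (auto simp: continuous_map_in_subtopology continuous_map_from_subtopology)
    ultimately have "closedin (subtopology X N) (\<tau> ` \<Phi> ` S)"
      using cl(2) closedin_continuous_map_preimage by metis
    then show "closedin (cyl (subtopology X N)) ({0..1} \<times> \<tau> ` \<Phi> ` S)"
      using c01 by (auto simp: closedin_prod_Times_iff)
    have sub: "subtopology (cyl (subtopology X N)) ({0..1} \<times> T) = cyl (subtopology X T)" if "T \<subseteq> N" for T
      using that by (simp only: subtopology_Times subtopology_subtopology Int_absorb Int_absorb1)
    have TN: "A \<subseteq> N" "\<Phi> ` S \<subseteq> N" "\<tau> ` \<Phi> ` S \<subseteq> N" by (auto simp: N orbit_image_def)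
    have "continuous_map (cyl (subtopology X A)) X snd"
      by (meson continuous_map_snd continuous_map_into_fulltopology)
    then show "continuous_map (subtopology (cyl (subtopology X N)) ({0..1} \<times> A)) X H"
      unfolding sub[OF TN(1)] by (rule continuous_map_eq) (auto simp: HA)
    show "continuous_map (subtopology (cyl (subtopology X N)) ({0..1} \<times> \<Phi> ` S)) X H"
      unfolding sub[OF TN(2)] by (rule continuous_map_eq[OF H1(1)]) (auto simp: H\<Phi> H1(2))
    have "continuous_map (cyl (subtopology X (\<tau> ` \<Phi> ` S))) X (\<tau> \<circ> (H1 \<circ> map_prod id \<tau>))"
    proof (intro continuous_map_compose[OF _ \<tau>(1)] continuous_map_compose[OF _ H1(1)] continuous_map_cyl)
      show "continuous_map (subtopology X (\<tau> ` \<Phi> ` S)) (subtopology X (\<Phi> ` S)) \<tau>"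
        using \<tau> \<Phi>X by (auto simp: continuous_map_in_subtopology continuous_map_from_subtopology)
    qed
    then show "continuous_map (subtopology (cyl (subtopology X N)) ({0..1} \<times> \<tau> ` \<Phi> ` S)) X H"
      unfolding sub[OF TN(3)] by (rule continuous_map_eq) (auto simp: H\<tau> H1(2) \<tau>(2) \<Phi>X)
  qed
  then show ?thesis using HA H\<Phi> H\<tau> equi by (intro exI[of _ H]) auto
qed

text \<open>An axiomatic cohomology theory on invariant subsets, seen only through orders:
  \<open>h k A\<close> is nonzero when the group is finite and 1 when it vanishes. The assumptions
  play the role of the Eilenberg-Steenrod axioms, \<open>h_orbit\<close> being the dimension axiom
  with a whole orbit as the point. One induction over cells then serves ordinary, fixed-point and
  relative equivariant cohomology.\<close>

locale equivariant_theory =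
  fixes X :: "'a topology" and \<tau> :: "'a \<Rightarrow> 'a" and h :: "nat \<Rightarrow> 'a set \<Rightarrow> nat"
  assumes \<tau>_cont: "continuous_map X X \<tau>" and \<tau>_inv: "x \<in> topspace X \<Longrightarrow> \<tau> (\<tau> x) = x"
    and h_Mayer_Vietoris: "\<lbrakk>U \<subseteq> topspace X; V \<subseteq> topspace X; \<tau> ` U \<subseteq> U; \<tau> ` V \<subseteq> V;
        openin (subtopology X (U \<union> V)) U; openin (subtopology X (U \<union> V)) V\<rbrakk> \<Longrightarrow>
      h (Suc k) (U \<union> V) dvd h (Suc k) U * h (Suc k) V * h k (U \<inter> V) \<and> h 0 (U \<union> V) dvd h 0 U * h 0 V"
    and h_retract: "\<lbrakk>R \<subseteq> U; U \<subseteq> topspace X; \<tau> ` U \<subseteq> U; \<tau> ` R \<subseteq> R;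
        continuous_map (cyl (subtopology X U)) (subtopology X U) H;
        \<And>u. u \<in> U \<Longrightarrow> H (0, u) = u \<and> H (1, u) \<in> R;
        \<And>t u. \<lbrakk>t \<in> {0..1}; u \<in> R\<rbrakk> \<Longrightarrow> H (t, u) = u;
        \<And>t u. \<lbrakk>t \<in> {0..1}; u \<in> U\<rbrakk> \<Longrightarrow> H (t, \<tau> u) = \<tau> (H (t, u))\<rbrakk> \<Longrightarrow> h k U = h k R"
    and h_orbit: "x \<in> topspace X \<Longrightarrow> h k {x, \<tau> x} \<noteq> 0 \<and> h (Suc k) {x, \<tau> x} = 1"
    and h_empty: "h k {} = 1"
begin

lemma h_retract_orbit_image:
  assumes "Hausdorff_space X" "continuous_map (disc n) X \<Phi>" "S \<subseteq> topspace (disc n)"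
    "\<forall>x\<in>S. \<forall>y\<in>topspace (disc n). \<Phi> x = \<Phi> y \<longrightarrow> y \<in> S"
    "continuous_map (cyl (subtopology (disc n) S)) (disc n) k"
    "\<forall>t\<in>{0..1}. \<forall>x\<in>S. \<forall>y\<in>S. \<Phi> x = \<Phi> y \<longrightarrow> \<Phi> (k (t, x)) = \<Phi> (k (t, y))"
    "\<forall>t\<in>{0..1}. \<forall>x\<in>S. \<forall>y\<in>S. \<Phi> x = \<tau> (\<Phi> y) \<longrightarrow> \<Phi> (k (t, x)) = \<tau> (\<Phi> (k (t, y)))"
    "\<forall>t\<in>{0..1}. \<forall>x\<in>S. \<Phi> x \<in> A \<longrightarrow> \<Phi> (k (t, x)) = \<Phi> x"
    "A \<subseteq> topspace X" "\<tau> ` A \<subseteq> A"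
    and N: "N = A \<union> orbit_image \<tau> \<Phi> S"
    and "closedin (subtopology X N) A" "closedin (subtopology X N) (\<Phi> ` S)"
    and k: "\<And>t x. \<lbrakk>t \<in> {0..1}; x \<in> S\<rbrakk> \<Longrightarrow> k (t, x) \<in> S" "\<And>x. x \<in> S \<Longrightarrow> k (0, x) = x"
    and R: "R \<subseteq> N" "A \<subseteq> R" "\<tau> ` R \<subseteq> R" "\<And>x. x \<in> S \<Longrightarrow> \<Phi> (k (1, x)) \<in> R"
    and Rfix: "\<And>t x. \<lbrakk>t \<in> {0..1}; x \<in> S; \<Phi> x \<in> R\<rbrakk> \<Longrightarrow> \<Phi> (k (t, x)) = \<Phi> x"
  shows "h j N = h j R"
proof -
  obtain H where H: "continuous_map (cyl (subtopology X N)) X H"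
    "\<And>t u. \<lbrakk>t \<in> {0..1}; u \<in> A\<rbrakk> \<Longrightarrow> H (t, u) = u"
    "\<And>t x. \<lbrakk>t \<in> {0..1}; x \<in> S\<rbrakk> \<Longrightarrow> H (t, \<Phi> x) = \<Phi> (k (t, x))"
    "\<And>t x. \<lbrakk>t \<in> {0..1}; x \<in> S\<rbrakk> \<Longrightarrow> H (t, \<tau> (\<Phi> x)) = \<tau> (\<Phi> (k (t, x)))"
    "\<And>t u. \<lbrakk>t \<in> {0..1}; u \<in> N\<rbrakk> \<Longrightarrow> H (t, \<tau> u) = \<tau> (H (t, u))"
    using orbit_homotopy[OF assms(1) \<tau>_cont _ assms(2-13)] \<tau>_inv by fast
  have \<Phi>X: "\<Phi> x \<in> topspace X" if "x \<in> S" for x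
    using assms(2,3) that by (auto simp: continuous_map_def)
  have \<tau>X: "\<tau> x \<in> topspace X" if "x \<in> topspace X" for x using \<tau>_cont that by (auto simp: continuous_map_def)
  have cases: "u \<in> A \<or> (\<exists>x\<in>S. u = \<Phi> x) \<or> (\<exists>x\<in>S. u = \<tau> (\<Phi> x))" if "u \<in> N" for u
    using that by (auto simp: N orbit_image_def)
  have inN: "\<Phi> x \<in> N" "\<tau> (\<Phi> x) \<in> N" if "x \<in> S" for x using that by (auto simp: N orbit_image_def)
  show ?thesis
  proof (rule h_retract[where H = H])
    show "N \<subseteq> topspace X" using assms(9) \<Phi>X \<tau>X by (auto simp: N orbit_image_def)
    show "\<tau> ` N \<subseteq> N" using assms(10) \<tau>_inv[OF \<Phi>X] by (auto simp: N orbit_image_def)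
    have "H (t, u) \<in> N" if "t \<in> {0..1}" "u \<in> N" for t u
      using cases[OF that(2)] H(2-4)[OF that(1)] inN k(1)[OF that(1)] R(1,2) by auto
    then show "continuous_map (cyl (subtopology X N)) (subtopology X N) H"
      using H(1) by (auto simp: continuous_map_in_subtopology)
    show "H (0, u) = u \<and> H (1, u) \<in> R" if "u \<in> N" for u
      using cases[OF that] H(2-4)[of 0] H(2-4)[of 1] k(2) R by auto
    show "H (t, u) = u" if t: "t \<in> {0..1}" and u: "u \<in> R" for t u
    proof -
      consider "u \<in> A" | x where "x \<in> S" "u = \<Phi> x" | x where "x \<in> S" "u = \<tau> (\<Phi> x)"
        using cases R(1) u by blast
      then show ?thesis
      proof cases
        case 1 then show ?thesis using H(2) t by blast
      next
        case 2 then show ?thesis using H(3) t Rfix u by simp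
      next
        case 3
        then have "\<Phi> x \<in> R" using u R(3) \<tau>_inv[OF \<Phi>X[OF 3(1)]] by (metis image_subset_iff)
        then show ?thesis using H(4) t 3 Rfix by simp
      qed
    qed
  qed (use R H(5) in auto)
qed

end

text \<open>One orbit of cells attached to a closed invariant set \<open>A\<close>. By
  \<open>\<tau>c\<close> it consists either of two disjoint cells, parametrised by
  \<open>\<Phi>\<close> and its translate, or of a single cell fixed pointwise, on which both
  parametrisations agree.\<close>

locale equivariant_cell = equivariant_theory +
  fixes n :: nat and c :: "'a set" and \<Phi> :: "(nat \<Rightarrow> real) \<Rightarrow> 'a" and A :: "'a set"
  assumes Hausdorff: "Hausdorff_space X" and \<Phi>_cont: "continuous_map (disc n) X \<Phi>"
    and \<Phi>_inj: "inj_on \<Phi> (open_disc n)" and \<Phi>_cell: "\<Phi> ` open_disc n = c"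
    and \<Phi>_boundary: "\<And>x. \<lbrakk>x \<in> topspace (disc n); x \<notin> open_disc n\<rbrakk> \<Longrightarrow> \<Phi> x \<in> A"
    and A_closed: "closedin X A" and A_inv: "\<tau> ` A \<subseteq> A"
    and cA: "c \<inter> A = {}" and \<tau>c: "(\<forall>u\<in>c. \<tau> u = u) \<or> c \<inter> \<tau> ` c = {}"
begin

abbreviation G :: "(nat \<Rightarrow> real) set \<Rightarrow> 'a set"
  where "G \<equiv> orbit_image \<tau> \<Phi>"

lemma in_G_iff: "u \<in> G S \<longleftrightarrow> (\<exists>x\<in>S. u = \<Phi> x \<or> u = \<tau> (\<Phi> x))"
  by (auto simp: orbit_image_def)

lemma \<Phi>_topspace: "x \<in> topspace (disc n) \<Longrightarrow> \<Phi> x \<in> topspace X"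
  using \<Phi>_cont by (auto simp: continuous_map_def)

lemma \<tau>_topspace: "x \<in> topspace X \<Longrightarrow> \<tau> x \<in> topspace X"
  using \<tau>_cont by (auto simp: continuous_map_def)

lemma A_subset: "A \<subseteq> topspace X"
  by (rule closedin_subset[OF A_closed])

lemma \<tau>_in_A: "u \<in> topspace X \<Longrightarrow> \<tau> u \<in> A \<longleftrightarrow> u \<in> A"
  using A_inv \<tau>_inv by (metis image_subset_iff)

lemma \<Phi>_in_A_iff: "x \<in> topspace (disc n) \<Longrightarrow> \<Phi> x \<in> A \<longleftrightarrow> x \<notin> open_disc n"
  using \<Phi>_boundary cA \<Phi>_cell by blast

lemma \<Phi>_eq:
  assumes "x \<in> topspace (disc n)" "y \<in> topspace (disc n)" "\<Phi> x = \<Phi> y"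
  shows "x = y \<or> x \<notin> open_disc n \<and> y \<notin> open_disc n"
  using assms \<Phi>_in_A_iff \<Phi>_inj by (metis inj_onD)

lemma \<Phi>_eq_\<tau>:
  assumes "x \<in> topspace (disc n)" "y \<in> topspace (disc n)" "\<Phi> x = \<tau> (\<Phi> y)"
  shows "x = y \<and> (\<forall>u\<in>c. \<tau> u = u) \<or> x \<notin> open_disc n \<and> y \<notin> open_disc n"
proof -
  have iff: "x \<in> open_disc n \<longleftrightarrow> y \<in> open_disc n"
    using assms \<Phi>_in_A_iff \<tau>_in_A[OF \<Phi>_topspace[OF assms(2)]] by metis
  show ?thesis
  proof (cases "x \<in> open_disc n")
    case True
    then have "\<Phi> x \<in> c" "\<Phi> y \<in> c" using iff \<Phi>_cell by auto
    then have fx: "\<forall>u\<in>c. \<tau> u = u" using \<tau>c assms(3) by blast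
    then have "\<Phi> x = \<Phi> y" using assms(3) \<open>\<Phi> y \<in> c\<close> by simp
    then show ?thesis using True iff fx \<Phi>_inj by (metis inj_onD)
  qed (use iff in blast)
qed

text \<open>Fixedness is given on the open cell only; density of the open disc and the Hausdorff
  property carry it to the boundary, as is needed for homotopies of the closed disc.\<close>

lemma fixed_closure:
  assumes "\<forall>u\<in>c. \<tau> u = u" "x \<in> topspace (disc n)" shows "\<tau> (\<Phi> x) = \<Phi> x"
proof -
  have "(\<tau> \<circ> \<Phi>) x = \<Phi> x"
    by (rule forall_in_closure_of_eq[OF subsetD[OF open_disc_closure assms(2)] Hausdorff
          continuous_map_compose[OF \<Phi>_cont \<tau>_cont] \<Phi>_cont])
      (use assms(1) \<Phi>_cell in auto)
  then show ?thesis by simp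
qed

lemma \<Phi>_image_closed: "closedin (disc n) K \<Longrightarrow> closedin X (\<Phi> ` K)"
  using continuous_imp_closed_map[OF \<Phi>_cont compact_space_disc Hausdorff] by (auto simp: closed_map_def)

lemma \<tau>_image_closed: "closedin X K \<Longrightarrow> closedin X (\<tau> ` K)"
proof -
  assume K: "closedin X K"
  have "\<tau> ` K = {u \<in> topspace X. \<tau> u \<in> K}"
  proof (intro equalityI subsetI)
    fix u assume "u \<in> {u \<in> topspace X. \<tau> u \<in> K}"
    then show "u \<in> \<tau> ` K" using \<tau>_inv[of u] by (metis (no_types, lifting) image_eqI mem_Collect_eq)
  qed (use closedin_subset[OF K] \<tau>_inv \<tau>_topspace in auto)
  then show ?thesis using closedin_continuous_map_preimage[OF \<tau>_cont K] by simp
qed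

lemma G_inv: "S \<subseteq> topspace (disc n) \<Longrightarrow> \<tau> ` G S \<subseteq> G S"
  using \<tau>_inv[OF \<Phi>_topspace] by (fastforce simp: orbit_image_def)

lemma G_subset: "S \<subseteq> topspace (disc n) \<Longrightarrow> G S \<subseteq> topspace X"
  using \<Phi>_topspace \<tau>_topspace by (auto simp: orbit_image_def)

lemma G_Un: "G (S \<union> T) = G S \<union> G T"
  by (auto simp: orbit_image_def)

lemma G_Int:
  assumes "S \<subseteq> open_disc n" "T \<subseteq> open_disc n" shows "G (S \<inter> T) = G S \<inter> G T"
proof (intro equalityI subsetI)
  fix u assume u: "u \<in> G S \<inter> G T"
  have D: "x \<in> topspace (disc n)" if "x \<in> S \<or> x \<in> T" for x using that assms open_disc_subset by blast
  obtain x where x: "x \<in> S" "u = \<Phi> x \<or> u = \<tau> (\<Phi> x)" using u by (auto simp: orbit_image_def)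
  obtain y where y: "y \<in> T" "u = \<Phi> y \<or> u = \<tau> (\<Phi> y)" using u by (auto simp: orbit_image_def)
  have xy: "x \<in> topspace (disc n)" "y \<in> topspace (disc n)" "x \<in> open_disc n" using D x y assms by auto
  have "\<Phi> x = \<Phi> y \<or> \<Phi> x = \<tau> (\<Phi> y)"
    using x(2) y(2) \<tau>_inv[OF \<Phi>_topspace[OF xy(1)]] \<tau>_inv[OF \<Phi>_topspace[OF xy(2)]] by metis
  then have "x = y" using \<Phi>_eq[OF xy(1,2)] \<Phi>_eq_\<tau>[OF xy(1,2)] xy(3) by blast
  then show "u \<in> G (S \<inter> T)" using x y by (auto simp: orbit_image_def)
qed (auto simp: orbit_image_def)

lemma disc_closed: "closedin X (\<Phi> ` topspace (disc n))"
  by (rule \<Phi>_image_closed) simp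

text \<open>On the open disc \<open>\<Phi>\<close> makes no identifications, and the translate meets
  the cell only if the cell is fixed. The straight-line contraction to \<open>p\<close> therefore
  descends to an equivariant retraction onto the orbit of \<open>\<Phi> p\<close>.\<close>

lemma h_star_shaped:
  assumes Q: "Q \<subseteq> open_disc n" and p: "p \<in> Q"
    and star: "\<And>x t. \<lbrakk>x \<in> Q; t \<in> {0..1}\<rbrakk> \<Longrightarrow> (\<lambda>i. (1 - t) * x i + t * p i) \<in> Q"
  shows "h j (G Q) = h j {\<Phi> p, \<tau> (\<Phi> p)}"
proof -
  define k where "k = (\<lambda>z i. (1 - fst z) * snd z i + fst z * p i)"
  have D: "Q \<subseteq> topspace (disc n)" using Q open_disc_subset by blast
  have eq: "x = y" if "x \<in> Q" "y \<in> topspace (disc n)" "\<Phi> x = \<Phi> y \<or> \<Phi> x = \<tau> (\<Phi> y) \<or> \<Phi> y = \<tau> (\<Phi> x)" for x y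
    using that \<Phi>_eq[of x y] \<Phi>_eq_\<tau>[of x y] \<Phi>_eq_\<tau>[of y x] D Q by blast
  have eq\<tau>: "\<tau> (\<Phi> z) = \<Phi> z" if "x \<in> Q" "y \<in> Q" "\<Phi> x = \<tau> (\<Phi> y)" "z \<in> topspace (disc n)" for x y z
    using that \<Phi>_eq_\<tau>[of x y] D Q fixed_closure by blast
  have kQ: "k (t, x) \<in> Q" if "t \<in> {0..1}" "x \<in> Q" for t x using star that by (simp add: k_def)
  have kp: "k (t, p) = p" for t by (auto simp: k_def algebra_simps)
  have k_cont: "continuous_map (cyl (subtopology (disc n) Q)) (disc n) k"
    unfolding continuous_map_into_disc
  proof (intro conjI allI)
    have f: "continuous_map (cyl (subtopology (disc n) Q)) euclideanreal fst"
      by (meson continuous_map_fst continuous_map_into_fulltopology)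
    have s: "continuous_map (cyl (subtopology (disc n) Q)) euclideanreal (\<lambda>z. snd z i)" for i
      by (rule continuous_map_compose[OF continuous_map_snd, unfolded o_def])
        (intro continuous_map_from_subtopology continuous_map_disc_coordinate)
    show "continuous_map (cyl (subtopology (disc n) Q)) euclideanreal (\<lambda>z. k z i)" for i
      unfolding k_def by (intro continuous_map_add continuous_map_real_mult continuous_map_diff f s) auto
    show "k \<in> topspace (cyl (subtopology (disc n) Q)) \<rightarrow> topspace (disc n)"
      using kQ D by auto
  qed
  show ?thesis
  proof (rule h_retract_orbit_image[OF Hausdorff \<Phi>_cont D _ k_cont, where A = "{}"])
    show "closedin (subtopology X (G Q)) (\<Phi> ` Q)"
    proof -
      have "\<Phi> ` Q = G Q \<inter> \<Phi> ` topspace (disc n)"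
      proof (intro equalityI subsetI)
        fix u assume "u \<in> G Q \<inter> \<Phi> ` topspace (disc n)"
        then have "u \<in> G Q" and u: "u \<in> \<Phi> ` topspace (disc n)" by auto
        then obtain x where "x \<in> Q" "u = \<Phi> x \<or> u = \<tau> (\<Phi> x)" using in_G_iff[of u Q] by blast
        moreover obtain y where "y \<in> topspace (disc n)" "u = \<Phi> y" using u by blast
        ultimately have "x = y" using eq[of x y] by metis
        then show "u \<in> \<Phi> ` Q" using \<open>x \<in> Q\<close> \<open>u = \<Phi> y\<close> by blast
      qed (use D in_G_iff in blast)
      then show ?thesis using disc_closed by (metis closedin_subtopology_Int_closed)
    qed
    show "\<forall>t\<in>{0..1}. \<forall>x\<in>Q. \<forall>y\<in>Q. \<Phi> x = \<tau> (\<Phi> y) \<longrightarrow> \<Phi> (k (t, x)) = \<tau> (\<Phi> (k (t, y)))"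
      using eq eq\<tau> kQ D by (metis subsetD)
    show "\<forall>t\<in>{0..1}. \<forall>x\<in>Q. \<forall>y\<in>Q. \<Phi> x = \<Phi> y \<longrightarrow> \<Phi> (k (t, x)) = \<Phi> (k (t, y))"
      using eq D by (metis subsetD)
    show "\<forall>x\<in>Q. \<forall>y\<in>topspace (disc n). \<Phi> x = \<Phi> y \<longrightarrow> y \<in> Q" using eq by blast
    show "\<tau> ` {\<Phi> p, \<tau> (\<Phi> p)} \<subseteq> {\<Phi> p, \<tau> (\<Phi> p)}" using \<tau>_inv[OF \<Phi>_topspace] p D by auto
    show "\<Phi> (k (t, x)) = \<Phi> x" if "t \<in> {0..1}" "x \<in> Q" "\<Phi> x \<in> {\<Phi> p, \<tau> (\<Phi> p)}" for t x
      using that eq[of x p] p D kp by auto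
    show "k (0, x) = x" "\<Phi> (k (1, x)) \<in> {\<Phi> p, \<tau> (\<Phi> p)}" for x by (simp_all add: k_def)
  qed (use kQ p in \<open>auto simp: orbit_image_def\<close>)
qed

text \<open>Openness is obtained from the complement: the image of the compact rest of the disc,
  together with its translate, is closed in \<open>X\<close> and, by injectivity on the open cell,
  misses \<open>G U\<close>.\<close>

lemma G_open:
  assumes "openin (disc n) U" "U \<subseteq> open_disc n" "G U \<subseteq> W" "W \<subseteq> G (open_disc n)"
  shows "openin (subtopology X W) (G U)"
proof -
  let ?K = "\<Phi> ` (topspace (disc n) - U)"
  have K: "closedin X (?K \<union> \<tau> ` ?K)"
    by (intro closedin_Un \<tau>_image_closed \<Phi>_image_closed) (use assms(1) in \<open>auto intro: closedin_diff\<close>)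
  have "u \<notin> ?K \<union> \<tau> ` ?K" if u: "u \<in> G U" for u
  proof
    assume "u \<in> ?K \<union> \<tau> ` ?K"
    then obtain y where y: "y \<in> topspace (disc n)" "y \<notin> U" "u = \<Phi> y \<or> u = \<tau> (\<Phi> y)" by auto
    obtain x where x: "x \<in> U" "u = \<Phi> x \<or> u = \<tau> (\<Phi> x)" using u by (auto simp: orbit_image_def)
    have xD: "x \<in> topspace (disc n)" "x \<in> open_disc n" using x assms(2) open_disc_subset by auto
    have "\<Phi> x = \<Phi> y \<or> \<Phi> x = \<tau> (\<Phi> y)"
      using x(2) y(3) \<tau>_inv[OF \<Phi>_topspace[OF xD(1)]] \<tau>_inv[OF \<Phi>_topspace[OF y(1)]] by metis
    then have "x = y" using \<Phi>_eq[OF xD(1) y(1)] \<Phi>_eq_\<tau>[OF xD(1) y(1)] xD(2) by blast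
    then show False using x y by simp
  qed
  moreover have "u \<in> G U \<or> u \<in> ?K \<union> \<tau> ` ?K" if "u \<in> W" for u
  proof -
    have "u \<in> G (open_disc n)" using that assms(4) by blast
    then obtain x where x: "x \<in> open_disc n" "u = \<Phi> x \<or> u = \<tau> (\<Phi> x)" unfolding in_G_iff by blast
    show ?thesis
    proof (cases "x \<in> U")
      case True
      then have "u \<in> G U" unfolding in_G_iff using x(2) by blast
      then show ?thesis ..
    next
      case False
      then have "\<Phi> x \<in> ?K" using x(1) open_disc_subset by blast
      then show ?thesis using x(2) by blast
    qed
  qed
  ultimately have "G U = W \<inter> (topspace X - (?K \<union> \<tau> ` ?K))"
    using assms(3) subset_trans[OF assms(4) G_subset[OF open_disc_subset]] by blast
  then show ?thesis
    using K by (metis openin_subtopology_Int2 openin_diff openin_topspace)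
qed

text \<open>For \<open>m \<le> n\<close> a set of the homotopy type of the sphere of dimension m -
  1. \<open>Q 0\<close> is empty and \<open>Q n\<close> is the open disc without its centre.\<close>

definition Q :: "nat \<Rightarrow> (nat \<Rightarrow> real) set"
  where "Q m = {x \<in> open_disc n. \<exists>i<m. x i \<noteq> 0}"

lemma openin_disc_coordinate: "open T \<Longrightarrow> openin (disc n) {x \<in> topspace (disc n). x i \<in> T}"
  by (rule openin_continuous_map_preimage[OF continuous_map_disc_coordinate]) simp

lemma openin_open_disc: "openin (disc n) (open_disc n)"
proof -
  have "openin (disc n) {x \<in> topspace (disc n). (\<Sum>i<n. (x i)\<^sup>2) \<in> {..<1}}"
  proof (rule openin_continuous_map_preimage[where Y = euclideanreal])
    show "continuous_map (disc n) euclideanreal (\<lambda>x. \<Sum>i<n. (x i)\<^sup>2)"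
      by (intro continuous_map_sum continuous_map_real_pow continuous_map_disc_coordinate) simp
  qed simp
  then show ?thesis by (simp add: open_disc_def)
qed

lemma openin_Q: "openin (disc n) (Q m)"
proof -
  have "Q m = open_disc n \<inter> (\<Union>i\<in>{..<m}. {x \<in> topspace (disc n). x i \<in> - {0}})"
    using open_disc_subset by (auto simp: Q_def)
  moreover have "openin (disc n) (\<Union>i\<in>{..<m}. {x \<in> topspace (disc n). x i \<in> - {0}})"
  proof (rule openin_Union)
    fix T assume "T \<in> (\<lambda>i. {x \<in> topspace (disc n). x i \<in> - {0}}) ` {..<m}"
    then obtain i where "T = {x \<in> topspace (disc n). x i \<in> - {0}}" by blast
    moreover have "open (- {0 :: real})" by (intro open_Compl closed_singleton)
    ultimately show "openin (disc n) T" using openin_disc_coordinate by metis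
  qed
  ultimately show ?thesis by (simp add: openin_Int openin_open_disc)
qed

lemma half_basis_in_open_disc:
  assumes "m < n" "s\<^sup>2 = 1/4" shows "(\<lambda>i. if i = m then s else 0) \<in> open_disc n"
proof -
  have "(\<Sum>i<n. (if i = m then s else 0)\<^sup>2) = (\<Sum>i<n. if i = m then s\<^sup>2 else 0)"
    by (intro sum.cong) auto
  also have "\<dots> = 1/4" using assms by simp
  finally show ?thesis using assms by (auto simp: open_disc_def topspace_disc)
qed

text \<open>
  \<open>Q (Suc m)\<close> is covered by two star-shaped sets with intersection \<open>Q m\<close>, so the punctured cell
  is treated like an iterated suspension.
\<close>

lemma h_punctured:
  assumes "m \<le> n" shows "h k (G (Q m)) \<noteq> 0 \<and> (m \<le> k \<longrightarrow> h k (G (Q m)) = 1)"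
  using assms
proof (induction m arbitrary: k)
  case 0
  have "G (Q 0) = {}" by (simp add: Q_def orbit_image_def)
  then show ?case by (simp add: h_empty)
next
  case (Suc m)
  \<comment> \<open>For \<open>s = 1\<close> and \<open>s = -1\<close> these correspond to the two
    hemispheres of the suspension, thickened by \<open>Q m\<close>, so that they are open and meet
    exactly in \<open>Q m\<close>. Each is star-shaped about the point \<open>s/2\<close> on the
    axis \<open>m\<close>.\<close>
  define U where "U = (\<lambda>s::real. Q m \<union> {x \<in> open_disc n. s * x m > 0})"
  have U_sub: "U s \<subseteq> open_disc n" for s by (auto simp: U_def Q_def)
  have U_open: "openin (disc n) (U s)" for s
  proof -
    have eq: "{x \<in> open_disc n. s * x m > 0} = open_disc n \<inter> {x \<in> topspace (disc n). x m \<in> {r. s * r > 0}}"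
      using open_disc_subset by auto
    have "open {r. s * r > 0}" by (intro open_Collect_less continuous_intros)
    then have "openin (disc n) {x \<in> topspace (disc n). x m \<in> {r. s * r > 0}}" by (rule openin_disc_coordinate)
    then have "openin (disc n) {x \<in> open_disc n. s * x m > 0}"
      unfolding eq by (rule openin_Int[OF openin_open_disc])
    then show ?thesis unfolding U_def by (rule openin_Un[OF openin_Q])
  qed
  have U_cover: "U 1 \<union> U (-1) = Q (Suc m)"
    unfolding U_def Q_def by (auto simp: less_Suc_eq)
  have U_Int: "U 1 \<inter> U (-1) = Q m" by (auto simp: U_def)
  have hU: "h j (G (U s)) \<noteq> 0 \<and> h (Suc j) (G (U s)) = 1" if s: "s\<^sup>2 = 1" for s j
  proof -
    define p where "p = (\<lambda>i. if i = m then s / 2 else 0)"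
    have p: "p \<in> open_disc n"
      unfolding p_def using s Suc.prems by (intro half_basis_in_open_disc) (auto simp: power_divide)
    have ss: "s * s = 1" using s by (simp add: power2_eq_square)
    have pU: "p \<in> U s" using p ss by (simp add: U_def p_def)
    have "(\<lambda>i. (1 - t) * x i + t * p i) \<in> U s" if x: "x \<in> U s" and t: "t \<in> {0..1}" for x t
    proof (cases "t = 0 \<or> t = 1")
      case True then show ?thesis using x pU by auto
    next
      case False
      then have t: "0 < t" "t < 1" using t by auto
      have o: "(\<lambda>i. (1 - t) * x i + t * p i) \<in> open_disc n"
        by (rule disc_convex) (use p t x U_sub open_disc_subset in auto)
      show ?thesis
      proof (cases "x \<in> Q m")
        case True
        then obtain i where "i < m" "x i \<noteq> 0" by (auto simp: Q_def)
        \<comment> \<open>\<open>p\<close> vanishes in all coordinates below \<open>m\<close>, so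
          before time 1 the nonzero coordinate of \<open>x\<close> is only scaled by a positive
          factor.\<close>
        then have "(1 - t) * x i + t * p i \<noteq> 0" using t by (simp add: p_def)
        then show ?thesis using o \<open>i < m\<close> by (auto simp: U_def Q_def)
      next
        case False
        then have "s * x m > 0" using x by (simp add: U_def)
        moreover have "s * ((1 - t) * x m + t * p m) = (1 - t) * (s * x m) + t * (s * s / 2)"
          by (simp add: p_def algebra_simps)
        ultimately have "s * ((1 - t) * x m + t * p m) > 0" using t ss by (simp add: add_pos_pos)
        then show ?thesis using o by (auto simp: U_def)
      qed
    qed
    then have "h j (G (U s)) = h j {\<Phi> p, \<tau> (\<Phi> p)}" for j
      by (rule h_star_shaped[OF U_sub pU])
    then show ?thesis using h_orbit[OF \<Phi>_topspace[OF subsetD[OF open_disc_subset p]]] by simp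
  qed
  have D: "U s \<subseteq> topspace (disc n)" for s using U_sub open_disc_subset by blast
  have G_cover: "G (U 1) \<union> G (U (-1)) = G (Q (Suc m))" by (simp flip: U_cover add: G_Un)
  have sub: "G (Q (Suc m)) \<subseteq> G (open_disc n)" by (auto simp: Q_def orbit_image_def)
  have MV: "h (Suc j) (G (Q (Suc m))) dvd h (Suc j) (G (U 1)) * h (Suc j) (G (U (-1))) * h j (G (Q m))"
    "h 0 (G (Q (Suc m))) dvd h 0 (G (U 1)) * h 0 (G (U (-1)))" for j
    using h_Mayer_Vietoris[OF G_subset[OF D] G_subset[OF D] G_inv[OF D] G_inv[OF D], of 1 "-1" j]
      G_open[OF U_open U_sub] G_cover sub G_Int[OF U_sub U_sub, of 1 "-1"] U_Int by auto
  show ?case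
  proof (cases k)
    case 0
    have "h 0 (G (Q (Suc m))) \<noteq> 0"
    proof
      assume "h 0 (G (Q (Suc m))) = 0"
      then show False using MV(2) hU[of 1 0] hU[of "-1" 0] by simp
    qed
    then show ?thesis using 0 by simp
  next
    case (Suc j)
    then have "h k (G (Q (Suc m))) dvd h j (G (Q m))" using MV(1)[of j] hU[of 1 j] hU[of "-1" j] by simp
    moreover have "h j (G (Q m)) \<noteq> 0 \<and> (m \<le> j \<longrightarrow> h j (G (Q m)) = 1)"
      using Suc.IH[of j] Suc.prems by simp
    ultimately show ?thesis using Suc by (metis Suc_le_mono dvd_0_left nat_dvd_1_iff_1)
  qed
qed

text \<open>Radial projection retracts the punctured closed cell onto its boundary, which lies in
  \<open>A\<close>. The identifications made by \<open>\<Phi>\<close> itself occur only on the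
  boundary, where the homotopy is constant, so it descends.\<close>

lemma h_remove_centre: "h j (A \<union> G (topspace (disc n) - {\<lambda>i. 0})) = h j A"
proof -
  let ?D = "topspace (disc n)"
  define S where "S = ?D - {\<lambda>i. 0}"
  define nr where "nr = (\<lambda>x :: nat \<Rightarrow> real. sqrt (\<Sum>i<n. (x i)\<^sup>2))"
  have SD: "S \<subseteq> ?D" by (auto simp: S_def)
  have nr_pos: "nr x > 0" if x: "x \<in> S" for x
  proof -
    obtain i where i: "x i \<noteq> 0" using x by (auto simp: S_def fun_eq_iff)
    then have "i < n" using x by (cases "i < n") (auto simp: S_def topspace_disc)
    then have "(\<Sum>i<n. (x i)\<^sup>2) > 0" using i by (intro sum_pos2[of _ i]) auto
    then show ?thesis by (simp add: nr_def)
  qed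
  have nr_le: "nr x \<le> 1" if "x \<in> S" for x using that by (auto simp: nr_def S_def topspace_disc)
  have nr_bd: "x \<notin> open_disc n \<longleftrightarrow> nr x = 1" if "x \<in> ?D" for x
    using that by (auto simp: nr_def open_disc_def topspace_disc)
  \<comment> \<open>The scaling factor that moves the norm of \<open>x\<close> linearly to 1 along
    its ray; points of norm 1 do not move.\<close>
  define r where "r = (\<lambda>t x. (1 - t) + t / nr x)"
  define k where "k = (\<lambda>z i. r (fst z) (snd z) * snd z i)"
  have nr_k: "nr (k (t, x)) = (1 - t) * nr x + t" "k (t, x) \<in> S" if t: "t \<in> {0..1}" and x: "x \<in> S" for t x
  proof -
    have r: "r t x > 0"
    proof -
      have "t \<le> t / nr x" using t nr_pos[OF x] nr_le[OF x] by (simp add: pos_le_divide_eq mult_left_le)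
      then have "1 \<le> r t x" by (simp add: r_def)
      then show ?thesis by simp
    qed
    have "nr (k (t, x)) = sqrt ((r t x)\<^sup>2 * (\<Sum>i<n. (x i)\<^sup>2))"
      by (simp add: nr_def k_def power_mult_distrib sum_distrib_left)
    also have "\<dots> = r t x * nr x" using r by (simp add: real_sqrt_mult nr_def)
    also have "\<dots> = (1 - t) * nr x + t" using nr_pos[OF x] by (simp add: r_def field_simps)
    finally show 1: "nr (k (t, x)) = (1 - t) * nr x + t" .
    also have "\<dots> \<le> 1"
      using t nr_le[OF x] mult_left_mono[of "nr x" 1 "1 - t"] by auto
    finally have "nr (k (t, x)) \<le> 1" .
    then have "(\<Sum>i<n. (k (t, x) i)\<^sup>2) \<le> 1" by (simp add: nr_def)
    moreover have "\<forall>i\<ge>n. k (t, x) i = 0" using x by (auto simp: k_def S_def topspace_disc)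
    moreover have "k (t, x) \<noteq> (\<lambda>i. 0)"
      using r x by (auto simp: k_def S_def fun_eq_iff)
    ultimately show "k (t, x) \<in> S" by (simp add: S_def topspace_disc)
  qed
  have k_bd: "k (t, x) = x" if "nr x = 1" for t x by (simp add: k_def r_def that)
  have k_cont: "continuous_map (cyl (subtopology (disc n) S)) (disc n) k"
    unfolding continuous_map_into_disc
  proof (intro conjI allI)
    let ?Z = "cyl (subtopology (disc n) S)"
    have f: "continuous_map ?Z euclideanreal fst"
      by (meson continuous_map_fst continuous_map_into_fulltopology)
    have s: "continuous_map ?Z euclideanreal (\<lambda>z. snd z i)" for i
      by (rule continuous_map_compose[OF continuous_map_snd, unfolded o_def])
        (intro continuous_map_from_subtopology continuous_map_disc_coordinate)
    have "continuous_map ?Z euclideanreal (\<lambda>z. nr (snd z))"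
      unfolding nr_def by (intro continuous_map_sqrt continuous_map_sum continuous_map_real_pow s) auto
    then show "continuous_map ?Z euclideanreal (\<lambda>z. k z i)" for i
      unfolding k_def r_def
      by (intro continuous_map_add continuous_map_real_mult continuous_map_diff continuous_map_real_divide f s)
        (use nr_pos in fastforce)+
    show "k \<in> topspace ?Z \<rightarrow> topspace (disc n)"
      using nr_k(2) SD by auto
  qed
  have bS: "x \<in> S" if "x \<in> ?D" "x \<notin> open_disc n" for x
    using that zero_in_open_disc by (auto simp: S_def)
  have "h j (A \<union> G S) = h j A"
  proof (rule h_retract_orbit_image[OF Hausdorff \<Phi>_cont SD _ k_cont _ _ _ A_subset A_inv refl])
    show "\<forall>x\<in>S. \<forall>y\<in>?D. \<Phi> x = \<Phi> y \<longrightarrow> y \<in> S" using \<Phi>_eq bS SD by blast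
    show "\<forall>t\<in>{0..1}. \<forall>x\<in>S. \<forall>y\<in>S. \<Phi> x = \<Phi> y \<longrightarrow> \<Phi> (k (t, x)) = \<Phi> (k (t, y))"
      using \<Phi>_eq k_bd nr_bd SD by (metis subsetD)
    show "\<forall>t\<in>{0..1}. \<forall>x\<in>S. \<forall>y\<in>S. \<Phi> x = \<tau> (\<Phi> y) \<longrightarrow> \<Phi> (k (t, x)) = \<tau> (\<Phi> (k (t, y)))"
      using \<Phi>_eq_\<tau> k_bd nr_bd SD fixed_closure nr_k(2) by (metis subsetD)
    show "\<forall>t\<in>{0..1}. \<forall>x\<in>S. \<Phi> x \<in> A \<longrightarrow> \<Phi> (k (t, x)) = \<Phi> x"
      using \<Phi>_in_A_iff k_bd nr_bd SD by (metis subsetD)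
    then show "\<Phi> (k (t, x)) = \<Phi> x" if "t \<in> {0..1}" "x \<in> S" "\<Phi> x \<in> A" for t x using that by blast
    show "closedin (subtopology X (A \<union> G S)) A"
    proof -
      have "(A \<union> G S) \<inter> A = A" by blast
      then show ?thesis using closedin_subtopology_Int_closed[OF A_closed, of "A \<union> G S"] by simp
    qed
    have "\<Phi> ` S = (A \<union> G S) \<inter> \<Phi> ` ?D"
    proof (intro equalityI subsetI)
      fix u assume "u \<in> (A \<union> G S) \<inter> \<Phi> ` ?D"
      then obtain x where x: "x \<in> ?D" "u = \<Phi> x" and u: "u \<in> A \<union> G S" by blast
      have "x \<in> S" if y: "u = \<Phi> y \<or> u = \<tau> (\<Phi> y)" "y \<in> S" for y
      proof -
        have yD: "y \<in> ?D" using y(2) SD by (rule subsetD[rotated])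
        have "x = y \<or> x \<notin> open_disc n"
          using \<Phi>_eq[OF x(1) yD] \<Phi>_eq_\<tau>[OF x(1) yD] y(1) x(2) by metis
        then show ?thesis using bS[OF x(1)] y(2) by metis
      qed
      moreover have "x \<in> S" if "u \<in> A" using that \<Phi>_in_A_iff[OF x(1)] x bS[OF x(1)] by simp
      ultimately have "x \<in> S" using u unfolding Un_iff in_G_iff by metis
      then show "u \<in> \<Phi> ` S" using x by blast
    qed (use SD in \<open>auto simp: orbit_image_def\<close>)
    then show "closedin (subtopology X (A \<union> G S)) (\<Phi> ` S)"
      using closedin_subtopology_Int_closed[OF disc_closed, of "A \<union> G S"] by simp
    show "k (0, x) = x" for x by (simp add: k_def r_def)
    show "\<Phi> (k (1, x)) \<in> A" if "x \<in> S" for x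
      using nr_k[of 1 x] that \<Phi>_boundary nr_bd SD by auto
  qed (use nr_k A_inv in auto)
  then show ?thesis by (simp add: S_def)
qed

text \<open>Mayer-Vietoris for the cover by \<open>U\<close>, everything except the centres, and
  \<open>V\<close>, the open cells. \<open>U\<close> retracts to \<open>A\<close>, \<open>V\<close>
  to the orbit of the centre, and they meet in the punctured cells \<open>G (Q n)\<close>; the orbit
  contributes the factor 1 in positive degree.\<close>

lemma h_attach:
  shows "h (Suc k) (A \<union> (c \<union> \<tau> ` c)) dvd h (Suc k) A * h k (G (Q n))"
    and "h 0 A \<noteq> 0 \<Longrightarrow> h 0 (A \<union> (c \<union> \<tau> ` c)) \<noteq> 0"
proof -
  let ?D = "topspace (disc n)"
  define z where "z = (\<lambda>i :: nat. 0 :: real)"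
  define M where "M = A \<union> (c \<union> \<tau> ` c)"
  define U where "U = A \<union> G (?D - {z})"
  define V where "V = G (open_disc n)"
  have V: "V = c \<union> \<tau> ` c" by (auto simp: V_def orbit_image_def \<Phi>_cell)
  have cX: "c \<subseteq> topspace X" using \<Phi>_cell \<Phi>_topspace open_disc_subset by blast
  have \<tau>cA: "\<tau> ` c \<inter> A = {}" using cA \<tau>_in_A cX by blast
  have o: "z \<in> ?D" "z \<in> open_disc n" using zero_in_open_disc open_disc_subset by (auto simp: z_def)
  have GA: "u \<in> A \<union> V" if "u \<in> G ?D" for u
    using that \<Phi>_boundary \<tau>_in_A[OF \<Phi>_topspace] unfolding Un_iff V_def in_G_iff by blast
  have UV: "U \<union> V = M"
  proof -
    have "G ?D = G (?D - {z}) \<union> G {z}" using o by (simp flip: G_Un add: insert_absorb)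
    moreover have "G {z} \<subseteq> V" using o by (auto simp: V_def orbit_image_def)
    moreover have "V \<subseteq> G ?D" unfolding V_def orbit_image_def using open_disc_subset by (intro Un_mono image_mono)
    ultimately show ?thesis using GA unfolding M_def V[symmetric] U_def by blast
  qed
  have UintV: "U \<inter> V = G (Q n)"
  proof -
    have Q: "Q n = open_disc n - {z}"
      by (auto simp: Q_def open_disc_def topspace_disc fun_eq_iff z_def) (meson not_le)
    have "A \<inter> V = {}" using V cA \<tau>cA by blast
    moreover have "G (?D - {z}) = G (Q n) \<union> G (?D - open_disc n)"
      unfolding G_Un[symmetric] Q using open_disc_subset o by (intro arg_cong[where f = G]) auto
    moreover have "G (?D - open_disc n) \<subseteq> A"
      using \<Phi>_boundary \<tau>_in_A[OF \<Phi>_topspace] by (auto simp: orbit_image_def)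
    moreover have "G (Q n) \<subseteq> V" by (auto simp: V_def Q orbit_image_def)
    ultimately show ?thesis unfolding U_def by blast
  qed
  have sub: "U \<subseteq> topspace X" "V \<subseteq> topspace X" "\<tau> ` U \<subseteq> U" "\<tau> ` V \<subseteq> V"
    using A_subset A_inv G_subset[of "?D - {z}"] G_subset[OF open_disc_subset]
      G_inv[of "?D - {z}"] G_inv[OF open_disc_subset] by (auto simp: U_def V_def)
  have MX: "M \<subseteq> topspace X" using UV sub by blast
  have openV: "openin (subtopology X M) V"
  proof -
    have "V = M \<inter> (topspace X - A)" using V cA \<tau>cA sub(2) unfolding M_def by blast
    then show ?thesis using A_closed by (metis openin_subtopology_Int2 openin_diff openin_topspace)
  qed
  have openU: "openin (subtopology X M) U"
  proof -
    let ?P = "{\<Phi> z, \<tau> (\<Phi> z)}"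
    have P: "?P \<subseteq> topspace X" using \<Phi>_topspace[OF o(1)] \<tau>_topspace by auto
    have "closedin X ?P"
      using P Hausdorff by (intro closedin_Hausdorff_finite) auto
    moreover have "U = M \<inter> (topspace X - ?P)"
    proof -
      have "u \<notin> ?P" if uU: "u \<in> U" for u
      proof
        assume u: "u \<in> ?P"
        have "\<Phi> z \<in> c" using o \<Phi>_cell by blast
        then have "u \<notin> A" using u cA \<tau>cA by blast
        then obtain x where x: "x \<in> ?D" "x \<noteq> z" "u = \<Phi> x \<or> u = \<tau> (\<Phi> x)"
          using uU by (auto simp: U_def orbit_image_def)
        have "\<Phi> z = \<Phi> x \<or> \<Phi> z = \<tau> (\<Phi> x)"
          using x(3) u \<tau>_inv[OF \<Phi>_topspace[OF x(1)]] \<tau>_inv[OF \<Phi>_topspace[OF o(1)]]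
          by (metis insert_iff empty_iff)
        then show False using \<Phi>_eq[OF o(1) x(1)] \<Phi>_eq_\<tau>[OF o(1) x(1)] x(2) o(2) by metis
      qed
      moreover have "u \<in> U" if uM: "u \<in> M" and uP: "u \<notin> ?P" for u
      proof (cases "u \<in> A")
        case False
        then have "u \<in> V" using uM V M_def by blast
        then obtain x where x: "x \<in> open_disc n" "u = \<Phi> x \<or> u = \<tau> (\<Phi> x)" by (auto simp: V_def orbit_image_def)
        then have "x \<noteq> z" using uP by auto
        then have "x \<in> ?D - {z}" using x(1) open_disc_subset by blast
        then show ?thesis unfolding U_def Un_iff in_G_iff using x(2) by blast
      qed (simp add: U_def)
      ultimately show ?thesis using MX UV by blast
    qed
    ultimately show ?thesis by (metis openin_subtopology_Int2 openin_diff openin_topspace)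
  qed
  have hV: "h j V = h j {\<Phi> z, \<tau> (\<Phi> z)}" for j
    unfolding V_def
  proof (rule h_star_shaped)
    fix x t assume "x \<in> open_disc n" "t \<in> {0..1::real}"
    then show "(\<lambda>i. (1 - t) * x i + t * z i) \<in> open_disc n"
      using disc_convex[OF subsetD[OF open_disc_subset] zero_in_open_disc, where x = x and t = t] by (cases "t = 0") (auto simp: z_def)
  qed (use o in auto)
  have hU: "h j U = h j A" for j unfolding U_def z_def by (rule h_remove_centre)
  have orb: "h j {\<Phi> z, \<tau> (\<Phi> z)} \<noteq> 0" "h (Suc j) {\<Phi> z, \<tau> (\<Phi> z)} = 1" for j
    using h_orbit[OF \<Phi>_topspace[OF o(1)]] by auto
  have MV: "h (Suc k) M dvd h (Suc k) U * h (Suc k) V * h k (U \<inter> V) \<and> h 0 M dvd h 0 U * h 0 V"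
    using h_Mayer_Vietoris[OF sub, of k] openU openV unfolding UV by blast
  then show "h (Suc k) (A \<union> (c \<union> \<tau> ` c)) dvd h (Suc k) A * h k (G (Q n))"
    by (simp add: hU hV orb UintV M_def[symmetric])
  show "h 0 (A \<union> (c \<union> \<tau> ` c)) \<noteq> 0" if "h 0 A \<noteq> 0"
  proof
    assume "h 0 (A \<union> (c \<union> \<tau> ` c)) = 0"
    then show False using MV that orb(1)[of 0] by (simp add: hU hV M_def[symmetric])
  qed
qed

end

section \<open>Induction over the cells of a finite complex\<close>

context equivariant_theory
begin

text \<open>Induction on the number of cells, detaching one orbit of cells of maximal dimension. The
  bound on the nonvanishing degrees comes from the punctured cell, which has the cohomological
  dimension of a sphere one dimension lower and enters with a shift by one.\<close>

lemma h_finite_complex: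
  assumes X: "Hausdorff_space X" and "finite S"
    and "\<forall>(m, c)\<in>S. \<forall>(n, d)\<in>S. (m, c) \<noteq> (n, d) \<longrightarrow> c \<inter> d = {}"
    and "\<forall>(n, c)\<in>S. (n, \<tau> ` c) \<in> S \<and> (\<tau> ` c = c \<longrightarrow> (\<forall>u\<in>c. \<tau> u = u))"
    and "\<forall>(n, c)\<in>S. \<exists>\<Phi>. continuous_map (disc n) X \<Phi> \<and> inj_on \<Phi> (open_disc n) \<and> \<Phi> ` open_disc n = c \<and>
      \<Phi> ` (topspace (disc n) - open_disc n) \<subseteq> \<Union>{d. \<exists>m<n. (m, d) \<in> S}"
    and "\<forall>(n, c)\<in>S. n \<le> D"
  shows "h k (\<Union>(snd ` S)) \<noteq> 0 \<and> (D < k \<longrightarrow> h k (\<Union>(snd ` S)) = 1)"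
  using assms(2-)
proof (induction "card S" arbitrary: S k rule: less_induct)
  case less
  note fin = less.prems(1) and disj = less.prems(2) and inv = less.prems(3) and cell = less.prems(4) and dim = less.prems(5)
  show ?case
  proof (cases "S = {}")
    case True
    then show ?thesis by (simp add: h_empty)
  next
    case False
    \<comment> \<open>By maximality no boundary of a remaining cell runs into the detached ones, so
      what remains is again a complex.\<close>
    define n where "n = Max (fst ` S)"
    have "n \<in> fst ` S" unfolding n_def using fin False by (intro Max_in) auto
    then obtain c where c: "(n, c) \<in> S" by (elim imageE) (metis prod.collapse)
    have max: "m \<le> n" if "(m, d) \<in> S" for m d
    proof -
      have "m \<in> fst ` S" using imageI[OF that, of fst] by simp
      then show ?thesis unfolding n_def using fin by (intro Max_ge) auto
    qed
    define T where "T = S - {(n, c), (n, \<tau> ` c)}"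
    define A where "A = \<Union>(snd ` T)"
    have TS: "T \<subseteq> S" by (auto simp: T_def)
    have cellD: "\<exists>\<Phi>. continuous_map (disc m) X \<Phi> \<and> inj_on \<Phi> (open_disc m) \<and> \<Phi> ` open_disc m = d \<and>
      \<Phi> ` (topspace (disc m) - open_disc m) \<subseteq> \<Union>{e. \<exists>l<m. (l, e) \<in> S}" if "(m, d) \<in> S" for m d
      using bspec[OF cell that] by simp
    have invD: "(m, \<tau> ` d) \<in> S \<and> (\<tau> ` d = d \<longrightarrow> (\<forall>u\<in>d. \<tau> u = u))" if "(m, d) \<in> S" for m d
      using bspec[OF inv that] by simp
    have disjD: "d \<inter> e = {}" if "(m, d) \<in> S" "(l, e) \<in> S" "(m, d) \<noteq> (l, e)" for m d l e
      using bspec[OF disj that(1)] that(2,3) by auto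
    have dimD: "m \<le> D" if "(m, d) \<in> S" for m d
      using bspec[OF dim that] by simp
    have sub: "d \<subseteq> topspace X" if md: "(m, d) \<in> S" for m d
    proof -
      obtain \<Phi> where "continuous_map (disc m) X \<Phi>" "\<Phi> ` open_disc m = d" using cellD[OF md] by blast
      then show ?thesis using open_disc_subset[of m] by (auto simp: continuous_map_def)
    qed
    have \<tau>\<tau>: "\<tau> ` \<tau> ` d = d" if "(m, d) \<in> S" for m d
    proof -
      have "\<tau> (\<tau> u) = u" if "u \<in> d" for u using sub \<open>(m, d) \<in> S\<close> that \<tau>_inv by blast
      then show ?thesis by (simp add: image_image)
    qed
    have invT: "(m, \<tau> ` d) \<in> T" if d: "(m, d) \<in> T" for m d
    proof -
      have dS: "(m, d) \<in> S" using d TS by blast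
      have "(m, \<tau> ` d) \<in> S" using invD[OF dS] by simp
      moreover have "\<tau> ` d \<noteq> c" if "m = n"
      proof
        assume "\<tau> ` d = c"
        then have "d = \<tau> ` c" using \<tau>\<tau>[OF dS] by simp
        then show False using d \<open>m = n\<close> by (simp add: T_def)
      qed
      moreover have "\<tau> ` d \<noteq> \<tau> ` c" if "m = n"
      proof
        assume "\<tau> ` d = \<tau> ` c"
        then have "d = c" using \<tau>\<tau>[OF dS] \<tau>\<tau>[OF c] by metis
        then show False using d \<open>m = n\<close> by (simp add: T_def)
      qed
      ultimately show ?thesis by (auto simp: T_def)
    qed
    have lower: "(l, e) \<in> T" if "(l, e) \<in> S" "l < n" for l e using that by (auto simp: T_def)
    have cellT: "\<exists>\<Phi>. continuous_map (disc m) X \<Phi> \<and> inj_on \<Phi> (open_disc m) \<and> \<Phi> ` open_disc m = d \<and>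
      \<Phi> ` (topspace (disc m) - open_disc m) \<subseteq> \<Union>{e. \<exists>l<m. (l, e) \<in> T}" if "(m, d) \<in> S" for m d
    proof -
      have "{e. \<exists>l<m. (l, e) \<in> S} = {e. \<exists>l<m. (l, e) \<in> T}"
      proof (intro equalityI subsetI)
        fix e assume "e \<in> {e. \<exists>l<m. (l, e) \<in> S}"
        then obtain l where "l < m" "(l, e) \<in> S" by blast
        moreover from this have "(l, e) \<in> T" by (intro lower less_le_trans[OF _ max[OF that]])
        ultimately show "e \<in> {e. \<exists>l<m. (l, e) \<in> T}" by blast
      qed (auto dest: subsetD[OF TS])
      then show ?thesis using cellD[OF that] by simp
    qed
    have "card T < card S"
      using fin c by (intro psubset_card_mono) (auto simp: T_def)
    then have IH: "h j A \<noteq> 0 \<and> (D < j \<longrightarrow> h j A = 1)" for j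
      unfolding A_def
    proof (rule less.hyps)
      show "finite T" using fin TS by (rule finite_subset[rotated])
      show "\<forall>(m, c)\<in>T. \<forall>(n, d)\<in>T. (m, c) \<noteq> (n, d) \<longrightarrow> c \<inter> d = {}" 
      proof (intro ballI)
        fix x assume "x \<in> T"
        then show "case x of (m, c) \<Rightarrow> \<forall>(n, d)\<in>T. (m, c) \<noteq> (n, d) \<longrightarrow> c \<inter> d = {}"
          using disjD[of "fst x" "snd x"] TS by (cases x) (simp add: subset_iff split_beta, metis prod.collapse)
      qed
      show "\<forall>(n, c)\<in>T. (n, \<tau> ` c) \<in> T \<and> (\<tau> ` c = c \<longrightarrow> (\<forall>u\<in>c. \<tau> u = u))"
      proof -
        have "(n, \<tau> ` c) \<in> T \<and> (\<tau> ` c = c \<longrightarrow> (\<forall>u\<in>c. \<tau> u = u))" if "(n, c) \<in> T" for n c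
          using invT[OF that] invD[OF subsetD[OF TS that]] by simp
        then show ?thesis by (intro ballI case_prodI2) simp
      qed
      show "\<forall>(n, c)\<in>T. n \<le> D" using dimD TS by (auto simp: subset_iff)
      show "\<forall>(n, c)\<in>T. \<exists>\<Phi>. continuous_map (disc n) X \<Phi> \<and> inj_on \<Phi> (open_disc n) \<and> \<Phi> ` open_disc n = c \<and>
        \<Phi> ` (topspace (disc n) - open_disc n) \<subseteq> \<Union>{d. \<exists>m<n. (m, d) \<in> T}"
      proof
        fix x assume "x \<in> T"
        then show "case x of (n, c) \<Rightarrow> \<exists>\<Phi>. continuous_map (disc n) X \<Phi> \<and> inj_on \<Phi> (open_disc n) \<and> \<Phi> ` open_disc n = c \<and>
          \<Phi> ` (topspace (disc n) - open_disc n) \<subseteq> \<Union>{d. \<exists>m<n. (m, d) \<in> T}"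
          using cellT[of "fst x" "snd x"] TS by (cases x) auto
      qed
    qed
    obtain \<Phi> where \<Phi>: "continuous_map (disc n) X \<Phi>" "inj_on \<Phi> (open_disc n)" "\<Phi> ` open_disc n = c"
      "\<Phi> ` (topspace (disc n) - open_disc n) \<subseteq> \<Union>{e. \<exists>l<n. (l, e) \<in> T}"
      using cellT[OF c] by blast
    have TA: "\<Union>{e. \<exists>l<m. (l, e) \<in> T} \<subseteq> A" for m by (force simp: A_def)
    have cTA: "c \<inter> A = {}"
    proof -
      have "c \<inter> e = {}" if "(l, e) \<in> T" for l e
        using disjD[OF c, of l e] that unfolding T_def by auto
      then show ?thesis by (force simp: A_def)
    qed
    have "equivariant_cell X \<tau> h n c \<Phi> A"
    proof unfold_locales
      show "\<Phi> x \<in> A" if "x \<in> topspace (disc n)" "x \<notin> open_disc n" for x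
        using \<Phi>(4) TA[of n] that by blast
      \<comment> \<open>A closed cell of \<open>T\<close> is compact, and its boundary lies in lower
        cells, which belong to \<open>T\<close> too. Hence \<open>A\<close> is a finite union of
        closed sets.\<close>
      have "\<exists>F. closedin X F \<and> d \<subseteq> F \<and> F \<subseteq> A" if d: "(m, d) \<in> T" for m d
      proof -
        obtain \<Psi> where \<Psi>: "continuous_map (disc m) X \<Psi>" "\<Psi> ` open_disc m = d"
          "\<Psi> ` (topspace (disc m) - open_disc m) \<subseteq> \<Union>{e. \<exists>l<m. (l, e) \<in> T}"
          using cellT[of m d] d TS by blast
        have "closedin X (\<Psi> ` topspace (disc m))"
          using continuous_imp_closed_map[OF \<Psi>(1) compact_space_disc X] by (auto simp: closed_map_def)
        moreover have "d \<subseteq> \<Psi> ` topspace (disc m)" using \<Psi>(2) open_disc_subset by blast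
        moreover have "\<Psi> ` topspace (disc m) \<subseteq> A"
        proof -
          have "d \<subseteq> A" using d by (force simp: A_def)
          then show ?thesis using \<Psi>(2,3) TA[of m] by blast
        qed
        ultimately show ?thesis by blast
      qed
      then have "\<forall>e\<in>snd ` T. \<exists>F. closedin X F \<and> e \<subseteq> F \<and> F \<subseteq> A" by auto
      then obtain F where F: "\<forall>e\<in>snd ` T. closedin X (F e) \<and> e \<subseteq> F e \<and> F e \<subseteq> A" by metis
      have "A = \<Union>(F ` snd ` T)" using F unfolding A_def by blast
      moreover have "closedin X (\<Union>(F ` snd ` T))"
        using fin TS F by (intro closedin_Union) (auto intro: finite_subset)
      ultimately show "closedin X A" by simp
      show "\<tau> ` A \<subseteq> A" using invT by (force simp: A_def)
      show "(\<forall>u\<in>c. \<tau> u = u) \<or> c \<inter> \<tau> ` c = {}"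
      proof (cases "\<tau> ` c = c")
        case True
        then show ?thesis using invD[OF c] by blast
      next
        case False
        have "(n, \<tau> ` c) \<in> S" using invD[OF c] by simp
        then have "c \<inter> \<tau> ` c = {}" using disjD[OF c] False by auto
        then show ?thesis by blast
      qed
    qed (use X \<Phi> cTA in auto)
    then interpret cell: equivariant_cell X \<tau> h n c \<Phi> A .
    have "(n, \<tau> ` c) \<in> S" using invD[OF c] by simp
    then have "S = T \<union> {(n, c), (n, \<tau> ` c)}" using c by (auto simp: T_def)
    then have US: "\<Union>(snd ` S) = A \<union> (c \<union> \<tau> ` c)" by (simp add: A_def) blast
    have nD: "n \<le> D" by (rule dimD[OF c])
    show ?thesis
    proof (cases k)
      case 0
      then show ?thesis using cell.h_attach(2) IH[of 0] unfolding US by simp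
    next
      case (Suc j)
      have dvd: "h k (\<Union>(snd ` S)) dvd h k A * h j (cell.G (cell.Q n))"
        using cell.h_attach(1)[of j] unfolding US Suc .
      have Q: "h j (cell.G (cell.Q n)) \<noteq> 0 \<and> (n \<le> j \<longrightarrow> h j (cell.G (cell.Q n)) = 1)"
        by (rule cell.h_punctured) simp
      have "h k (\<Union>(snd ` S)) \<noteq> 0"
      proof
        assume "h k (\<Union>(snd ` S)) = 0"
        then show False using dvd Q IH[of k] by simp
      qed
      \<comment> \<open>Here \<open>k = Suc j\<close> and \<open>n \<le> D < k\<close>, so
        \<open>n \<le> j\<close>, the range in which the punctured cell contributes 1.\<close>
      moreover have "h k (\<Union>(snd ` S)) = 1" if "D < k"
        using dvd Q IH[of k] that nD Suc by simp
      ultimately show ?thesis by blast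
    qed
  qed
qed

lemma h_finite_CW_complex:
  assumes CW: "CW_complex X C" and fin: "finite_cells C"
    and act: "\<And>n c. c \<in> C n \<Longrightarrow> \<tau> ` c \<in> C n \<and> (\<tau> ` c = c \<longrightarrow> (\<forall>u\<in>c. \<tau> u = u))"
  shows "h k (topspace X) \<noteq> 0" and "cw_dim C < k \<Longrightarrow> h k (topspace X) = 1"
proof -
  define S where "S = (SIGMA n:UNIV. C n)"
  have fS: "finite S" using fin by (simp add: finite_cells_def S_def)
  have X: "Hausdorff_space X" "topspace X = (\<Union>n. \<Union>(C n))"
    and disj: "\<And>m n c d. \<lbrakk>c \<in> C m; d \<in> C n; (m, c) \<noteq> (n, d)\<rbrakk> \<Longrightarrow> c \<inter> d = {}"
    and char: "\<And>n c. c \<in> C n \<Longrightarrow> \<exists>\<Phi>. characteristic_map X C n c \<Phi>"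
    using CW unfolding CW_complex_def by simp_all
  have XS: "topspace X = \<Union>(snd ` S)"
    unfolding X(2) S_def by force
  have "h k (\<Union>(snd ` S)) \<noteq> 0 \<and> (cw_dim C < k \<longrightarrow> h k (\<Union>(snd ` S)) = 1)"
  proof (rule h_finite_complex[OF X(1) fS])
    show "\<forall>(m, c)\<in>S. \<forall>(n, d)\<in>S. (m, c) \<noteq> (n, d) \<longrightarrow> c \<inter> d = {}"
      using disj by (intro ballI case_prodI2 impI) (simp add: S_def)
    show "\<forall>(n, c)\<in>S. (n, \<tau> ` c) \<in> S \<and> (\<tau> ` c = c \<longrightarrow> (\<forall>u\<in>c. \<tau> u = u))"
      using act by (auto simp: S_def)
    have bdd: "bdd_above {n. C n \<noteq> {}}"
    proof -
      have "{n. C n \<noteq> {}} = fst ` S" by (force simp: S_def)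
      then show ?thesis using fS by simp
    qed
    show "\<forall>(n, c)\<in>S. n \<le> cw_dim C"
      unfolding cw_dim_def S_def using cSup_upper[OF _ bdd] by auto
    show "\<forall>(n, c)\<in>S. \<exists>\<Phi>. continuous_map (disc n) X \<Phi> \<and> inj_on \<Phi> (open_disc n) \<and> \<Phi> ` open_disc n = c \<and>
        \<Phi> ` (topspace (disc n) - open_disc n) \<subseteq> \<Union>{d. \<exists>m<n. (m, d) \<in> S}"
    proof clarify
      fix n c assume "(n, c) \<in> S"
      then have c: "c \<in> C n" by (simp add: S_def)
      then obtain \<Phi> where "characteristic_map X C n c \<Phi>" using char by blast
      then obtain F where \<Phi>: "continuous_map (disc n) X \<Phi>"
          "homeomorphic_map (subtopology (disc n) (open_disc n)) (subtopology X c) \<Phi>"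
        and F: "F \<subseteq> (\<Union>m<n. C m)" "\<Phi> ` (topspace (disc n) - open_disc n) \<subseteq> \<Union>F"
        unfolding characteristic_map_def by blast
      have "c \<subseteq> topspace X" using c X(2) by blast
      then have "inj_on \<Phi> (open_disc n)" "\<Phi> ` open_disc n = c"
        using homeomorphic_imp_injective_map[OF \<Phi>(2)] homeomorphic_imp_surjective_map[OF \<Phi>(2)] open_disc_subset[of n]
        by (simp_all add: Int_absorb1)
      moreover have "\<Union>F \<subseteq> \<Union>{d. \<exists>m<n. (m, d) \<in> S}" using F(1) by (force simp: S_def)
      ultimately show "\<exists>\<Phi>. continuous_map (disc n) X \<Phi> \<and> inj_on \<Phi> (open_disc n) \<and> \<Phi> ` open_disc n = c \<and>
        \<Phi> ` (topspace (disc n) - open_disc n) \<subseteq> \<Union>{d. \<exists>m<n. (m, d) \<in> S}"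
        using \<Phi>(1) F(2) by (intro exI[of _ \<Phi>]) auto
    qed
  qed
  then show "h k (topspace X) \<noteq> 0" "cw_dim C < k \<Longrightarrow> h k (topspace X) = 1"
    using XS by auto
qed

end

section \<open>Three equivariant theories\<close>

lemma coh_retract:
  assumes Y: "inv_pair Y \<tau> B" and R: "R \<subseteq> topspace Y" "\<tau> ` R \<subseteq> R"
    and K: "continuous_map (cyl Y) Y K"
    and "\<And>y. y \<in> topspace Y \<Longrightarrow> K (0, y) = y" "\<And>y. y \<in> topspace Y \<Longrightarrow> K (1, y) \<in> R"
    and "\<And>y. y \<in> R \<Longrightarrow> K (1, y) = y"
    and "\<And>t y. \<lbrakk>t \<in> {0..1}; y \<in> topspace Y\<rbrakk> \<Longrightarrow> K (t, \<tau> y) = \<tau> (K (t, y))"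
    and "\<And>t y. \<lbrakk>t \<in> {0..1}; y \<in> topspace Y; y \<in> B\<rbrakk> \<Longrightarrow> K (t, y) \<in> B"
  shows "coh Y \<tau> B p = coh (subtopology Y R) \<tau> B p"
proof -
  let ?R = "subtopology Y R" and ?g = "\<lambda>y. K (1, y)"
  have R': "inv_pair ?R \<tau> B" using R by (intro inv_pair_subtopology[OF Y]) auto
  have "continuous_map Y Y (K \<circ> Pair 1)"
    by (rule continuous_map_compose[OF _ K]) (auto simp: continuous_map_pairwise o_def)
  then have g: "continuous_map Y Y ?g" by (simp add: o_def)
  have "coh ?R \<tau> B p = coh Y \<tau> B p"
  proof (rule coh_homotopy_equivalence(3)[OF R' Y, where f = id and g = ?g])
    show "pair_map ?R \<tau> B Y \<tau> B id" by (simp add: pair_map_def continuous_map_from_subtopology)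
    show gm: "pair_map Y \<tau> B ?R \<tau> B ?g"
      using assms g by (auto simp: pair_map_def continuous_map_in_subtopology)
    show "equi_homotopic ?R \<tau> B ?R \<tau> B id (?g \<circ> id)"
      by (rule equi_homotopic_refl) (use assms in \<open>auto simp: pair_map_def\<close>)
    show "equi_homotopic Y \<tau> B Y \<tau> B id (id \<circ> ?g)"
      unfolding equi_homotopic_def using assms by (intro exI[of _ K]) auto
  qed
  then show ?thesis by simp
qed

lemma openin_Hausdorff_point:
  assumes "Hausdorff_space X" "x \<in> topspace X" "y \<in> topspace X" "x \<noteq> y"
  shows "openin (subtopology X {x, y}) {x}"
proof -
  have "{x} = {x, y} \<inter> (topspace X - {y})" using assms by auto
  moreover have "openin X (topspace X - {y})"
    using closedin_Hausdorff_sing_eq[OF assms(1)] assms(3) by (intro openin_diff) auto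
  ultimately show ?thesis using openin_subtopology_Int2 by metis
qed

text \<open>The dimension axiom for ordinary cohomology. Equality of the two points is allowed
  because an orbit may be a single fixed point.\<close>

lemma coh_two_points:
  assumes X: "Hausdorff_space X" and "x \<in> topspace X" "y \<in> topspace X"
  shows "coh (subtopology X {x, y}) id {} k \<noteq> 0 \<and> coh (subtopology X {x, y}) id {} (Suc k) = 1"
proof (cases "x = y")
  case True
  then have t: "topspace (subtopology X {x, y}) = {x}" using assms by auto
  show ?thesis using coh_singleton[OF t] by (intro conjI)
next
  case False
  let ?Y = "subtopology X {x, y}"
  have o: "openin ?Y {x}" "openin ?Y {y}"
    using openin_Hausdorff_point[OF X assms(2,3) False] openin_Hausdorff_point[OF X assms(3,2) False[symmetric]]
    by (simp_all add: insert_commute[of y x])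
  have "{x, y} \<inter> {x} = {x}" "{x, y} \<inter> {y} = {y}" by auto
  then have ss: "subtopology ?Y {x} = subtopology X {x}" "subtopology ?Y {y} = subtopology X {y}"
    by (simp_all only: subtopology_subtopology)
  have pt: "coh (subtopology X {z}) id {} j \<noteq> 0" "coh (subtopology X {z}) id {} (Suc j) = 1" if "z \<in> topspace X" for z j
    using coh_singleton[of "subtopology X {z}" z j] that by auto
  have tY: "topspace ?Y = {x} \<union> {y}" using assms by auto
  have e: "coh (subtopology ?Y ({x} \<inter> {y})) id {} j = 1" for j
    using False by (intro coh_empty) auto
  note MV = coh_Mayer_Vietoris[OF inv_pair_id o tY]
  have 1: "coh ?Y id {} (Suc j) = 1" for j
    using MV(1)[of j] by (simp add: ss pt assms e[simplified])
  moreover have "coh ?Y id {} 0 \<noteq> 0"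
  proof
    assume "coh ?Y id {} 0 = 0"
    then show False using MV(2) pt(1)[OF assms(2), of 0] pt(1)[OF assms(3), of 0] by (simp add: ss)
  qed
  ultimately show ?thesis by (cases k) auto
qed

text \<open>
  The Mayer-Vietoris property is inherited along an equivariant map \<open>p : Z \<rightarrow> X\<close>.
\<close>

lemma coh_preimage_Mayer_Vietoris:
  assumes Z: "inv_pair Z \<sigma> B" and p: "continuous_map Z X p"
    and equi: "\<And>z. z \<in> topspace Z \<Longrightarrow> p (\<sigma> z) = p z \<or> p (\<sigma> z) = \<tau> (p z)"
    and UV: "\<tau> ` U \<subseteq> U" "\<tau> ` V \<subseteq> V"
      "openin (subtopology X (U \<union> V)) U" "openin (subtopology X (U \<union> V)) V"
  shows "coh (subtopology Z {z \<in> topspace Z. p z \<in> U \<union> V}) \<sigma> B (Suc k) dvd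
      coh (subtopology Z {z \<in> topspace Z. p z \<in> U}) \<sigma> B (Suc k) *
      coh (subtopology Z {z \<in> topspace Z. p z \<in> V}) \<sigma> B (Suc k) *
      coh (subtopology Z {z \<in> topspace Z. p z \<in> U \<inter> V}) \<sigma> B k"
    and "coh (subtopology Z {z \<in> topspace Z. p z \<in> U \<union> V}) \<sigma> B 0 dvd
      coh (subtopology Z {z \<in> topspace Z. p z \<in> U}) \<sigma> B 0 *
      coh (subtopology Z {z \<in> topspace Z. p z \<in> V}) \<sigma> B 0"
proof -
  define P where "P = (\<lambda>S. {z \<in> topspace Z. p z \<in> S})"
  let ?Y = "subtopology Z (P (U \<union> V))"
  have inv: "\<sigma> z \<in> P S" if "z \<in> P S" "\<tau> ` S \<subseteq> S" for z S
  proof -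
    have "\<sigma> z \<in> topspace Z" using Z that(1) by (auto simp: inv_pair_def continuous_map_def P_def)
    then show ?thesis using equi[of z] that by (auto simp: P_def)
  qed
  have Y: "inv_pair ?Y \<sigma> B"
    by (rule inv_pair_subtopology[OF Z]) (use inv UV in blast)
  have op: "openin ?Y (P S)" if S: "openin (subtopology X (U \<union> V)) S" for S
  proof -
    obtain T where T: "openin X T" "S = T \<inter> (U \<union> V)" using S by (auto simp: openin_subtopology)
    have "P S = P (U \<union> V) \<inter> {z \<in> topspace Z. p z \<in> T}" using T(2) by (auto simp: P_def)
    then show ?thesis
      using openin_subtopology_Int2 openin_continuous_map_preimage[OF p T(1)] by metis
  qed
  have top: "topspace ?Y = P U \<union> P V" by (auto simp: P_def)
  have ss: "subtopology ?Y (P U) = subtopology Z (P U)" "subtopology ?Y (P V) = subtopology Z (P V)"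
    "subtopology ?Y (P U \<inter> P V) = subtopology Z (P (U \<inter> V))"
  proof -
    have "P (U \<union> V) \<inter> P U = P U" "P (U \<union> V) \<inter> P V = P V" "P (U \<union> V) \<inter> (P U \<inter> P V) = P (U \<inter> V)"
      by (auto simp: P_def)
    then show "subtopology ?Y (P U) = subtopology Z (P U)" "subtopology ?Y (P V) = subtopology Z (P V)"
      "subtopology ?Y (P U \<inter> P V) = subtopology Z (P (U \<inter> V))"
      by (simp_all only: subtopology_subtopology)
  qed
  have \<sigma>: "\<sigma> ` P U \<subseteq> P U" "\<sigma> ` P V \<subseteq> P V" using inv UV by blast+
  note MV = coh_Mayer_Vietoris[OF Y op[OF UV(3)] op[OF UV(4)] top \<sigma>, unfolded ss]
  show "coh (subtopology Z {z \<in> topspace Z. p z \<in> U \<union> V}) \<sigma> B (Suc k) dvd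
      coh (subtopology Z {z \<in> topspace Z. p z \<in> U}) \<sigma> B (Suc k) *
      coh (subtopology Z {z \<in> topspace Z. p z \<in> V}) \<sigma> B (Suc k) *
      coh (subtopology Z {z \<in> topspace Z. p z \<in> U \<inter> V}) \<sigma> B k"
    using MV(1)[of k] by (simp only: P_def Un_upper1 Un_upper2)
  show "coh (subtopology Z {z \<in> topspace Z. p z \<in> U \<union> V}) \<sigma> B 0 dvd
      coh (subtopology Z {z \<in> topspace Z. p z \<in> U}) \<sigma> B 0 *
      coh (subtopology Z {z \<in> topspace Z. p z \<in> V}) \<sigma> B 0"
    using MV(2) by (simp only: P_def Un_upper1 Un_upper2)
qed

locale involution_space =
  fixes X :: "'a topology" and \<tau> :: "'a \<Rightarrow> 'a"
  assumes X_Hausdorff: "Hausdorff_space X" and \<tau>_cont: "continuous_map X X \<tau>"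
    and \<tau>_inv: "x \<in> topspace X \<Longrightarrow> \<tau> (\<tau> x) = x"
begin

lemma \<tau>_topspace: "x \<in> topspace X \<Longrightarrow> \<tau> x \<in> topspace X"
  using \<tau>_cont by (auto simp: continuous_map_def)

text \<open>Only the subsets are invariant here; the cochains are arbitrary. The preimage under
  \<open>id\<close> brings the formula into the shape of
  \<open>coh_preimage_Mayer_Vietoris\<close>.\<close>

lemma equivariant_theory_ordinary:
  "equivariant_theory X \<tau> (\<lambda>k A. coh (subtopology X {z \<in> topspace X. id z \<in> A}) id {} k)"
proof unfold_locales
  fix U V k
  assume UV: "\<tau> ` U \<subseteq> U" "\<tau> ` V \<subseteq> V" "openin (subtopology X (U \<union> V)) U" "openin (subtopology X (U \<union> V)) V"
  show "coh (subtopology X {z \<in> topspace X. id z \<in> U \<union> V}) id {} (Suc k) dvd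
      coh (subtopology X {z \<in> topspace X. id z \<in> U}) id {} (Suc k) *
      coh (subtopology X {z \<in> topspace X. id z \<in> V}) id {} (Suc k) *
      coh (subtopology X {z \<in> topspace X. id z \<in> U \<inter> V}) id {} k \<and>
    coh (subtopology X {z \<in> topspace X. id z \<in> U \<union> V}) id {} 0 dvd
      coh (subtopology X {z \<in> topspace X. id z \<in> U}) id {} 0 *
      coh (subtopology X {z \<in> topspace X. id z \<in> V}) id {} 0"
    using coh_preimage_Mayer_Vietoris[OF inv_pair_id continuous_map_id _ UV] by simp
next
  fix R U H k
  assume R: "R \<subseteq> U" "U \<subseteq> topspace X" "continuous_map (cyl (subtopology X U)) (subtopology X U) H"
    "\<And>u. u \<in> U \<Longrightarrow> H (0, u) = u \<and> H (1, u) \<in> R" "\<And>t u. \<lbrakk>t \<in> {0..1}; u \<in> R\<rbrakk> \<Longrightarrow> H (t, u) = u"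
  have "coh (subtopology X U) id {} k = coh (subtopology (subtopology X U) R) id {} k"
    by (rule coh_retract[OF inv_pair_id _ _ R(3)]) (use R in auto)
  moreover have "subtopology X {z \<in> topspace X. id z \<in> U} = subtopology X U"
    "subtopology X {z \<in> topspace X. id z \<in> R} = subtopology (subtopology X U) R"
  proof -
    have "{z \<in> topspace X. id z \<in> U} = U" "{z \<in> topspace X. id z \<in> R} = U \<inter> R" using R(1,2) by auto
    then show "subtopology X {z \<in> topspace X. id z \<in> U} = subtopology X U"
      "subtopology X {z \<in> topspace X. id z \<in> R} = subtopology (subtopology X U) R"
      by (simp_all only: subtopology_subtopology)
  qed
  ultimately show "coh (subtopology X {z \<in> topspace X. id z \<in> U}) id {} k = coh (subtopology X {z \<in> topspace X. id z \<in> R}) id {} k"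
    by simp
next
  fix x k assume x: "x \<in> topspace X"
  have "{z \<in> topspace X. id z \<in> {x, \<tau> x}} = {x, \<tau> x}" using x \<tau>_topspace by auto
  then show "coh (subtopology X {z \<in> topspace X. id z \<in> {x, \<tau> x}}) id {} k \<noteq> 0 \<and>
      coh (subtopology X {z \<in> topspace X. id z \<in> {x, \<tau> x}}) id {} (Suc k) = 1"
    using coh_two_points[OF X_Hausdorff x \<tau>_topspace[OF x]] by simp
next
  show "coh (subtopology X {z \<in> topspace X. id z \<in> {}}) id {} k = 1" for k
    by (rule coh_empty) simp
qed (use \<tau>_cont \<tau>_inv in auto)

abbreviation Fix :: "'a set"
  where "Fix \<equiv> {x. \<tau> x = x}"

text \<open>Equivariant homotopies carry fixed points to fixed points, so retractions restrict to
  \<open>Fix\<close>; an orbit meets \<open>Fix\<close> in one point or not at all.\<close>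

lemma equivariant_theory_fixed:
  "equivariant_theory X \<tau> (\<lambda>k A. coh (subtopology (subtopology X Fix) {z \<in> topspace (subtopology X Fix). id z \<in> A}) id {} k)"
proof unfold_locales
  let ?F = "subtopology X Fix"
  have c: "continuous_map ?F X id" by (simp add: continuous_map_from_subtopology)
  fix U V k
  assume UV: "\<tau> ` U \<subseteq> U" "\<tau> ` V \<subseteq> V" "openin (subtopology X (U \<union> V)) U" "openin (subtopology X (U \<union> V)) V"
  show "coh (subtopology ?F {z \<in> topspace ?F. id z \<in> U \<union> V}) id {} (Suc k) dvd
      coh (subtopology ?F {z \<in> topspace ?F. id z \<in> U}) id {} (Suc k) *
      coh (subtopology ?F {z \<in> topspace ?F. id z \<in> V}) id {} (Suc k) *
      coh (subtopology ?F {z \<in> topspace ?F. id z \<in> U \<inter> V}) id {} k \<and>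
    coh (subtopology ?F {z \<in> topspace ?F. id z \<in> U \<union> V}) id {} 0 dvd
      coh (subtopology ?F {z \<in> topspace ?F. id z \<in> U}) id {} 0 *
      coh (subtopology ?F {z \<in> topspace ?F. id z \<in> V}) id {} 0"
    using coh_preimage_Mayer_Vietoris[OF inv_pair_id c _ UV] by simp
next
  let ?F = "subtopology X Fix"
  fix R U H k
  assume R: "R \<subseteq> U" "U \<subseteq> topspace X" "continuous_map (cyl (subtopology X U)) (subtopology X U) H"
    "\<And>u. u \<in> U \<Longrightarrow> H (0, u) = u \<and> H (1, u) \<in> R" "\<And>t u. \<lbrakk>t \<in> {0..1}; u \<in> R\<rbrakk> \<Longrightarrow> H (t, u) = u"
    "\<And>t u. \<lbrakk>t \<in> {0..1}; u \<in> U\<rbrakk> \<Longrightarrow> H (t, \<tau> u) = \<tau> (H (t, u))"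
  let ?Y = "subtopology X (U \<inter> Fix)"
  have HU: "H (t, u) \<in> U" if "t \<in> {0..1}" "u \<in> U" for t u
    using R(2,3) that by (auto simp: continuous_map_in_subtopology)
  have H: "continuous_map (cyl ?Y) ?Y H"
  proof -
    have "cyl ?Y = subtopology (cyl (subtopology X U)) ({0..1} \<times> Fix)"
      by (simp only: subtopology_Times subtopology_subtopology Int_absorb)
    moreover have "continuous_map (cyl (subtopology X U)) X H" using R(3) by (simp add: continuous_map_in_subtopology)
    moreover have "H (t, u) \<in> U \<inter> Fix" if "t \<in> {0..1}" "u \<in> U" "\<tau> u = u" for t u
      using HU[OF that(1,2)] R(6)[OF that(1,2)] that(3) by simp
    ultimately show ?thesis
      by (auto simp: continuous_map_in_subtopology intro: continuous_map_from_subtopology)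
  qed
  have "coh ?Y id {} k = coh (subtopology ?Y (R \<inter> Fix)) id {} k"
  proof (rule coh_retract[OF inv_pair_id _ _ H])
    fix y assume y: "y \<in> topspace ?Y"
    then show "H (1, y) \<in> R \<inter> Fix" using R(4)[of y] R(6)[of 1 y] by simp
  qed (use R in auto)
  moreover have "subtopology ?F {z \<in> topspace ?F. id z \<in> U} = ?Y"
    "subtopology ?F {z \<in> topspace ?F. id z \<in> R} = subtopology ?Y (R \<inter> Fix)"
  proof -
    have "Fix \<inter> {z \<in> topspace ?F. id z \<in> U} = U \<inter> Fix"
      "Fix \<inter> {z \<in> topspace ?F. id z \<in> R} = U \<inter> Fix \<inter> (R \<inter> Fix)" using R(1,2) by auto
    then show "subtopology ?F {z \<in> topspace ?F. id z \<in> U} = ?Y"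
      "subtopology ?F {z \<in> topspace ?F. id z \<in> R} = subtopology ?Y (R \<inter> Fix)"
      by (simp_all only: subtopology_subtopology)
  qed
  ultimately show "coh (subtopology ?F {z \<in> topspace ?F. id z \<in> U}) id {} k = coh (subtopology ?F {z \<in> topspace ?F. id z \<in> R}) id {} k"
    by simp
next
  let ?F = "subtopology X Fix"
  fix x k assume x: "x \<in> topspace X"
  have "coh (subtopology ?F {z \<in> topspace ?F. id z \<in> {x, \<tau> x}}) id {} k \<noteq> 0 \<and>
      coh (subtopology ?F {z \<in> topspace ?F. id z \<in> {x, \<tau> x}}) id {} (Suc k) = 1"
  proof (cases "\<tau> x = x")
    case True
    then have t: "topspace (subtopology ?F {z \<in> topspace ?F. id z \<in> {x, \<tau> x}}) = {x}" using x by auto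
    show ?thesis using coh_singleton[OF t] by (intro conjI)
  next
    case False
    then have t: "topspace (subtopology ?F {z \<in> topspace ?F. id z \<in> {x, \<tau> x}}) = {}" using \<tau>_inv[OF x] by auto
    show ?thesis unfolding coh_empty[OF t] by simp
  qed
  then show "coh (subtopology ?F {z \<in> topspace ?F. id z \<in> {x, \<tau> x}}) id {} k \<noteq> 0 \<and>
      coh (subtopology ?F {z \<in> topspace ?F. id z \<in> {x, \<tau> x}}) id {} (Suc k) = 1" .
next
  show "coh (subtopology (subtopology X Fix) {z \<in> topspace (subtopology X Fix). id z \<in> {}}) id {} k = 1" for k
    by (rule coh_empty) simp
qed (use \<tau>_cont \<tau>_inv in auto)

text \<open>Passing to cochains relative to the fixed points removes the infinite cohomology of the
  group, and the dimension axiom holds again. Over a fixed point everything is relative, which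
  leaves order 1. Over a free orbit there are no relative conditions, and the space consists of two
  copies of \<open>E\<close> that are exchanged, so invariant cochains compute the cohomology of the
  contractible space \<open>E\<close>.\<close>

lemma equivariant_theory_relative:
  fixes E :: "'e topology"
  assumes E: "contractible_space E" "topspace E \<noteq> {}" and \<epsilon>: "continuous_map E E \<epsilon>" "\<And>e. e \<in> topspace E \<Longrightarrow> \<epsilon> (\<epsilon> e) = e"
  shows "equivariant_theory X \<tau> (\<lambda>k A. coh (subtopology (prod_topology X E) {z \<in> topspace (prod_topology X E). fst z \<in> A})
    (map_prod \<tau> \<epsilon>) (Fix \<times> UNIV) k)"
proof unfold_locales
  let ?Z = "prod_topology X E" and ?s = "map_prod \<tau> \<epsilon>" and ?B = "Fix \<times> UNIV :: ('a \<times> 'e) set"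
  have \<epsilon>E: "\<epsilon> e \<in> topspace E" if "e \<in> topspace E" for e using \<epsilon>(1) that by (auto simp: continuous_map_def)
  have "continuous_map ?Z ?Z ?s"
    using \<tau>_cont \<epsilon>(1) by (simp add: map_prod_def continuous_map_prod_top)
  then have Z: "inv_pair ?Z ?s ?B"
    using \<tau>_inv \<epsilon>(2) by (auto simp: inv_pair_def)
  have sub: "subtopology ?Z {z \<in> topspace ?Z. fst z \<in> A} = prod_topology (subtopology X A) E" for A
  proof -
    have "{z \<in> topspace ?Z. fst z \<in> A} = topspace ?Z \<inter> (A \<times> topspace E)" by auto
    then have "subtopology ?Z {z \<in> topspace ?Z. fst z \<in> A} = subtopology ?Z (A \<times> topspace E)"
      by (simp only: subtopology_restrict)
    then show ?thesis by (simp only: subtopology_Times subtopology_topspace)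
  qed
  {
    fix U V k
    assume UV: "\<tau> ` U \<subseteq> U" "\<tau> ` V \<subseteq> V" "openin (subtopology X (U \<union> V)) U" "openin (subtopology X (U \<union> V)) V"
    have c: "continuous_map ?Z X fst" by (rule continuous_map_fst)
    have "fst (?s z) = fst z \<or> fst (?s z) = \<tau> (fst z)" for z by (cases z) simp
    then show "coh (subtopology ?Z {z \<in> topspace ?Z. fst z \<in> U \<union> V}) ?s ?B (Suc k) dvd
        coh (subtopology ?Z {z \<in> topspace ?Z. fst z \<in> U}) ?s ?B (Suc k) *
        coh (subtopology ?Z {z \<in> topspace ?Z. fst z \<in> V}) ?s ?B (Suc k) *
        coh (subtopology ?Z {z \<in> topspace ?Z. fst z \<in> U \<inter> V}) ?s ?B k \<and>
      coh (subtopology ?Z {z \<in> topspace ?Z. fst z \<in> U \<union> V}) ?s ?B 0 dvd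
        coh (subtopology ?Z {z \<in> topspace ?Z. fst z \<in> U}) ?s ?B 0 *
        coh (subtopology ?Z {z \<in> topspace ?Z. fst z \<in> V}) ?s ?B 0"
      using coh_preimage_Mayer_Vietoris[OF Z c _ UV] by blast
  next
    fix R U H k
    assume R: "R \<subseteq> U" "U \<subseteq> topspace X" "\<tau> ` U \<subseteq> U" "\<tau> ` R \<subseteq> R"
      "continuous_map (cyl (subtopology X U)) (subtopology X U) H"
      "\<And>u. u \<in> U \<Longrightarrow> H (0, u) = u \<and> H (1, u) \<in> R" "\<And>t u. \<lbrakk>t \<in> {0..1}; u \<in> R\<rbrakk> \<Longrightarrow> H (t, u) = u"
      "\<And>t u. \<lbrakk>t \<in> {0..1}; u \<in> U\<rbrakk> \<Longrightarrow> H (t, \<tau> u) = \<tau> (H (t, u))"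
    let ?Y = "prod_topology (subtopology X U) E"
    have tU: "topspace (subtopology X U) = U" using R(2) by auto
    have Y: "inv_pair ?Y ?s ?B"
      unfolding sub[symmetric] by (rule inv_pair_subtopology[OF Z]) (use R(3) \<tau>_topspace \<epsilon>E in auto)
    define K where "K = (\<lambda>z. (H (fst z, fst (snd z)), snd (snd z :: 'a \<times> 'e)))"
    have K: "continuous_map (cyl ?Y) ?Y K"
    proof -
      have "continuous_map (cyl ?Y) (cyl (subtopology X U)) (\<lambda>z. (fst z, fst (snd z)))"
        unfolding continuous_map_pairwise o_def
        by (auto intro: continuous_map_fst continuous_map_compose[OF continuous_map_snd continuous_map_fst, unfolded o_def])
      then have "continuous_map (cyl ?Y) (subtopology X U) (\<lambda>z. H (fst z, fst (snd z)))"
        using continuous_map_compose[OF _ R(5)] by (auto simp: o_def)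
      moreover have "continuous_map (cyl ?Y) E (\<lambda>z. snd (snd z))"
        using continuous_map_compose[OF continuous_map_snd continuous_map_snd] by (auto simp: o_def)
      ultimately show ?thesis by (simp add: K_def continuous_map_pairwise o_def)
    qed
    have K_simp: "K (t, (x, e)) = (H (t, x), e)" for t x e by (simp add: K_def)
    have "coh ?Y ?s ?B k = coh (subtopology ?Y (R \<times> topspace E)) ?s ?B k"
    proof (rule coh_retract[OF Y _ _ K])
      show "R \<times> topspace E \<subseteq> topspace ?Y" using R(1,2) by auto
      show "?s ` (R \<times> topspace E) \<subseteq> R \<times> topspace E" using R(4) \<epsilon>E by auto
    next
      fix y assume "y \<in> topspace ?Y"
      then obtain x e where y: "y = (x, e)" "x \<in> U" "e \<in> topspace E" using tU by (cases y) auto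
      show "K (0, y) = y" "K (1, y) \<in> R \<times> topspace E" using R(6)[OF y(2)] y(3) by (simp_all add: y(1) K_simp)
    next
      fix y assume "y \<in> R \<times> topspace E"
      then obtain x e where y: "y = (x, e)" "x \<in> R" by (cases y) auto
      show "K (1, y) = y" using R(7)[of 1 x] y(2) by (simp add: y(1) K_simp)
    next
      fix t y assume t: "t \<in> {0..1::real}" and "y \<in> topspace ?Y"
      then obtain x e where y: "y = (x, e)" "x \<in> U" using tU by (cases y) auto
      have H\<tau>: "H (t, \<tau> x) = \<tau> (H (t, x))" by (rule R(8)[OF t y(2)])
      then show "K (t, ?s y) = ?s (K (t, y))" by (simp add: y(1) K_simp)
      show "K (t, y) \<in> ?B" if "y \<in> ?B"
      proof -
        have "\<tau> x = x" using that y(1) by simp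
        then have "\<tau> (H (t, x)) = H (t, x)" using H\<tau> by metis
        then show ?thesis by (simp add: y(1) K_simp)
      qed
    qed
    also have "subtopology ?Y (R \<times> topspace E) = prod_topology (subtopology X R) E"
      using R(1) by (simp add: subtopology_Times subtopology_subtopology Int_absorb1)
    finally show "coh (subtopology ?Z {z \<in> topspace ?Z. fst z \<in> U}) ?s ?B k = coh (subtopology ?Z {z \<in> topspace ?Z. fst z \<in> R}) ?s ?B k"
      by (simp only: sub)
  next
    fix x k assume x: "x \<in> topspace X"
    let ?Y = "prod_topology (subtopology X {x, \<tau> x}) E"
    have Y: "inv_pair ?Y ?s ?B"
      unfolding sub[symmetric] by (rule inv_pair_subtopology[OF Z]) (use x \<tau>_inv \<tau>_topspace \<epsilon>E in auto)
    have "coh ?Y ?s ?B k \<noteq> 0 \<and> coh ?Y ?s ?B (Suc k) = 1"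
    proof (cases "\<tau> x = x")
      case True
      then have t: "topspace ?Y \<subseteq> ?B" by auto
      show ?thesis unfolding coh_all_relative[OF t] by simp
    next
      case False
      let ?W = "{x} \<times> topspace E"
      have disj: "?B \<inter> topspace ?Y = {} \<inter> topspace ?Y" using False \<tau>_inv[OF x] by auto
      have 1: "coh ?Y ?s ?B = coh ?Y ?s {}" by (rule coh_cong[OF refl disj])
      have 2: "coh ?Y ?s {} j = coh (subtopology ?Y ?W) id {} j" for j
      proof (rule coh_two_sheets)
        show "inv_pair ?Y ?s {}" using Y by (simp add: inv_pair_def)
        have "\<epsilon> ` topspace E = topspace E" using \<epsilon>(2) \<epsilon>E by (metis image_eqI image_subset_iff subsetI subset_antisym)
        then have im: "?s ` ?W = {\<tau> x} \<times> topspace E" by (intro map_prod_surj_on) simp_all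
        have o: "openin (subtopology X {x, \<tau> x}) {x}" "openin (subtopology X {x, \<tau> x}) {\<tau> x}"
          using openin_Hausdorff_point[OF X_Hausdorff x \<tau>_topspace[OF x]]
            openin_Hausdorff_point[OF X_Hausdorff \<tau>_topspace[OF x] x] False
          by (simp_all add: insert_commute[of "\<tau> x" x])
        show "openin ?Y ?W" "openin ?Y (?s ` ?W)"
          unfolding im by (simp_all add: openin_prod_Times_iff o)
        show "topspace ?Y = ?W \<union> ?s ` ?W" "?W \<inter> ?s ` ?W = {}"
          unfolding im using x \<tau>_topspace False by auto
      qed
      have 3: "subtopology ?Y ?W = prod_topology (subtopology X {x}) E"
        by (simp add: subtopology_Times subtopology_subtopology)
      have 4: "contractible_space (prod_topology (subtopology X {x}) E)" "topspace (prod_topology (subtopology X {x}) E) \<noteq> {}"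
        using E x by (auto simp: contractible_space_prod_topology)
      show ?thesis unfolding 1 2 3 using coh_contractible[OF 4] by (intro conjI)
    qed
    then show "coh (subtopology ?Z {z \<in> topspace ?Z. fst z \<in> {x, \<tau> x}}) ?s ?B k \<noteq> 0 \<and>
        coh (subtopology ?Z {z \<in> topspace ?Z. fst z \<in> {x, \<tau> x}}) ?s ?B (Suc k) = 1"
      unfolding sub .
  next
    show "coh (subtopology ?Z {z \<in> topspace ?Z. fst z \<in> {}}) ?s ?B k = 1" for k
      by (rule coh_empty) simp
  }
qed (use \<tau>_cont \<tau>_inv in auto)

end

section \<open>Lifting simplices through the orbit map of a free involution\<close>

lemma connectedin_convex_powertop:
  fixes K :: "(nat \<Rightarrow> real) set"
  assumes "\<And>x y u. \<lbrakk>x \<in> K; y \<in> K; 0 \<le> u; u \<le> 1\<rbrakk> \<Longrightarrow> (\<lambda>i. (1 - u) * x i + u * y i) \<in> K"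
  shows "connectedin (powertop_real UNIV) K"
proof (rule path_connectedin_imp_connectedin)
  define g where "g = (\<lambda>(x :: nat \<Rightarrow> real) y u i. (1 - u) * x i + u * y i)"
  have 1: "continuous_map (top_of_set {0..1}) (powertop_real UNIV) (g x y)" for x y
    unfolding g_def continuous_map_componentwise_UNIV
    by (auto intro!: continuous_intros simp: continuous_map_iff_continuous)
  have 2: "g x y \<in> {0..1} \<rightarrow> K" "g x y 0 = x" "g x y 1 = y" if "x \<in> K" "y \<in> K" for x y
    using that assms by (auto simp: g_def)
  show "path_connectedin (powertop_real UNIV) K"
    unfolding path_connectedin_def path_connected_space_def pathin_def
  proof (intro conjI ballI)
    fix x y assume "x \<in> topspace (subtopology (powertop_real UNIV) K)" "y \<in> topspace (subtopology (powertop_real UNIV) K)"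
    then have xy: "x \<in> K" "y \<in> K" by auto
    have "continuous_map (top_of_set {0..1}) (subtopology (powertop_real UNIV) K) (g x y)"
      using 1[of x y] 2(1)[OF xy] by (auto simp: continuous_map_in_subtopology)
    then show "\<exists>g. continuous_map (top_of_set {0..1::real}) (subtopology (powertop_real UNIV) K) g \<and> g 0 = x \<and> g 1 = y"
      using 2(2,3)[OF xy] by (intro exI[of _ "g x y"] conjI)
  qed simp
qed

locale free_involution =
  fixes Y :: "'a topology" and \<tau> :: "'a \<Rightarrow> 'a" and W :: "'b topology" and q :: "'a \<Rightarrow> 'b"
  assumes Hausdorff: "Hausdorff_space Y" and \<tau>_cont: "continuous_map Y Y \<tau>"
    and \<tau>_inv: "y \<in> topspace Y \<Longrightarrow> \<tau> (\<tau> y) = y" and free: "y \<in> topspace Y \<Longrightarrow> \<tau> y \<noteq> y"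
    and quotient: "quotient_map Y W q"
    and q_eq: "\<lbrakk>y \<in> topspace Y; z \<in> topspace Y\<rbrakk> \<Longrightarrow> q y = q z \<longleftrightarrow> z = y \<or> z = \<tau> y"
begin

lemma \<tau>_topspace: "y \<in> topspace Y \<Longrightarrow> \<tau> y \<in> topspace Y"
  using \<tau>_cont by (auto simp: continuous_map_def)

lemma q_\<tau>: "y \<in> topspace Y \<Longrightarrow> q (\<tau> y) = q y"
  using q_eq[of y "\<tau> y"] \<tau>_topspace by auto

lemma q_cont: "continuous_map Y W q"
  using quotient quotient_imp_continuous_map by blast

lemma q_surj: "q ` topspace Y = topspace W"
  using quotient quotient_imp_surjective_map by blast

lemma q_open: "openin Y U \<Longrightarrow> openin W (q ` U)"
proof -
  assume U: "openin Y U"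
  have US: "U \<subseteq> topspace Y" using U openin_subset by blast
  have "{y \<in> topspace Y. q y \<in> q ` U} = U \<union> {y \<in> topspace Y. \<tau> y \<in> U}"
  proof (intro equalityI subsetI)
    fix y assume "y \<in> {y \<in> topspace Y. q y \<in> q ` U}"
    then obtain u where "y \<in> topspace Y" "u \<in> U" "q y = q u" by auto
    then have "u = y \<or> u = \<tau> y" using q_eq[of y u] US by blast
    then show "y \<in> U \<union> {y \<in> topspace Y. \<tau> y \<in> U}" using \<open>u \<in> U\<close> \<open>y \<in> topspace Y\<close> by auto
  next
    fix y assume "y \<in> U \<union> {y \<in> topspace Y. \<tau> y \<in> U}"
    then show "y \<in> {y \<in> topspace Y. q y \<in> q ` U}"
    proof
      assume "y \<in> {y \<in> topspace Y. \<tau> y \<in> U}"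
      then have y: "y \<in> topspace Y" "\<tau> y \<in> U" by auto
      then have "q y \<in> q ` U" using imageI[OF y(2), of q] q_\<tau> by simp
      then show ?thesis using y(1) by simp
    qed (use US in auto)
  qed
  then have eq: "{y \<in> topspace Y. q y \<in> q ` U} = U \<union> {y \<in> topspace Y. \<tau> y \<in> U}" .
  have op: "openin Y (U \<union> {y \<in> topspace Y. \<tau> y \<in> U})"
    using U openin_continuous_map_preimage[OF \<tau>_cont U] by (rule openin_Un)
  have sub: "q ` U \<subseteq> topspace W" using US q_surj by blast
  show ?thesis
    using spec[OF conjunct2[OF quotient[unfolded quotient_map_def]], of "q ` U"] sub op unfolding eq by simp
qed

text \<open>Separating \<open>y\<close> from its translate by disjoint open sets produces a
  neighbourhood on which \<open>q\<close> is injective. As \<open>q\<close> is open, it is a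
  homeomorphism there.\<close>

lemma local_section:
  assumes "w \<in> topspace W"
  obtains V s where "openin W V" "w \<in> V" "continuous_map (subtopology W V) Y s" "\<forall>v\<in>V. q (s v) = v"
proof -
  have "w \<in> q ` topspace Y" using assms q_surj by simp
  then obtain y where y: "y \<in> topspace Y" "q y = w" by (elim imageE) simp
  obtain A B where AB: "openin Y A" "openin Y B" "y \<in> A" "\<tau> y \<in> B" "disjnt A B"
    using Hausdorff[unfolded Hausdorff_space_def, rule_format, of y "\<tau> y"] y(1) free[OF y(1)] \<tau>_topspace[OF y(1)]
    by auto
  define U where "U = A \<inter> {z \<in> topspace Y. \<tau> z \<in> B}"
  have U: "openin Y U" "y \<in> U"
    using AB y openin_continuous_map_preimage[OF \<tau>_cont AB(2)] by (auto simp: U_def)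
  have US: "U \<subseteq> topspace Y" by (auto simp: U_def)
  have inj: "inj_on q U"
  proof (rule inj_onI)
    fix a b assume ab: "a \<in> U" "b \<in> U" "q a = q b"
    then have "b = a \<or> b = \<tau> a" using q_eq[of a b] subsetD[OF US ab(1)] subsetD[OF US ab(2)] by simp
    moreover have "\<tau> a \<in> B" "b \<in> A" using ab by (auto simp: U_def)
    ultimately show "a = b" using AB(5) by (auto simp: disjnt_def)
  qed
  have tU: "topspace (subtopology Y U) = U" "topspace (subtopology W (q ` U)) = q ` U"
    using US q_surj by auto
  have "homeomorphic_map (subtopology Y U) (subtopology W (q ` U)) q"
  proof (rule bijective_open_imp_homeomorphic_map)
    show "continuous_map (subtopology Y U) (subtopology W (q ` U)) q"
      using q_cont by (auto simp: continuous_map_in_subtopology continuous_map_from_subtopology)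
    show "open_map (subtopology Y U) (subtopology W (q ` U)) q"
      unfolding open_map_def using q_open U(1) US
      by (auto simp: openin_open_subtopology q_open)
  qed (use inj tU in auto)
  then obtain s where s: "homeomorphic_maps (subtopology Y U) (subtopology W (q ` U)) q s"
    using homeomorphic_map_maps by blast
  show ?thesis
  proof
    show "openin W (q ` U)" by (rule q_open[OF U(1)])
    show "w \<in> q ` U" using y U by blast
    show "continuous_map (subtopology W (q ` U)) Y s"
      using s by (auto simp: homeomorphic_maps_def continuous_map_in_subtopology)
    show "\<forall>v\<in>q ` U. q (s v) = v"
      using s tU by (auto simp: homeomorphic_maps_def)
  qed
qed

text \<open>The places where \<open>g\<close> equals \<open>f\<close> and where it equals the
  translate of \<open>f\<close> are closed, cover \<open>Z\<close>, and are disjoint by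
  freeness.\<close>

lemma lifts_connected:
  assumes Z: "connected_space Z" and f: "continuous_map Z Y f" and g: "continuous_map Z Y g"
    and eq: "\<And>z. z \<in> topspace Z \<Longrightarrow> q (f z) = q (g z)"
  shows "(\<forall>z\<in>topspace Z. g z = f z) \<or> (\<forall>z\<in>topspace Z. g z = \<tau> (f z))"
proof -
  have fgY: "f z \<in> topspace Y" "g z \<in> topspace Y" if "z \<in> topspace Z" for z
    using f g that by (auto simp: continuous_map_def)
  let ?A = "{z \<in> topspace Z. g z = f z}" and ?B = "{z \<in> topspace Z. g z = (\<tau> \<circ> f) z}"
  have "closedin Z ?A" "closedin Z ?B"
    using closedin_continuous_maps_eq[OF Hausdorff g f]
      closedin_continuous_maps_eq[OF Hausdorff g continuous_map_compose[OF f \<tau>_cont]] by auto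
  moreover have "?A \<union> ?B = topspace Z" using q_eq[OF fgY] eq by auto
  moreover have "?A \<inter> ?B = {}" using free fgY by fastforce
  ultimately have "?A = {} \<or> ?B = {}"
    using Z unfolding connected_space_closedin_eq by blast
  then show ?thesis using \<open>?A \<union> ?B = topspace Z\<close> by auto
qed

text \<open>On the connected overlap the two lifts agree or differ by the involution; in the second
  case one of them is replaced by its translate.\<close>

lemma lift_glue:
  assumes K: "K = K1 \<union> K2" and cl: "closedin (subtopology T K) K1" "closedin (subtopology T K) K2"
    and conn: "connectedin T (K1 \<inter> K2)"
    and f1: "continuous_map (subtopology T K1) Y f1" "\<And>x. x \<in> K1 \<Longrightarrow> q (f1 x) = \<sigma> x"
    and f2: "continuous_map (subtopology T K2) Y f2" "\<And>x. x \<in> K2 \<Longrightarrow> q (f2 x) = \<sigma> x"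
  shows "\<exists>f. continuous_map (subtopology T K) Y f \<and> (\<forall>x\<in>K. q (f x) = \<sigma> x)"
proof -
  have KT: "K1 \<subseteq> topspace T" "K2 \<subseteq> topspace T"
    using closedin_subset[OF cl(1)] closedin_subset[OF cl(2)] by auto
  let ?Z = "subtopology T (K1 \<inter> K2)"
  have fY: "f1 x \<in> topspace Y" if "x \<in> K1" for x using f1(1) that KT by (auto simp: continuous_map_def)
  have f2Y: "f2 x \<in> topspace Y" if "x \<in> K2" for x using f2(1) that KT by (auto simp: continuous_map_def)
  have "continuous_map ?Z Y f1" "continuous_map ?Z Y f2"
    using f1(1) f2(1) by (auto intro: continuous_map_from_subtopology_mono)
  moreover have "connected_space ?Z" using conn by (simp add: connectedin_def)
  ultimately have "(\<forall>z\<in>topspace ?Z. f2 z = f1 z) \<or> (\<forall>z\<in>topspace ?Z. f2 z = \<tau> (f1 z))"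
    using f1(2) f2(2) by (intro lifts_connected) auto
  then have "\<exists>g. continuous_map (subtopology T K2) Y g \<and> (\<forall>x\<in>K2. q (g x) = \<sigma> x) \<and> (\<forall>x\<in>K1 \<inter> K2. g x = f1 x)"
  proof
    assume "\<forall>z\<in>topspace ?Z. f2 z = f1 z"
    then show ?thesis using f2 KT by (intro exI[of _ f2]) auto
  next
    assume r: "\<forall>z\<in>topspace ?Z. f2 z = \<tau> (f1 z)"
    show ?thesis
    proof (intro exI[of _ "\<tau> \<circ> f2"] conjI ballI)
      show "continuous_map (subtopology T K2) Y (\<tau> \<circ> f2)" by (rule continuous_map_compose[OF f2(1) \<tau>_cont])
      show "q ((\<tau> \<circ> f2) x) = \<sigma> x" if "x \<in> K2" for x using q_\<tau>[OF f2Y[OF that]] f2(2)[OF that] by simp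
      show "(\<tau> \<circ> f2) x = f1 x" if "x \<in> K1 \<inter> K2" for x
        using r that KT \<tau>_inv[OF fY] by auto
    qed
  qed
  then obtain g where g: "continuous_map (subtopology T K2) Y g" "\<forall>x\<in>K2. q (g x) = \<sigma> x" "\<forall>x\<in>K1 \<inter> K2. g x = f1 x"
    by blast
  define f where "f = (\<lambda>x. if x \<in> K1 then f1 x else g x)"
  have "continuous_map (subtopology T K) Y f"
  proof (rule continuous_map_closed_cover_3[where A = K1 and B = K2 and C = "{}"])
    show "topspace (subtopology T K) = K1 \<union> K2 \<union> {}" using K KT by auto
    have ss: "subtopology (subtopology T K) K1 = subtopology T K1" "subtopology (subtopology T K) K2 = subtopology T K2"
      by (simp_all add: subtopology_subtopology K Int_absorb1 Int_commute inf_sup_absorb)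
    show "continuous_map (subtopology (subtopology T K) K1) Y f"
      unfolding ss by (rule continuous_map_eq[OF f1(1)]) (auto simp: f_def)
    show "continuous_map (subtopology (subtopology T K) K2) Y f"
      unfolding ss by (rule continuous_map_eq[OF g(1)]) (use g(3) in \<open>auto simp: f_def\<close>)
  qed (use cl in auto)
  then show ?thesis using f1(2) g(2) K by (intro exI[of _ f]) (auto simp: f_def)
qed

text \<open>The simplex is cut by a coordinate grid so fine that \<open>\<sigma>\<close> lifts on
  each box through a local section. Lifts on neighbouring boxes are glued along their intersections,
  which are convex and so connected.\<close>

lemma simplex_lift:
  assumes \<sigma>: "singular_simplex p W \<sigma>"
  obtains \<sigma>' where "singular_simplex p Y \<sigma>'" "simplex_map p q \<sigma>' = \<sigma>"
proof -
  let ?T = "powertop_real UNIV :: (nat \<Rightarrow> real) topology" and ?\<Delta> = "standard_simplex p"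
  define L where "L = (\<lambda>K. \<exists>f. continuous_map (subtopology ?T K) Y f \<and> (\<forall>x\<in>K. q (f x) = \<sigma> x))"
  \<comment> \<open>Liftability is demanded for every subset of \<open>U\<close> in the simplex, so
    that it passes to any box that fits into \<open>U\<close>.\<close>
  define \<C> where "\<C> = {U. openin ?T U \<and> (\<forall>K\<subseteq>U \<inter> ?\<Delta>. L K)}"
  have cov: "?\<Delta> \<subseteq> \<Union>\<C>"
  proof
    fix x assume x: "x \<in> ?\<Delta>"
    then have "\<sigma> x \<in> topspace W" using \<sigma> singular_simplex_in_topspace by blast
    then obtain V s where V: "openin W V" "\<sigma> x \<in> V" "continuous_map (subtopology W V) Y s" "\<forall>v\<in>V. q (s v) = v"
      by (rule local_section)
    have c\<sigma>: "continuous_map (simplex_top p) W \<sigma>" using \<sigma> by (simp add: singular_simplex_def)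
    then have "openin (simplex_top p) {y \<in> topspace (simplex_top p). \<sigma> y \<in> V}"
      using V(1) by (rule openin_continuous_map_preimage)
    then obtain U where U: "openin ?T U" "{y \<in> topspace (simplex_top p). \<sigma> y \<in> V} = U \<inter> ?\<Delta>"
      unfolding openin_subtopology by blast
    have "L K" if K: "K \<subseteq> U \<inter> ?\<Delta>" for K
    proof -
      have KV: "\<sigma> y \<in> V" if "y \<in> K" for y using K U(2) that by blast
      have "continuous_map (subtopology ?T K) W \<sigma>"
        using c\<sigma> by (rule continuous_map_from_subtopology_mono) (use K in auto)
      then have "continuous_map (subtopology ?T K) (subtopology W V) \<sigma>"
        using KV by (auto simp: continuous_map_in_subtopology)
      then have "continuous_map (subtopology ?T K) Y (s \<circ> \<sigma>)" using V(3) continuous_map_compose by blast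
      then show ?thesis unfolding L_def using V(4) KV by (intro exI[of _ "s \<circ> \<sigma>"]) auto
    qed
    moreover have "x \<in> U" using U(2) x V(2) by auto
    ultimately show "x \<in> \<Union>\<C>" using U(1) unfolding \<C>_def by blast
  qed
  \<comment> \<open>\<open>llemma\<close> is the Lebesgue number lemma for the standard simplex,
    with distances measured coordinatewise.\<close>
  obtain d where d: "0 < d" "\<And>K. \<lbrakk>K \<subseteq> ?\<Delta>; \<And>x y i. \<lbrakk>i \<le> p; x \<in> K; y \<in> K\<rbrakk> \<Longrightarrow> \<bar>x i - y i\<bar> \<le> d\<rbrakk> \<Longrightarrow> \<exists>U. U \<in> \<C> \<and> K \<subseteq> U"
  proof (rule llemma[of p \<C>])
    show "?\<Delta> \<subseteq> \<Union>\<C>" by (rule cov)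
    show "openin ?T U" if "U \<in> \<C>" for U using that by (simp add: \<C>_def)
  qed auto
  have small: "L K" if K: "K \<subseteq> ?\<Delta>" "\<And>x y i. \<lbrakk>i \<le> p; x \<in> K; y \<in> K\<rbrakk> \<Longrightarrow> \<bar>x i - y i\<bar> \<le> d" for K
  proof -
    have "\<exists>U. U \<in> \<C> \<and> K \<subseteq> U" using K by (rule d(2))
    then obtain U where "U \<in> \<C> \<and> K \<subseteq> U" ..
    then show ?thesis using K(1) by (simp add: \<C>_def)
  qed
  \<comment> \<open>Corners are grid points, counted in units of the mesh \<open>d\<close>; natural
    number corners give the induction its measure.\<close>
  define box where "box = (\<lambda>(a :: nat \<Rightarrow> nat) b. {x \<in> ?\<Delta>. \<forall>i\<le>p. real (a i) * d \<le> x i \<and> x i \<le> real (b i) * d})"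
  have box_closed: "closedin ?T (box a b)" for a b
  proof -
    have pr: "continuous_map ?T euclideanreal (\<lambda>x. x i)" for i
      by (rule continuous_map_product_projection) simp
    have c: "closedin ?T {x. x i \<in> {real (a i) * d..real (b i) * d}}" for i
      using closedin_continuous_map_preimage[OF pr, of "{real (a i) * d..real (b i) * d}" i] by simp
    have "closedin ?T (\<Inter>i\<in>{..p}. {x. x i \<in> {real (a i) * d..real (b i) * d}})"
      by (rule closedin_INT) (use c in simp_all)
    then have "closedin ?T (?\<Delta> \<inter> (\<Inter>i\<in>{..p}. {x. x i \<in> {real (a i) * d..real (b i) * d}}))"
      by (rule closedin_Int[OF closedin_standard_simplex])
    moreover have "box a b = ?\<Delta> \<inter> (\<Inter>i\<in>{..p}. {x. x i \<in> {real (a i) * d..real (b i) * d}})"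
      unfolding box_def by (rule Set.set_eqI) (simp only: mem_Collect_eq Int_iff INT_iff atLeastAtMost_iff Ball_def atMost_iff)
    ultimately show ?thesis by (simp only:)
  qed
  have box_convex: "(\<lambda>i. (1 - u) * x i + u * y i) \<in> box a b"
    if xy: "x \<in> box a b" "y \<in> box a b" and u: "0 \<le> u" "u \<le> 1" for x y u a b
  proof -
    have "real (a i) * d \<le> (1 - u) * x i + u * y i" "(1 - u) * x i + u * y i \<le> real (b i) * d" if "i \<le> p" for i
    proof -
      have xi: "real (a i) * d \<le> x i" "x i \<le> real (b i) * d" "real (a i) * d \<le> y i" "y i \<le> real (b i) * d"
        using xy that by (auto simp: box_def)
      have "(1 - u) * (real (a i) * d) + u * (real (a i) * d) \<le> (1 - u) * x i + u * y i"
        "(1 - u) * x i + u * y i \<le> (1 - u) * (real (b i) * d) + u * (real (b i) * d)"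
        using xi u by (intro add_mono mult_left_mono; simp)+
      then show "real (a i) * d \<le> (1 - u) * x i + u * y i" "(1 - u) * x i + u * y i \<le> real (b i) * d"
        by (simp_all add: algebra_simps)
    qed
    then show ?thesis using xy u convex_standard_simplex[of x p y u] by (auto simp: box_def)
  qed
  have box_lift: "L (box a b)" for a b
  proof (induction "\<Sum>i\<le>p. b i - a i" arbitrary: a b rule: less_induct)
    case less
    show ?case
    proof (cases "\<forall>i\<le>p. b i \<le> Suc (a i)")
      case True
      show ?thesis
      proof (rule small)
        fix x y i assume i: "i \<le> p" and xy: "x \<in> box a b" "y \<in> box a b"
        have "real (b i) * d \<le> (real (a i) + 1) * d" using True i d(1) by (intro mult_right_mono) auto
        moreover have "real (a i) * d \<le> x i" "x i \<le> real (b i) * d" "real (a i) * d \<le> y i" "y i \<le> real (b i) * d"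
          using i xy by (auto simp: box_def)
        ultimately show "\<bar>x i - y i\<bar> \<le> d" by (simp add: algebra_simps)
      qed (auto simp: box_def)
    next
      case False
      then obtain j where j: "j \<le> p" "Suc (a j) < b j" by (meson not_le)
      \<comment> \<open>Cutting off one layer of the grid at coordinate \<open>j\<close>. Both parts
        have smaller total side length, and they meet in the box whose coordinate \<open>j\<close>
        is pinned to \<open>m\<close>.\<close>
      define m where "m = Suc (a j)"
      let ?K1 = "box a (b(j := m))" and ?K2 = "box (a(j := m)) b"
      have sum1: "(\<Sum>i\<le>p. (b(j := m)) i - a i) < (\<Sum>i\<le>p. b i - a i)"
        by (rule sum_strict_mono_ex1) (use j in \<open>auto simp: m_def intro!: bexI[of _ j]\<close>)
      have sum2: "(\<Sum>i\<le>p. b i - (a(j := m)) i) < (\<Sum>i\<le>p. b i - a i)"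
        by (rule sum_strict_mono_ex1) (use j in \<open>auto simp: m_def intro!: bexI[of _ j]\<close>)
      have mono: "real (a j) * d \<le> real m * d" "real m * d \<le> real (b j) * d"
        using j d(1) by (auto simp: m_def intro!: mult_right_mono)
      have K: "box a b = ?K1 \<union> ?K2"
      proof (intro equalityI subsetI)
        fix x assume x: "x \<in> box a b"
        show "x \<in> ?K1 \<union> ?K2"
        proof (cases "x j \<le> real m * d")
          case True then have "x \<in> ?K1" using x by (auto simp: box_def)
          then show ?thesis ..
        next
          case False then have "x \<in> ?K2" using x by (auto simp: box_def)
          then show ?thesis ..
        qed
      next
        fix x assume "x \<in> ?K1 \<union> ?K2"
        then have "x \<in> ?\<Delta>" and "(\<forall>i\<le>p. real (a i) * d \<le> x i \<and> x i \<le> real ((b(j := m)) i) * d) \<or>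
            (\<forall>i\<le>p. real ((a(j := m)) i) * d \<le> x i \<and> x i \<le> real (b i) * d)"
          by (auto simp: box_def)
        moreover from this(2) have "real (a i) * d \<le> x i \<and> x i \<le> real (b i) * d" if "i \<le> p" for i
          using that mono by (cases "i = j") (auto simp del: of_nat_Suc split: if_splits dest!: spec[of _ i])
        ultimately show "x \<in> box a b" by (auto simp: box_def)
      qed
      have "?K1 \<inter> ?K2 = box (a(j := m)) (b(j := m))"
      proof (intro equalityI subsetI)
        fix x assume x: "x \<in> box (a(j := m)) (b(j := m))"
        then have "x j = real m * d" using j(1) by (auto simp: box_def intro!: antisym dest!: spec[of _ j])
        then show "x \<in> ?K1 \<inter> ?K2" using x mono by (auto simp: box_def split: if_splits)
      next
        fix x assume "x \<in> ?K1 \<inter> ?K2"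
        then show "x \<in> box (a(j := m)) (b(j := m))" by (auto simp: box_def split: if_splits)
      qed
      then have conn: "connectedin ?T (?K1 \<inter> ?K2)"
        using connectedin_convex_powertop[of "box (a(j := m)) (b(j := m))"] box_convex by simp
      obtain f1 where "continuous_map (subtopology ?T ?K1) Y f1 \<and> (\<forall>x\<in>?K1. q (f1 x) = \<sigma> x)"
        using less[OF sum1] unfolding L_def ..
      then have f1: "continuous_map (subtopology ?T ?K1) Y f1" "\<And>x. x \<in> ?K1 \<Longrightarrow> q (f1 x) = \<sigma> x" by auto
      obtain f2 where "continuous_map (subtopology ?T ?K2) Y f2 \<and> (\<forall>x\<in>?K2. q (f2 x) = \<sigma> x)"
        using less[OF sum2] unfolding L_def ..
      then have f2: "continuous_map (subtopology ?T ?K2) Y f2" "\<And>x. x \<in> ?K2 \<Longrightarrow> q (f2 x) = \<sigma> x" by auto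
      have sub: "?K1 \<subseteq> box a b" "?K2 \<subseteq> box a b" unfolding K by simp_all
      note cl = closedin_subset_topspace[OF box_closed sub(1)] closedin_subset_topspace[OF box_closed sub(2)]
      show ?thesis unfolding L_def
        by (rule lift_glue[OF K cl conn f1 f2])
    qed
  qed
  \<comment> \<open>Coordinates of the simplex are at most 1, so \<open>N\<close> layers in every
    direction exhaust it.\<close>
  obtain N :: nat where N: "1 \<le> real N * d"
    using reals_Archimedean3[OF d(1)] by (metis less_eq_real_def)
  have "box (\<lambda>_. 0) (\<lambda>_. N) = ?\<Delta>"
  proof -
    have "x i \<le> real N * d" if "x \<in> ?\<Delta>" for x i
      using that N unfolding standard_simplex_def by (smt (verit) mem_Collect_eq)
    moreover have "0 \<le> x i" if "x \<in> ?\<Delta>" for x i using that by (simp add: standard_simplex_def)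
    ultimately show ?thesis by (auto simp: box_def)
  qed
  then have "L ?\<Delta>" using box_lift[of "\<lambda>_. 0" "\<lambda>_. N"] by simp
  then obtain f where "continuous_map (simplex_top p) Y f \<and> (\<forall>x\<in>?\<Delta>. q (f x) = \<sigma> x)"
    unfolding L_def ..
  then have f: "continuous_map (simplex_top p) Y f" "\<forall>x\<in>?\<Delta>. q (f x) = \<sigma> x" by auto
  show ?thesis
  proof
    show "singular_simplex p Y (restrict f ?\<Delta>)"
      unfolding singular_simplex_def by (auto intro!: continuous_map_eq[OF f(1)])
    show "simplex_map p q (restrict f ?\<Delta>) = \<sigma>"
    proof
      fix x
      show "simplex_map p q (restrict f ?\<Delta>) x = \<sigma> x"
        using f(2) \<sigma> by (cases "x \<in> ?\<Delta>") (auto simp: simplex_map_def singular_simplex_def extensional_def)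
    qed
  qed
qed

lemma simplex_lift_unique:
  assumes f: "singular_simplex p Y f" and g: "singular_simplex p Y g" and eq: "simplex_map p q f = simplex_map p q g"
  shows "g = f \<or> g = simplex_map p \<tau> f"
proof -
  have "connected_space (simplex_top p)"
    using connectedin_standard_simplex by (simp add: connectedin_def)
  moreover have "continuous_map (simplex_top p) Y f" "continuous_map (simplex_top p) Y g"
    using f g by (auto simp: singular_simplex_def)
  moreover have "q (f z) = q (g z)" if "z \<in> standard_simplex p" for z
    using fun_cong[OF eq, of z] that by (simp add: simplex_map_def)
  ultimately have "(\<forall>z\<in>standard_simplex p. g z = f z) \<or> (\<forall>z\<in>standard_simplex p. g z = \<tau> (f z))"
    using lifts_connected[of "simplex_top p" f g] by simp
  then show ?thesis
  proof
    assume "\<forall>z\<in>standard_simplex p. g z = f z"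
    then have "g = f" using f g by (auto simp: singular_simplex_def intro: extensionalityI)
    then show ?thesis ..
  next
    assume "\<forall>z\<in>standard_simplex p. g z = \<tau> (f z)"
    then have "g = simplex_map p \<tau> f"
      using g by (auto simp: singular_simplex_def simplex_map_def extensional_def fun_eq_iff)
    then show ?thesis ..
  qed
qed

text \<open>Lifts of a simplex exist and are unique up to the involution, so an invariant cochain of
  \<open>Y\<close> defines one on \<open>W\<close> by evaluation at any lift. The cocycle condition
  is tested on a lift as well.\<close>

lemma pull_cocycles:
  "pull Y q p ` cyc (coch W id {}) (cob W) p = cyc (coch Y \<tau> {}) (cob Y) p"
proof (intro equalityI subsetI)
  have Y: "inv_pair Y \<tau> {}" by (simp add: inv_pair_def \<tau>_cont \<tau>_inv)
  have qm: "pair_map Y \<tau> {} W id {} q" by (simp add: pair_map_def q_cont q_\<tau>)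
  fix c assume "c \<in> pull Y q p ` cyc (coch W id {}) (cob W) p"
  then show "c \<in> cyc (coch Y \<tau> {}) (cob Y) p"
    using cmap_cyc[OF cmap_pull[OF Y qm] cplx_coch[OF inv_pair_id]] by blast
next
  fix c assume c: "c \<in> cyc (coch Y \<tau> {}) (cob Y) p"
  then have cc: "c \<in> coch Y \<tau> {} p" "cob Y p c = 0" by (auto simp: cyc_def)
  define l where "l = (\<lambda>\<sigma>. SOME f. singular_simplex p Y f \<and> simplex_map p q f = \<sigma>)"
  have l: "singular_simplex p Y (l \<sigma>) \<and> simplex_map p q (l \<sigma>) = \<sigma>" if "singular_simplex p W \<sigma>" for \<sigma>
  proof -
    have "\<exists>f. singular_simplex p Y f \<and> simplex_map p q f = \<sigma>" by (rule simplex_lift[OF that]) blast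
    from someI_ex[OF this] show ?thesis by (simp add: l_def)
  qed
  define c' where "c' = (\<lambda>\<sigma>. if singular_simplex p W \<sigma> then c (l \<sigma>) else 0)"
  have c': "c' \<in> coch W id {} p"
  proof (rule cochI)
    fix \<sigma> assume "singular_simplex p W \<sigma>"
    then show "c' (simplex_map p id \<sigma>) = c' \<sigma>"
      using simplex_map_id_singular by metis
  qed (auto simp: c'_def nonempty_standard_simplex)
  have pc: "pull Y q p c' = c"
  proof
    fix \<sigma>
    show "pull Y q p c' \<sigma> = c \<sigma>"
    proof (cases "singular_simplex p Y \<sigma>")
      case True
      let ?s = "simplex_map p q \<sigma>"
      have s: "singular_simplex p W ?s" using singular_simplex_simplex_map[OF True q_cont] .
      have "l ?s = \<sigma> \<or> l ?s = simplex_map p \<tau> \<sigma>"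
        using simplex_lift_unique[OF True] l[OF s] by simp
      then have "c (l ?s) = c \<sigma>" using cochD(3)[OF cc(1) True] by auto
      then show ?thesis using True s by (simp add: pull_def c'_def)
    qed (use cochD(1)[OF cc(1)] in \<open>simp add: pull_def\<close>)
  qed
  have "cob W p c' \<sigma> = 0" for \<sigma>
  proof (cases "singular_simplex (Suc p) W \<sigma>")
    case True
    then obtain \<sigma>' where \<sigma>': "singular_simplex (Suc p) Y \<sigma>'" "simplex_map (Suc p) q \<sigma>' = \<sigma>"
      using simplex_lift by blast
    have "pull Y q (Suc p) (cob W p c') \<sigma>' = 0"
      using cob_pull[OF q_cont, of p c'] pc cc(2) by (metis zero_fun_apply)
    then show ?thesis using \<sigma>' by (simp add: pull_def)
  qed (simp add: cob_def)
  then have "c' \<in> cyc (coch W id {}) (cob W) p" using c' by (auto simp: cyc_def)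
  then show "c \<in> pull Y q p ` cyc (coch W id {}) (cob W) p" using pc by blast
qed

end

section \<open>The Gysin sequence of the double cover and localisation\<close>

locale gysin_data = involution_space X \<tau> for X :: "'a topology" and \<tau> :: "'a \<Rightarrow> 'a" +
  fixes E :: "'e topology" and \<epsilon> :: "'e \<Rightarrow> 'e" and e :: 'e
  assumes E_Hausdorff: "Hausdorff_space E" and E_contractible: "contractible_space E"
    and \<epsilon>_cont: "continuous_map E E \<epsilon>" and \<epsilon>_inv: "y \<in> topspace E \<Longrightarrow> \<epsilon> (\<epsilon> y) = y"
    and \<epsilon>_free: "y \<in> topspace E \<Longrightarrow> \<epsilon> y \<noteq> y" and e: "e \<in> topspace E"
begin

abbreviation Y :: "('a \<times> 'e) topology"
  where "Y \<equiv> prod_topology X E"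

abbreviation s :: "'a \<times> 'e \<Rightarrow> 'a \<times> 'e"
  where "s \<equiv> map_prod \<tau> \<epsilon>"

definition b :: "nat \<Rightarrow> nat"
  where "b n = coh X id {} n"

definition hG :: "nat \<Rightarrow> nat"
  where "hG n = coh Y s {} n"

text \<open>
  The space \<open>Y\<close> covers the Borel construction twice, so the cocycles of the latter are the invariant
  cocycles of \<open>Y\<close>: \<open>hG\<close> counts Borel cohomology and \<open>a\<close> the image of the forgetful map.
\<close>

definition fibre_classes :: "nat \<Rightarrow> 'a cochain set"
  where "fibre_classes n = pull X (\<lambda>x. (x, e)) n ` cyc (coch Y s {}) (cob Y) n"

definition a :: "nat \<Rightarrow> nat"
  where "a n = idx (ssum (fibre_classes n) (bnd (coch X id {}) (cob X) n)) (bnd (coch X id {}) (cob X) n)"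

lemma s_cont: "continuous_map Y Y s"
  using \<tau>_cont \<epsilon>_cont by (simp add: map_prod_def continuous_map_prod_top)

lemma s_inv: "y \<in> topspace Y \<Longrightarrow> s (s y) = y"
  using \<tau>_inv \<epsilon>_inv by (cases y) auto

lemma s_free: "y \<in> topspace Y \<Longrightarrow> s y \<noteq> y"
  using \<epsilon>_free by (cases y) auto

lemma inv_pair_Y: "inv_pair Y s {}"
  using s_cont s_inv by (auto simp: inv_pair_def)

lemma coch_Y_subset: "coch Y s {} p \<subseteq> coch Y id {} p"
proof
  fix c assume c: "c \<in> coch Y s {} p"
  show "c \<in> coch Y id {} p"
  proof (rule cochI)
    fix \<sigma> assume "singular_simplex p Y \<sigma>"
    then show "c (simplex_map p id \<sigma>) = c \<sigma>" using simplex_map_id_singular by metis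
  qed (use cochD(1,2)[OF c] in auto)
qed

text \<open>The transfer \<open>1 + s\<close>. Modulo 2 it equals \<open>1 - s\<close>, so the
  invariant cochains are its kernel and, as the action is free, also its image.\<close>

definition tr :: "nat \<Rightarrow> ('a \<times> 'e) cochain \<Rightarrow> ('a \<times> 'e) cochain"
  where "tr p c = c + pull Y s p c"

lemma simplex_s_s: "singular_simplex p Y \<sigma> \<Longrightarrow> simplex_map p s (simplex_map p s \<sigma>) = \<sigma>"
proof -
  assume \<sigma>: "singular_simplex p Y \<sigma>"
  have "simplex_map p (s \<circ> s) \<sigma> = \<sigma>"
    by (rule simplex_map_id_gen[OF \<sigma>]) (use s_inv in simp)
  then show ?thesis by (simp add: simplex_map_compose)
qed

lemma simplex_s: "singular_simplex p Y \<sigma> \<Longrightarrow> singular_simplex p Y (simplex_map p s \<sigma>)"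
  by (rule singular_simplex_simplex_map[OF _ s_cont])

lemma simplex_s_free: "singular_simplex p Y \<sigma> \<Longrightarrow> simplex_map p s \<sigma> \<noteq> \<sigma>"
proof
  assume \<sigma>: "singular_simplex p Y \<sigma>" and eq: "simplex_map p s \<sigma> = \<sigma>"
  obtain x where x: "x \<in> standard_simplex p" using nonempty_standard_simplex by blast
  have "s (\<sigma> x) = \<sigma> x" using fun_cong[OF eq, of x] x by (simp add: simplex_map_def)
  then show False using s_free[OF singular_simplex_in_topspace[OF \<sigma> x]] by simp
qed

lemma tr_in: "c \<in> coch Y id {} p \<Longrightarrow> tr p c \<in> coch Y s {} p"
proof (rule cochI)
  fix \<sigma> assume c: "c \<in> coch Y id {} p"
  show "\<not> singular_simplex p Y \<sigma> \<Longrightarrow> tr p c \<sigma> = 0" using cochD(1)[OF c] by (simp add: tr_def pull_def)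
  show "tr p c (simplex_map p s \<sigma>) = tr p c \<sigma>" if "singular_simplex p Y \<sigma>"
    using that simplex_s[OF that] simplex_s_s[OF that] by (simp add: tr_def pull_def add.commute)
qed (auto simp: nonempty_standard_simplex)

lemma tr_eq_0: "c \<in> coch Y id {} p \<Longrightarrow> tr p c = 0 \<longleftrightarrow> c \<in> coch Y s {} p"
proof
  assume c: "c \<in> coch Y id {} p" and 0: "tr p c = 0"
  show "c \<in> coch Y s {} p"
  proof (rule cochI)
    fix \<sigma> assume "singular_simplex p Y \<sigma>"
    then have "c \<sigma> + c (simplex_map p s \<sigma>) = 0" using fun_cong[OF 0, of \<sigma>] by (simp add: tr_def pull_def)
    then show "c (simplex_map p s \<sigma>) = c \<sigma>" by (cases "c \<sigma>"; cases "c (simplex_map p s \<sigma>)") auto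
  qed (use cochD(1,2)[OF c] in auto)
next
  assume c: "c \<in> coch Y s {} p"
  have "c \<sigma> + pull Y s p c \<sigma> = 0" for \<sigma>
    using cochD(1)[OF c, of \<sigma>] cochD(3)[OF c, of \<sigma>]
    by (cases "singular_simplex p Y \<sigma>"; cases "c \<sigma>") (auto simp: pull_def)
  then show "tr p c = 0" by (simp add: tr_def fun_eq_iff)
qed

text \<open>Since the action is free, a choice of one simplex in each orbit splits the transfer.\<close>

lemma tr_surj: "c \<in> coch Y s {} p \<Longrightarrow> \<exists>c'\<in>coch Y id {} p. tr p c' = c"
proof
  assume c: "c \<in> coch Y s {} p"
  define r where "r = (\<lambda>\<sigma>. SOME \<rho>. \<rho> \<in> {\<sigma>, simplex_map p s \<sigma>})"
  have r: "r \<sigma> = \<sigma> \<or> r \<sigma> = simplex_map p s \<sigma>" for \<sigma>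
    using someI[of "\<lambda>\<rho>. \<rho> \<in> {\<sigma>, simplex_map p s \<sigma>}" \<sigma>] by (auto simp: r_def)
  have rs: "r (simplex_map p s \<sigma>) = r \<sigma>" if "singular_simplex p Y \<sigma>" for \<sigma>
    unfolding r_def simplex_s_s[OF that] by (simp add: insert_commute[of "simplex_map p s \<sigma>" \<sigma>])
  define c' where "c' = (\<lambda>\<sigma>. if r \<sigma> = \<sigma> then c \<sigma> else 0)"
  have "c' \<in> coch Y id {} p"
  proof (rule cochI)
    fix \<sigma> assume "singular_simplex p Y \<sigma>"
    then show "c' (simplex_map p id \<sigma>) = c' \<sigma>" using simplex_map_id_singular by metis
  qed (use cochD(1,2)[OF c] in \<open>auto simp: c'_def\<close>)
  moreover have "tr p c' \<sigma> = c \<sigma>" for \<sigma>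
  proof (cases "singular_simplex p Y \<sigma>")
    case True
    have "r \<sigma> = \<sigma> \<longleftrightarrow> r (simplex_map p s \<sigma>) \<noteq> simplex_map p s \<sigma>"
      using r[of \<sigma>] rs[OF True] simplex_s_free[OF True] by auto
    then show ?thesis
      using True cochD(3)[OF c True] by (auto simp: tr_def pull_def c'_def)
  qed (use cochD(1)[OF c] in \<open>auto simp: tr_def pull_def c'_def\<close>)
  ultimately show "tr p c' = c" "c' \<in> coch Y id {} p" by auto
qed

lemma cmap_tr: "cmap (coch Y id {}) (cob Y) (coch Y s {}) (cob Y) tr"
  unfolding cmap_def
proof (intro conjI allI ballI)
  fix p c c' show "tr p (c - c') = tr p c - tr p c'"
    unfolding tr_def by (rule ext) (simp add: pull_def ac_simps)
next
  fix p c
  have "cob Y p (c + pull Y s p c) = cob Y p c + cob Y p (pull Y s p c)"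
    by (rule ext) (simp add: cob_def sum.distrib del: sum.atMost_Suc)
  then show "tr (Suc p) (cob Y p c) = cob Y p (tr p c)"
    by (simp add: tr_def cob_pull[OF s_cont])
qed (rule tr_in)

text \<open>The analogue of \<open>a\<close> on \<open>Y\<close>, where the exact sequence lives:
  the order of the image of invariant cohomology in H^n(Y).\<close>

definition a' :: "nat \<Rightarrow> nat"
  where "a' n = idx (ssum (cyc (coch Y s {}) (cob Y) n) (bnd (coch Y id {}) (cob Y) n)) (bnd (coch Y id {}) (cob Y) n)"

text \<open>In the exact sequence of the transfer the outer complexes coincide. It gives hG(n+1) =
  a'(n+1) x, hG(n) = x y and |H^n(Y)| = y a'(n); eliminating \<open>x\<close> and \<open>y\<close>
  leaves the relation, in a form that remains valid if some order is 0.\<close>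

lemma gysin_a':
  "hG (Suc n) * coh Y id {} n = a' (Suc n) * a' n * hG n" "hG 0 = a' 0"
proof -
  have ker: "coch Y s {} p = {c \<in> coch Y id {} p. tr p c = 0}" for p
    using tr_eq_0 coch_Y_subset by blast
  obtain x y where "hcard (coch Y s {}) (cob Y) (Suc n) = a' (Suc n) * x"
    "hcard (coch Y s {}) (cob Y) n = x * y" "hcard (coch Y id {}) (cob Y) n = y * a' n"
    unfolding a'_def
    by (rule hcard_short_exact[OF cplx_coch[OF inv_pair_Y] cplx_coch[OF inv_pair_id] cplx_coch[OF inv_pair_Y] cmap_tr tr_surj ker, of n])
  then show "hG (Suc n) * coh Y id {} n = a' (Suc n) * a' n * hG n"
    by (simp add: hG_def coh_def)
  show "hG 0 = a' 0"
    unfolding a'_def hG_def coh_def by (rule hcard_short_exact_0[OF cplx_coch[OF inv_pair_Y]])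
qed

section \<open>Restriction to the fibre\<close>

lemma slice_equivalence:
  shows "z \<in> cyc (coch Y id {}) (cob Y) p \<Longrightarrow>
      pull X (\<lambda>x. (x, e)) p z \<in> bnd (coch X id {}) (cob X) p \<longleftrightarrow> z \<in> bnd (coch Y id {}) (cob Y) p"
    and "coh X id {} p = coh Y id {} p"
proof -
  let ?i = "\<lambda>x. (x, e)"
  have i: "pair_map X id {} Y id {} ?i"
    using e by (simp add: pair_map_def continuous_map_pairwise o_def)
  have f: "pair_map Y id {} X id {} fst"
    by (simp add: pair_map_def continuous_map_fst)
  have fi: "equi_homotopic X id {} X id {} id (fst \<circ> ?i)"
    by (rule equi_homotopic_refl) (auto simp: pair_map_def)
  have "homotopic_with (\<lambda>h. True) Y Y id (?i \<circ> fst)"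
  proof -
    have "homotopic_with (\<lambda>h. True) E E id (\<lambda>y. e)"
      using E_contractible e by (simp add: contractible_space_alt)
    then obtain h where h: "continuous_map (cyl E) E h" "\<And>y. h (0, y) = y" "\<And>y. h (1, y) = e"
      by (auto simp: homotopic_with_def)
    define k where "k = (\<lambda>z :: real \<times> ('a \<times> 'e). (fst (snd z), h (fst z, snd (snd z))))"
    have "continuous_map (cyl Y) X (\<lambda>z. fst (snd z))"
      using continuous_map_compose[OF continuous_map_snd continuous_map_fst] by (simp add: o_def)
    moreover have "continuous_map (cyl Y) (cyl E) (\<lambda>z. (fst z, snd (snd z)))"
    proof -
      have "continuous_map (cyl Y) E (snd \<circ> snd)"
        by (rule continuous_map_compose[OF continuous_map_snd continuous_map_snd])
      then show ?thesis
        by (intro continuous_map_pairedI continuous_map_fst) (simp add: o_def)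
    qed
    then have "continuous_map (cyl Y) E (h \<circ> (\<lambda>z. (fst z, snd (snd z))))"
      using h(1) by (rule continuous_map_compose)
    ultimately have "continuous_map (cyl Y) Y k"
      unfolding k_def by (intro continuous_map_pairedI) (simp_all add: o_def)
    then show ?thesis
      unfolding homotopic_with_def using h(2,3) by (intro exI[of _ k]) (auto simp: k_def)
  qed
  then have if': "equi_homotopic Y id {} Y id {} id (?i \<circ> fst)" by (rule equi_homotopic_if_homotopic)
  note HE = coh_homotopy_equivalence[OF inv_pair_id inv_pair_id i f fi if']
  show "z \<in> cyc (coch Y id {}) (cob Y) p \<Longrightarrow>
      pull X ?i p z \<in> bnd (coch X id {}) (cob X) p \<longleftrightarrow> z \<in> bnd (coch Y id {}) (cob Y) p"
    by (rule HE(1))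
  show "coh X id {} p = coh Y id {} p" by (rule HE(3))
qed

lemma slice_map: "pair_map X id {} Y id {} (\<lambda>x. (x, e))"
  using e by (simp add: pair_map_def continuous_map_pairwise o_def)

lemmas cmap_slice = cmap_pull[OF inv_pair_id slice_map]

lemma cyc_Y_subset: "cyc (coch Y s {}) (cob Y) n \<subseteq> cyc (coch Y id {}) (cob Y) n"
  using coch_Y_subset by (auto simp: cyc_def)

lemma fibre_classes_subset: "fibre_classes n \<subseteq> cyc (coch X id {}) (cob X) n"
  unfolding fibre_classes_def
  using cmap_cyc[OF cmap_slice cplx_coch[OF inv_pair_id]] cyc_Y_subset by blast

lemma sgrp_fibre_classes: "sgrp (fibre_classes n)"
  unfolding fibre_classes_def
  by (rule sgrp_image[OF sgrp_cyc[OF cplx_coch[OF inv_pair_Y]]]) (auto simp: pull_def fun_eq_iff)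

text \<open>\<open>E\<close> is contractible, so restriction to the slice at \<open>e\<close> is
  injective on classes, and by definition it maps the classes counted by \<open>a'\<close> onto
  those counted by \<open>a\<close>.\<close>

lemma a_eq_a': "a n = a' n"
proof -
  let ?i = "\<lambda>x. (x, e)"
  let ?BY = "bnd (coch Y id {}) (cob Y) n" and ?BX = "bnd (coch X id {}) (cob X) n" and ?Z = "cyc (coch Y s {}) (cob Y) n"
  note cY = cplx_coch[OF inv_pair_id, of Y] and cX = cplx_coch[OF inv_pair_id, of X]
  have sZ: "sgrp ?Z" by (rule sgrp_cyc[OF cplx_coch[OF inv_pair_Y]])
  have sub: "ssum ?Z ?BY \<subseteq> cyc (coch Y id {}) (cob Y) n"
    by (rule ssum_least[OF cyc_Y_subset bnd_subset_cyc[OF cY] sgrp_cyc[OF cY]])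
  have diff: "pull X ?i n (x - y) = pull X ?i n x - pull X ?i n y" for x y
    by (auto simp: pull_def fun_eq_iff)
  have "a' n = a n"
    unfolding a_def a'_def
  proof (rule idx_iso[where f = "pull X ?i n"])
    fix z assume z: "z \<in> ssum ?Z ?BY"
    then obtain w where w: "w \<in> ?BY" "z - w \<in> ?Z" unfolding in_ssum_iff[OF sZ] by blast
    have "pull X ?i n w \<in> ?BX" by (rule cmap_bnd[OF cmap_slice cY w(1)])
    moreover have "pull X ?i n z - pull X ?i n w \<in> fibre_classes n"
      unfolding diff[symmetric] fibre_classes_def by (rule imageI[OF w(2)])
    ultimately show "pull X ?i n z \<in> ssum (fibre_classes n) ?BX"
      unfolding in_ssum_iff[OF sgrp_fibre_classes] by blast
    show "pull X ?i n z \<in> ?BX \<longleftrightarrow> z \<in> ?BY"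
      by (rule slice_equivalence(1)[OF subsetD[OF sub z]])
  next
    fix w assume "w \<in> ssum (fibre_classes n) ?BX"
    then obtain v where v: "v \<in> ?BX" "w - v \<in> fibre_classes n"
      unfolding in_ssum_iff[OF sgrp_fibre_classes] by blast
    then obtain z where z: "z \<in> ?Z" "w - v = pull X ?i n z" unfolding fibre_classes_def by blast
    have "z \<in> ssum ?Z ?BY" using ssum_upper[OF sZ sgrp_bnd[OF cY]] z(1) by blast
    moreover have "w - pull X ?i n z = v" unfolding z(2)[symmetric] by (rule ext) simp
    ultimately show "\<exists>z\<in>ssum ?Z ?BY. w - pull X ?i n z \<in> ?BX" using v(1) by metis
  qed (simp_all only: diff sgrp_ssum sZ sgrp_bnd[OF cY] sgrp_bnd[OF cX])
  then show ?thesis by simp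
qed

lemma gysin: "hG (Suc n) * b n = a (Suc n) * a n * hG n" "hG 0 = a 0"
  using gysin_a' by (simp_all add: a_eq_a' b_def slice_equivalence(2))

lemma a_dvd_b: "a n dvd b n"
proof -
  let ?B = "bnd (coch X id {}) (cob X) n" and ?Z = "cyc (coch X id {}) (cob X) n"
  note c = cplx_coch[OF inv_pair_id, of X]
  have "b n = idx ?Z (ssum (fibre_classes n) ?B) * a n"
    unfolding a_def b_def coh_def hcard_def
    by (intro idx_tower ssum_least conjunct2[OF ssum_upper] fibre_classes_subset bnd_subset_cyc[OF c]
        sgrp_cyc[OF c] sgrp_bnd[OF c] sgrp_ssum sgrp_fibre_classes)
  then show ?thesis by simp
qed

text \<open>The Gysin relation telescopes. It is kept free of division because the order of Borel
  cohomology could still be 0, that is, infinite, at this stage.\<close>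

lemma gysin_product: "hG N * (\<Prod>n<N. b n) = (\<Prod>n\<le>N. a n) * (\<Prod>n<N. a n)"
proof (induction N)
  case 0
  then show ?case by (simp add: gysin)
next
  case (Suc N)
  have "hG (Suc N) * (\<Prod>n<Suc N. b n) = (hG (Suc N) * b N) * (\<Prod>n<N. b n)" by simp
  also have "\<dots> = a (Suc N) * a N * (hG N * (\<Prod>n<N. b n))" by (simp add: gysin)
  also have "\<dots> = (\<Prod>n\<le>Suc N. a n) * (\<Prod>n<Suc N. a n)" by (simp add: Suc)
  finally show ?case .
qed

text \<open>Under a trivial action the projection of \<open>Y\<close> to \<open>X\<close> is
  invariant, and pulling a cocycle back along it gives an invariant extension of that
  cocycle.\<close>

lemma a_eq_b_if_trivial_action:
  assumes "\<And>x. x \<in> topspace X \<Longrightarrow> \<tau> x = x"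
  shows "a n = b n"
proof -
  let ?i = "\<lambda>x. (x, e)"
  note c = cplx_coch[OF inv_pair_id, of X]
  have f: "pair_map Y s {} X id {} fst"
    using assms by (auto simp: pair_map_def continuous_map_fst)
  have "cyc (coch X id {}) (cob X) n \<subseteq> fibre_classes n"
  proof
    fix z assume z: "z \<in> cyc (coch X id {}) (cob X) n"
    have "pull Y fst n z \<in> cyc (coch Y s {}) (cob Y) n"
      by (rule cmap_cyc[OF cmap_pull[OF inv_pair_Y f] c z])
    moreover have "pull X ?i n (pull Y fst n z) = z"
    proof -
      have "continuous_map X Y ?i" using slice_map by (simp add: pair_map_def)
      then have "pull X ?i n (pull Y fst n z) = pull X (fst \<circ> ?i) n z" by (rule pull_pull)
      also have "\<dots> = z" by (rule pull_id[of z X id "{}"]) (use z in \<open>auto simp: cyc_def\<close>)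
      finally show ?thesis .
    qed
    ultimately show "z \<in> fibre_classes n" unfolding fibre_classes_def by (metis imageI)
  qed
  then have "fibre_classes n = cyc (coch X id {}) (cob X) n" using fibre_classes_subset by blast
  moreover have "ssum (cyc (coch X id {}) (cob X) n) (bnd (coch X id {}) (cob X) n) = cyc (coch X id {}) (cob X) n"
    by (intro equalityI ssum_least bnd_subset_cyc[OF c] sgrp_cyc[OF c] conjunct1[OF ssum_upper] sgrp_bnd[OF c] order_refl)
  ultimately show ?thesis by (simp add: a_def b_def coh_def hcard_def)
qed

section \<open>Comparison with the fixed points\<close>

lemma gysin_data_fixed: "gysin_data (subtopology X Fix) \<tau> E \<epsilon> e"
proof unfold_locales
  show "Hausdorff_space (subtopology X Fix)" using X_Hausdorff by (rule Hausdorff_space_subtopology)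
  show "continuous_map (subtopology X Fix) (subtopology X Fix) \<tau>"
    using \<tau>_cont by (auto simp: continuous_map_in_subtopology continuous_map_from_subtopology)
qed (use \<tau>_inv E_Hausdorff E_contractible \<epsilon>_cont \<epsilon>_inv \<epsilon>_free e in auto)

theorem product_formula:
  assumes "CW_complex X C" "finite_cells C"
    and "\<And>n c. c \<in> C n \<Longrightarrow> \<tau> ` c \<in> C n \<and> (\<tau> ` c = c \<longrightarrow> (\<forall>u\<in>c. \<tau> u = u))"
  defines "D \<equiv> cw_dim C"
  shows "b n \<noteq> 0" and "D < n \<Longrightarrow> b n = 1"
    and "coh (subtopology X Fix) id {} n \<noteq> 0" and "D < n \<Longrightarrow> coh (subtopology X Fix) id {} n = 1"
    and "(\<Prod>n\<le>D. coh (subtopology X Fix) id {} n) * (\<Prod>n\<le>D. b n) = (\<Prod>n\<le>D. a n)\<^sup>2"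
proof -
  have E: "topspace E \<noteq> {}" using e by blast
  interpret o: equivariant_theory X \<tau> "\<lambda>k A. coh (subtopology X {z \<in> topspace X. id z \<in> A}) id {} k"
    by (rule equivariant_theory_ordinary)
  interpret f: equivariant_theory X \<tau> "\<lambda>k A. coh (subtopology (subtopology X Fix) {z \<in> topspace (subtopology X Fix). id z \<in> A}) id {} k"
    by (rule equivariant_theory_fixed)
  interpret r: equivariant_theory X \<tau> "\<lambda>k A. coh (subtopology Y {z \<in> topspace Y. fst z \<in> A}) s (Fix \<times> UNIV) k"
    by (rule equivariant_theory_relative[OF E_contractible E \<epsilon>_cont \<epsilon>_inv])
  have so: "subtopology X {z \<in> topspace X. id z \<in> topspace X} = X" by simp
  have "{z \<in> topspace (subtopology X Fix). id z \<in> topspace X} = topspace (subtopology X Fix)" by auto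
  then have sf: "subtopology (subtopology X Fix) {z \<in> topspace (subtopology X Fix). id z \<in> topspace X} = subtopology X Fix"
    by (simp only: subtopology_topspace)
  have "{z \<in> topspace Y. fst z \<in> topspace X} = topspace Y" by auto
  then have sr: "subtopology Y {z \<in> topspace Y. fst z \<in> topspace X} = Y" by (simp only: subtopology_topspace)
  note o = o.h_finite_CW_complex[OF assms(1,2,3), unfolded so]
  note f = f.h_finite_CW_complex[OF assms(1,2,3), unfolded sf]
  note r = r.h_finite_CW_complex[OF assms(1,2,3), unfolded sr]
  show b: "b n \<noteq> 0" "D < n \<Longrightarrow> b n = 1" for n using o by (auto simp: b_def D_def)
  show bF: "coh (subtopology X Fix) id {} n \<noteq> 0" "D < n \<Longrightarrow> coh (subtopology X Fix) id {} n = 1" for n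
    using f by (auto simp: D_def)
  interpret F: gysin_data "subtopology X Fix" \<tau> E \<epsilon> e by (rule gysin_data_fixed)
  \<comment> \<open>The first degree for which the relative groups vanish in this degree and the
    next, as \<open>coh_restrict_eq\<close> demands. The orders \<open>b\<close> and
    \<open>a\<close> are 1 here, so the products may stop at \<open>D\<close>.\<close>
  let ?N = "Suc D"
  have ip: "inv_pair Y s (Fix \<times> UNIV)"
    using s_cont s_inv \<tau>_inv by (auto simp: inv_pair_def)
  have "coh Y s {} ?N = coh (subtopology Y (Fix \<times> UNIV)) s {} ?N"
    by (rule coh_restrict_eq[OF ip]) (use r(2) in \<open>auto simp: D_def\<close>)
  moreover have "subtopology Y (Fix \<times> UNIV) = F.Y" by (simp add: subtopology_Times)
  ultimately have hN: "hG ?N = F.hG ?N" by (simp add: hG_def F.hG_def)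
  have aN: "a ?N = 1" using a_dvd_b[of ?N] b(2)[of ?N] by simp
  have 1: "hG ?N * (\<Prod>n\<le>D. b n) = (\<Prod>n\<le>D. a n)\<^sup>2"
    using gysin_product[of ?N] aN by (simp add: lessThan_Suc_atMost power2_eq_square)
  have aF: "F.a n = F.b n" for n by (rule F.a_eq_b_if_trivial_action) auto
  have FN: "F.b ?N = 1" using bF(2)[of ?N] by (simp add: F.b_def)
  \<comment> \<open>The Gysin product of the fixed set, with \<open>F.a\<close> replaced by
    \<open>F.b\<close>. Cancelling one product, which is nonzero because the groups are finite,
    determines the Borel cohomology of the fixed set in degree \<open>D + 1\<close>.\<close>
  have "F.hG ?N * (\<Prod>n\<le>D. F.b n) = (\<Prod>n\<le>D. F.b n) * (\<Prod>n\<le>D. F.b n)"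
    using F.gysin_product[of ?N] FN by (simp add: lessThan_Suc_atMost aF)
  moreover have "(\<Prod>n\<le>D. F.b n) \<noteq> 0" using bF(1) by (simp add: F.b_def)
  ultimately have "F.hG ?N = (\<Prod>n\<le>D. F.b n)" by simp
  then show "(\<Prod>n\<le>D. coh (subtopology X Fix) id {} n) * (\<Prod>n\<le>D. b n) = (\<Prod>n\<le>D. a n)\<^sup>2"
    using 1 hN by (simp add: F.b_def)
qed

end

section \<open>Groups of exponent two\<close>

definition exp2 :: "('m, 'b) monoid_scheme \<Rightarrow> bool"
  where "exp2 M \<longleftrightarrow> comm_group M \<and> (\<forall>x\<in>carrier M. x \<otimes>\<^bsub>M\<^esub> x = \<one>\<^bsub>M\<^esub>)"

lemma field_F2: "field F2"
proof -
  have UNIV_bit: "x = 0 \<or> x = 1" for x :: bit by (cases x) auto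
  have "abelian_group F2"
  proof (rule abelian_groupI)
    fix x assume "x \<in> carrier F2"
    have "x + x = 0" using UNIV_bit[of x] by auto
    then show "\<exists>y\<in>carrier F2. y \<oplus>\<^bsub>F2\<^esub> x = \<zero>\<^bsub>F2\<^esub>" by (intro bexI[of _ x]) simp_all
  qed (auto simp: ac_simps)
  moreover have "comm_monoid F2"
    by (rule comm_monoidI) (auto simp: ac_simps)
  ultimately have "cring F2"
    by (rule cringI) (simp add: distrib_right)
  moreover have "Units F2 = carrier F2 - {\<zero>\<^bsub>F2\<^esub>}"
    using UNIV_bit by (auto simp: Units_def)
  ultimately show ?thesis by (rule cring.cring_fieldI)
qed

lemma vectorspace_F2_vs:
  assumes "exp2 M" shows "vectorspace F2 (F2_vs M)"
proof -
  interpret comm_group M using assms by (simp add: exp2_def)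
  have two: "x \<otimes>\<^bsub>M\<^esub> x = \<one>\<^bsub>M\<^esub>" if "x \<in> carrier M" for x using assms that by (simp add: exp2_def)
  have bit: "x = 0 \<or> x = 1" for x :: bit by (cases x) auto
  show ?thesis
  proof (rule vs_criteria[OF field_F2])
    show "\<forall>v\<in>carrier (F2_vs M). \<exists>neg_v\<in>carrier (F2_vs M). v \<oplus>\<^bsub>F2_vs M\<^esub> neg_v = \<zero>\<^bsub>F2_vs M\<^esub>"
      using two by (auto simp: F2_vs_def)
    show "\<forall>a b v. a \<in> carrier F2 \<and> b \<in> carrier F2 \<and> v \<in> carrier (F2_vs M) \<longrightarrow>
        (a \<oplus>\<^bsub>F2\<^esub> b) \<odot>\<^bsub>F2_vs M\<^esub> v = (a \<odot>\<^bsub>F2_vs M\<^esub> v) \<oplus>\<^bsub>F2_vs M\<^esub> (b \<odot>\<^bsub>F2_vs M\<^esub> v)"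
    proof (intro allI impI)
      fix a b :: bit and v assume "a \<in> carrier F2 \<and> b \<in> carrier F2 \<and> v \<in> carrier (F2_vs M)"
      then show "(a \<oplus>\<^bsub>F2\<^esub> b) \<odot>\<^bsub>F2_vs M\<^esub> v = (a \<odot>\<^bsub>F2_vs M\<^esub> v) \<oplus>\<^bsub>F2_vs M\<^esub> (b \<odot>\<^bsub>F2_vs M\<^esub> v)"
        using two bit[of a] bit[of b] by (auto simp: F2_vs_def)
    qed
    show "\<forall>a b v. a \<in> carrier F2 \<and> b \<in> carrier F2 \<and> v \<in> carrier (F2_vs M) \<longrightarrow>
        (a \<otimes>\<^bsub>F2\<^esub> b) \<odot>\<^bsub>F2_vs M\<^esub> v = a \<odot>\<^bsub>F2_vs M\<^esub> (b \<odot>\<^bsub>F2_vs M\<^esub> v)"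
    proof (intro allI impI)
      fix a b :: bit and v assume "a \<in> carrier F2 \<and> b \<in> carrier F2 \<and> v \<in> carrier (F2_vs M)"
      then show "(a \<otimes>\<^bsub>F2\<^esub> b) \<odot>\<^bsub>F2_vs M\<^esub> v = a \<odot>\<^bsub>F2_vs M\<^esub> (b \<odot>\<^bsub>F2_vs M\<^esub> v)"
        using bit[of a] bit[of b] by (auto simp: F2_vs_def)
    qed
  qed (auto simp: F2_vs_def m_assoc intro: m_comm)
qed

text \<open>Coordinates in a basis count the elements. This is what converts the sums of dimensions
  in the definitions of M- and GM-spaces into products of orders.\<close>

lemma card_eq_2_power_F2_dim:
  assumes M: "exp2 M" and finM: "finite (carrier M)"
  shows "card (carrier M) = 2 ^ F2_dim M"
proof -
  interpret vectorspace F2 "F2_vs M" by (rule vectorspace_F2_vs[OF M])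
  have carr: "carrier (F2_vs M) = carrier M" by (simp add: F2_vs_def)
  have "gen_set (carrier (F2_vs M))"
    using span_is_subset2[of "carrier (F2_vs M)"] in_own_span[of "carrier (F2_vs M)"] by auto
  then have "fin_dim" unfolding fin_dim_def using finM carr by (intro exI[of _ "carrier M"]) simp
  then obtain B where B: "finite B" "basis B" using finite_basis_exists by blast
  have BC: "B \<subseteq> carrier (F2_vs M)" using B(2) by (simp add: basis_def)
  have ex1: "\<exists>!a. a \<in> B \<rightarrow>\<^sub>E carrier F2 \<and> lincomb a B = v" if "v \<in> carrier (F2_vs M)" for v
    using basis_criterion[OF B(1) BC] B(2) that by blast
  have closed: "lincomb a B \<in> carrier (F2_vs M)" for a
    by (rule lincomb_closed[OF BC]) auto
  have "bij_betw (\<lambda>a. lincomb a B) (B \<rightarrow>\<^sub>E carrier F2) (carrier (F2_vs M))"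
    unfolding bij_betw_def
  proof (intro conjI equalityI subsetI)
    show "inj_on (\<lambda>a. lincomb a B) (B \<rightarrow>\<^sub>E carrier F2)"
    proof (rule inj_onI)
      fix a a' assume a: "a \<in> B \<rightarrow>\<^sub>E carrier F2" "a' \<in> B \<rightarrow>\<^sub>E carrier F2" "lincomb a B = lincomb a' B"
      then show "a = a'" using ex1[OF closed[of a]] by metis
    qed
  next
    fix v assume "v \<in> (\<lambda>a. lincomb a B) ` (B \<rightarrow>\<^sub>E carrier F2)"
    then show "v \<in> carrier (F2_vs M)" using closed by blast
  next
    fix v assume "v \<in> carrier (F2_vs M)"
    from ex1[OF this] obtain a where "a \<in> B \<rightarrow>\<^sub>E carrier F2" "lincomb a B = v" by blast
    then show "v \<in> (\<lambda>a. lincomb a B) ` (B \<rightarrow>\<^sub>E carrier F2)" by blast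
  qed
  then have "card (carrier (F2_vs M)) = card (B \<rightarrow>\<^sub>E (UNIV :: bit set))"
    by (simp add: bij_betw_same_card)
  also have "\<dots> = card (UNIV :: bit set) ^ card B" by (rule card_funcsetE[OF B(1)])
  also have "(UNIV :: bit set) = {0, 1}" by (auto intro: bit.exhaust)
  finally show ?thesis using dim_basis[OF B] carr by (simp add: F2_dim_def numeral_2_eq_2)
qed

lemma exp2_subgroupI:
  assumes "exp2 A" "K \<subseteq> carrier A" "\<one>\<^bsub>A\<^esub> \<in> K" "\<And>x y. \<lbrakk>x \<in> K; y \<in> K\<rbrakk> \<Longrightarrow> x \<otimes>\<^bsub>A\<^esub> y \<in> K"
  shows "subgroup K A"
proof -
  interpret comm_group A using assms(1) by (simp add: exp2_def)
  show ?thesis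
  proof (rule subgroupI)
    show "inv\<^bsub>A\<^esub> x \<in> K" if "x \<in> K" for x
    proof -
      have "inv\<^bsub>A\<^esub> x = x" using assms(1,2) that by (intro inv_equality) (auto simp: exp2_def)
      then show ?thesis using that by simp
    qed
  qed (use assms in auto)
qed

lemma exp2_inv: "exp2 A \<Longrightarrow> x \<in> carrier A \<Longrightarrow> inv\<^bsub>A\<^esub> x = x"
  by (rule group.inv_equality) (auto simp: exp2_def comm_group_def)

lemma exp2_quotient:
  assumes A: "exp2 A" and K: "subgroup K A" and H: "subgroup H A" "H \<subseteq> K"
  defines "Q \<equiv> subgroup_generated A K Mod H"
  shows "exp2 Q" and "carrier Q = (\<lambda>z. H #>\<^bsub>A\<^esub> z) ` K" and "\<one>\<^bsub>Q\<^esub> = H"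
    and "\<lbrakk>x \<in> K; y \<in> K\<rbrakk> \<Longrightarrow> (H #>\<^bsub>A\<^esub> x) \<otimes>\<^bsub>Q\<^esub> (H #>\<^bsub>A\<^esub> y) = H #>\<^bsub>A\<^esub> (x \<otimes>\<^bsub>A\<^esub> y)"
    and "card (carrier Q) * card H = card K"
proof -
  interpret A: comm_group A using A by (simp add: exp2_def)
  let ?A = "subgroup_generated A K"
  have cK: "carrier ?A = K" by (rule subgroup.carrier_subgroup_generated_subgroup[OF K])
  interpret B: comm_group ?A by (rule A.abelian_subgroup_generated[OF A.comm_group_axioms])
  have sub: "subgroup H ?A" using H(1) H(2) A.subgroup_subgroup_generated_iff cK by metis
  have normal: "H \<lhd> ?A" by (rule B.subgroup_imp_normal[OF sub])
  have coset: "H #>\<^bsub>?A\<^esub> z = H #>\<^bsub>A\<^esub> z" for z by (simp add: r_coset_def)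
  show carr: "carrier Q = (\<lambda>z. H #>\<^bsub>A\<^esub> z) ` K"
    by (auto simp: Q_def FactGroup_def RCOSETS_def coset cK)
  show one: "\<one>\<^bsub>Q\<^esub> = H" by (simp add: Q_def FactGroup_def)
  have mult: "(H #>\<^bsub>A\<^esub> x) \<otimes>\<^bsub>Q\<^esub> (H #>\<^bsub>A\<^esub> y) = H #>\<^bsub>A\<^esub> (x \<otimes>\<^bsub>A\<^esub> y)" if "x \<in> K" "y \<in> K" for x y
    using normal.rcos_sum[OF normal, of x y] that by (simp add: Q_def FactGroup_def coset cK)
  then show "\<lbrakk>x \<in> K; y \<in> K\<rbrakk> \<Longrightarrow> (H #>\<^bsub>A\<^esub> x) \<otimes>\<^bsub>Q\<^esub> (H #>\<^bsub>A\<^esub> y) = H #>\<^bsub>A\<^esub> (x \<otimes>\<^bsub>A\<^esub> y)" .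
  have "u \<otimes>\<^bsub>Q\<^esub> u = \<one>\<^bsub>Q\<^esub>" if u: "u \<in> carrier Q" for u
  proof -
    obtain z where z: "z \<in> K" "u = H #>\<^bsub>A\<^esub> z" using u unfolding carr by blast
    then have "z \<in> carrier A" using subgroup.subset[OF K] by auto
    then have "z \<otimes>\<^bsub>A\<^esub> z = \<one>\<^bsub>A\<^esub>" using A by (simp add: exp2_def)
    then show ?thesis using mult[OF z(1,1)] z(2) one A.coset_mult_one[OF subgroup.subset[OF H(1)]] by simp
  qed
  moreover have "comm_group Q" unfolding Q_def by (rule B.abelian_FactGroup[OF sub])
  ultimately show "exp2 Q" by (simp add: exp2_def)
  show "card (carrier Q) * card H = card K"
    using B.lagrange[OF sub] by (simp add: Q_def FactGroup_def order_def cK)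
qed

lemma exp2_product_group:
  assumes "exp2 M" shows "exp2 (product_group I (\<lambda>_. M))"
proof -
  interpret comm_group M using assms by (simp add: exp2_def)
  have "group (product_group I (\<lambda>_. M))" by (rule product_group) (rule group_axioms)
  then have "comm_group (product_group I (\<lambda>_. M))"
    by (rule group.group_comm_groupI) (auto simp: PiE_iff m_comm intro!: restrict_ext)
  then show ?thesis using assms by (auto simp: exp2_def intro!: restrict_ext)
qed

lemma carrier_C2: "carrier C2 = {0, 1}"
  by (auto simp: carrier_integer_mod_group)

text \<open>A crossed homomorphism is determined by its value at the generator, which can be any
  fixed element, since \<open>m = - m\<close>. The principal ones have the values
  \<open>k m\<close>, so H^1 is the quotient of the fixed elements by the image of \<open>k\<close>.
  The kernel of \<open>k\<close> is again the fixed elements, whence the square.\<close>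

lemma card_group_H1:
  assumes M: "exp2 M" and fin: "finite (carrier M)"
    and hom: "\<rho> 1 \<in> hom M M" and \<rho>0: "\<And>m. m \<in> carrier M \<Longrightarrow> \<rho> 0 m = m"
    and \<rho>1: "\<And>m. m \<in> carrier M \<Longrightarrow> \<rho> 1 (\<rho> 1 m) = m"
  shows "exp2 (group_H1 C2 M \<rho>)" "finite (carrier (group_H1 C2 M \<rho>))"
    and "card (carrier (group_H1 C2 M \<rho>)) * card (carrier M) = (card {m \<in> carrier M. \<rho> 1 m = m})\<^sup>2"
proof -
  interpret M: comm_group M using M by (simp add: exp2_def)
  let ?A = "product_group (carrier C2) (\<lambda>_. M)"
  \<comment> \<open>The crossed homomorphism with value \<open>m\<close> at the generator; its value
    at 0 has to be the neutral element.\<close>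
  define h where "h = (\<lambda>m. \<lambda>g\<in>carrier C2. if g = 0 then \<one>\<^bsub>M\<^esub> else m)"
  define F where "F = {m \<in> carrier M. \<rho> 1 m = m}"
  define k where "k = (\<lambda>m. \<rho> 1 m \<otimes>\<^bsub>M\<^esub> m)"
  have two: "x \<otimes>\<^bsub>M\<^esub> x = \<one>\<^bsub>M\<^esub>" if "x \<in> carrier M" for x using M that by (simp add: exp2_def)
  have \<rho>c: "\<rho> 1 m \<in> carrier M" if "m \<in> carrier M" for m using hom that by (auto simp: hom_def)
  have \<rho>m: "\<rho> 1 (m \<otimes>\<^bsub>M\<^esub> m') = \<rho> 1 m \<otimes>\<^bsub>M\<^esub> \<rho> 1 m'" if "m \<in> carrier M" "m' \<in> carrier M" for m m'
    using hom that by (auto simp: hom_def)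
  have \<rho>one: "\<rho> 1 \<one>\<^bsub>M\<^esub> = \<one>\<^bsub>M\<^esub>" by (rule hom_one[OF hom M.group_axioms M.group_axioms])
  have cancel: "x = y" if "x \<otimes>\<^bsub>M\<^esub> y = \<one>\<^bsub>M\<^esub>" "x \<in> carrier M" "y \<in> carrier M" for x y
    using that two[of y] M.right_cancel[of y x y] by simp
  have A: "exp2 ?A" by (rule exp2_product_group[OF M])
  have h_mult: "h m \<otimes>\<^bsub>?A\<^esub> h m' = h (m \<otimes>\<^bsub>M\<^esub> m')" for m m'
    by (auto simp: h_def intro!: restrict_ext)
  have h_one: "h \<one>\<^bsub>M\<^esub> = \<one>\<^bsub>?A\<^esub>" by (auto simp: h_def intro!: restrict_ext)
  have h_carr: "h m \<in> carrier ?A" if "m \<in> carrier M" for m using that by (auto simp: h_def)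
  have h_inj: "inj h"
  proof (rule injI)
    fix m m' assume "h m = h m'"
    from fun_cong[OF this, of 1] show "m = m'" by (simp add: h_def carrier_C2)
  qed
  have kF: "k m \<in> F" if "m \<in> carrier M" for m
    using that by (simp add: F_def k_def \<rho>c \<rho>m \<rho>1 M.m_comm)
  have crossed: "crossed_homs C2 M \<rho> = h ` F"
  proof (intro equalityI subsetI)
    fix f assume "f \<in> crossed_homs C2 M \<rho>"
    then have f: "f \<in> carrier C2 \<rightarrow>\<^sub>E carrier M"
      and c: "\<And>g g'. \<lbrakk>g \<in> {0, 1}; g' \<in> {0, 1}\<rbrakk> \<Longrightarrow> f ((g + g') mod 2) = f g \<otimes>\<^bsub>M\<^esub> \<rho> g (f g')"
      by (auto simp: crossed_homs_def carrier_C2)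
    have fc: "f 0 \<in> carrier M" "f 1 \<in> carrier M" using f by (auto simp: carrier_C2)
    have "f 0 = f 0 \<otimes>\<^bsub>M\<^esub> f 0" using c[of 0 0] \<rho>0[OF fc(1)] by simp
    then have f0: "f 0 = \<one>\<^bsub>M\<^esub>" using two[OF fc(1)] by simp
    have "f 1 \<otimes>\<^bsub>M\<^esub> \<rho> 1 (f 1) = \<one>\<^bsub>M\<^esub>" using c[of 1 1] f0 by simp
    then have "\<rho> 1 (f 1) = f 1" using cancel[OF _ fc(2) \<rho>c[OF fc(2)]] by simp
    then have F: "f 1 \<in> F" using fc by (simp add: F_def)
    have "f = h (f 1)"
    proof
      fix g show "f g = h (f 1) g"
        using f f0 by (cases "g \<in> carrier C2") (auto simp: h_def carrier_C2 PiE_iff extensional_def)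
    qed
    then show "f \<in> h ` F" using F by blast
  next
    fix f assume "f \<in> h ` F"
    then obtain m where m: "m \<in> F" "f = h m" by blast
    then have mc: "m \<in> carrier M" "\<rho> 1 m = m" by (auto simp: F_def)
    have hc: "h m \<in> carrier C2 \<rightarrow>\<^sub>E carrier M" using h_carr[OF mc(1)] by simp
    have hm: "h m ((g + g') mod int 2) = h m g \<otimes>\<^bsub>M\<^esub> \<rho> g (h m g')" if "g \<in> carrier C2" "g' \<in> carrier C2" for g g'
      using that mc two[OF mc(1)] \<rho>one \<rho>0 by (auto simp: h_def carrier_C2)
    show "f \<in> crossed_homs C2 M \<rho>"
      unfolding m(2) crossed_homs_def mem_Collect_eq mult_integer_mod_group
      by (intro conjI ballI hc hm)
  qed
  have principal: "principal_crossed_homs C2 M \<rho> = h ` (k ` carrier M)"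
  proof -
    have "(\<lambda>g\<in>carrier C2. \<rho> g m \<otimes>\<^bsub>M\<^esub> inv\<^bsub>M\<^esub> m) = h (k m)" if "m \<in> carrier M" for m
      using that \<rho>0 by (auto simp: h_def k_def exp2_inv[OF M] two carrier_C2 intro!: restrict_ext)
    then show ?thesis by (auto simp: principal_crossed_homs_def image_image)
  qed
  have FK: "F \<subseteq> carrier M" by (auto simp: F_def)
  have sF: "subgroup (h ` F) ?A"
  proof (rule exp2_subgroupI[OF A])
    show "h ` F \<subseteq> carrier ?A" using h_carr FK by blast
    have "\<one>\<^bsub>M\<^esub> \<in> F" by (simp add: F_def \<rho>one)
    then show "\<one>\<^bsub>?A\<^esub> \<in> h ` F" unfolding h_one[symmetric] by (rule imageI)
    fix x y assume "x \<in> h ` F" "y \<in> h ` F"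
    then obtain m m' where m: "m \<in> F" "m' \<in> F" "x = h m" "y = h m'" by blast
    then have "m \<otimes>\<^bsub>M\<^esub> m' \<in> F" by (auto simp: F_def \<rho>m)
    then show "x \<otimes>\<^bsub>?A\<^esub> y \<in> h ` F" unfolding m h_mult by (rule imageI)
  qed
  have k_mult: "k (m \<otimes>\<^bsub>M\<^esub> m') = k m \<otimes>\<^bsub>M\<^esub> k m'" if "m \<in> carrier M" "m' \<in> carrier M" for m m'
    using that by (simp add: k_def \<rho>m \<rho>c M.m_ac)
  have sP: "subgroup (h ` k ` carrier M) ?A"
  proof (rule exp2_subgroupI[OF A])
    show "h ` k ` carrier M \<subseteq> carrier ?A" using h_carr FK kF by blast
    have "k \<one>\<^bsub>M\<^esub> = \<one>\<^bsub>M\<^esub>" by (simp add: k_def \<rho>one)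
    then have "\<one>\<^bsub>M\<^esub> \<in> k ` carrier M" by (metis M.one_closed imageI)
    then show "\<one>\<^bsub>?A\<^esub> \<in> h ` k ` carrier M" unfolding h_one[symmetric] by (rule imageI)
    fix x y assume "x \<in> h ` k ` carrier M" "y \<in> h ` k ` carrier M"
    then obtain m m' where m: "m \<in> carrier M" "m' \<in> carrier M" "x = h (k m)" "y = h (k m')" by blast
    then have "k m \<otimes>\<^bsub>M\<^esub> k m' \<in> k ` carrier M" unfolding k_mult[OF m(1,2), symmetric] by simp
    then show "x \<otimes>\<^bsub>?A\<^esub> y \<in> h ` k ` carrier M" unfolding m h_mult by (rule imageI)
  qed
  have "h ` k ` carrier M \<subseteq> h ` F" using kF by blast
  note Q = exp2_quotient[OF A sF sP this]
  have H1: "group_H1 C2 M \<rho> = subgroup_generated ?A (h ` F) Mod h ` k ` carrier M"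
    by (simp only: group_H1_def crossed principal)
  show "exp2 (group_H1 C2 M \<rho>)" unfolding H1 by (rule Q(1))
  show "finite (carrier (group_H1 C2 M \<rho>))"
    unfolding H1 Q(2) using fin by (intro finite_imageI finite_subset[OF FK])
  have 1: "card (carrier (group_H1 C2 M \<rho>)) * card (k ` carrier M) = card F"
    using Q(5) by (simp add: H1 card_image inj_on_subset[OF h_inj])
  \<comment> \<open>Nonempty fibres of \<open>k\<close> are translates of its kernel
    \<open>F\<close>.\<close>
  have "card {m \<in> carrier M. k m = p} = card F" if p: "p \<in> k ` carrier M" for p
  proof -
    obtain m0 where m0: "m0 \<in> carrier M" "p = k m0" using p by blast
    have "{m \<in> carrier M. k m = p} = (\<lambda>f. f \<otimes>\<^bsub>M\<^esub> m0) ` F"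
    proof (intro equalityI subsetI)
      fix m assume "m \<in> {m \<in> carrier M. k m = p}"
      then have m: "m \<in> carrier M" "k m = k m0" using m0 by auto
      have "k (m \<otimes>\<^bsub>M\<^esub> m0) = \<one>\<^bsub>M\<^esub>"
        using k_mult[OF m(1) m0(1)] m(2) two[of "k m0"] kF[OF m0(1)] FK by auto
      then have "m \<otimes>\<^bsub>M\<^esub> m0 \<in> F"
        unfolding k_def F_def using m(1) m0(1) by (auto intro!: cancel \<rho>c)
      moreover have "m = (m \<otimes>\<^bsub>M\<^esub> m0) \<otimes>\<^bsub>M\<^esub> m0"
        using m(1) m0(1) two[OF m0(1)] by (simp add: M.m_assoc)
      ultimately show "m \<in> (\<lambda>f. f \<otimes>\<^bsub>M\<^esub> m0) ` F" by (rule rev_image_eqI)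
    next
      fix m assume "m \<in> (\<lambda>f. f \<otimes>\<^bsub>M\<^esub> m0) ` F"
      then obtain f where f: "f \<in> carrier M" "\<rho> 1 f = f" "m = f \<otimes>\<^bsub>M\<^esub> m0" by (auto simp: F_def)
      have "k f = \<one>\<^bsub>M\<^esub>" using f two by (simp add: k_def)
      then have "k m = k m0" using k_mult[OF f(1) m0(1)] f(3) kF[OF m0(1)] FK by auto
      then show "m \<in> {m \<in> carrier M. k m = p}" using f m0 by simp
    qed
    moreover have "inj_on (\<lambda>f. f \<otimes>\<^bsub>M\<^esub> m0) F" using m0(1) FK by (auto simp: inj_on_def subset_iff)
    ultimately show ?thesis by (simp add: card_image)
  qed
  then have "(\<Sum>p\<in>k ` carrier M. card {m \<in> carrier M. k m = p}) = card (k ` carrier M) * card F" by simp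
  moreover have "card (carrier M) = (\<Sum>p\<in>k ` carrier M. card {m \<in> carrier M. k m = p})"
    using sum.image_gen[OF fin, of "\<lambda>_. 1 :: nat" k] by simp
  ultimately have 2: "card (carrier M) = card (k ` carrier M) * card F" by simp
  show "card (carrier (group_H1 C2 M \<rho>)) * card (carrier M) = (card {m \<in> carrier M. \<rho> 1 m = m})\<^sup>2"
    unfolding 2 F_def[symmetric] power2_eq_square using 1 by (metis mult.assoc)
qed

section \<open>Cohomology groups by cochains extended by zero\<close>

text \<open>Translates cochains extended by zero, on which all counting is done, into the
  extensional functions from which \<open>cohomology_group\<close> is built.\<close>

definition rst :: "nat \<Rightarrow> 'a topology \<Rightarrow> 'a cochain \<Rightarrow> 'a cochain"
  where "rst p X c = restrict c (singular_simplex_set p X)"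

abbreviation Zc :: "nat \<Rightarrow> 'a topology \<Rightarrow> 'a cochain set"
  where "Zc p X \<equiv> cyc (coch X id {}) (cob X) p"

abbreviation Bc :: "nat \<Rightarrow> 'a topology \<Rightarrow> 'a cochain set"
  where "Bc p X \<equiv> bnd (coch X id {}) (cob X) p"

definition cls :: "nat \<Rightarrow> 'a topology \<Rightarrow> 'a cochain \<Rightarrow> 'a cochain set"
  where "cls p X z = coboundaries p X #>\<^bsub>cochain_group p X\<^esub> rst p X z"

lemma bit_add_self: "x + x = (0 :: bit)"
  by (cases x) auto

lemma exp2_cochain_group: "exp2 (cochain_group p X)"
proof -
  have "comm_group (add_monoid F2)"
  proof (rule comm_groupI)
    fix x assume "x \<in> carrier (add_monoid F2)"
    show "\<exists>y\<in>carrier (add_monoid F2). y \<otimes>\<^bsub>add_monoid F2\<^esub> x = \<one>\<^bsub>add_monoid F2\<^esub>"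
      by (intro bexI[of _ x]) (simp_all add: bit_add_self)
  qed (simp_all add: ac_simps)
  then have "exp2 (add_monoid F2)" by (simp add: exp2_def bit_add_self)
  then show ?thesis unfolding cochain_group_def by (rule exp2_product_group)
qed

lemma rst_carrier: "rst p X c \<in> carrier (cochain_group p X)"
  by (simp add: rst_def cochain_group_def)

lemma rst_add: "rst p X (c + c') = rst p X c \<otimes>\<^bsub>cochain_group p X\<^esub> rst p X c'"
  by (auto simp: rst_def cochain_group_def intro!: restrict_ext)

lemma rst_0: "rst p X 0 = \<one>\<^bsub>cochain_group p X\<^esub>"
  by (auto simp: rst_def cochain_group_def intro!: restrict_ext)

lemma coch_idI: "(\<And>\<sigma>. \<not> singular_simplex p X \<sigma> \<Longrightarrow> c \<sigma> = 0) \<Longrightarrow> c \<in> coch X id {} p"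
  by (rule cochI) (auto simp: simplex_map_id_singular nonempty_standard_simplex simp del: simplex_map_id)

lemma rst_inj: "inj_on (rst p X) (coch X id {} p)"
proof (rule inj_onI)
  fix c c' assume c: "c \<in> coch X id {} p" "c' \<in> coch X id {} p" "rst p X c = rst p X c'"
  have "c \<sigma> = c' \<sigma>" for \<sigma>
    using fun_cong[OF c(3), of \<sigma>] cochD(1)[OF c(1), of \<sigma>] cochD(1)[OF c(2), of \<sigma>]
    by (cases "singular_simplex p X \<sigma>") (auto simp: rst_def)
  then show "c = c'" by (rule ext)
qed

lemma carrier_cochain_group: "carrier (cochain_group p X) = rst p X ` coch X id {} p"
proof (intro equalityI subsetI)
  fix u assume u: "u \<in> carrier (cochain_group p X)"
  define c where "c = (\<lambda>\<sigma>. if singular_simplex p X \<sigma> then u \<sigma> else 0)"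
  have "c \<in> coch X id {} p" by (rule coch_idI) (simp add: c_def)
  moreover have "u = rst p X c"
  proof
    fix \<sigma> show "u \<sigma> = rst p X c \<sigma>"
      using u by (auto simp: rst_def c_def cochain_group_def PiE_iff extensional_def)
  qed
  ultimately show "u \<in> rst p X ` coch X id {} p" by blast
qed (auto simp: rst_carrier)

lemma coboundary_rst: "coboundary p X (rst p X c) = rst (Suc p) X (cob X p c)"
proof -
  have "(\<Sum>k\<le>Suc p. rst p X c (singular_face (Suc p) k \<sigma>)) = cob X p c \<sigma>"
    if "singular_simplex (Suc p) X \<sigma>" for \<sigma>
  proof -
    have "(\<Sum>k\<le>Suc p. rst p X c (singular_face (Suc p) k \<sigma>)) = (\<Sum>k\<le>Suc p. c (singular_face (Suc p) k \<sigma>))"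
      by (rule sum.cong) (use singular_simplex_face[OF that] in \<open>auto simp: rst_def\<close>)
    then show ?thesis using that by (simp add: cob_def del: sum.atMost_Suc)
  qed
  then show ?thesis
    unfolding coboundary_def rst_def[of "Suc p"] by (intro restrict_ext) simp
qed

lemma cocycles_eq: "cocycles p X = rst p X ` Zc p X"
proof -
  have "coboundary p X (rst p X c) = \<one>\<^bsub>cochain_group (Suc p) X\<^esub> \<longleftrightarrow> cob X p c = 0" for c
  proof -
    have "cob X p c \<in> coch X id {} (Suc p)" "0 \<in> coch X id {} (Suc p)"
      by (auto intro!: coch_idI simp: cob_def)
    from inj_on_eq_iff[OF rst_inj this] show ?thesis by (simp add: coboundary_rst rst_0)
  qed
  then show ?thesis unfolding cocycles_def kernel_def carrier_cochain_group cyc_def by auto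
qed

lemma coboundaries_eq: "coboundaries p X = rst p X ` Bc p X"
  by (cases p) (simp_all add: rst_0 carrier_cochain_group image_image coboundary_rst)

lemma sgrp_Zc: "sgrp (Zc p X)" and sgrp_Bc: "sgrp (Bc p X)" and Bc_subset_Zc: "Bc p X \<subseteq> Zc p X"
  using cplx_coch[OF inv_pair_id, of X] by (auto intro: sgrp_cyc sgrp_bnd bnd_subset_cyc[THEN subsetD])

lemma cls_eq: "cls p X z = rst p X ` ((+) z ` Bc p X)"
  unfolding cls_def coboundaries_eq r_coset_def
  by (auto simp: rst_add[symmetric] add.commute image_iff)

lemma cls_eq_iff:
  assumes "z \<in> Zc p X" "z' \<in> Zc p X" shows "cls p X z = cls p X z' \<longleftrightarrow> z - z' \<in> Bc p X"
proof -
  have "(+) z ` Bc p X \<subseteq> coch X id {} p" if "z \<in> Zc p X" for z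
    using sgrp_add[OF sgrp_Zc that] Bc_subset_Zc[of X p] cyc_subset by blast
  then show ?thesis
    unfolding cls_eq using inj_on_image_eq_iff[OF rst_inj] coset_eq_iff[OF sgrp_Bc] assms by metis
qed

lemma subgroup_rst_image:
  assumes "sgrp S" shows "subgroup (rst p X ` S) (cochain_group p X)"
proof (rule exp2_subgroupI[OF exp2_cochain_group])
  show "rst p X ` S \<subseteq> carrier (cochain_group p X)" using rst_carrier by blast
  show "\<one>\<^bsub>cochain_group p X\<^esub> \<in> rst p X ` S" unfolding rst_0[symmetric] by (rule imageI[OF sgrp_zero[OF assms]])
  fix x y assume "x \<in> rst p X ` S" "y \<in> rst p X ` S"
  then obtain c c' where c: "c \<in> S" "c' \<in> S" "x = rst p X c" "y = rst p X c'" by blast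
  show "x \<otimes>\<^bsub>cochain_group p X\<^esub> y \<in> rst p X ` S"
    unfolding c rst_add[symmetric] by (rule imageI[OF sgrp_add[OF assms c(1,2)]])
qed

lemma cohomology_group:
  shows "exp2 (cohomology_group p X)"
    and "carrier (cohomology_group p X) = cls p X ` Zc p X"
    and "\<lbrakk>z \<in> Zc p X; z' \<in> Zc p X\<rbrakk> \<Longrightarrow> cls p X z \<otimes>\<^bsub>cohomology_group p X\<^esub> cls p X z' = cls p X (z + z')"
proof -
  have K: "subgroup (cocycles p X) (cochain_group p X)"
    unfolding cocycles_eq by (rule subgroup_rst_image[OF sgrp_Zc])
  have H: "subgroup (coboundaries p X) (cochain_group p X)"
    unfolding coboundaries_eq by (rule subgroup_rst_image[OF sgrp_Bc])
  have "coboundaries p X \<subseteq> cocycles p X"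
    unfolding cocycles_eq coboundaries_eq by (rule image_mono[OF Bc_subset_Zc])
  note Q = exp2_quotient[OF exp2_cochain_group K H this, folded cohomology_group_def]
  show "exp2 (cohomology_group p X)" by (rule Q(1))
  show "carrier (cohomology_group p X) = cls p X ` Zc p X"
    unfolding Q(2) cocycles_eq cls_def by (simp add: image_image)
  show "cls p X z \<otimes>\<^bsub>cohomology_group p X\<^esub> cls p X z' = cls p X (z + z')" if "z \<in> Zc p X" "z' \<in> Zc p X"
    unfolding cls_def rst_add by (rule Q(4)) (use that in \<open>simp_all add: cocycles_eq\<close>)
qed

lemma card_cls_image:
  assumes "S \<subseteq> Zc p X" shows "card (cls p X ` S) = idx S (Bc p X)"
  unfolding idx_def
proof (rule card_image_eq_if_same_fibres)
  fix x y assume "x \<in> S" "y \<in> S"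
  then have "x \<in> Zc p X" "y \<in> Zc p X" using assms by auto
  then show "cls p X x = cls p X y \<longleftrightarrow> (+) x ` Bc p X = (+) y ` Bc p X"
    by (simp only: cls_eq_iff coset_eq_iff[OF sgrp_Bc])
qed

lemma card_cohomology_group: "card (carrier (cohomology_group p X)) = coh X id {} p"
  unfolding cohomology_group(2) card_cls_image[OF order_refl] coh_def hcard_def ..

lemma pull_Zc: "continuous_map X Y f \<Longrightarrow> z \<in> Zc p Y \<Longrightarrow> pull X f p z \<in> Zc p X"
  and pull_Bc: "continuous_map X Y f \<Longrightarrow> z \<in> Bc p Y \<Longrightarrow> pull X f p z \<in> Bc p X"
proof -
  have f: "cmap (coch Y id {}) (cob Y) (coch X id {}) (cob X) (pull X f)" if "continuous_map X Y f"
    by (rule cmap_pull[OF inv_pair_id]) (use that in \<open>simp add: pair_map_def\<close>)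
  show "pull X f p z \<in> Zc p X" if "continuous_map X Y f" "z \<in> Zc p Y"
    by (rule cmap_cyc[OF f[OF that(1)] cplx_coch[OF inv_pair_id] that(2)])
  show "pull X f p z \<in> Bc p X" if "continuous_map X Y f" "z \<in> Bc p Y"
    by (rule cmap_bnd[OF f[OF that(1)] cplx_coch[OF inv_pair_id] that(2)])
qed

lemma pull_add: "pull X f p (c + c') = pull X f p c + pull X f p c'"
  and pull_diff: "pull X f p (c - c') = pull X f p c - pull X f p c'"
  by (auto simp: pull_def fun_eq_iff)

lemma cochain_map_rst:
  assumes "continuous_map X Y f" shows "cochain_map p X f (rst p Y c) = rst p X (pull X f p c)"
  unfolding cochain_map_def rst_def
  by (rule restrict_ext) (use singular_simplex_simplex_map[OF _ assms] in \<open>simp add: pull_def\<close>)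

text \<open>Representatives of a class differ by a coboundary and pullback preserves coboundaries,
  so the set in \<open>cohomology_map\<close> is a singleton and \<open>the_elem\<close> is
  meaningful.\<close>

lemma cohomology_map_cls:
  assumes f: "continuous_map X Y f" and z: "z \<in> Zc p Y"
  shows "cohomology_map p X f (cls p Y z) = cls p X (pull X f p z)"
proof -
  have "cls p X (pull X f p (z + b)) = cls p X (pull X f p z)" if b: "b \<in> Bc p Y" for b
  proof -
    have zb: "z + b \<in> Zc p Y" using sgrp_add[OF sgrp_Zc z] b Bc_subset_Zc by blast
    have "pull X f p (z + b) - pull X f p z \<in> Bc p X"
      using pull_Bc[OF f b] by (simp add: pull_add)
    then show ?thesis using cls_eq_iff pull_Zc[OF f] z zb by blast
  qed
  then have "(\<lambda>b. cls p X (pull X f p (z + b))) ` Bc p Y = {cls p X (pull X f p z)}"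
    using sgrp_zero[OF sgrp_Bc[of Y p]] by blast
  then show ?thesis
    unfolding cohomology_map_def cls_eq[of p Y] image_image cochain_map_rst[OF f] cls_def[symmetric]
    by (simp only: the_elem_eq)
qed

section \<open>Orbit spaces\<close>

lemma openin_orbit_space:
  "openin (orbit_space Y \<psi>) U \<longleftrightarrow>
    U \<subseteq> orbits C2 (topspace Y) \<psi> \<and> openin Y {y \<in> topspace Y. orbit C2 \<psi> y \<in> U}"
proof -
  have "istopology (\<lambda>U. U \<subseteq> orbits C2 (topspace Y) \<psi> \<and> openin Y {y \<in> topspace Y. orbit C2 \<psi> y \<in> U})"
    unfolding istopology_def
  proof (intro conjI allI impI)
    fix S T assume S: "S \<subseteq> orbits C2 (topspace Y) \<psi> \<and> openin Y {y \<in> topspace Y. orbit C2 \<psi> y \<in> S}"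
      and T: "T \<subseteq> orbits C2 (topspace Y) \<psi> \<and> openin Y {y \<in> topspace Y. orbit C2 \<psi> y \<in> T}"
    show "S \<inter> T \<subseteq> orbits C2 (topspace Y) \<psi>" using S by blast
    have "{y \<in> topspace Y. orbit C2 \<psi> y \<in> S \<inter> T} = {y \<in> topspace Y. orbit C2 \<psi> y \<in> S} \<inter> {y \<in> topspace Y. orbit C2 \<psi> y \<in> T}"
      by blast
    then show "openin Y {y \<in> topspace Y. orbit C2 \<psi> y \<in> S \<inter> T}" using S T by (simp only: openin_Int)
  next
    fix \<K> assume K: "\<forall>K\<in>\<K>. K \<subseteq> orbits C2 (topspace Y) \<psi> \<and> openin Y {y \<in> topspace Y. orbit C2 \<psi> y \<in> K}"
    show "\<Union>\<K> \<subseteq> orbits C2 (topspace Y) \<psi>" using K by blast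
    have eq: "{y \<in> topspace Y. orbit C2 \<psi> y \<in> \<Union>\<K>} = (\<Union>K\<in>\<K>. {y \<in> topspace Y. orbit C2 \<psi> y \<in> K})"
      by blast
    show "openin Y {y \<in> topspace Y. orbit C2 \<psi> y \<in> \<Union>\<K>}"
      unfolding eq by (rule openin_Union) (use K in blast)
  qed
  from topology_inverse'[OF this] show ?thesis by (simp add: orbit_space_def)
qed

lemma quotient_map_orbit: "quotient_map Y (orbit_space Y \<psi>) (orbit C2 \<psi>)"
proof -
  have orb: "orbits C2 (topspace Y) \<psi> = orbit C2 \<psi> ` topspace Y" by (auto simp: orbits_def)
  have "openin (orbit_space Y \<psi>) (orbits C2 (topspace Y) \<psi>)"
  proof -
    have "{y \<in> topspace Y. orbit C2 \<psi> y \<in> orbits C2 (topspace Y) \<psi>} = topspace Y" unfolding orb by blast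
    then show ?thesis by (simp add: openin_orbit_space)
  qed
  moreover have "topspace (orbit_space Y \<psi>) \<subseteq> orbits C2 (topspace Y) \<psi>"
    using openin_topspace[of "orbit_space Y \<psi>"] unfolding openin_orbit_space by blast
  ultimately have top: "topspace (orbit_space Y \<psi>) = orbits C2 (topspace Y) \<psi>"
    using openin_subset by blast
  show ?thesis
    unfolding quotient_map_def openin_orbit_space top orb by blast
qed

lemma C2_space_involution:
  assumes "C2_space Y \<psi>"
  shows "continuous_map Y Y (\<psi> 1)" and "y \<in> topspace Y \<Longrightarrow> \<psi> 0 y = y"
    and "y \<in> topspace Y \<Longrightarrow> \<psi> 1 (\<psi> 1 y) = y"
proof -
  interpret group_action C2 "topspace Y" \<psi> using assms by (simp add: C2_space_def)
  show "continuous_map Y Y (\<psi> 1)" using assms by (simp add: C2_space_def carrier_C2)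
  show 0: "\<psi> 0 y = y" if "y \<in> topspace Y" for y
    using fun_cong[OF id_eq_one, of y] that by simp
  show "\<psi> 1 (\<psi> 1 y) = y" if "y \<in> topspace Y"
    using composition_rule[OF that, of 1 1] 0[OF that] by (simp add: carrier_C2)
qed

lemma orbit_C2:
  assumes "\<psi> 0 y = y" shows "orbit C2 \<psi> y = {y, \<psi> 1 y}"
proof -
  have "orbit C2 \<psi> y = (\<lambda>g. \<psi> g y) ` {0, 1}" by (auto simp: orbit_def carrier_C2)
  then show ?thesis using assms by simp
qed

section \<open>The image of the forgetful map\<close>

text \<open>An invariant cocycle \<open>w\<close> on \<open>Y\<close> has the same restriction to
  the slice at \<open>e\<close> and, translated by \<open>s\<close>, to the slice at the image of
  \<open>e\<close>. Since \<open>E\<close> is contractible, the two slices carry the same classes up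
  to the action on \<open>X\<close>.\<close>

lemma (in gysin_data) fibre_classes_invariant:
  assumes "z \<in> fibre_classes n" shows "pull X \<tau> n z - z \<in> Bc n X"
proof -
  let ?i = "\<lambda>x. (x, e)"
  obtain w where w: "w \<in> cyc (coch Y s {}) (cob Y) n" "z = pull X ?i n w"
    using assms unfolding fibre_classes_def by blast
  have wZ: "w \<in> Zc n Y" using cyc_Y_subset w(1) by blast
  have ci: "continuous_map X Y ?i" using slice_map by (simp add: pair_map_def)
  have cif: "continuous_map Y Y (?i \<circ> fst)" by (rule continuous_map_compose[OF continuous_map_fst ci])
  \<comment> \<open>\<open>w\<close> minus the cocycle that its slice induces on all of
    \<open>Y\<close>. It vanishes on the slice, so it is a coboundary of \<open>Y\<close>; pulled
    back along the translated slice \<open>s \<circ> ?i\<close> it becomes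
    \<open>z - pull X \<tau> n z\<close>.\<close>
  define u where "u = w - pull Y (?i \<circ> fst) n w"
  have "u \<in> Zc n Y" unfolding u_def by (rule sgrp_diff[OF sgrp_Zc wZ pull_Zc[OF cif wZ]])
  moreover have "pull X ?i n u = 0"
  proof -
    have "pull X ?i n (pull Y (?i \<circ> fst) n w) = pull X ((?i \<circ> fst) \<circ> ?i) n w" by (rule pull_pull[OF ci])
    also have "(?i \<circ> fst) \<circ> ?i = ?i" by (simp add: o_def)
    finally show ?thesis unfolding u_def pull_diff by (simp only: diff_self)
  qed
  then have "pull X ?i n u \<in> Bc n X" using sgrp_zero[OF sgrp_Bc] by simp
  ultimately have u: "u \<in> Bc n Y" using slice_equivalence(1) by blast
  let ?k = "s \<circ> ?i"
  have ck: "continuous_map X Y ?k" by (rule continuous_map_compose[OF ci s_cont])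
  have sw: "pull Y s n w = w"
  proof
    fix \<sigma> show "pull Y s n w \<sigma> = w \<sigma>"
      using cochD(1,3)[of w Y s "{}" n \<sigma>] w(1) by (simp add: cyc_def pull_def)
  qed
  have "pull X ?k n w = pull X ?i n (pull Y s n w)" by (rule pull_pull[OF ci, symmetric])
  also have "\<dots> = z" unfolding sw by (rule w(2)[symmetric])
  finally have 1: "pull X ?k n w = z" .
  have "pull X ?k n (pull Y (?i \<circ> fst) n w) = pull X ((?i \<circ> fst) \<circ> ?k) n w" by (rule pull_pull[OF ck])
  also have "(?i \<circ> fst) \<circ> ?k = ?i \<circ> \<tau>" by (simp add: o_def)
  also have "pull X (?i \<circ> \<tau>) n w = pull X \<tau> n z" unfolding w(2) by (rule pull_pull[OF \<tau>_cont, symmetric])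
  finally have 2: "pull X ?k n (pull Y (?i \<circ> fst) n w) = pull X \<tau> n z" .
  have "z - pull X \<tau> n z \<in> Bc n X"
    using pull_Bc[OF ck u] unfolding u_def pull_diff 1 2 .
  from sgrp_uminus[OF sgrp_Bc this] show ?thesis by simp
qed

lemma (in gysin_data) card_cls_fibre_classes: "card (cls n X ` fibre_classes n) = a n"
proof -
  let ?F = "fibre_classes n" and ?B = "Bc n X"
  have sub: "ssum ?F ?B \<subseteq> Zc n X" by (rule ssum_least[OF fibre_classes_subset Bc_subset_Zc sgrp_Zc])
  have "cls n X ` ssum ?F ?B = cls n X ` ?F"
  proof (rule equalityI)
    show "cls n X ` ?F \<subseteq> cls n X ` ssum ?F ?B"
      by (rule image_mono[OF conjunct1[OF ssum_upper[OF sgrp_fibre_classes sgrp_Bc]]])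
    show "cls n X ` ssum ?F ?B \<subseteq> cls n X ` ?F"
    proof
    fix u assume "u \<in> cls n X ` ssum ?F ?B"
    then obtain x where x: "x \<in> ssum ?F ?B" "u = cls n X x" by blast
    obtain y where y: "y \<in> ?B" "x - y \<in> ?F" using x(1) unfolding in_ssum_iff[OF sgrp_fibre_classes] by blast
    have "cls n X x = cls n X (x - y)"
      using cls_eq_iff[of x X n "x - y"] x(1) sub y fibre_classes_subset by auto
    then show "u \<in> cls n X ` ?F" using x(2) y(2) by blast
    qed
  qed
  then show ?thesis using card_cls_image[OF sub] by (simp add: a_def)
qed

text \<open>A deficit in one degree cannot be made up in another, so equality of totals decides
  every degree.\<close>

lemma prod_eq_prod_iff_if_le:
  fixes f g :: "'i \<Rightarrow> nat"
  assumes "finite A" "\<And>x. x \<in> A \<Longrightarrow> 0 < f x \<and> f x \<le> g x"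
  shows "prod f A = prod g A \<longleftrightarrow> (\<forall>x\<in>A. f x = g x)"
proof
  assume eq: "prod f A = prod g A"
  show "\<forall>x\<in>A. f x = g x"
  proof (rule ballI, rule ccontr)
    fix y assume y: "y \<in> A" "f y \<noteq> g y"
    have "prod f (A - {y}) \<le> prod g (A - {y})" using assms(2) by (intro prod_mono) auto
    then have "prod f A \<le> f y * prod g (A - {y})" using assms(1) y(1) by (simp add: prod.remove)
    also have "\<dots> < g y * prod g (A - {y})"
      using assms(2)[OF y(1)] y(2) assms(2) by (intro mult_strict_right_mono prod_pos) (auto, fastforce)
    also have "\<dots> = prod g A" using assms(1) y(1) by (simp add: prod.remove)
    finally show False using eq by simp
  qed
qed simp

lemma sum_F2_dim_eq_iff:
  assumes "\<And>q. q \<le> D \<Longrightarrow> exp2 (M q) \<and> finite (carrier (M q))"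
    and "\<And>q. q \<le> D \<Longrightarrow> exp2 (N q) \<and> finite (carrier (N q))"
  shows "(\<Sum>q\<le>D. F2_dim (M q)) = (\<Sum>q\<le>D. F2_dim (N q)) \<longleftrightarrow>
    (\<Prod>q\<le>D. card (carrier (M q))) = (\<Prod>q\<le>D. card (carrier (N q)))"
proof -
  have "(\<Prod>q\<le>D. card (carrier (M q))) = 2 ^ (\<Sum>q\<le>D. F2_dim (M q))"
    unfolding power_sum using assms(1) by (intro prod.cong) (auto simp: card_eq_2_power_F2_dim)
  moreover have "(\<Prod>q\<le>D. card (carrier (N q))) = 2 ^ (\<Sum>q\<le>D. F2_dim (N q))"
    unfolding power_sum using assms(2) by (intro prod.cong) (auto simp: card_eq_2_power_F2_dim)
  ultimately show ?thesis by simp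
qed

section \<open>Finite complexes with an action, and the forgetful map\<close>

locale borel_data =
  fixes X :: "'a topology" and \<phi> :: "int \<Rightarrow> 'a \<Rightarrow> 'a" and C :: "nat \<Rightarrow> 'a set set"
    and E :: "'e topology" and \<epsilon> :: "int \<Rightarrow> 'e \<Rightarrow> 'e" and e :: 'e
  assumes X: "C2_CW_complex X \<phi> C" and C: "finite_cells C" and E: "is_EC2 E \<epsilon>" and e_in: "e \<in> topspace E"
begin

lemma X_space: "C2_space X \<phi>" and E_space: "C2_space E \<epsilon>"
  using X E by (auto simp: C2_CW_complex_def is_EC2_def)

sublocale gysin_data X "\<phi> 1" E "\<epsilon> 1" e
proof
  show "Hausdorff_space X" using X by (simp add: C2_CW_complex_def CW_complex_def)
  show "Hausdorff_space E" using E by (auto simp: is_EC2_def C2_CW_complex_def CW_complex_def)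
  show "contractible_space E" using E by (simp add: is_EC2_def)
  show "\<epsilon> 1 y \<noteq> y" if "y \<in> topspace E" for y
    using E that by (auto simp: is_EC2_def carrier_C2)
qed (use C2_space_involution[OF X_space] C2_space_involution[OF E_space] e_in in auto)

lemma orbit_eq: "y \<in> topspace Y \<Longrightarrow> orbit C2 (diagonal_action \<phi> \<epsilon>) y = {y, s y}"
  using orbit_C2[of "diagonal_action \<phi> \<epsilon>" y] C2_space_involution(2)[OF X_space] C2_space_involution(2)[OF E_space]
  by (cases y) (auto simp: diagonal_action_def)

lemma free_involution_Y: "free_involution Y s (borel_construction X \<phi> E \<epsilon>) (orbit C2 (diagonal_action \<phi> \<epsilon>))"
proof
  show "Hausdorff_space Y" using X_Hausdorff E_Hausdorff by (simp add: Hausdorff_space_prod_topology)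
  show "quotient_map Y (borel_construction X \<phi> E \<epsilon>) (orbit C2 (diagonal_action \<phi> \<epsilon>))"
    unfolding borel_construction_def by (rule quotient_map_orbit)
  fix y z assume y: "y \<in> topspace Y" "z \<in> topspace Y"
  show "orbit C2 (diagonal_action \<phi> \<epsilon>) y = orbit C2 (diagonal_action \<phi> \<epsilon>) z \<longleftrightarrow> z = y \<or> z = s y"
    unfolding orbit_eq[OF y(1)] orbit_eq[OF y(2)] using s_inv[OF y(1)] s_inv[OF y(2)]
    by (auto simp: doubleton_eq_iff)
qed (use s_cont s_inv s_free in auto)

text \<open>The inclusion of the fibre is the slice at \<open>e\<close> followed by the orbit map,
  and the orbit map pulls the cocycles of the Borel construction back onto the invariant cocycles of
  \<open>Y\<close>.\<close>

lemma psi_Bor_image: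
  "psi_Bor q X \<phi> \<epsilon> e ` carrier (borel_cohomology_group q X \<phi> E \<epsilon>) = cls q X ` fibre_classes q"
proof -
  let ?W = "borel_construction X \<phi> E \<epsilon>" and ?o = "orbit C2 (diagonal_action \<phi> \<epsilon>)" and ?i = "\<lambda>x. (x, e)"
  interpret F: free_involution Y s ?W ?o by (rule free_involution_Y)
  have ci: "continuous_map X Y ?i" using slice_map by (simp add: pair_map_def)
  have incl: "fibre_inclusion \<phi> \<epsilon> e = ?o \<circ> ?i" by (simp add: fibre_inclusion_def fun_eq_iff)
  have "continuous_map X ?W (?o \<circ> ?i)" by (rule continuous_map_compose[OF ci F.q_cont])
  note map = cohomology_map_cls[OF this]
  have "psi_Bor q X \<phi> \<epsilon> e (cls q ?W z) = cls q X (pull X ?i q (pull Y ?o q z))" if "z \<in> Zc q ?W" for z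
    unfolding psi_Bor_def incl pull_pull[OF ci] by (rule map[OF that])
  then have "psi_Bor q X \<phi> \<epsilon> e ` cls q ?W ` Zc q ?W = cls q X ` pull X ?i q ` pull Y ?o q ` Zc q ?W"
    unfolding image_image by (rule image_cong[OF refl])
  then show ?thesis
    unfolding borel_cohomology_group_def cohomology_group(2) F.pull_cocycles fibre_classes_def .
qed

lemma action_cls: "z \<in> Zc q X \<Longrightarrow> cohomology_action q X \<phi> 1 (cls q X z) = cls q X (pull X (\<phi> 1) q z)"
  unfolding cohomology_action_def by (rule cohomology_map_cls[OF \<tau>_cont])

lemma action_0: "u \<in> carrier (cohomology_group q X) \<Longrightarrow> cohomology_action q X \<phi> 0 u = u"
proof -
  assume "u \<in> carrier (cohomology_group q X)"
  then obtain z where z: "z \<in> Zc q X" "u = cls q X z" unfolding cohomology_group(2) by blast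
  have "continuous_map X X (\<phi> 0)" using X_space by (simp add: C2_space_def)
  moreover have "pull X (\<phi> 0) q z = z"
    by (rule pull_id[where \<tau> = id and B = "{}"]) (use z C2_space_involution(2)[OF X_space] in \<open>auto simp: cyc_def\<close>)
  ultimately show ?thesis
    using cohomology_map_cls z by (metis cohomology_action_def)
qed

lemma cohomology_fixed_eq:
  "cohomology_fixed q X \<phi> = {u \<in> carrier (cohomology_group q X). cohomology_action q X \<phi> 1 u = u}"
  using action_0 by (auto simp: cohomology_fixed_def carrier_C2)

lemma action_1_1:
  "u \<in> carrier (cohomology_group q X) \<Longrightarrow> cohomology_action q X \<phi> 1 (cohomology_action q X \<phi> 1 u) = u"
proof -
  assume "u \<in> carrier (cohomology_group q X)"
  then obtain z where z: "z \<in> Zc q X" "u = cls q X z" unfolding cohomology_group(2) by blast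
  have "pull X (\<phi> 1) q (pull X (\<phi> 1) q z) = pull X (\<phi> 1 \<circ> \<phi> 1) q z" by (rule pull_pull[OF \<tau>_cont])
  also have "\<dots> = z"
    by (rule pull_id[where \<tau> = id and B = "{}"]) (use z \<tau>_inv in \<open>auto simp: cyc_def\<close>)
  finally show ?thesis using z action_cls pull_Zc[OF \<tau>_cont] by metis
qed

lemma action_hom: "cohomology_action q X \<phi> 1 \<in> hom (cohomology_group q X) (cohomology_group q X)"
proof (rule homI)
  fix u v assume "u \<in> carrier (cohomology_group q X)" "v \<in> carrier (cohomology_group q X)"
  then obtain z w where z: "z \<in> Zc q X" "u = cls q X z" and w: "w \<in> Zc q X" "v = cls q X w"
    unfolding cohomology_group(2) by blast
  note p = pull_Zc[OF \<tau>_cont z(1)] pull_Zc[OF \<tau>_cont w(1)]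
  show "cohomology_action q X \<phi> 1 u \<in> carrier (cohomology_group q X)"
    unfolding z(2) action_cls[OF z(1)] cohomology_group(2) by (rule imageI[OF p(1)])
  show "cohomology_action q X \<phi> 1 (u \<otimes>\<^bsub>cohomology_group q X\<^esub> v) =
      cohomology_action q X \<phi> 1 u \<otimes>\<^bsub>cohomology_group q X\<^esub> cohomology_action q X \<phi> 1 v"
    unfolding z(2) w(2) action_cls[OF z(1)] action_cls[OF w(1)] cohomology_group(3)[OF p]
      cohomology_group(3)[OF z(1) w(1)] action_cls[OF sgrp_add[OF sgrp_Zc z(1) w(1)]] pull_add ..
qed

lemma fibre_classes_subset_fixed: "cls q X ` fibre_classes q \<subseteq> cohomology_fixed q X \<phi>"
proof
  fix u assume "u \<in> cls q X ` fibre_classes q"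
  then obtain z where z: "z \<in> fibre_classes q" "u = cls q X z" by blast
  have zZ: "z \<in> Zc q X" using fibre_classes_subset z(1) by blast
  have "cls q X (pull X (\<phi> 1) q z) = cls q X z"
    using fibre_classes_invariant[OF z(1)] cls_eq_iff[OF pull_Zc[OF \<tau>_cont zZ] zZ] by blast
  then show "u \<in> cohomology_fixed q X \<phi>"
    using zZ z(2) action_cls[OF zZ] by (auto simp: cohomology_fixed_eq cohomology_group(2))
qed

lemma cell_action: "c \<in> C n \<Longrightarrow> \<phi> 1 ` c \<in> C n \<and> (\<phi> 1 ` c = c \<longrightarrow> (\<forall>u\<in>c. \<phi> 1 u = u))"
  using X by (auto simp: C2_CW_complex_def carrier_C2)

lemma CW_X: "CW_complex X C"
  using X by (simp add: C2_CW_complex_def)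

lemma formula:
  shows "b n \<noteq> 0" and "cw_dim C < n \<Longrightarrow> b n = 1"
    and "coh (subtopology X {x. \<phi> 1 x = x}) id {} n \<noteq> 0"
    and "(\<Prod>n\<le>cw_dim C. coh (subtopology X {x. \<phi> 1 x = x}) id {} n) * (\<Prod>n\<le>cw_dim C. b n) = (\<Prod>n\<le>cw_dim C. a n)\<^sup>2"
  subgoal by (rule product_formula(1)[OF CW_X C]) (erule cell_action)
  subgoal by (rule product_formula(2)[OF CW_X C]) (erule cell_action, assumption)
  subgoal by (rule product_formula(3)[OF CW_X C]) (erule cell_action)
  subgoal by (rule product_formula(5)[OF CW_X C]) (erule cell_action)
  done

lemma fixed_space_eq: "fixed_space X \<phi> = subtopology X {x. \<phi> 1 x = x}"
proof -
  have "fixed_space X \<phi> = subtopology X (topspace X \<inter> {x. \<forall>g\<in>carrier C2. \<phi> g x = x})"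
    unfolding fixed_space_def by (rule subtopology_restrict[symmetric])
  also have "topspace X \<inter> {x. \<forall>g\<in>carrier C2. \<phi> g x = x} = topspace X \<inter> {x. \<phi> 1 x = x}"
    using C2_space_involution(2)[OF X_space] unfolding carrier_C2 by blast
  also have "subtopology X \<dots> = subtopology X {x. \<phi> 1 x = x}" by (rule subtopology_restrict)
  finally show ?thesis .
qed

lemma card_cohomology: "card (carrier (cohomology_group q X)) = b q"
  by (simp add: card_cohomology_group b_def)

lemma finite_cohomology: "finite (carrier (cohomology_group q X))"
  by (rule ccontr) (use formula(1)[of q] card_cohomology[of q] in simp)

lemma card_fixed_space:
  "card (carrier (cohomology_group q (fixed_space X \<phi>))) = coh (subtopology X {x. \<phi> 1 x = x}) id {} q"
  by (simp add: card_cohomology_group fixed_space_eq)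

lemma finite_fixed_space: "finite (carrier (cohomology_group q (fixed_space X \<phi>)))"
  by (rule ccontr) (use formula(3)[of q] card_fixed_space[of q] in simp)

lemma H1:
  shows "exp2 (group_H1 C2 (cohomology_group q X) (cohomology_action q X \<phi>))"
    and "finite (carrier (group_H1 C2 (cohomology_group q X) (cohomology_action q X \<phi>)))"
    and "card (carrier (group_H1 C2 (cohomology_group q X) (cohomology_action q X \<phi>))) * b q =
      (card (cohomology_fixed q X \<phi>))\<^sup>2"
  unfolding cohomology_fixed_eq card_cohomology[symmetric]
  by (rule card_group_H1[where \<rho> = "cohomology_action q X \<phi>" and M = "cohomology_group q X", OF cohomology_group(1) finite_cohomology action_hom]; erule action_0 action_1_1)+

lemma fixed_subset: "cohomology_fixed q X \<phi> \<subseteq> carrier (cohomology_group q X)"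
  by (auto simp: cohomology_fixed_def)

lemma a_pos: "0 < a n"
  using a_dvd_b[of n] formula(1)[of n] by (cases "a n") auto

lemma a_le: "a n \<le> card (cohomology_fixed n X \<phi>)" "card (cohomology_fixed n X \<phi>) \<le> b n"
  using card_mono[OF finite_subset[OF fixed_subset finite_cohomology] fibre_classes_subset_fixed, of n]
    card_mono[OF finite_cohomology fixed_subset, of n] card_cls_fibre_classes[of n] card_cohomology[of n] by auto

lemma image_eq_iff:
  assumes "cls n X ` fibre_classes n \<subseteq> S" "finite S"
  shows "cls n X ` fibre_classes n = S \<longleftrightarrow> a n = card S"
  using card_subset_eq[OF assms(2,1)] card_cls_fibre_classes[of n] by auto

text \<open>The sums defining M- and GM-spaces stop at the dimension, whereas surjectivity is asked
  in every degree; in the remaining degrees there is only the zero class.\<close>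

lemma all_above_dim: "\<not> n \<le> cw_dim C \<Longrightarrow> b n = 1 \<and> a n = 1 \<and> card (cohomology_fixed n X \<phi>) = 1"
  using formula(2)[of n] a_pos[of n] a_le[of n] by auto

theorem M_space_iff:
  "M_space X \<phi> C \<longleftrightarrow>
    (\<forall>q. psi_Bor q X \<phi> \<epsilon> e ` carrier (borel_cohomology_group q X \<phi> E \<epsilon>) = carrier (cohomology_group q X))"
proof -
  let ?D = "cw_dim C"
  let ?bF = "\<lambda>n. coh (subtopology X {x. \<phi> 1 x = x}) id {} n"
  have "M_space X \<phi> C \<longleftrightarrow> prod ?bF {..?D} = prod b {..?D}"
    unfolding M_space_def
    by (subst sum_F2_dim_eq_iff)
      (simp_all only: cohomology_group(1) finite_cohomology finite_fixed_space card_fixed_space card_cohomology)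
  \<comment> \<open>With F B = A^2 and B nonzero, F = B says the same as A^2 = B^2.\<close>
  also have "\<dots> \<longleftrightarrow> (prod a {..?D})\<^sup>2 = (prod b {..?D})\<^sup>2"
  proof -
    have *: "F = B \<longleftrightarrow> A\<^sup>2 = B\<^sup>2" if "F * B = A\<^sup>2" "B \<noteq> 0" for A B F :: nat
      unfolding that(1)[symmetric] using that(2) by (simp add: power2_eq_square)
    show ?thesis by (rule *[OF formula(4)]) (use formula(1) in simp)
  qed
  also have "\<dots> \<longleftrightarrow> prod a {..?D} = prod b {..?D}" by (auto simp: power2_eq_iff_nonneg)
  also have "\<dots> \<longleftrightarrow> (\<forall>n\<in>{..?D}. a n = b n)"
    using a_pos a_le by (intro prod_eq_prod_iff_if_le) (auto intro: order_trans)
  also have "\<dots> \<longleftrightarrow> (\<forall>n. a n = b n)"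
    unfolding atMost_iff Ball_def using all_above_dim by metis
  also have "\<dots> \<longleftrightarrow> (\<forall>n. cls n X ` fibre_classes n = carrier (cohomology_group n X))"
    using image_eq_iff[OF order_trans[OF fibre_classes_subset_fixed fixed_subset] finite_cohomology]
    by (simp only: card_cohomology)
  finally show ?thesis by (simp only: psi_Bor_image)
qed

theorem GM_space_iff:
  "GM_space X \<phi> C \<longleftrightarrow>
    (\<forall>q. psi_Bor q X \<phi> \<epsilon> e ` carrier (borel_cohomology_group q X \<phi> E \<epsilon>) = cohomology_fixed q X \<phi>)"
proof -
  let ?D = "cw_dim C"
  let ?bF = "\<lambda>n. coh (subtopology X {x. \<phi> 1 x = x}) id {} n"
  let ?h = "\<lambda>n. card (carrier (group_H1 C2 (cohomology_group n X) (cohomology_action n X \<phi>)))"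
  let ?f = "\<lambda>n. card (cohomology_fixed n X \<phi>)"
  have "GM_space X \<phi> C \<longleftrightarrow> prod ?bF {..?D} = prod ?h {..?D}"
    unfolding GM_space_def
    by (subst sum_F2_dim_eq_iff)
      (simp_all only: cohomology_group(1) H1(1,2) finite_fixed_space card_fixed_space)
  \<comment> \<open>Multiplying by the nonzero total order of H(X) turns both sides into squares:
    the left one by the product formula, the right one by the order of H^1.\<close>
  also have "\<dots> \<longleftrightarrow> prod ?bF {..?D} * prod b {..?D} = prod ?h {..?D} * prod b {..?D}"
  proof -
    have *: "F = H \<longleftrightarrow> F * B = H * B" if "B \<noteq> 0" for B F H :: nat using that by simp
    show ?thesis by (rule *) (use formula(1) in simp)
  qed
  also have "prod ?h {..?D} * prod b {..?D} = (prod ?f {..?D})\<^sup>2"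
    unfolding prod.distrib[symmetric] H1(3) by (simp add: prod_power_distrib)
  also have "prod ?bF {..?D} * prod b {..?D} = (prod a {..?D})\<^sup>2" by (rule formula(4))
  also have "(prod a {..?D})\<^sup>2 = (prod ?f {..?D})\<^sup>2 \<longleftrightarrow> prod a {..?D} = prod ?f {..?D}"
    by (auto simp: power2_eq_iff_nonneg)
  also have "\<dots> \<longleftrightarrow> (\<forall>n\<in>{..?D}. a n = ?f n)"
    using a_pos a_le by (intro prod_eq_prod_iff_if_le) auto
  also have "\<dots> \<longleftrightarrow> (\<forall>n. a n = ?f n)"
    unfolding atMost_iff Ball_def using all_above_dim by metis
  also have "\<dots> \<longleftrightarrow> (\<forall>n. cls n X ` fibre_classes n = cohomology_fixed n X \<phi>)"
    using image_eq_iff[OF fibre_classes_subset_fixed finite_subset[OF fixed_subset finite_cohomology]] by simp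
  finally show ?thesis by (simp only: psi_Bor_image)
qed

end

theorem corollary3p28:
  fixes X :: "'a topology" and \<phi> :: "int \<Rightarrow> 'a \<Rightarrow> 'a" and C :: "nat \<Rightarrow> 'a set set"
    and E :: "'e topology" and \<epsilon> :: "int \<Rightarrow> 'e \<Rightarrow> 'e" and e :: 'e
  assumes "C2_CW_complex X \<phi> C" and "finite_cells C"
    and "is_EC2 E \<epsilon>" and "e \<in> topspace E"
  shows "(M_space X \<phi> C \<longleftrightarrow>
      (\<forall>q. psi_Bor q X \<phi> \<epsilon> e ` carrier (borel_cohomology_group q X \<phi> E \<epsilon>)
        = carrier (cohomology_group q X))) \<and>
    (GM_space X \<phi> C \<longleftrightarrow>
      (\<forall>q. psi_Bor q X \<phi> \<epsilon> e ` carrier (borel_cohomology_group q X \<phi> E \<epsilon>)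
        = cohomology_fixed q X \<phi>))"
proof -
  interpret borel_data X \<phi> C E \<epsilon> e by unfold_locales (use assms in auto)
  show ?thesis using M_space_iff GM_space_iff by blast
qed

end
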